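(* Let $n \in \omega$ with $n \geq 2$. Let $\alpha \in \omega_1$ be such that $L_\alpha$ is the minimum model of $\mathsf{M}+\Pi_n\textsf{-Collection}$. There is no $\mathcal{L}$-structure $\mathcal{N}= \langle N, \in^{\mathcal{N}} \rangle$ such that $\langle L_\alpha, \in \rangle \prec_{e, n+1} \mathcal{N}$, $N \neq L_\alpha$ and $\mathcal{N} \models \Pi_{n-1}\textsf{-Collection}$.
   Context: $\mathcal{L}$ is the first-order language with equality and one binary relation symbol $\in$. $\Delta_0=\Sigma_0=\Pi_0$, $\Sigma_k$, $\Pi_k$ are the L\'evy classes of $\mathcal{L}$-formulae. For a class $\Gamma$ of $\mathcal{L}$-formulae, $\Gamma\textsf{-Collection}$ is the scheme $\forall \vec z\,\forall w\,((\forall x\in w)\exists y\,\phi(x,y,\vec z)\Rightarrow \exists c(\forall x\in w)(\exists y\in c)\phi(x,y,\vec z))$ for $\phi\in\Gamma$. $\mathsf{M}^-$ is the $\mathcal{L}$-theory with axioms: Extensionality, Pair, Union, Emptyset, Infinity (there is a set containing $\emptyset$ and closed under $y\mapsto y\cup\{y\}$), $\mathsf{TCo}$ (every set is a subset of a transitive set), Set-Foundation (every nonempty set has an $\in$-minimal element), and $\Delta_0\textsf{-Separation}$. $\mathsf{M}$ is $\mathsf{M}^-$ plus the Powerset axiom. $L_\alpha$ is the $\alpha$-th level of G\"odel's constructible hierarchy. A transitive set $K$ is the minimum model of a theory $T$ if $\langle K,\in\rangle\models T$ and $K\subseteq K'$ for every transitive $K'$ with $\langle K',\in\rangle\models T$.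 For structures $\mathcal{M}=\langle M,\in^{\mathcal{M}}\rangle$, $\mathcal{N}=\langle N,\in^{\mathcal{N}}\rangle$ (not necessarily well-founded), $\mathcal{M}\prec_{e,k}\mathcal{N}$ means: $\mathcal{M}$ is a substructure of $\mathcal{N}$; $\mathcal{N}$ is an end extension of $\mathcal{M}$ (if $y\in M$, $x\in N$ and $\mathcal{N}\models x\in y$ then $x\in M$); and for every $\Sigma_k$-formula $\phi$ and all $\vec a\in M$, $\mathcal{M}\models\phi(\vec a)$ iff $\mathcal{N}\models\phi(\vec a)$. *)

theory Defs
  imports "HOL-Library.Countable_Set" "HOL-Library.Equipollence"
begin

section \<open>A universe of sets\<close>

text \<open>
  A tree represents the set of all sets represented by its immediate subtrees, and \<open>'k V\<close> is the
  type of the sets so represented. It consists of all sets that are hereditarily of cardinality at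
  most \<open>\<kappa> = |nat + 'k|\<close>, i.e. it is \<open>H(\<kappa>\<^sup>+)\<close>; adding \<open>nat\<close> makes \<open>\<kappa>\<close> infinite. Since \<open>'k\<close> is an
  arbitrary type, a statement about \<open>'k V\<close> covers sets and structures of any cardinality. All
  countable ordinals, and all elements of the corresponding levels of the constructible
  hierarchy, are in \<open>'k V\<close> for every \<open>'k\<close>. Transitive sets and carriers of structures have type
  \<open>'k V set\<close>, so they need not be elements of \<open>'k V\<close>.
\<close>

datatype 'k tree = Node "nat + 'k \<Rightarrow> 'k tree option"

primrec subtrees :: "'k tree \<Rightarrow> 'k tree set" where
  "subtrees (Node f) = {t. Some t \<in> range f}"

inductive same_set :: "'k tree \<Rightarrow> 'k tree \<Rightarrow> bool" where
  "(\<forall>x\<in>subtrees s. \<exists>y\<in>subtrees t. same_set x y) \<Longrightarrow>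
   (\<forall>y\<in>subtrees t. \<exists>x\<in>subtrees s. same_set x y) \<Longrightarrow> same_set s t"

lemma tree_induct:
  assumes "\<And>t. (\<And>u. u \<in> subtrees t \<Longrightarrow> P u) \<Longrightarrow> P t"
  shows "P t"
proof (induction t)
  case (Node f)
  show ?case
  proof (rule assms)
    fix u assume "u \<in> subtrees (Node f)"
    then show "P u" using Node[of "Some u" u] by simp
  qed
qed

lemma same_set_refl: "same_set t t"
  by (induction t rule: tree_induct) (auto intro: same_set.intros)

lemma same_set_sym: "same_set s t \<Longrightarrow> same_set t s"
proof (induction rule: same_set.induct)
  case (1 s t)
  then show ?case by (intro same_set.intros) blast+
qed

lemma same_set_trans: "same_set s t \<Longrightarrow> same_set t u \<Longrightarrow> same_set s u"
proof (induction s arbitrary: t u rule: tree_induct)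
  case (1 s)
  note st = 1(2)[unfolded same_set.simps[of s]]
  note tu = 1(3)[unfolded same_set.simps[of t]]
  show ?case
  proof (rule same_set.intros; intro ballI)
    fix x assume x: "x \<in> subtrees s"
    then obtain y where y: "y \<in> subtrees t" "same_set x y" using st by blast
    then obtain z where "z \<in> subtrees u" "same_set y z" using tu by blast
    then show "\<exists>z\<in>subtrees u. same_set x z" using 1(1)[OF x y(2)] by blast
  next
    fix z assume "z \<in> subtrees u"
    then obtain y where y: "y \<in> subtrees t" "same_set y z" using tu by blast
    then obtain x where x: "x \<in> subtrees s" "same_set x y" using st by blast
    then show "\<exists>x\<in>subtrees s. same_set x z" using 1(1)[OF x y(2)] by blast
  qed
qed

quotient_type 'k V = "'k tree" / same_set
proof (rule equivpI)
  show "reflp same_set" by (rule reflpI) (rule same_set_refl)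
  show "symp same_set" by (rule sympI) (rule same_set_sym)
  show "transp same_set" by (rule transpI) (rule same_set_trans)
qed

lemma abs_V_eq: "abs_V s = abs_V t \<longleftrightarrow> same_set s t"
  by (simp add: V.abs_eq_iff)

lemma abs_rep_V: "abs_V (rep_V x) = x"
  by (rule Quotient3_abs_rep[OF Quotient3_V])

definition elts :: "'k V \<Rightarrow> 'k V set" where
  "elts x = abs_V ` subtrees (rep_V x)"

lemma elts_abs_V: "elts (abs_V t) = abs_V ` subtrees t"
proof -
  have "same_set (rep_V (abs_V t)) t"
    using abs_rep_V abs_V_eq by blast
  then show ?thesis
    by (auto simp: elts_def same_set.simps[of "rep_V (abs_V t)"] image_iff abs_V_eq)
       (blast intro: same_set_sym)
qed

lemma V_extensionality: "elts x = elts y \<Longrightarrow> x = y"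
proof -
  assume eq: "elts x = elts y"
  have "same_set (rep_V x) (rep_V y)"
  proof (rule same_set.intros; intro ballI)
    fix s assume "s \<in> subtrees (rep_V x)"
    then have "abs_V s \<in> elts x" by (simp add: elts_def)
    then have "abs_V s \<in> elts y" using eq by simp
    then show "\<exists>t\<in>subtrees (rep_V y). same_set s t"
      by (auto simp: elts_def abs_V_eq)
  next
    fix t assume "t \<in> subtrees (rep_V y)"
    then have "abs_V t \<in> elts y" by (simp add: elts_def)
    then have "abs_V t \<in> elts x" using eq by simp
    then show "\<exists>s\<in>subtrees (rep_V x). same_set s t"
      using same_set_sym by (fastforce simp: elts_def abs_V_eq)
  qed
  then show "x = y"
    using abs_V_eq abs_rep_V by metis
qed

lemma V_comprehension:
  fixes A :: "'k V set"
  shows "(\<exists>x. elts x = A) \<longleftrightarrow> A \<lesssim> (UNIV :: (nat + 'k) set)"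
proof
  assume "\<exists>x. elts x = A"
  then obtain f where A: "A = abs_V ` subtrees (Node f :: 'k tree)"
    unfolding elts_def by (metis tree.exhaust)
  have "A \<subseteq> (\<lambda>i. abs_V (the (f i))) ` UNIV"
  proof
    fix a assume "a \<in> A"
    then obtain t where t: "Some t \<in> range f" "a = abs_V t" by (auto simp: A)
    then obtain i where "f i = Some t" by (metis rangeE)
    then have "a = abs_V (the (f i))" using t by simp
    then show "a \<in> (\<lambda>i. abs_V (the (f i))) ` UNIV" by (rule image_eqI) simp
  qed
  then show "A \<lesssim> (UNIV :: (nat + 'k) set)"
    unfolding lepoll_iff by blast
next
  assume "A \<lesssim> (UNIV :: (nat + 'k) set)"
  then obtain g :: "nat + 'k \<Rightarrow> 'k V" where g: "A \<subseteq> range g"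
    unfolding lepoll_iff by blast
  define f where "f i = (if g i \<in> A then Some (rep_V (g i)) else None)" for i
  have "elts (abs_V (Node f)) = {abs_V (rep_V (g i)) | i. g i \<in> A}"
    by (auto simp: elts_abs_V f_def image_iff split: if_splits)
  also have "\<dots> = A" using g by (auto simp: abs_rep_V)
  finally show "\<exists>x. elts x = A" ..
qed

lemma wf_elts: "wf {(x, y :: 'k V). x \<in> elts y}"
proof (rule wfUNIVI)
  fix P :: "'k V \<Rightarrow> bool" and x
  assume step: "\<forall>x. (\<forall>y. (y, x) \<in> {(x, y). x \<in> elts y} \<longrightarrow> P y) \<longrightarrow> P x"
  have "P (abs_V t)" for t
  proof (induction t rule: tree_induct)
    case (1 t)
    then have "\<forall>y. (y, abs_V t) \<in> {(x, y). x \<in> elts y} \<longrightarrow> P y"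
      by (auto simp: elts_abs_V)
    then show ?case using step by blast
  qed
  then show "P x" using abs_rep_V by metis
qed

definition transitive :: "'k V set \<Rightarrow> bool" where
  "transitive K \<longleftrightarrow> (\<forall>x\<in>K. elts x \<subseteq> K)"

definition Ord :: "'k V \<Rightarrow> bool" where
  "Ord \<alpha> \<longleftrightarrow> transitive (elts \<alpha>) \<and> (\<forall>\<beta>\<in>elts \<alpha>. transitive (elts \<beta>))"

definition omega1 :: "'k V set" where
  "omega1 = {\<alpha>. Ord \<alpha> \<and> countable (elts \<alpha>)}"


section \<open>The language of set theory\<close>

text \<open>Variables are natural numbers, with named binders.\<close>

datatype fm =
    Mem nat nat
  | Eq nat nat
  | Neg fm
  | Conj fm fm
  | Disj fm fm
  | Imp fm fm
  | Forall nat fm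
  | Exists nat fm

abbreviation Iff :: "fm \<Rightarrow> fm \<Rightarrow> fm" where
  "Iff p q \<equiv> Conj (Imp p q) (Imp q p)"

abbreviation ForallIn :: "nat \<Rightarrow> nat \<Rightarrow> fm \<Rightarrow> fm" where
  "ForallIn x y p \<equiv> Forall x (Imp (Mem x y) p)"

abbreviation ExistsIn :: "nat \<Rightarrow> nat \<Rightarrow> fm \<Rightarrow> fm" where
  "ExistsIn x y p \<equiv> Exists x (Conj (Mem x y) p)"

primrec fv :: "fm \<Rightarrow> nat set" where
  "fv (Mem x y) = {x, y}"
| "fv (Eq x y) = {x, y}"
| "fv (Neg p) = fv p"
| "fv (Conj p q) = fv p \<union> fv q"
| "fv (Disj p q) = fv p \<union> fv q"
| "fv (Imp p q) = fv p \<union> fv q"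
| "fv (Forall x p) = fv p - {x}"
| "fv (Exists x p) = fv p - {x}"

record 'a struct =
  dom :: "'a set"
  mem :: "'a \<Rightarrow> 'a \<Rightarrow> bool"

primrec sat :: "'a struct \<Rightarrow> (nat \<Rightarrow> 'a) \<Rightarrow> fm \<Rightarrow> bool" where
  "sat M s (Mem x y) \<longleftrightarrow> mem M (s x) (s y)"
| "sat M s (Eq x y) \<longleftrightarrow> s x = s y"
| "sat M s (Neg p) \<longleftrightarrow> \<not> sat M s p"
| "sat M s (Conj p q) \<longleftrightarrow> sat M s p \<and> sat M s q"
| "sat M s (Disj p q) \<longleftrightarrow> sat M s p \<or> sat M s q"
| "sat M s (Imp p q) \<longleftrightarrow> (sat M s p \<longrightarrow> sat M s q)"
| "sat M s (Forall x p) \<longleftrightarrow> (\<forall>a\<in>dom M. sat M (s(x := a)) p)"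
| "sat M s (Exists x p) \<longleftrightarrow> (\<exists>a\<in>dom M. sat M (s(x := a)) p)"

text \<open>
  Structures have nonempty domains, and the free variables of an axiom are read as universally
  quantified.
\<close>

definition models :: "'a struct \<Rightarrow> fm set \<Rightarrow> bool" where
  "models M T \<longleftrightarrow> dom M \<noteq> {} \<and> (\<forall>p\<in>T. \<forall>s. range s \<subseteq> dom M \<longrightarrow> sat M s p)"


section \<open>The Levy hierarchy\<close>

inductive_set Delta0 :: "fm set" where
  Mem: "Mem x y \<in> Delta0"
| Eq: "Eq x y \<in> Delta0"
| Neg: "p \<in> Delta0 \<Longrightarrow> Neg p \<in> Delta0"
| Conj: "p \<in> Delta0 \<Longrightarrow> q \<in> Delta0 \<Longrightarrow> Conj p q \<in> Delta0"
| Disj: "p \<in> Delta0 \<Longrightarrow> q \<in> Delta0 \<Longrightarrow> Disj p q \<in> Delta0"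
| Imp: "p \<in> Delta0 \<Longrightarrow> q \<in> Delta0 \<Longrightarrow> Imp p q \<in> Delta0"
| ForallIn: "p \<in> Delta0 \<Longrightarrow> x \<noteq> y \<Longrightarrow> ForallIn x y p \<in> Delta0"
| ExistsIn: "p \<in> Delta0 \<Longrightarrow> x \<noteq> y \<Longrightarrow> ExistsIn x y p \<in> Delta0"

text \<open>
  A \<open>\<Sigma>\<^sub>k\<^sub>+\<^sub>1\<close> formula is a \<open>\<Pi>\<^sub>k\<close> formula preceded by a finite, possibly empty, block of existential
  quantifiers; dually for \<open>\<Pi>\<^sub>k\<^sub>+\<^sub>1\<close>.
\<close>

inductive is_Sigma :: "nat \<Rightarrow> fm \<Rightarrow> bool" and is_Pi :: "nat \<Rightarrow> fm \<Rightarrow> bool" where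
  Sigma_0: "p \<in> Delta0 \<Longrightarrow> is_Sigma 0 p"
| Sigma_Pi: "is_Pi k p \<Longrightarrow> is_Sigma (Suc k) p"
| Sigma_Exists: "is_Sigma (Suc k) p \<Longrightarrow> is_Sigma (Suc k) (Exists x p)"
| Pi_0: "p \<in> Delta0 \<Longrightarrow> is_Pi 0 p"
| Pi_Sigma: "is_Sigma k p \<Longrightarrow> is_Pi (Suc k) p"
| Pi_Forall: "is_Pi (Suc k) p \<Longrightarrow> is_Pi (Suc k) (Forall x p)"

definition Sigma_fm :: "nat \<Rightarrow> fm set" where
  "Sigma_fm k = {p. is_Sigma k p}"

definition Pi_fm :: "nat \<Rightarrow> fm set" where
  "Pi_fm k = {p. is_Pi k p}"


section \<open>Set theories\<close>

definition Extensionality :: fm where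
  "Extensionality = Forall 0 (Forall 1 (Imp (Forall 2 (Iff (Mem 2 0) (Mem 2 1))) (Eq 0 1)))"

definition Pairing :: fm where
  "Pairing = Forall 0 (Forall 1 (Exists 2 (Forall 3 (Iff (Mem 3 2) (Disj (Eq 3 0) (Eq 3 1))))))"

definition Union_ax :: fm where
  "Union_ax = Forall 0 (Exists 1 (Forall 2 (Iff (Mem 2 1) (ExistsIn 3 0 (Mem 2 3)))))"

definition Emptyset :: fm where
  "Emptyset = Exists 0 (Forall 1 (Neg (Mem 1 0)))"

definition Infinity :: fm where
  "Infinity = Exists 0 (Conj
     (ExistsIn 1 0 (Forall 2 (Neg (Mem 2 1))))
     (ForallIn 1 0 (ExistsIn 2 0 (Forall 3 (Iff (Mem 3 2) (Disj (Mem 3 1) (Eq 3 1)))))))"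

definition TCo :: fm where
  "TCo = Forall 0 (Exists 1 (Conj
     (ForallIn 2 0 (Mem 2 1))
     (ForallIn 2 1 (ForallIn 3 2 (Mem 3 1)))))"

definition Set_Foundation :: fm where
  "Set_Foundation = Forall 0 (Imp
     (Exists 1 (Mem 1 0))
     (ExistsIn 1 0 (ForallIn 2 0 (Neg (Mem 2 1)))))"

definition Powerset :: fm where
  "Powerset = Forall 0 (Exists 1 (Forall 2 (Iff (Mem 2 1) (ForallIn 3 2 (Mem 3 0)))))"

definition Separation :: "fm set \<Rightarrow> fm set" where
  "Separation \<Gamma> = {Forall w (Exists y (Forall x (Iff (Mem x y) (Conj (Mem x w) p)))) | p x y w.
     p \<in> \<Gamma> \<and> distinct [x, y, w] \<and> y \<notin> fv p \<and> w \<notin> fv p}"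

definition Collection :: "fm set \<Rightarrow> fm set" where
  "Collection \<Gamma> = {Forall w (Imp
       (ForallIn x w (Exists y p))
       (Exists c (ForallIn x w (ExistsIn y c p)))) | p x y w c.
     p \<in> \<Gamma> \<and> distinct [x, y, w, c] \<and> w \<notin> fv p \<and> c \<notin> fv p}"

definition M_minus :: "fm set" where
  "M_minus = {Extensionality, Pairing, Union_ax, Emptyset, Infinity, TCo, Set_Foundation}
     \<union> Separation Delta0"

definition M_theory :: "fm set" where
  "M_theory = M_minus \<union> {Powerset}"


section \<open>The constructible hierarchy and minimum models\<close>

definition in_struct :: "'k V set \<Rightarrow> 'k V struct" where
  "in_struct K = \<lparr>dom = K, mem = (\<lambda>x y. x \<in> elts y)\<rparr>"

text \<open>
  The parameters of \<open>p\<close> are the values of its free variables other than \<open>v\<close>. Only these are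
  required to lie in \<open>A\<close>, so that \<open>Def {}\<close> contains the empty set.
\<close>

definition Def :: "'k V set \<Rightarrow> 'k V set" where
  "Def A = {x. \<exists>p v s. (\<forall>i\<in>fv p - {v}. s i \<in> A) \<and>
                       elts x = {a\<in>A. sat (in_struct A) (s(v := a)) p}}"

text \<open>
  The lemmas \<open>L_zero\<close>, \<open>L_succ\<close> and \<open>L_limit\<close> below show that this is the usual hierarchy, given by its
  zero, successor and limit stages.
\<close>

function L :: "'k V \<Rightarrow> 'k V set" where
  "L \<alpha> = (\<Union>\<beta>\<in>elts \<alpha>. Def (L \<beta>))"
  by auto
termination
  by (relation "{(x, y). x \<in> elts y}") (auto intro: wf_elts)

declare L.simps [simp del]

lemma L_zero: "elts \<alpha> = {} \<Longrightarrow> L \<alpha> = {}"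
  by (simp add: L.simps[of \<alpha>])

lemma transitive_L: "transitive (L \<alpha>)"
proof (induction \<alpha> rule: wf_induct_rule[OF wf_elts])
  case (1 \<alpha>)
  show ?case
    unfolding transitive_def
  proof (intro ballI subsetI)
    fix x y assume "x \<in> L \<alpha>" and y: "y \<in> elts x"
    then obtain \<beta> where b: "\<beta> \<in> elts \<alpha>" "x \<in> Def (L \<beta>)"
      by (subst (asm) L.simps) auto
    then have "y \<in> L \<beta>" using y by (auto simp: Def_def)
    moreover have "transitive (L \<beta>)" using 1 b by auto
    ultimately have "elts y = {a \<in> L \<beta>. a \<in> elts y}" "y \<in> L \<beta>"
      by (auto simp: transitive_def)
    then have "y \<in> Def (L \<beta>)"
      unfolding Def_def
      by (intro CollectI exI[of _ "Mem 0 1"] exI[of _ 0] exI[of _ "\<lambda>_. y"])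
         (simp add: in_struct_def)
    with b show "y \<in> L \<alpha>" by (subst L.simps) auto
  qed
qed

lemma L_subset_Def: "L \<alpha> \<subseteq> Def (L \<alpha>)"
proof
  fix y assume y: "y \<in> L \<alpha>"
  then have "elts y = {a \<in> L \<alpha>. a \<in> elts y}"
    using transitive_L[of \<alpha>] by (auto simp: transitive_def)
  with y show "y \<in> Def (L \<alpha>)"
    unfolding Def_def
    by (intro CollectI exI[of _ "Mem 0 1"] exI[of _ 0] exI[of _ "\<lambda>_. y"])
       (simp add: in_struct_def)
qed

lemma L_succ: "elts \<alpha> = insert \<beta> (elts \<beta>) \<Longrightarrow> L \<alpha> = Def (L \<beta>)"
  using L_subset_Def[of \<beta>] by (auto simp: L.simps[of \<alpha>] L.simps[of \<beta>])

lemma L_limit: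
  assumes "\<forall>\<beta>\<in>elts \<alpha>. \<exists>\<gamma>\<in>elts \<alpha>. \<beta> \<in> elts \<gamma>"
  shows "L \<alpha> = (\<Union>\<beta>\<in>elts \<alpha>. L \<beta>)"
proof (intro subset_antisym subsetI)
  fix x assume "x \<in> L \<alpha>"
  then obtain \<beta> where b: "\<beta> \<in> elts \<alpha>" "x \<in> Def (L \<beta>)"
    by (subst (asm) L.simps) auto
  then obtain \<gamma> where "\<gamma> \<in> elts \<alpha>" "\<beta> \<in> elts \<gamma>" using assms by blast
  moreover from this b have "x \<in> L \<gamma>" by (subst L.simps) auto
  ultimately show "x \<in> (\<Union>\<beta>\<in>elts \<alpha>. L \<beta>)" by blast
next
  fix x assume "x \<in> (\<Union>\<beta>\<in>elts \<alpha>. L \<beta>)"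
  then show "x \<in> L \<alpha>"
    using L_subset_Def by (subst L.simps) blast
qed

definition minimum_model :: "fm set \<Rightarrow> 'k V set \<Rightarrow> bool" where
  "minimum_model T K \<longleftrightarrow> transitive K \<and> models (in_struct K) T \<and>
     (\<forall>K'. transitive K' \<and> models (in_struct K') T \<longrightarrow> K \<subseteq> K')"


section \<open>Elementary end extensions\<close>

definition substructure :: "'a struct \<Rightarrow> 'a struct \<Rightarrow> bool" where
  "substructure M N \<longleftrightarrow> dom M \<subseteq> dom N \<and> (\<forall>x\<in>dom M. \<forall>y\<in>dom M. mem M x y \<longleftrightarrow> mem N x y)"

definition end_extension :: "'a struct \<Rightarrow> 'a struct \<Rightarrow> bool" where
  "end_extension M N \<longleftrightarrow> substructure M N \<and>
     (\<forall>y\<in>dom M. \<forall>x\<in>dom N. mem N x y \<longrightarrow> x \<in> dom M)"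

definition elem_end_ext :: "nat \<Rightarrow> 'a struct \<Rightarrow> 'a struct \<Rightarrow> bool" where
  "elem_end_ext k M N \<longleftrightarrow> end_extension M N \<and>
     (\<forall>p\<in>Sigma_fm k. \<forall>s. range s \<subseteq> dom M \<longrightarrow> (sat M s p \<longleftrightarrow> sat N s p))"

end

theory Submission
  imports Defs
begin

text \<open>
  Write \<open>A = L \<alpha>\<close> and \<open>n = m + 1\<close>, and suppose that \<open>NN\<close> is a proper end extension of \<open>A\<close> that is
  elementary for \<open>\<Sigma>\<^sub>m\<^sub>+\<^sub>2\<close> formulas and satisfies \<open>\<Pi>\<^sub>m\<close>-Collection. The extension is used to find a transitive
  model \<open>K\<close> of \<open>M\<close> and \<open>\<Pi>\<^sub>n\<close>-Collection that is included in an element \<open>b\<close> of \<open>A\<close>. Minimality of \<open>A\<close> then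
  gives \<open>A \<subseteq> K \<subseteq> elts b\<close>, so \<open>b\<close> is an element of itself.

  The cumulative hierarchy is available in \<open>A\<close> without ordinals. A history is a set \<open>h\<close> in which every
  element \<open>u\<close> consists of the subsets of the elements of \<open>h\<close> that lie in \<open>u\<close>; the elements of histories
  are the levels. Being a history is \<open>\<Pi>\<^sub>1\<close>, so the facts that levels are transitive, closed under subsets,
  linearly ordered by membership, and cover everything pass from \<open>A\<close> to \<open>NN\<close>. Since the extension is proper and
  end, there is a history \<open>h0\<close> of \<open>NN\<close> with an element outside \<open>A\<close>, and every such nonstandard level
  includes \<open>A\<close>. There are two cases.

  If \<open>h0\<close> has a least nonstandard element \<open>u\<close>, then the elements of \<open>u\<close> in \<open>NN\<close> are exactly those of \<open>A\<close>. So
  \<open>NN\<close> satisfies the \<open>\<Sigma>\<^sub>2\<close> statement that there is a transitive set, closed under subsets of its elements,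
  which is a model of a given finite set of axioms true in \<open>A\<close>; by elementarity, \<open>A\<close> contains such a set. The
  scheme of \<open>\<Pi>\<^sub>n\<close>-Collection follows from finitely many axioms because there is a universal \<open>\<Pi>\<^sub>n\<close> formula
  (\<open>universal\<close>), and \<open>\<Delta>\<^sub>0\<close>-Separation is inherited from \<open>A\<close> (lemma \<open>least_nonstd_model\<close>).

  If there is no least nonstandard element, \<open>K\<close> is obtained as a union of an increasing \<open>\<omega>\<close>-sequence of standard
  levels which is closed under witnesses for a \<open>\<Pi>\<^sub>n\<close> predicate \<open>Phi\<close>; when \<open>Phi\<close> comes from the universal
  formula, this makes \<open>K\<close> a \<open>\<Sigma>\<^sub>n\<^sub>+\<^sub>1\<close>-elementary substructure of \<open>A\<close> (lemma \<open>reflecting_model\<close>), and Collection in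
  \<open>K\<close> follows by reflecting the bound \<open>b\<close>. Two things must be arranged: each level must have a level closing it
  off, and the whole sequence must be bounded by an element of \<open>A\<close>.

  The first is a strengthening of Collection (\<open>strong_coll\<close>): for each \<open>w\<close> in \<open>A\<close> there is one set with witnesses for
  all those \<open>x\<close> in \<open>w\<close> that have any. It suffices that the set of these \<open>x\<close>, which is \<open>\<Sigma>\<^sub>n\<^sub>+\<^sub>1\<close> over
  \<open>A\<close>, is an element of \<open>A\<close>. Replacing the unbounded quantifier in \<open>Phi\<close> by one over a nonstandard level gives
  approximations to this set, indexed by the levels in \<open>h0\<close>, of which those with standard index have it as their union;
  all of them are elements of \<open>A\<close>, and so is their set. The latter is well-founded under inclusion as seen from \<open>NN\<close>.
  Hence it is really well-founded (\<open>real_wf\<close>), and a least approximation that has no standard index separates off the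
  standard ones.

  The second is an overspill (\<open>gap\<close>). Below each nonstandard level there are chains, of every finite length, of levels
  that close each other off. That one level closes off another is certified, in a way expressible by a bounded quantifier,
  by a sufficiently large parameter \<open>c\<close>. A single \<open>c\<close> serves all nonstandard levels (\<open>chains_stable\<close>): otherwise the
  values of \<open>c\<close> at which more levels become available would themselves form chains of all finite lengths, and a
  least bound for such chains could be lowered. With \<open>c\<close> fixed, the least level below which there are chains
  of every finite length exists by Separation; it is standard, since there is no least nonstandard level. In the real
  world, an infinite sequence of levels below it is then picked by always taking the least possible next level.
\<close>

section \<open>Definability in a class of structures\<close>

text \<open>
  Formulas are handled through the predicates of a structure and an assignment that they define. A predicate is
  in \<open>Dfn C \<Gamma>\<close> if one formula of \<open>\<Gamma>\<close> defines it in all structures of \<open>C\<close>; it is this uniformity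
  that lets facts be transferred between two structures. Bound variables are de Bruijn indices: in the
  premise of a quantifier rule, the quantified value is at position 0 and the others are shifted.
\<close>

definition econs :: "'a \<Rightarrow> (nat \<Rightarrow> 'a) \<Rightarrow> nat \<Rightarrow> 'a" (infixr "##" 65) where
  "a ## s = (\<lambda>i. case i of 0 \<Rightarrow> a | Suc j \<Rightarrow> s j)"

lemma econs_simps [simp]: "(a ## s) 0 = a" "(a ## s) (Suc i) = s i"
  "(a ## s) 1 = s 0" "i > 0 \<Longrightarrow> (a ## s) i = s (i - 1)"
  "(a ## s) (numeral k) = s (pred_numeral k)"
  by (auto simp: econs_def numeral_eq_Suc split: nat.splits)

lemma range_econs [simp]: "range (a ## s) \<subseteq> D \<longleftrightarrow> a \<in> D \<and> range s \<subseteq> D"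
  by (auto simp: econs_def image_subset_iff split: nat.splits)

definition Dfn :: "'a struct set \<Rightarrow> fm set \<Rightarrow> ('a struct \<Rightarrow> (nat \<Rightarrow> 'a) \<Rightarrow> bool) \<Rightarrow> bool" where
  "Dfn C \<Gamma> P \<longleftrightarrow> (\<exists>p\<in>\<Gamma>. \<forall>M\<in>C. \<forall>s. range s \<subseteq> dom M \<longrightarrow> P M s = sat M s p)"

abbreviation "D0 C \<equiv> Dfn C Delta0"
abbreviation "Sig C k \<equiv> Dfn C (Sigma_fm k)"
abbreviation "Pie C k \<equiv> Dfn C (Pi_fm k)"

lemma finite_fv [simp]: "finite (fv p)"
  by (induction p) auto

lemma sat_cong: "(\<And>i. i \<in> fv p \<Longrightarrow> s i = t i) \<Longrightarrow> sat M s p = sat M t p"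
proof (induction p arbitrary: s t)
  case (Forall x p)
  have "sat M (s(x := a)) p = sat M (t(x := a)) p" for a
    by (rule Forall.IH) (use Forall.prems in auto)
  then show ?case by simp
next
  case (Exists x p)
  have "sat M (s(x := a)) p = sat M (t(x := a)) p" for a
    by (rule Exists.IH) (use Exists.prems in auto)
  then show ?case by simp
next
  case (Conj p q)
  have "sat M s p = sat M t p" "sat M s q = sat M t q"
    by (rule Conj.IH; use Conj.prems in auto)+
  then show ?case by simp
next
  case (Disj p q)
  have "sat M s p = sat M t p" "sat M s q = sat M t q"
    by (rule Disj.IH; use Disj.prems in auto)+
  then show ?case by simp
next
  case (Imp p q)
  have "sat M s p = sat M t p" "sat M s q = sat M t q"
    by (rule Imp.IH; use Imp.prems in auto)+
  then show ?case by simp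
next
  case (Neg p)
  have "sat M s p = sat M t p" by (rule Neg.IH) (use Neg.prems in auto)
  then show ?case by simp
qed auto

text \<open>
  The successor of the maximum, so that \<open>fresh X\<close> exceeds all elements of a finite \<open>X\<close>.
\<close>

definition fresh :: "nat set \<Rightarrow> nat" where "fresh X = Suc (Max (insert 0 X))"

lemma fresh: "finite X \<Longrightarrow> i \<in> X \<Longrightarrow> i < fresh X"
  by (simp add: fresh_def le_imp_less_Suc)

text \<open>
  Renaming of free variables by \<open>f\<close>; a quantified variable becomes one outside the values of \<open>f\<close>, which avoids capture.
\<close>

primrec sub :: "fm \<Rightarrow> (nat \<Rightarrow> nat) \<Rightarrow> fm" where
  "sub (Mem x y) = (\<lambda>f. Mem (f x) (f y))"
| "sub (Eq x y) = (\<lambda>f. Eq (f x) (f y))"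
| "sub (Neg p) = (\<lambda>f. Neg (sub p f))"
| "sub (Conj p q) = (\<lambda>f. Conj (sub p f) (sub q f))"
| "sub (Disj p q) = (\<lambda>f. Disj (sub p f) (sub q f))"
| "sub (Imp p q) = (\<lambda>f. Imp (sub p f) (sub q f))"
| "sub (Forall x p) = (\<lambda>f. let z = fresh (f ` fv p) in Forall z (sub p (f(x := z))))"
| "sub (Exists x p) = (\<lambda>f. let z = fresh (f ` fv p) in Exists z (sub p (f(x := z))))"

lemma sub_quant: 
  assumes "\<And>s f. sat M s (sub p f) = sat M (s \<circ> f) p"
  shows "sat M (s(fresh (f ` fv p) := a)) (sub p (f(x := fresh (f ` fv p)))) = sat M ((s \<circ> f)(x := a)) p"
proof -
  have "f i \<noteq> fresh (f ` fv p)" if "i \<in> fv p" for i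
    using fresh[of "f ` fv p" "f i"] that by auto
  then show ?thesis
    unfolding assms by (auto intro!: sat_cong)
qed

lemma sat_sub: "sat M s (sub p f) = sat M (s \<circ> f) p"
proof (induction p arbitrary: s f)
  case (Forall x p)
  show ?case using sub_quant[OF Forall, where s=s and f=f and x=x] by (simp add: Let_def comp_def)
next
  case (Exists x p)
  show ?case using sub_quant[OF Exists, where s=s and f=f and x=x] by (simp add: Let_def comp_def)
qed auto

lemma sub_Delta0: "p \<in> Delta0 \<Longrightarrow> sub p f \<in> Delta0"
proof (induction p arbitrary: f rule: Delta0.induct)
  case (ForallIn p x y)
  let ?z = "fresh (f ` fv (Imp (Mem x y) p))"
  have "?z \<noteq> f y" using fresh[of "f ` fv (Imp (Mem x y) p)" "f y"] by auto
  then show ?case using ForallIn by (auto simp: Let_def intro!: Delta0.intros)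
next
  case (ExistsIn p x y)
  let ?z = "fresh (f ` fv (Conj (Mem x y) p))"
  have "?z \<noteq> f y" using fresh[of "f ` fv (Conj (Mem x y) p)" "f y"] by auto
  then show ?case using ExistsIn by (auto simp: Let_def intro!: Delta0.intros)
qed (auto intro: Delta0.intros)

lemma sub_levy:
  "is_Sigma k p \<Longrightarrow> is_Sigma k (sub p f)" "is_Pi k p \<Longrightarrow> is_Pi k (sub p f)"
  by (induction k p and k p arbitrary: f and f rule: is_Sigma_is_Pi.inducts)
     (auto simp: Let_def sub_Delta0 intro: is_Sigma_is_Pi.intros)

lemma Sig0: "Sig C 0 = D0 C" and Pie0: "Pie C 0 = D0 C"
proof -
  have "Sigma_fm 0 = Delta0" "Pi_fm 0 = Delta0"
    by (auto simp: Sigma_fm_def Pi_fm_def elim: is_Sigma.cases is_Pi.cases intro: is_Sigma_is_Pi.intros)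
  then show "Sig C 0 = D0 C" "Pie C 0 = D0 C" by auto
qed

lemma levy_neg:
  "is_Sigma k p \<Longrightarrow> \<exists>q. is_Pi k q \<and> (\<forall>(M :: 'a struct) s. sat M s q = (\<not> sat M s p))"
  "is_Pi k p \<Longrightarrow> \<exists>q. is_Sigma k q \<and> (\<forall>(M :: 'a struct) s. sat M s q = (\<not> sat M s p))"
proof (induction k p and k p rule: is_Sigma_is_Pi.inducts)
  case (Sigma_0 p)
  then show ?case by (intro exI[of _ "Neg p"]) (auto intro: is_Sigma_is_Pi.intros Delta0.intros)
next
  case (Sigma_Exists k p x)
  then obtain q where "is_Pi (Suc k) q" "\<forall>(M :: 'a struct) s. sat M s q = (\<not> sat M s p)" by auto
  then show ?case by (intro exI[of _ "Forall x q"]) (auto intro: is_Sigma_is_Pi.intros)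
next
  case (Pi_0 p)
  then show ?case by (intro exI[of _ "Neg p"]) (auto intro: is_Sigma_is_Pi.intros Delta0.intros)
next
  case (Pi_Forall k p x)
  then obtain q where "is_Sigma (Suc k) q" "\<forall>(M :: 'a struct) s. sat M s q = (\<not> sat M s p)" by auto
  then show ?case by (intro exI[of _ "Exists x q"]) (auto intro: is_Sigma_is_Pi.intros)
qed (auto intro: is_Sigma_is_Pi.intros)

lemma Sig_notI: "Pie C k P \<Longrightarrow> Sig C k (\<lambda>M s. \<not> P M s)"
  unfolding Dfn_def Sigma_fm_def Pi_fm_def using levy_neg(2) by (metis mem_Collect_eq)

lemma Pie_notI: "Sig C k P \<Longrightarrow> Pie C k (\<lambda>M s. \<not> P M s)"
  unfolding Dfn_def Sigma_fm_def Pi_fm_def using levy_neg(1) by (metis mem_Collect_eq)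

lemma D0_not: "D0 C P \<Longrightarrow> D0 C (\<lambda>M s. \<not> P M s)"
  using Sig_notI[of C 0 P] by (simp add: Sig0 Pie0)

lemma levy_Suc:
  "is_Sigma k p \<Longrightarrow> is_Sigma (Suc k) p \<and> is_Pi (Suc k) p"
  "is_Pi k p \<Longrightarrow> is_Sigma (Suc k) p \<and> is_Pi (Suc k) p"
  by (induction k p and k p rule: is_Sigma_is_Pi.inducts) (auto intro: is_Sigma_is_Pi.intros)

lemma levy_mono:
  assumes "k \<le> l"
  shows "is_Sigma k p \<Longrightarrow> is_Sigma l p" "is_Pi k p \<Longrightarrow> is_Pi l p"
  using assms by (induction l rule: dec_induct) (auto dest: levy_Suc)

lemma levy_less:
  assumes "k < l"
  shows "is_Sigma k p \<Longrightarrow> is_Pi l p" "is_Pi k p \<Longrightarrow> is_Sigma l p"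
  using levy_Suc[of k p] levy_mono[of "Suc k" l p] assms by auto

lemma Dfn_mono: "Dfn C \<Gamma> P \<Longrightarrow> \<Gamma> \<subseteq> \<Gamma>' \<Longrightarrow> C' \<subseteq> C \<Longrightarrow> Dfn C' \<Gamma>' P"
  unfolding Dfn_def by blast

lemma Dfn_class: "Dfn C \<Gamma> P \<Longrightarrow> C' \<subseteq> C \<Longrightarrow> Dfn C' \<Gamma> P"
  by (rule Dfn_mono) auto

lemma Dfn_UNIV: "Dfn UNIV \<Gamma> P \<Longrightarrow> Dfn C \<Gamma> P"
  by (rule Dfn_class) auto

lemma Sig_mono: "Sig C k P \<Longrightarrow> k \<le> l \<Longrightarrow> Sig C l P"
  by (erule Dfn_mono) (auto simp: Sigma_fm_def levy_mono)
lemma Pie_mono: "Pie C k P \<Longrightarrow> k \<le> l \<Longrightarrow> Pie C l P"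
  by (erule Dfn_mono) (auto simp: Pi_fm_def levy_mono)
lemma Sig_Pie: "Sig C k P \<Longrightarrow> k < l \<Longrightarrow> Pie C l P"
  by (erule Dfn_mono) (auto simp: Sigma_fm_def Pi_fm_def levy_less)
lemma Pie_Sig: "Pie C k P \<Longrightarrow> k < l \<Longrightarrow> Sig C l P"
  by (erule Dfn_mono) (auto simp: Sigma_fm_def Pi_fm_def levy_less)
lemma D0_Sig: "D0 C P \<Longrightarrow> Sig C l P"
  using Sig_mono[of C 0 P l] by (simp add: Sig0)
lemma D0_Pie: "D0 C P \<Longrightarrow> Pie C l P"
  using Pie_mono[of C 0 P l] by (simp add: Pie0)

lemma Dfn_sub:
  fixes f :: "nat \<Rightarrow> nat" and C :: "'a struct set"
  assumes "Dfn C \<Gamma> P" "\<And>p. p \<in> \<Gamma> \<Longrightarrow> sub p f \<in> \<Gamma>"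
  shows "Dfn C \<Gamma> (\<lambda>M s. P M (\<lambda>i. s (f i)))"
proof -
  from assms(1) obtain p where p: "p \<in> \<Gamma>" "\<forall>M\<in>C. \<forall>s. range s \<subseteq> dom M \<longrightarrow> P M s = sat M s p"
    unfolding Dfn_def by auto
  show ?thesis unfolding Dfn_def
  proof (intro bexI[of _ "sub p f"] ballI allI impI)
    fix M :: "'a struct" and s :: "nat \<Rightarrow> 'a" assume "M \<in> C" "range s \<subseteq> dom M"
    then have "P M (\<lambda>i. s (f i)) = sat M (\<lambda>i. s (f i)) p" using p(2) by (auto simp: image_subset_iff)
    then show "P M (\<lambda>i. s (f i)) = sat M s (sub p f)" by (simp add: sat_sub comp_def)
  qed (use p assms in auto)
qed

lemma D0_sub: "D0 C P \<Longrightarrow> D0 C (\<lambda>M s. P M (\<lambda>i. s (f i)))"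
  by (erule Dfn_sub) (rule sub_Delta0)
lemma Sig_sub: "Sig C k P \<Longrightarrow> Sig C k (\<lambda>M s. P M (\<lambda>i. s (f i)))"
  by (erule Dfn_sub) (simp add: Sigma_fm_def sub_levy)
lemma Pie_sub: "Pie C k P \<Longrightarrow> Pie C k (\<lambda>M s. P M (\<lambda>i. s (f i)))"
  by (erule Dfn_sub) (simp add: Pi_fm_def sub_levy)

lemma sub_econs:
  assumes "\<And>i. Suc i \<in> fv p \<Longrightarrow> i \<noteq> x"
  shows "sat M (s(x := a)) (sub p (\<lambda>j. case j of 0 \<Rightarrow> x | Suc i \<Rightarrow> i)) = sat M (a ## s) p"
  unfolding sat_sub using assms by (intro sat_cong) (auto simp: econs_def split: nat.splits)

lemma fresh_fv: "Suc i \<in> fv p \<Longrightarrow> i \<noteq> fresh (insert y (fv p))"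
  using fresh[of "insert y (fv p)" "Suc i"] by auto

lemma Sig_Ex:
  fixes C :: "'a struct set"
  assumes "Sig C (Suc k) (\<lambda>M s. R M (\<lambda>i. s (Suc i)) (s 0))"
  shows "Sig C (Suc k) (\<lambda>M s. \<exists>a\<in>dom M. R M s a)"
proof -
  from assms obtain p where p: "is_Sigma (Suc k) p"
    "\<forall>M\<in>C. \<forall>s. range s \<subseteq> dom M \<longrightarrow> R M (\<lambda>i. s (Suc i)) (s 0) = sat M s p"
    unfolding Dfn_def Sigma_fm_def by auto
  define x where "x = fresh (insert 0 (fv p))"
  show ?thesis unfolding Dfn_def
  proof (intro bexI[of _ "Exists x (sub p (\<lambda>j. case j of 0 \<Rightarrow> x | Suc i \<Rightarrow> i))"] ballI allI impI)
    fix M :: "'a struct" and s :: "nat \<Rightarrow> 'a" assume M: "M \<in> C" "range s \<subseteq> dom M"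
    have "R M s a = sat M (a ## s) p" if "a \<in> dom M" for a
      using p(2)[rule_format, of M "a ## s"] M that by simp
    then show "(\<exists>a\<in>dom M. R M s a) = sat M s (Exists x (sub p (\<lambda>j. case j of 0 \<Rightarrow> x | Suc i \<Rightarrow> i)))"
      using fresh_fv[of _ p 0] by (simp add: sub_econs x_def)
  qed (use p in \<open>auto simp: Sigma_fm_def intro!: is_Sigma_is_Pi.intros sub_levy\<close>)
qed

lemma Pie_All:
  assumes "Pie C (Suc k) (\<lambda>M s. R M (\<lambda>i. s (Suc i)) (s 0))"
  shows "Pie C (Suc k) (\<lambda>M s. \<forall>a\<in>dom M. R M s a)"
proof -
  have "Sig C (Suc k) (\<lambda>M s. \<not> R M (\<lambda>i. s (Suc i)) (s 0))"
    using assms by (rule Sig_notI)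
  then have "Sig C (Suc k) (\<lambda>M s. \<exists>a\<in>dom M. \<not> R M s a)" by (rule Sig_Ex)
  then show ?thesis by (drule_tac Pie_notI) simp
qed

lemma D0_ExIn:
  fixes C :: "'a struct set"
  assumes "D0 C (\<lambda>M s. R M (\<lambda>i. s (Suc i)) (s 0))"
  shows "D0 C (\<lambda>M s. \<exists>a\<in>dom M. mem M a (s y) \<and> R M s a)"
proof -
  from assms obtain p where p: "p \<in> Delta0"
    "\<forall>M\<in>C. \<forall>s. range s \<subseteq> dom M \<longrightarrow> R M (\<lambda>i. s (Suc i)) (s 0) = sat M s p"
    unfolding Dfn_def by auto
  define x where "x = fresh (insert y (fv p))"
  have xy: "x \<noteq> y" using fresh[of "insert y (fv p)" y] by (auto simp: x_def)
  show ?thesis unfolding Dfn_def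
  proof (intro bexI[of _ "ExistsIn x y (sub p (\<lambda>j. case j of 0 \<Rightarrow> x | Suc i \<Rightarrow> i))"] ballI allI impI)
    fix M :: "'a struct" and s :: "nat \<Rightarrow> 'a" assume M: "M \<in> C" "range s \<subseteq> dom M"
    have "R M s a = sat M (a ## s) p" if "a \<in> dom M" for a
      using p(2)[rule_format, of M "a ## s"] M that by simp
    then show "(\<exists>a\<in>dom M. mem M a (s y) \<and> R M s a) =
        sat M s (ExistsIn x y (sub p (\<lambda>j. case j of 0 \<Rightarrow> x | Suc i \<Rightarrow> i)))"
      using fresh_fv[of _ p y] xy by (simp add: sub_econs x_def)
  qed (use p xy in \<open>auto intro!: Delta0.intros sub_Delta0\<close>)
qed

lemma D0_AllIn:
  assumes "D0 C (\<lambda>M s. R M (\<lambda>i. s (Suc i)) (s 0))"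
  shows "D0 C (\<lambda>M s. \<forall>a\<in>dom M. mem M a (s y) \<longrightarrow> R M s a)"
proof -
  have "D0 C (\<lambda>M s. \<exists>a\<in>dom M. mem M a (s y) \<and> \<not> R M s a)"
    by (rule D0_ExIn) (rule D0_not[OF assms])
  then show ?thesis by (drule_tac D0_not) simp
qed

lemma D0_mem: "D0 C (\<lambda>M s. mem M (s i) (s j))"
  unfolding Dfn_def by (rule bexI[of _ "Mem i j"]) (auto intro: Delta0.intros)
lemma D0_eq: "D0 C (\<lambda>M s. s i = s j)"
  unfolding Dfn_def by (rule bexI[of _ "Eq i j"]) (auto intro: Delta0.intros)

lemma D0_conj: "D0 C P \<Longrightarrow> D0 C Q \<Longrightarrow> D0 C (\<lambda>M s. P M s \<and> Q M s)"
proof -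
  assume "D0 C P" "D0 C Q"
  then obtain p q where "p \<in> Delta0" "q \<in> Delta0"
    "\<forall>M\<in>C. \<forall>s. range s \<subseteq> dom M \<longrightarrow> P M s = sat M s p"
    "\<forall>M\<in>C. \<forall>s. range s \<subseteq> dom M \<longrightarrow> Q M s = sat M s q" unfolding Dfn_def by auto
  then show ?thesis unfolding Dfn_def by (intro bexI[of _ "Conj p q"]) (auto intro: Delta0.intros)
qed

lemma D0_disj: assumes "D0 C P" "D0 C Q" shows "D0 C (\<lambda>M s. P M s \<or> Q M s)"
  using D0_not[OF D0_conj[OF D0_not[OF assms(1)] D0_not[OF assms(2)]]] by simp
lemma D0_imp: assumes "D0 C P" "D0 C Q" shows "D0 C (\<lambda>M s. P M s \<longrightarrow> Q M s)"
  using D0_disj[OF D0_not[OF assms(1)] assms(2)] by simp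
lemma D0_iff: assumes "D0 C P" "D0 C Q" shows "D0 C (\<lambda>M s. P M s \<longleftrightarrow> Q M s)"
  using D0_conj[OF D0_imp[OF assms] D0_imp[OF assms(2,1)]] unfolding iff_conv_conj_imp .

lemma Dfn_sat: "p \<in> \<Gamma> \<Longrightarrow> Dfn C \<Gamma> (\<lambda>M s. sat M s p)"
  unfolding Dfn_def by auto

lemma Dfn_cong:
  assumes "Dfn C \<Gamma> P" "\<And>M s. M \<in> C \<Longrightarrow> range s \<subseteq> dom M \<Longrightarrow> P M s = Q M s"
  shows "Dfn C \<Gamma> Q"
  using assms unfolding Dfn_def by metis

lemma Sigma_Suc_induct [consumes 1, case_names base Exists]:
  assumes "is_Sigma (Suc k) p"
    and base: "\<And>p. is_Pi k p \<Longrightarrow> R p"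
    and step: "\<And>p x. is_Sigma (Suc k) p \<Longrightarrow> R p \<Longrightarrow> R (Exists x p)"
  shows "R p"
proof -
  have "is_Sigma l p \<Longrightarrow> l = Suc k \<Longrightarrow> R p" and "is_Pi l p \<Longrightarrow> True" for l
    by (induction l p and l p rule: is_Sigma_is_Pi.inducts) (auto intro: base step)
  then show ?thesis using assms(1) by blast
qed

text \<open>
  The quantifier block of \<open>q\<close> is pulled out of \<open>F (P M s) (sat M s q)\<close>, one quantifier at a time; this
  needs the domain to be nonempty when \<open>F\<close> is disjunction. The renaming \<open>f\<close> keeps the
  variables of \<open>P\<close> and \<open>q\<close> apart.
\<close>

lemma Sig_prenex_step:
  fixes C :: "'a struct set"
  assumes F: "F = (\<and>) \<or> F = (\<or>)"
  assumes "is_Sigma (Suc k) q"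
    and "\<And>q'. is_Pi k q' \<Longrightarrow> \<forall>P f. Dfn C G P \<longrightarrow> Sig C (Suc k) (\<lambda>M s. F (P M s) (sat M (\<lambda>i. s (f i)) q'))"
    and Gsub: "\<And>P f. Dfn C G P \<Longrightarrow> Dfn C G (\<lambda>M s. P M (\<lambda>i. s (f i)))"
  shows "\<forall>P f. Dfn C G P \<longrightarrow> Sig C (Suc k) (\<lambda>M s. F (P M s) (sat M (\<lambda>i. s (f i)) q))"
  using assms(2)
proof (induction q rule: Sigma_Suc_induct)
  case (base q)
  then show ?case using assms(3) by auto
next
  case (Exists q x)
  show ?case
  proof (intro allI impI)
    fix P and f :: "nat \<Rightarrow> nat" assume P: "Dfn C G P"
    let ?g = "\<lambda>i. if i = x then 0 else Suc (f i)"
    have "Sig C (Suc k) (\<lambda>M s. F (P M (\<lambda>i. s (Suc i))) (sat M (\<lambda>i. s (?g i)) q))"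
      using Exists.IH[rule_format, OF Gsub[OF P, of Suc], of ?g] .
    then have "Sig C (Suc k) (\<lambda>M s. F (P M (\<lambda>i. s (Suc i))) (sat M ((\<lambda>i. (\<lambda>i. s (Suc i)) (f i))(x := s 0)) q))"
      by (simp add: fun_upd_def if_distrib)
    then have "Sig C (Suc k) (\<lambda>M s. \<exists>a\<in>dom M. F (P M s) (sat M ((\<lambda>i. s (f i))(x := a)) q))"
      by (rule Sig_Ex)
    then show "Sig C (Suc k) (\<lambda>M s. F (P M s) (sat M (\<lambda>i. s (f i)) (Exists x q)))"
    proof (rule Dfn_cong)
      fix M :: "'a struct" and s :: "nat \<Rightarrow> 'a" assume "range s \<subseteq> dom M"
      then have "dom M \<noteq> {}" by auto
      then show "(\<exists>a\<in>dom M. F (P M s) (sat M ((\<lambda>i. s (f i))(x := a)) q)) =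
         F (P M s) (sat M (\<lambda>i. s (f i)) (Exists x q))"
        using F by auto
    qed
  qed
qed

text \<open>
  Closure of \<open>\<Sigma>\<^sub>k\<close> under conjunction and disjunction: first the quantifiers of the second argument are
  pulled out, for a first argument that is \<open>\<Pi>\<^sub>k\<close>, and then, by symmetry, those of the first argument.
\<close>

lemma levy_bool:
  fixes C :: "'a struct set"
  shows "Sig C k P \<Longrightarrow> Sig C k Q \<Longrightarrow> Sig C k (\<lambda>M s. P M s \<and> Q M s) \<and> Sig C k (\<lambda>M s. P M s \<or> Q M s)"
proof (induction k arbitrary: P Q)
  case 0
  then show ?case unfolding Sig0 by (intro conjI D0_conj D0_disj)
next
  case (Suc k)
  have pi: "Pie C k (\<lambda>M s. P M s \<and> Q M s) \<and> Pie C k (\<lambda>M s. P M s \<or> Q M s)"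
    if "Pie C k P" "Pie C k Q" for P Q
    using Suc.IH[OF Sig_notI[OF that(1)] Sig_notI[OF that(2)]]
    by (auto dest!: Pie_notI)
  have *: "Sig C (Suc k) (\<lambda>M s. F (P M s) (Q M s))"
    if F: "F = (\<and>) \<or> F = (\<or>)" for F
  proof -
    from Suc.prems obtain p where p: "is_Sigma (Suc k) p" "\<forall>M\<in>C. \<forall>s. range s \<subseteq> dom M \<longrightarrow> P M s = sat M s p"
      unfolding Dfn_def Sigma_fm_def by auto
    from Suc.prems obtain q where q: "is_Sigma (Suc k) q" "\<forall>M\<in>C. \<forall>s. range s \<subseteq> dom M \<longrightarrow> Q M s = sat M s q"
      unfolding Dfn_def Sigma_fm_def by auto
    have comm: "F a b = F b a" for a b using F by auto
    have 0: "Sig C (Suc k) (\<lambda>M s. F (P M s) (Q M s))" if "Pie C k P" "Pie C k Q" for P Q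
    proof (rule Pie_Sig)
      show "Pie C k (\<lambda>M s. F (P M s) (Q M s))"
        by (rule disjE[OF F]; hypsubst; rule conjunct1[OF pi[OF that]] conjunct2[OF pi[OF that]])
    qed simp
    have 1: "\<forall>P f. Pie C k P \<longrightarrow> Sig C (Suc k) (\<lambda>M s. F (P M s) (sat M (\<lambda>i. s (f i)) q))"
      if "is_Sigma (Suc k) q" for q
      using F that
    proof (rule Sig_prenex_step)
      fix q' assume q': "is_Pi k q'"
      have "Pie C k (\<lambda>M s. sat M (\<lambda>i. s (f i)) q')" for f
        by (rule Pie_sub[of C k "\<lambda>M s. sat M s q'", OF Dfn_sat]) (simp add: Pi_fm_def q')
      then show "\<forall>P f. Pie C k P \<longrightarrow> Sig C (Suc k) (\<lambda>M s. F (P M s) (sat M (\<lambda>i. s (f i)) q'))"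
        by - (intro allI impI, rule 0)
    qed (rule Pie_sub)
    have 2: "\<forall>P f. Sig C (Suc k) P \<longrightarrow> Sig C (Suc k) (\<lambda>M s. F (P M s) (sat M (\<lambda>i. s (f i)) q))"
      using F q(1)
    proof (rule Sig_prenex_step)
      fix q' assume q': "is_Pi k q'"
      show "\<forall>P f. Sig C (Suc k) P \<longrightarrow> Sig C (Suc k) (\<lambda>M s. F (P M s) (sat M (\<lambda>i. s (f i)) q'))"
      proof (intro allI impI)
        fix P and f :: "nat \<Rightarrow> nat" assume "Sig C (Suc k) P"
        then obtain p where p: "is_Sigma (Suc k) p" "\<forall>M\<in>C. \<forall>s. range s \<subseteq> dom M \<longrightarrow> P M s = sat M s p"
          unfolding Dfn_def Sigma_fm_def by auto
        have "Pie C k (\<lambda>M s. sat M (\<lambda>i. s (f i)) q')"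
          by (rule Pie_sub[of C k "\<lambda>M s. sat M s q'", OF Dfn_sat]) (simp add: Pi_fm_def q')
        then have "Sig C (Suc k) (\<lambda>M s. F (sat M (\<lambda>i. s (f i)) q') (sat M (\<lambda>i. s (id i)) p))"
          by (rule 1[OF p(1), rule_format])
        then show "Sig C (Suc k) (\<lambda>M s. F (P M s) (sat M (\<lambda>i. s (f i)) q'))"
          by (rule Dfn_cong) (use p(2) comm in auto)
      qed
    qed (rule Sig_sub)
    have "Sig C (Suc k) (\<lambda>M s. F (P M s) (sat M (\<lambda>i. s (id i)) q))"
      by (rule 2[rule_format, OF Suc.prems(1)])
    then show ?thesis by (rule Dfn_cong) (use q(2) in auto)
  qed
  show ?case by (rule conjI; rule *; blast)
qed

lemma Sig_conj: "Sig C k P \<Longrightarrow> Sig C k Q \<Longrightarrow> Sig C k (\<lambda>M s. P M s \<and> Q M s)"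
  and Sig_disj: "Sig C k P \<Longrightarrow> Sig C k Q \<Longrightarrow> Sig C k (\<lambda>M s. P M s \<or> Q M s)"
  using levy_bool by auto

lemma Pie_conj: assumes "Pie C k P" "Pie C k Q" shows "Pie C k (\<lambda>M s. P M s \<and> Q M s)"
  using Pie_notI[OF Sig_disj[OF Sig_notI[OF assms(1)] Sig_notI[OF assms(2)]]] by simp
lemma Pie_disj: assumes "Pie C k P" "Pie C k Q" shows "Pie C k (\<lambda>M s. P M s \<or> Q M s)"
  using Pie_notI[OF Sig_conj[OF Sig_notI[OF assms(1)] Sig_notI[OF assms(2)]]] by simp
lemma Sig_imp: assumes "Pie C k P" "Sig C k Q" shows "Sig C k (\<lambda>M s. P M s \<longrightarrow> Q M s)"
  using Sig_disj[OF Sig_notI[OF assms(1)] assms(2)] by simp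
lemma Pie_imp: assumes "Sig C k P" "Pie C k Q" shows "Pie C k (\<lambda>M s. P M s \<longrightarrow> Q M s)"
  using Pie_disj[OF Pie_notI[OF assms(1)] assms(2)] by simp

lemma Pi_Suc_induct [consumes 1, case_names base Forall]:
  assumes "is_Pi (Suc k) p"
    and base: "\<And>p. is_Sigma k p \<Longrightarrow> R p"
    and step: "\<And>p x. is_Pi (Suc k) p \<Longrightarrow> R p \<Longrightarrow> R (Forall x p)"
  shows "R p"
proof -
  have "is_Pi l p \<Longrightarrow> l = Suc k \<Longrightarrow> R p" and "is_Sigma l p \<Longrightarrow> True" for l
    by (induction l p and l p rule: is_Sigma_is_Pi.inducts(2,1)) (auto intro: base step)
  then show ?thesis using assms(1) by blast
qed

text \<open>
  Two assignments that differ at most on \<open>X\<close>; quantifying over such \<open>t\<close> is a block of quantifiers over the variables in \<open>X\<close>.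
\<close>

definition eqoff :: "nat set \<Rightarrow> (nat \<Rightarrow> 'a) \<Rightarrow> (nat \<Rightarrow> 'a) \<Rightarrow> bool" where
  "eqoff X s t \<longleftrightarrow> (\<forall>i. i \<notin> X \<longrightarrow> t i = s i)"

lemma eqoff_insert_ex:
  assumes "range s \<subseteq> D"
  shows "(\<exists>a\<in>D. \<exists>t. range t \<subseteq> D \<and> eqoff X (s(x := a)) t \<and> Q t) \<longleftrightarrow>
         (\<exists>t. range t \<subseteq> D \<and> eqoff (insert x X) s t \<and> Q t)" (is "?l = ?r")
proof
  assume ?l
  then obtain a t where t: "a \<in> D" "range t \<subseteq> D" "eqoff X (s(x := a)) t" "Q t" by blast
  then have "eqoff (insert x X) s t" by (auto simp: eqoff_def)
  with t show ?r by blast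
next
  assume ?r
  then obtain t where t: "range t \<subseteq> D" "eqoff (insert x X) s t" "Q t" by blast
  then have "eqoff X (s(x := t x)) t" "t x \<in> D" by (auto simp: eqoff_def)
  with t show ?l by blast
qed

lemma eqoff_insert_all:
  assumes "range s \<subseteq> D"
  shows "(\<forall>a\<in>D. \<forall>t. range t \<subseteq> D \<and> eqoff X (s(x := a)) t \<longrightarrow> Q t) \<longleftrightarrow>
         (\<forall>t. range t \<subseteq> D \<and> eqoff (insert x X) s t \<longrightarrow> Q t)"
  using eqoff_insert_ex[OF assms, of X x "\<lambda>t. \<not> Q t"] by blast

lemma eqoff_empty [simp]: "eqoff {} s t \<longleftrightarrow> t = s"
  by (auto simp: eqoff_def)

lemma range_upd: "range s \<subseteq> D \<Longrightarrow> a \<in> D \<Longrightarrow> range (s(x := a)) \<subseteq> D" by auto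

lemma Sigma_block:
  assumes "is_Sigma (Suc k) p"
  shows "\<exists>X q. finite X \<and> is_Pi k q \<and> fv q \<subseteq> fv p \<union> X \<and>
     (\<forall>(M :: 'a struct) s. range s \<subseteq> dom M \<longrightarrow>
        sat M s p = (\<exists>t. range t \<subseteq> dom M \<and> eqoff X s t \<and> sat M t q))"
  using assms
proof (induction rule: Sigma_Suc_induct)
  case (base p)
  then show ?case by (intro exI[of _ "{}"] exI[of _ p]) auto
next
  case (Exists p x)
  then obtain X q where *: "finite X" "is_Pi k q" "fv q \<subseteq> fv p \<union> X"
    and q: "\<And>(M :: 'a struct) s. range s \<subseteq> dom M \<Longrightarrow>
        sat M s p = (\<exists>t. range t \<subseteq> dom M \<and> eqoff X s t \<and> sat M t q)" by metis
  show ?case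
  proof (intro exI[of _ "insert x X"] exI[of _ q] conjI allI impI)
    fix M :: "'a struct" and s :: "nat \<Rightarrow> 'a" assume s: "range s \<subseteq> dom M"
    have "sat M s (Exists x p) = (\<exists>a\<in>dom M. \<exists>t. range t \<subseteq> dom M \<and> eqoff X (s(x := a)) t \<and> sat M t q)"
      using q[OF range_upd[OF s]] by simp
    then show "sat M s (Exists x p) = (\<exists>t. range t \<subseteq> dom M \<and> eqoff (insert x X) s t \<and> sat M t q)"
      unfolding eqoff_insert_ex[OF s] .
  qed (use * in auto)
qed

lemma Pi_block:
  assumes "is_Pi (Suc k) p"
  shows "\<exists>X q. finite X \<and> is_Sigma k q \<and> fv q \<subseteq> fv p \<union> X \<and>
     (\<forall>(M :: 'a struct) s. range s \<subseteq> dom M \<longrightarrow>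
        sat M s p = (\<forall>t. range t \<subseteq> dom M \<and> eqoff X s t \<longrightarrow> sat M t q))"
  using assms
proof (induction rule: Pi_Suc_induct)
  case (base p)
  then show ?case by (intro exI[of _ "{}"] exI[of _ p]) auto
next
  case (Forall p x)
  then obtain X q where *: "finite X" "is_Sigma k q" "fv q \<subseteq> fv p \<union> X"
    and q: "\<And>(M :: 'a struct) s. range s \<subseteq> dom M \<Longrightarrow>
        sat M s p = (\<forall>t. range t \<subseteq> dom M \<and> eqoff X s t \<longrightarrow> sat M t q)" by metis
  show ?case
  proof (intro exI[of _ "insert x X"] exI[of _ q] conjI allI impI)
    fix M :: "'a struct" and s :: "nat \<Rightarrow> 'a" assume s: "range s \<subseteq> dom M"
    have "sat M s (Forall x p) = (\<forall>a\<in>dom M. \<forall>t. range t \<subseteq> dom M \<and> eqoff X (s(x := a)) t \<longrightarrow> sat M t q)"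
      using q[OF range_upd[OF s]] by simp
    then show "sat M s (Forall x p) = (\<forall>t. range t \<subseteq> dom M \<and> eqoff (insert x X) s t \<longrightarrow> sat M t q)"
      unfolding eqoff_insert_all[OF s] .
  qed (use * in auto)
qed

subsection \<open>Universal closure and transfer\<close>

lemma closure_block:
  assumes "finite X"
  shows "\<exists>q. (\<forall>k. is_Pi (Suc k) p \<longrightarrow> is_Pi (Suc k) q) \<and> (\<forall>(M :: 'a struct) s. range s \<subseteq> dom M \<longrightarrow>
      sat M s q = (\<forall>t. range t \<subseteq> dom M \<and> eqoff X s t \<longrightarrow> sat M t p))"
  using assms
proof induction
  case empty
  then show ?case by (intro exI[of _ p]) auto
next
  case (insert x X)
  then obtain q where q: "\<And>k. is_Pi (Suc k) p \<Longrightarrow> is_Pi (Suc k) q" "\<And>(M :: 'a struct) s. range s \<subseteq> dom M \<Longrightarrow>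
      sat M s q = (\<forall>t. range t \<subseteq> dom M \<and> eqoff X s t \<longrightarrow> sat M t p)" by blast
  show ?case
  proof (intro exI[of _ "Forall x q"] conjI allI impI)
    fix M :: "'a struct" and s :: "nat \<Rightarrow> 'a" assume s: "range s \<subseteq> dom M"
    have "sat M s (Forall x q) = (\<forall>a\<in>dom M. \<forall>t. range t \<subseteq> dom M \<and> eqoff X (s(x := a)) t \<longrightarrow> sat M t p)"
      using q(2)[OF range_upd[OF s]] by simp
    then show "sat M s (Forall x q) = (\<forall>t. range t \<subseteq> dom M \<and> eqoff (insert x X) s t \<longrightarrow> sat M t p)"
      unfolding eqoff_insert_all[OF s] .
  next
    fix k assume "is_Pi (Suc k) p"
    then show "is_Pi (Suc k) (Forall x q)" by (rule is_Sigma_is_Pi.Pi_Forall[OF q(1)])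
  qed
qed

lemma closure:
  "\<exists>q. (\<forall>k. is_Pi (Suc k) p \<longrightarrow> is_Pi (Suc k) q) \<and> (\<forall>(M :: 'a struct) s. range s \<subseteq> dom M \<longrightarrow>
      sat M s q = (\<forall>t. range t \<subseteq> dom M \<longrightarrow> sat M t p))"
proof -
  obtain q where q': "(\<forall>k. is_Pi (Suc k) p \<longrightarrow> is_Pi (Suc k) q) \<and> (\<forall>(M :: 'a struct) s. range s \<subseteq> dom M \<longrightarrow>
      sat M s q = (\<forall>t. range t \<subseteq> dom M \<and> eqoff (fv p) s t \<longrightarrow> sat M t p))"
    using closure_block[OF finite_fv, of p p] by (rule exE)
  note q = conjunct1[OF q'] conjunct2[OF q', rule_format]
  show ?thesis
  proof (intro exI[of _ q] conjI allI impI)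
    fix M :: "'a struct" and s :: "nat \<Rightarrow> 'a" assume s: "range s \<subseteq> dom M"
    have "sat M t p" if t: "range t \<subseteq> dom M"
      and *: "\<forall>t. range t \<subseteq> dom M \<and> eqoff (fv p) s t \<longrightarrow> sat M t p" for t
    proof -
      let ?t = "\<lambda>i. if i \<in> fv p then t i else s i"
      have "range ?t \<subseteq> dom M" "eqoff (fv p) s ?t" using s t by (auto simp: eqoff_def)
      then have "sat M ?t p" using * by blast
      then show ?thesis using sat_cong[of p ?t t M] by simp
    qed
    then show "sat M s q = (\<forall>t. range t \<subseteq> dom M \<longrightarrow> sat M t p)" using q(2)[OF s] by blast
  qed (use q(1) in blast)
qed

lemma elem_Sig:
  fixes M :: "'a struct"
  assumes "elem_end_ext k M N" "Sig {M, N} k P" "range s \<subseteq> dom M"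
  shows "P M s \<longleftrightarrow> P N s"
proof -
  have "dom M \<subseteq> dom N" using assms(1) by (auto simp: elem_end_ext_def end_extension_def substructure_def)
  moreover obtain p where p: "p \<in> Sigma_fm k"
    "\<forall>K\<in>{M, N}. \<forall>s. range s \<subseteq> dom K \<longrightarrow> P K s = sat K s p"
    using assms(2) unfolding Dfn_def by blast
  moreover have "sat M s p = sat N s p"
    using assms(1,3) p(1) by (auto simp: elem_end_ext_def)
  ultimately show ?thesis using assms(3) by auto
qed

lemma elem_Pie:
  assumes "elem_end_ext k M N" "Pie {M, N} k P" "range s \<subseteq> dom M"
  shows "P M s \<longleftrightarrow> P N s"
  using elem_Sig[OF assms(1) Sig_notI[OF assms(2)] assms(3)] by simp

text \<open>
  A \<open>\<Sigma>\<^sub>k\<close> predicate that is true of everything in \<open>M\<close> is true of everything in \<open>N\<close>, including what is outside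
  \<open>M\<close>, because its universal closure is a \<open>\<Pi>\<^sub>k\<^sub>+\<^sub>1\<close> sentence. Almost all that is known about \<open>N\<close> comes from
  here.
\<close>

lemma transfer_up:
  fixes M :: "'a struct"
  assumes "elem_end_ext (Suc k) M N" "Sig {M, N} k P" "\<And>s. range s \<subseteq> dom M \<Longrightarrow> P M s"
    and "dom M \<noteq> {}" "range t \<subseteq> dom N"
  shows "P N t"
proof -
  have MN: "dom M \<subseteq> dom N" using assms(1) by (auto simp: elem_end_ext_def end_extension_def substructure_def)
  obtain p where p: "is_Sigma k p"
    "\<forall>K\<in>{M, N}. \<forall>s. range s \<subseteq> dom K \<longrightarrow> P K s = sat K s p"
    using assms(2) unfolding Dfn_def Sigma_fm_def by auto
  have "is_Pi (Suc k) p" using p levy_Suc by blast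
  obtain q where q': "(\<forall>k. is_Pi (Suc k) p \<longrightarrow> is_Pi (Suc k) q) \<and> (\<forall>(M :: 'a struct) s. range s \<subseteq> dom M \<longrightarrow>
      sat M s q = (\<forall>t. range t \<subseteq> dom M \<longrightarrow> sat M t p))"
    using closure[of p] by (rule exE)
  note q = conjunct1[OF q', rule_format, OF \<open>is_Pi (Suc k) p\<close>] conjunct2[OF q', rule_format]
  obtain a where a: "a \<in> dom M" using assms(4) by blast
  let ?s = "\<lambda>_::nat. a"
  have s: "range ?s \<subseteq> dom M" "range ?s \<subseteq> dom N" using a MN by auto
  have "Pie {M, N} (Suc k) (\<lambda>M s. sat M s q)" by (rule Dfn_sat) (simp add: Pi_fm_def q)
  from elem_Pie[OF assms(1) this s(1)] have "sat M ?s q = sat N ?s q" .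
  moreover have "sat M ?s q" using q(2)[OF s(1)] assms(3) p(2) by auto
  ultimately have "sat N t p" using q(2)[OF s(2)] assms(5) by blast
  then show ?thesis using p(2) assms(5) by auto
qed

subsection \<open>Relativization\<close>

definition restr :: "'a struct \<Rightarrow> 'a \<Rightarrow> 'a struct" where
  "restr M m = \<lparr>dom = {a \<in> dom M. mem M a m}, mem = mem M\<rparr>"

lemma restr_sel [simp]: "dom (restr M m) = {a \<in> dom M. mem M a m}" "mem (restr M m) = mem M"
  by (auto simp: restr_def)

text \<open>
  The quantifiers become bounded by the variable \<open>m\<close>, so that the result is \<open>\<Delta>\<^sub>0\<close>.
\<close>

primrec rel :: "nat \<Rightarrow> fm \<Rightarrow> fm" where
  "rel m (Mem x y) = Mem x y"
| "rel m (Eq x y) = Eq x y"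
| "rel m (Neg p) = Neg (rel m p)"
| "rel m (Conj p q) = Conj (rel m p) (rel m q)"
| "rel m (Disj p q) = Disj (rel m p) (rel m q)"
| "rel m (Imp p q) = Imp (rel m p) (rel m q)"
| "rel m (Forall x p) = ForallIn x m (rel m p)"
| "rel m (Exists x p) = ExistsIn x m (rel m p)"

primrec vars :: "fm \<Rightarrow> nat set" where
  "vars (Mem x y) = {x, y}"
| "vars (Eq x y) = {x, y}"
| "vars (Neg p) = vars p"
| "vars (Conj p q) = vars p \<union> vars q"
| "vars (Disj p q) = vars p \<union> vars q"
| "vars (Imp p q) = vars p \<union> vars q"
| "vars (Forall x p) = insert x (vars p)"
| "vars (Exists x p) = insert x (vars p)"

lemma finite_vars: "finite (vars p)" and fv_vars: "fv p \<subseteq> vars p"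
  by (induction p) auto

lemma rel_Delta0: "m \<notin> vars p \<Longrightarrow> rel m p \<in> Delta0"
  by (induction p) (auto intro!: Delta0.intros)

lemma sat_rel: "m \<notin> vars p \<Longrightarrow> sat M s (rel m p) = sat (restr M (s m)) s p"
  by (induction p arbitrary: s) auto

lemma D0_restr: "D0 C (\<lambda>M s. sat (restr M (s 0)) (\<lambda>i. s (Suc i)) p)"
proof -
  define m where "m = fresh (vars p)"
  have m: "m \<notin> vars p" using fresh[OF finite_vars, of m p] by (auto simp: m_def)
  let ?f = "\<lambda>i. if i = m then 0 else Suc i"
  have "D0 C (\<lambda>M s. sat M s (rel m p))" by (rule Dfn_sat) (rule rel_Delta0[OF m])
  then have "D0 C (\<lambda>M s. sat M (\<lambda>i. s (?f i)) (rel m p))" by (rule D0_sub)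
  then show ?thesis
  proof (rule Dfn_cong)
    fix M :: "'a struct" and s :: "nat \<Rightarrow> 'a"
    have "sat (restr M (s 0)) (\<lambda>i. s (?f i)) p = sat (restr M (s 0)) (\<lambda>i. s (Suc i)) p"
      using m fv_vars[of p] by (intro sat_cong) auto
    then show "sat M (\<lambda>i. s (?f i)) (rel m p) = sat (restr M (s 0)) (\<lambda>i. s (Suc i)) p"
      by (simp add: sat_rel[OF m])
  qed
qed

lemma sat_struct_cong:
  assumes "dom M = dom N" "\<And>a b. a \<in> dom M \<Longrightarrow> b \<in> dom M \<Longrightarrow> mem M a b = mem N a b"
    and "range s \<subseteq> dom M"
  shows "sat M s p = sat N s p"
  using assms(3)
proof (induction p arbitrary: s)
  case (Forall x p)
  have "sat M (s(x := a)) p = sat N (s(x := a)) p" if "a \<in> dom M" for a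
    by (rule Forall.IH) (use Forall.prems that in auto)
  then show ?case using assms(1) by simp
next
  case (Exists x p)
  have "sat M (s(x := a)) p = sat N (s(x := a)) p" if "a \<in> dom M" for a
    by (rule Exists.IH) (use Exists.prems that in auto)
  then show ?case using assms(1) by simp
qed (use assms(1,2) in \<open>auto simp: image_subset_iff\<close>)

subsection \<open>Collection and Separation for predicates\<close>

definition coll :: "'a struct \<Rightarrow> ('a \<Rightarrow> 'a \<Rightarrow> bool) \<Rightarrow> bool" where
  "coll M R \<longleftrightarrow> (\<forall>w\<in>dom M. (\<forall>x\<in>dom M. mem M x w \<longrightarrow> (\<exists>y\<in>dom M. R x y)) \<longrightarrow>
     (\<exists>c\<in>dom M. \<forall>x\<in>dom M. mem M x w \<longrightarrow> (\<exists>y\<in>dom M. mem M y c \<and> R x y)))"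

definition sepa :: "'a struct \<Rightarrow> ('a \<Rightarrow> bool) \<Rightarrow> bool" where
  "sepa M R \<longleftrightarrow> (\<forall>w\<in>dom M. \<exists>y\<in>dom M. \<forall>x\<in>dom M. mem M x y \<longleftrightarrow> mem M x w \<and> R x)"

lemma Coll_ax:
  fixes C :: "'a struct set"
  assumes "Dfn C \<Gamma> (\<lambda>M s. R M (\<lambda>i. s (Suc (Suc i))) (s (Suc 0)) (s 0))"
  shows "\<exists>ax\<in>Collection \<Gamma>. \<forall>M\<in>C. (\<forall>t. range t \<subseteq> dom M \<longrightarrow> sat M t ax) \<longrightarrow>
     (\<forall>s. range s \<subseteq> dom M \<longrightarrow> coll M (R M s))"
proof -
  from assms obtain p where p: "p \<in> \<Gamma>" "\<And>M s. M \<in> C \<Longrightarrow> range s \<subseteq> dom M \<Longrightarrow>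
     R M (\<lambda>i. s (Suc (Suc i))) (s (Suc 0)) (s 0) = sat M s p" unfolding Dfn_def by auto
  define w where "w = Suc (Suc (fresh (fv p)))"
  have w: "w \<notin> fv p" "Suc w \<notin> fv p" "w \<noteq> 0" "w \<noteq> Suc 0"
    using fresh[of "fv p" w] fresh[of "fv p" "Suc w"] by (auto simp: w_def)
  let ?ax = "Forall w (Imp (ForallIn (Suc 0) w (Exists 0 p))
       (Exists (Suc w) (ForallIn (Suc 0) w (ExistsIn 0 (Suc w) p))))"
  show ?thesis
  proof (intro bexI[of _ ?ax] ballI allI impI)
    fix M :: "'a struct" and s :: "nat \<Rightarrow> 'a" assume M: "M \<in> C" and ax: "\<forall>t. range t \<subseteq> dom M \<longrightarrow> sat M t ?ax"
      and s: "range s \<subseteq> dom M"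
    obtain a where a: "a \<in> dom M" using s by blast
    have R: "R M s x y = sat M (y ## x ## s) p" if "x \<in> dom M" "y \<in> dom M" for x y
      using p(2)[OF M, of "y ## x ## s"] s that by simp
    let ?t = "a ## a ## s"
    have 1: "sat M (?t(w := b, Suc 0 := x, 0 := y)) p = sat M (y ## x ## s) p" for b x y
      using w by (intro sat_cong) (auto simp: econs_def split: nat.splits)
    have 2: "sat M (?t(w := b, Suc w := c, Suc 0 := x, 0 := y)) p = sat M (y ## x ## s) p" for b c x y
      using w by (intro sat_cong) (auto simp: econs_def split: nat.splits)
    have "sat M ?t ?ax" using ax s a by simp
    then show "coll M (R M s)"
      using w by (simp add: 1 2 coll_def R cong: conj_cong)
  next
    show "?ax \<in> Collection \<Gamma>" unfolding Collection_def using p(1) w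
      by (intro CollectI exI[of _ p] exI[of _ "Suc 0"] exI[of _ 0] exI[of _ w] exI[of _ "Suc w"]) auto
  qed
qed

lemma Sep_ax:
  fixes C :: "'a struct set"
  assumes "Dfn C \<Gamma> (\<lambda>M s. R M (\<lambda>i. s (Suc i)) (s 0))"
  shows "\<exists>ax\<in>Separation \<Gamma>. \<forall>M\<in>C. (\<forall>t. range t \<subseteq> dom M \<longrightarrow> sat M t ax) \<longrightarrow>
     (\<forall>s. range s \<subseteq> dom M \<longrightarrow> sepa M (R M s))"
proof -
  from assms obtain p where p: "p \<in> \<Gamma>" "\<And>M s. M \<in> C \<Longrightarrow> range s \<subseteq> dom M \<Longrightarrow>
     R M (\<lambda>i. s (Suc i)) (s 0) = sat M s p" unfolding Dfn_def by auto
  define w where "w = Suc (fresh (fv p))"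
  have w: "w \<notin> fv p" "Suc w \<notin> fv p" "w \<noteq> 0"
    using fresh[of "fv p" w] fresh[of "fv p" "Suc w"] by (auto simp: w_def)
  let ?ax = "Forall w (Exists (Suc w) (Forall 0 (Iff (Mem 0 (Suc w)) (Conj (Mem 0 w) p))))"
  show ?thesis
  proof (intro bexI[of _ ?ax] ballI allI impI)
    fix M :: "'a struct" and s :: "nat \<Rightarrow> 'a" assume M: "M \<in> C" and ax: "\<forall>t. range t \<subseteq> dom M \<longrightarrow> sat M t ?ax"
      and s: "range s \<subseteq> dom M"
    obtain a where a: "a \<in> dom M" using s by blast
    have R: "R M s x = sat M (x ## s) p" if "x \<in> dom M" for x
      using p(2)[OF M, of "x ## s"] s that by simp
    let ?t = "a ## s"
    have 2: "sat M (?t(w := b, Suc w := c, 0 := x)) p = sat M (x ## s) p" for b c x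
      using w by (intro sat_cong) (auto simp: econs_def split: nat.splits)
    have "sat M ?t ?ax" using ax s a by simp
    then have "\<forall>w\<in>dom M. \<exists>y\<in>dom M. \<forall>x\<in>dom M. (mem M x y \<longrightarrow> mem M x w \<and> R M s x) \<and> (mem M x w \<and> R M s x \<longrightarrow> mem M x y)"
      using w by (simp add: 2 R cong: conj_cong)
    then show "sepa M (R M s)" unfolding sepa_def iff_conv_conj_imp .
  next
    show "?ax \<in> Separation \<Gamma>" unfolding Separation_def using p(1) w
      by (intro CollectI exI[of _ p] exI[of _ "0"] exI[of _ "Suc w"] exI[of _ w]) auto
  qed
qed

lemma Coll_models:
  assumes "models M (Collection \<Gamma>)" "Dfn {M} \<Gamma> (\<lambda>M s. R M (\<lambda>i. s (Suc (Suc i))) (s (Suc 0)) (s 0))"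
    "range s \<subseteq> dom M"
  shows "coll M (R M s)"
  using Coll_ax[OF assms(2)] assms(1,3) by (auto simp: models_def)

lemma Sep_models:
  assumes "models M (Separation \<Gamma>)" "Dfn {M} \<Gamma> (\<lambda>M s. R M (\<lambda>i. s (Suc i)) (s 0))"
    "range s \<subseteq> dom M"
  shows "sepa M (R M s)"
  using Sep_ax[OF assms(2)] assms(1,3) by (auto simp: models_def)

lemmas D0_intros = D0_mem D0_eq D0_not D0_conj D0_disj D0_imp D0_iff D0_ExIn D0_AllIn

lemma collD:
  assumes "coll M R" "w \<in> dom M" "\<And>x. x \<in> dom M \<Longrightarrow> mem M x w \<Longrightarrow> \<exists>y\<in>dom M. R x y"
  shows "\<exists>c\<in>dom M. \<forall>x\<in>dom M. mem M x w \<longrightarrow> (\<exists>y\<in>dom M. mem M y c \<and> R x y)"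
  using assms unfolding coll_def by auto

lemma sepaD:
  assumes "sepa M R" "w \<in> dom M"
  shows "\<exists>y\<in>dom M. \<forall>x\<in>dom M. mem M x y \<longleftrightarrow> mem M x w \<and> R x"
  using assms unfolding sepa_def by auto

subsection \<open>Absorption of bounded quantifiers\<close>

text \<open>
  The weak forms of Pairing and Union, giving supersets only, on which the collapse of
  quantifiers relies: several witnesses are replaced by a set that contains them all.
\<close>

definition base :: "'a struct \<Rightarrow> bool" where
  "base M \<longleftrightarrow> dom M \<noteq> {} \<and> (\<forall>a\<in>dom M. \<forall>b\<in>dom M. \<exists>d\<in>dom M. mem M a d \<and> mem M b d) \<and>
     (\<forall>c\<in>dom M. \<exists>e\<in>dom M. \<forall>d\<in>dom M. mem M d c \<longrightarrow> (\<forall>y\<in>dom M. mem M y d \<longrightarrow> mem M y e))"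

text \<open>
  What is needed of every structure in \<open>C\<close> for \<open>\<Sigma>\<^sub>k\<close> to be closed under bounded quantification.
\<close>

definition good :: "'a struct set \<Rightarrow> nat \<Rightarrow> bool" where
  "good C k \<longleftrightarrow> (\<forall>M\<in>C. base M \<and> models M (Separation Delta0) \<and>
     (\<forall>j<k. models M (Collection (Pi_fm j))))"

lemma good_mono: "good C k \<Longrightarrow> j \<le> k \<Longrightarrow> good C j"
  unfolding good_def by auto

lemma Pie_AllIn:
  assumes "Pie C k (\<lambda>M s. R M (\<lambda>i. s (Suc i)) (s 0))"
  shows "Pie C k (\<lambda>M s. \<forall>a\<in>dom M. mem M a (s y) \<longrightarrow> R M s a)"
proof (cases k)
  case 0
  with assms show ?thesis by (simp add: Pie0 D0_AllIn)
next
  case (Suc j)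
  show ?thesis unfolding Suc
    by (rule Pie_All) (rule Pie_imp[OF D0_Sig[OF D0_mem] assms[unfolded Suc]])
qed

lemma Sig_ExIn:
  assumes "Sig C k (\<lambda>M s. R M (\<lambda>i. s (Suc i)) (s 0))"
  shows "Sig C k (\<lambda>M s. \<exists>a\<in>dom M. mem M a (s y) \<and> R M s a)"
proof -
  have "Pie C k (\<lambda>M s. \<forall>a\<in>dom M. mem M a (s y) \<longrightarrow> \<not> R M s a)"
    by (rule Pie_AllIn) (rule Pie_notI[OF assms])
  from Sig_notI[OF this] show ?thesis by simp
qed

text \<open>
  The induction that follows needs this closure property of \<open>\<Sigma>\<^sub>k\<close> as a hypothesis about all predicates of
  level \<open>k\<close>.
\<close>

definition absorbs :: "'a struct set \<Rightarrow> nat \<Rightarrow> bool" where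
  "absorbs C k \<longleftrightarrow> (\<forall>R y. Sig C k (\<lambda>M s. R M (\<lambda>i. s (Suc i)) (s 0)) \<longrightarrow>
     Sig C k (\<lambda>M s. \<forall>a\<in>dom M. mem M a (s y) \<longrightarrow> R M s a))"

lemma absorbs_Pie:
  assumes "absorbs C k" "Pie C k (\<lambda>M s. R M (\<lambda>i. s (Suc i)) (s 0))"
  shows "Pie C k (\<lambda>M s. \<exists>a\<in>dom M. mem M a (s y) \<and> R M s a)"
proof -
  have "Sig C k (\<lambda>M s. \<forall>a\<in>dom M. mem M a (s y) \<longrightarrow> \<not> R M s a)"
    using assms(1)[unfolded absorbs_def, rule_format, of "\<lambda>M s a. \<not> R M s a", OF Sig_notI[OF assms(2)]] .
  from Pie_notI[OF this] show ?thesis by simp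
qed

text \<open>
  A block of existential quantifiers collapses to one: the single witness is a set containing witnesses of the block,
  and the bounded quantifiers that this introduces are absorbed at level \<open>k\<close>.
\<close>

lemma single_ex:
  fixes C :: "'a struct set"
  assumes base: "\<And>M. M \<in> C \<Longrightarrow> base M" and abs: "absorbs C k" and P: "Sig C (Suc k) P"
  shows "\<exists>Q. Pie C k (\<lambda>M s. Q M (\<lambda>i. s (Suc i)) (s 0)) \<and>
    (\<forall>M\<in>C. \<forall>s. range s \<subseteq> dom M \<longrightarrow> P M s = (\<exists>c\<in>dom M. Q M s c))"
proof -
  have *: "\<exists>Q. Pie C k (\<lambda>M s. Q M (\<lambda>i. s (Suc i)) (s 0)) \<and>
    (\<forall>M\<in>C. \<forall>s. range s \<subseteq> dom M \<longrightarrow> sat M s p = (\<exists>c\<in>dom M. Q M s c))"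
    if "is_Sigma (Suc k) p" for p
    using that
  proof (induction rule: Sigma_Suc_induct)
    case (base p)
    have "Pie C k (\<lambda>M s. sat M (\<lambda>i. s (Suc i)) p)"
      by (rule Pie_sub[of C k "\<lambda>M s. sat M s p", OF Dfn_sat]) (simp add: Pi_fm_def base)
    then show ?case by (intro exI[of _ "\<lambda>M s c. sat M s p"]) auto
  next
    case (Exists p x)
    then obtain Q where Q: "Pie C k (\<lambda>M s. Q M (\<lambda>i. s (Suc i)) (s 0))"
      "\<forall>M\<in>C. \<forall>s. range s \<subseteq> dom M \<longrightarrow> sat M s p = (\<exists>c\<in>dom M. Q M s c)" by auto
    let ?f = "\<lambda>j. case j of 0 \<Rightarrow> 0 | Suc i \<Rightarrow> if i = x then Suc 0 else Suc (Suc (Suc i))"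
    have "Pie C k (\<lambda>M s. Q M (\<lambda>i. s (?f (Suc i))) (s (?f 0)))"
      by (rule Pie_sub[OF Q(1)])
    then have 1: "Pie C k (\<lambda>M s. Q M ((\<lambda>i. s (Suc (Suc (Suc i))))(x := s (Suc 0))) (s 0))"
      by (simp add: fun_upd_def if_distrib)
    have 2: "Pie C k (\<lambda>M s. \<exists>a\<in>dom M. mem M a (s 0) \<and>
        (\<exists>c\<in>dom M. mem M c (s 0) \<and> Q M ((\<lambda>i. s (Suc i))(x := a)) c))"
      by (rule absorbs_Pie[OF abs], rule absorbs_Pie[OF abs], rule 1)
    show ?case
    proof (intro exI conjI ballI allI impI)
      show "Pie C k (\<lambda>M s. (\<lambda>M s d. \<exists>a\<in>dom M. mem M a d \<and>
        (\<exists>c\<in>dom M. mem M c d \<and> Q M (s(x := a)) c)) M (\<lambda>i. s (Suc i)) (s 0))"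
        using 2 .
    next
      fix M :: "'a struct" and s :: "nat \<Rightarrow> 'a" assume M: "M \<in> C" and s: "range s \<subseteq> dom M"
      have q: "sat M (s(x := a)) p = (\<exists>c\<in>dom M. Q M (s(x := a)) c)" if "a \<in> dom M" for a
        using Q(2)[rule_format, OF M range_upd[OF s that]] .
      have "\<exists>d\<in>dom M. mem M a d \<and> mem M b d" if "a \<in> dom M" "b \<in> dom M" for a b
        using base[OF M] that by (auto simp: base_def)
      with q show "sat M s (Exists x p) = (\<exists>d\<in>dom M. \<exists>a\<in>dom M. mem M a d \<and>
        (\<exists>c\<in>dom M. mem M c d \<and> Q M (s(x := a)) c))"
        unfolding sat.simps by (metis (no_types, lifting))
    qed
  qed
  from P obtain p where p: "is_Sigma (Suc k) p"
    "\<forall>M\<in>C. \<forall>s. range s \<subseteq> dom M \<longrightarrow> P M s = sat M s p" unfolding Dfn_def Sigma_fm_def by auto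
  from *[OF p(1)] obtain Q where Q: "Pie C k (\<lambda>M s. Q M (\<lambda>i. s (Suc i)) (s 0))"
    "\<forall>M\<in>C. \<forall>s. range s \<subseteq> dom M \<longrightarrow> sat M s p = (\<exists>c\<in>dom M. Q M s c)" by auto
  show ?thesis by (intro exI[of _ Q] conjI) (use Q p in auto)
qed

text \<open>
  A bounded quantifier passes a single unbounded one by Collection, leaving \<open>\<exists>e. \<forall>a\<in>y. \<exists>c\<in>e\<close>, whose
  bounded part is \<open>\<Pi>\<^sub>k\<close> by the induction hypothesis.
\<close>

lemma good_absorbs: "good C k \<Longrightarrow> absorbs C k"
proof (induction k)
  case 0
  show ?case unfolding absorbs_def Sig0 by (intro allI impI) (rule D0_AllIn)
next
  case (Suc k)
  have abs: "absorbs C k" by (rule Suc.IH[OF good_mono[OF Suc.prems]]) simp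
  have b: "base M" if "M \<in> C" for M using Suc.prems that by (simp add: good_def)
  show ?case unfolding absorbs_def
  proof (intro allI impI)
    fix R :: "'a struct \<Rightarrow> (nat \<Rightarrow> 'a) \<Rightarrow> 'a \<Rightarrow> bool" and y
    assume "Sig C (Suc k) (\<lambda>M s. R M (\<lambda>i. s (Suc i)) (s 0))"
    from single_ex[OF b abs this] obtain Q where Q:
      "Pie C k (\<lambda>M s. Q M (\<lambda>i. s (Suc i)) (s 0))"
      "\<forall>M\<in>C. \<forall>s. range s \<subseteq> dom M \<longrightarrow> R M (\<lambda>i. s (Suc i)) (s 0) = (\<exists>c\<in>dom M. Q M s c)" by auto
    have R: "R M s a = (\<exists>c\<in>dom M. Q M (a ## s) c)" if "M \<in> C" "range s \<subseteq> dom M" "a \<in> dom M" for M s a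
      using Q(2)[rule_format, of M "a ## s"] that by simp
    let ?f = "\<lambda>j. case j of 0 \<Rightarrow> 0 | Suc 0 \<Rightarrow> Suc 0 | Suc (Suc i) \<Rightarrow> Suc (Suc (Suc i))"
    have "Pie C k (\<lambda>M s. Q M (\<lambda>i. s (?f (Suc i))) (s (?f 0)))"
      by (rule Pie_sub[OF Q(1)])
    then have 1: "Pie C k (\<lambda>M s. Q M (s (Suc 0) ## (\<lambda>i. s (Suc (Suc (Suc i))))) (s 0))"
      by (rule Dfn_cong) (auto simp: econs_def intro!: arg_cong2[where f = "Q _"] split: nat.splits)
    have "Sig C (Suc k) (\<lambda>M s. \<exists>e\<in>dom M. \<forall>a\<in>dom M. mem M a (s y) \<longrightarrow>
         (\<exists>c\<in>dom M. mem M c e \<and> Q M (a ## s) c))"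
      by (rule Sig_Ex, rule Pie_Sig[of C k], rule Pie_AllIn, rule absorbs_Pie[OF abs], rule 1) simp
    then show "Sig C (Suc k) (\<lambda>M s. \<forall>a\<in>dom M. mem M a (s y) \<longrightarrow> R M s a)"
    proof (rule Dfn_cong)
      fix M :: "'a struct" and s :: "nat \<Rightarrow> 'a" assume M: "M \<in> C" and s: "range s \<subseteq> dom M"
      let ?f = "\<lambda>j. case j of 0 \<Rightarrow> 0 | Suc 0 \<Rightarrow> Suc 0 | Suc (Suc i) \<Rightarrow> Suc (Suc i)"
      have "Pie {M} k (\<lambda>M s. Q M (s (Suc 0) ## (\<lambda>i. s (Suc (Suc i)))) (s 0))"
      proof (rule Dfn_class[of C])
        have "Pie C k (\<lambda>M s. Q M (\<lambda>i. s (?f (Suc i))) (s (?f 0)))"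
          by (rule Pie_sub[OF Q(1)])
        then show "Pie C k (\<lambda>M s. Q M (s (Suc 0) ## (\<lambda>i. s (Suc (Suc i)))) (s 0))"
          by (rule Dfn_cong) (auto simp: econs_def intro!: arg_cong2[where f = "Q _"] split: nat.splits)
      qed (use M in auto)
      then have "coll M ((\<lambda>M s x y. Q M (x ## s) y) M s)"
        using Suc.prems M s by (intro Coll_models[of M "Pi_fm k"]) (auto simp: good_def)
      then have "(\<forall>a\<in>dom M. mem M a (s y) \<longrightarrow> (\<exists>c\<in>dom M. Q M (a ## s) c)) \<Longrightarrow>
        (\<exists>e\<in>dom M. \<forall>a\<in>dom M. mem M a (s y) \<longrightarrow> (\<exists>c\<in>dom M. mem M c e \<and> Q M (a ## s) c))"
        using s unfolding coll_def by blast
      then show "(\<exists>e\<in>dom M. \<forall>a\<in>dom M. mem M a (s y) \<longrightarrow> (\<exists>c\<in>dom M. mem M c e \<and> Q M (a ## s) c)) =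
        (\<forall>a\<in>dom M. mem M a (s y) \<longrightarrow> R M s a)"
        using R[OF M s] by blast
    qed
  qed
qed

lemma Sig_AllIn:
  assumes "good C k" "Sig C k (\<lambda>M s. R M (\<lambda>i. s (Suc i)) (s 0))"
  shows "Sig C k (\<lambda>M s. \<forall>a\<in>dom M. mem M a (s y) \<longrightarrow> R M s a)"
  using good_absorbs[OF assms(1), unfolded absorbs_def, rule_format, OF assms(2)] .

lemma Pie_ExIn:
  assumes "good C k" "Pie C k (\<lambda>M s. R M (\<lambda>i. s (Suc i)) (s 0))"
  shows "Pie C k (\<lambda>M s. \<exists>a\<in>dom M. mem M a (s y) \<and> R M s a)"
  by (rule absorbs_Pie[OF good_absorbs[OF assms(1)] assms(2)])

text \<open>
  \<open>\<Pi>\<^sub>k\<close>-Collection implies \<open>\<Sigma>\<^sub>k\<^sub>+\<^sub>1\<close>-Collection: sets are collected that contain both the value and a witness for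
  it, and the union of the collection is the bound.
\<close>

lemma Coll_Sig:
  fixes M :: "'a struct"
  assumes g: "good C (Suc k)" and M: "M \<in> C" and s: "range s \<subseteq> dom M"
    and R: "Sig C (Suc k) (\<lambda>M s. R M (\<lambda>i. s (Suc (Suc i))) (s (Suc 0)) (s 0))"
  shows "coll M (R M s)"
proof -
  have g': "good C k" using g by (rule good_mono) simp
  have b: "base M" if "M \<in> C" for M using g that by (simp add: good_def)
  from single_ex[OF b good_absorbs[OF g'] R] obtain Q where Q:
    "Pie C k (\<lambda>M s. Q M (\<lambda>i. s (Suc i)) (s 0))"
    "\<forall>M\<in>C. \<forall>s. range s \<subseteq> dom M \<longrightarrow> R M (\<lambda>i. s (Suc (Suc i))) (s (Suc 0)) (s 0) = (\<exists>c\<in>dom M. Q M s c)" by auto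
  have R: "R M s x y = (\<exists>c\<in>dom M. Q M (y ## x ## s) c)" if "x \<in> dom M" "y \<in> dom M" for x y
    using Q(2)[rule_format, of M "y ## x ## s"] that M s by simp
  let ?f = "\<lambda>j. case j of 0 \<Rightarrow> 0 | Suc 0 \<Rightarrow> Suc 0 | Suc (Suc i) \<Rightarrow> Suc (Suc (Suc i))"
  have "Pie C k (\<lambda>M s. Q M (\<lambda>i. s (?f (Suc i))) (s (?f 0)))" by (rule Pie_sub[OF Q(1)])
  then have 1: "Pie C k (\<lambda>M s. Q M (s (Suc 0) ## (\<lambda>i. s (Suc (Suc (Suc i))))) (s 0))"
    by (rule Dfn_cong) (auto simp: econs_def intro!: arg_cong2[where f = "Q _"] split: nat.splits)
  let ?S = "\<lambda>M (s::nat \<Rightarrow> 'a) x d. \<exists>y\<in>dom M. mem M y d \<and> (\<exists>c\<in>dom M. mem M c d \<and> Q M (y ## x ## s) c)"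
  have "Pie C k (\<lambda>M s. ?S M (\<lambda>i. s (Suc (Suc i))) (s (Suc 0)) (s 0))"
  proof (rule Pie_ExIn[OF g'], rule Pie_ExIn[OF g'])
    let ?f = "\<lambda>j. case j of 0 \<Rightarrow> 0 | Suc 0 \<Rightarrow> Suc 0 | Suc (Suc 0) \<Rightarrow> Suc (Suc (Suc 0)) | Suc (Suc (Suc i)) \<Rightarrow> Suc (Suc (Suc (Suc i)))"
    have "Pie C k (\<lambda>M s. Q M (\<lambda>i. s (?f (Suc i))) (s (?f 0)))" by (rule Pie_sub[OF Q(1)])
    then show "Pie C k (\<lambda>M s. Q M (s (Suc 0) ## s (Suc (Suc (Suc 0))) ## (\<lambda>i. s (Suc (Suc (Suc (Suc i)))))) (s 0))"
      by (rule Dfn_cong) (auto simp: econs_def intro!: arg_cong2[where f = "Q _"] split: nat.splits)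
  qed
  then have "Pie {M} k (\<lambda>M s. ?S M (\<lambda>i. s (Suc (Suc i))) (s (Suc 0)) (s 0))"
    by (rule Dfn_class) (use M in auto)
  then have c: "coll M (?S M s)"
    using g M s by (intro Coll_models[of M "Pi_fm k"]) (auto simp: good_def)
  show ?thesis unfolding coll_def
  proof (intro ballI impI)
    fix w assume w: "w \<in> dom M" "\<forall>x\<in>dom M. mem M x w \<longrightarrow> (\<exists>y\<in>dom M. R M s x y)"
    have ex: "\<exists>d\<in>dom M. ?S M s x d" if x: "x \<in> dom M" "mem M x w" for x
    proof -
      obtain y c where "y \<in> dom M" "c \<in> dom M" "Q M (y ## x ## s) c" using w x R by metis
      moreover from this obtain d where "d \<in> dom M" "mem M y d" "mem M c d"
        using b[OF M] unfolding base_def by blast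
      ultimately show ?thesis by blast
    qed
    obtain C where C1: "C \<in> dom M" and C2: "\<forall>x\<in>dom M. mem M x w \<longrightarrow> (\<exists>d\<in>dom M. mem M d C \<and> ?S M s x d)"
      using collD[OF c w(1) ex] ..
    note C = C1 C2[rule_format]
    obtain e where e: "e \<in> dom M" "\<forall>d\<in>dom M. mem M d C \<longrightarrow> (\<forall>y\<in>dom M. mem M y d \<longrightarrow> mem M y e)"
      using b[OF M] C(1) unfolding base_def by blast
    show "\<exists>c\<in>dom M. \<forall>x\<in>dom M. mem M x w \<longrightarrow> (\<exists>y\<in>dom M. mem M y c \<and> R M s x y)"
    proof (rule bexI[of _ e], intro ballI impI)
      fix x assume x: "x \<in> dom M" "mem M x w"
      then obtain d y c where "d \<in> dom M" "mem M d C" "y \<in> dom M" "mem M y d" "c \<in> dom M" "Q M (y ## x ## s) c"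
        using C(2)[OF x] by blast
      then show "\<exists>y\<in>dom M. mem M y e \<and> R M s x y" using e(2) R[OF x(1)] by blast
    qed (rule e(1))
  qed
qed

lemma sepa_not:
  assumes "models M (Separation Delta0)" "sepa M R"
  shows "sepa M (\<lambda>x. \<not> R x)"
  unfolding sepa_def
proof
  fix w assume w: "w \<in> dom M"
  then obtain y where y: "y \<in> dom M" "\<forall>x\<in>dom M. mem M x y \<longleftrightarrow> mem M x w \<and> R x"
    using assms(2) unfolding sepa_def by blast
  have "sepa M ((\<lambda>M s x. \<not> mem M x (s 0)) M (\<lambda>_. y))"
    by (rule Sep_models[OF assms(1)]) (use y in \<open>auto intro!: D0_intros\<close>)
  then obtain z where "z \<in> dom M" "\<forall>x\<in>dom M. mem M x z \<longleftrightarrow> mem M x w \<and> \<not> mem M x y"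
    using w unfolding sepa_def by blast
  with y show "\<exists>y\<in>dom M. \<forall>x\<in>dom M. mem M x y \<longleftrightarrow> mem M x w \<and> \<not> R x" by blast
qed

text \<open>
  If the complement of \<open>R\<close> is \<open>\<exists>c. Q x c\<close>, Collection bounds the witnesses for all \<open>x\<close> in \<open>w\<close> that have one;
  with the bound as a parameter, the complement has lower complexity. The disjunct \<open>R\<close> in the collected predicate gives
  the other \<open>x\<close> some value.
\<close>

lemma Sep_levy:
  fixes M :: "'a struct"
  assumes "good C (Suc k)" "M \<in> C" 
  shows "Pie C k (\<lambda>M s. R M (\<lambda>i. s (Suc i)) (s 0)) \<Longrightarrow> range s \<subseteq> dom M \<Longrightarrow> sepa M (R M s)"
  using assms
proof (induction k arbitrary: R s)
  case 0
  then show ?case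
    by (intro Sep_models[of M Delta0]) (auto simp: good_def Pie0 intro: Dfn_class)
next
  case (Suc k)
  have g1: "good C (Suc k)" "good C k" by (rule good_mono[OF Suc.prems(3)]; simp)+
  have M: "M \<in> C" by fact
  have b: "base M" if "M \<in> C" for M using g1 that by (simp add: good_def)
  have "Sig C (Suc k) (\<lambda>M s. \<not> R M (\<lambda>i. s (Suc i)) (s 0))" by (rule Sig_notI) fact
  from single_ex[OF b good_absorbs[OF g1(2)] this] obtain Q where Q:
    "Pie C k (\<lambda>M s. Q M (\<lambda>i. s (Suc i)) (s 0))"
    "\<forall>M\<in>C. \<forall>s. range s \<subseteq> dom M \<longrightarrow> (\<not> R M (\<lambda>i. s (Suc i)) (s 0)) = (\<exists>c\<in>dom M. Q M s c)" by auto
  have R: "(\<not> R M s x) = (\<exists>c\<in>dom M. Q M (x ## s) c)" if "x \<in> dom M" for x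
    using Q(2)[rule_format, of M "x ## s"] that M Suc.prems(2) by simp
  let ?f = "\<lambda>j. case j of 0 \<Rightarrow> 0 | Suc 0 \<Rightarrow> Suc 0 | Suc (Suc i) \<Rightarrow> Suc (Suc i)"
  have "Pie C k (\<lambda>M s. Q M (\<lambda>i. s (?f (Suc i))) (s (?f 0)))" by (rule Pie_sub[OF Q(1)])
  then have 1: "Pie C k (\<lambda>M s. Q M (s (Suc 0) ## (\<lambda>i. s (Suc (Suc i)))) (s 0))"
    by (rule Dfn_cong) (auto simp: econs_def intro!: arg_cong2[where f = "Q _"] split: nat.splits)
  have R1: "Pie C (Suc k) (\<lambda>M s. R M (\<lambda>i. s (Suc (Suc i))) (s (Suc 0)))"
    using Pie_sub[OF Suc.prems(1), of "\<lambda>i. Suc i"] by simp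
  have "coll M ((\<lambda>M s x c. Q M (x ## s) c \<or> R M s x) M s)"
  proof (rule Coll_Sig[OF Suc.prems(3) M Suc.prems(2)])
    show "Sig C (Suc (Suc k)) (\<lambda>M s. Q M (s (Suc 0) ## (\<lambda>i. s (Suc (Suc i)))) (s 0) \<or> R M (\<lambda>i. s (Suc (Suc i))) (s (Suc 0)))"
      by (intro Sig_disj Pie_Sig[OF 1] Pie_Sig[OF R1]) auto
  qed
  note c = this
  show ?case unfolding sepa_def
  proof
    fix w assume w: "w \<in> dom M"
    have dne: "dom M \<noteq> {}" using w by auto
    then have ex: "\<exists>y\<in>dom M. Q M (x ## s) y \<or> R M s x" if "x \<in> dom M" for x using R[OF that] by blast
    obtain D where D1: "D \<in> dom M" and D2: "\<forall>x\<in>dom M. mem M x w \<longrightarrow>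
      (\<exists>y\<in>dom M. mem M y D \<and> (Q M (x ## s) y \<or> R M s x))" using collD[OF c w ex] ..
    note D = D1 D2[rule_format]
    let ?R = "\<lambda>M s x. \<exists>c\<in>dom M. mem M c (s 0) \<and> Q M (x ## (\<lambda>i. s (Suc i))) c"
    have "Pie C k (\<lambda>M s. ?R M (\<lambda>i. s (Suc i)) (s 0))"
    proof (rule Pie_ExIn[OF g1(2)])
      let ?f = "\<lambda>j. case j of 0 \<Rightarrow> 0 | Suc 0 \<Rightarrow> Suc 0 | Suc (Suc i) \<Rightarrow> Suc (Suc (Suc i))"
      have "Pie C k (\<lambda>M s. Q M (\<lambda>i. s (?f (Suc i))) (s (?f 0)))" by (rule Pie_sub[OF Q(1)])
      then show "Pie C k (\<lambda>M s. Q M (s (Suc 0) ## (\<lambda>i. s (Suc (Suc (Suc i))))) (s 0))"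
        by (rule Dfn_cong) (auto simp: econs_def intro!: arg_cong2[where f = "Q _"] split: nat.splits)
    qed
    then have "sepa M (?R M (D ## s))"
      by (rule Suc.IH) (use Suc.prems D g1 in auto)
    then have sep: "sepa M (\<lambda>x. \<not> ?R M (D ## s) x)"
      using Suc.prems(3) M by (intro sepa_not) (auto simp: good_def)
    obtain y where y1: "y \<in> dom M" and y2: "\<forall>x\<in>dom M. mem M x y \<longleftrightarrow> mem M x w \<and> \<not> ?R M (D ## s) x"
      using sepaD[OF sep w] ..
    note y = y1 y2[rule_format]
    have "R M s x \<longleftrightarrow> \<not> ?R M (D ## s) x" if "x \<in> dom M" "mem M x w" for x
      using D(2)[OF that] R[OF that(1)] D(1) by (auto simp: econs_def)
    then show "\<exists>y\<in>dom M. \<forall>x\<in>dom M. mem M x y \<longleftrightarrow> mem M x w \<and> R M s x" using y by blast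
  qed
qed

subsection \<open>Predicates that are both \<open>\<Sigma>\<^sub>k\<close> and \<open>\<Pi>\<^sub>k\<close>\<close>

text \<open>
  Both \<open>\<Sigma>\<^sub>k\<close> and \<open>\<Pi>\<^sub>k\<close>, by possibly unrelated formulas, in all structures of \<open>C\<close>.
\<close>

definition Del :: "'a struct set \<Rightarrow> nat \<Rightarrow> ('a struct \<Rightarrow> (nat \<Rightarrow> 'a) \<Rightarrow> bool) \<Rightarrow> bool" where
  "Del C k P \<longleftrightarrow> Sig C k P \<and> Pie C k P"

lemma Del_D0: "D0 C P \<Longrightarrow> Del C k P"
  by (simp add: Del_def D0_Sig D0_Pie)
lemma Del_Sig: "Sig C j P \<Longrightarrow> j < k \<Longrightarrow> Del C k P"
  unfolding Del_def using Sig_mono[of C j P k] Sig_Pie[of C j P k] by simp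
lemma Del_Pie: "Pie C j P \<Longrightarrow> j < k \<Longrightarrow> Del C k P"
  unfolding Del_def using Pie_mono[of C j P k] Pie_Sig[of C j P k] by simp
lemma Del_not: "Del C k P \<Longrightarrow> Del C k (\<lambda>M s. \<not> P M s)"
  unfolding Del_def by (intro conjI Sig_notI Pie_notI; simp)
lemma Del_conj: "Del C k P \<Longrightarrow> Del C k Q \<Longrightarrow> Del C k (\<lambda>M s. P M s \<and> Q M s)"
  unfolding Del_def by (intro conjI Sig_conj Pie_conj; simp)
lemma Del_disj: "Del C k P \<Longrightarrow> Del C k Q \<Longrightarrow> Del C k (\<lambda>M s. P M s \<or> Q M s)"
  unfolding Del_def by (intro conjI Sig_disj Pie_disj; simp)
lemma Del_imp: "Del C k P \<Longrightarrow> Del C k Q \<Longrightarrow> Del C k (\<lambda>M s. P M s \<longrightarrow> Q M s)"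
  unfolding Del_def by (intro conjI Sig_imp Pie_imp; simp)
lemma Del_iff: assumes "Del C k P" "Del C k Q" shows "Del C k (\<lambda>M s. P M s \<longleftrightarrow> Q M s)"
  using Del_conj[OF Del_imp[OF assms] Del_imp[OF assms(2,1)]] unfolding iff_conv_conj_imp .
lemma Del_ExIn:
  assumes "good C k" "Del C k (\<lambda>M s. R M (\<lambda>i. s (Suc i)) (s 0))"
  shows "Del C k (\<lambda>M s. \<exists>a\<in>dom M. mem M a (s y) \<and> R M s a)"
  using assms(2) unfolding Del_def by (intro conjI Sig_ExIn Pie_ExIn[OF assms(1)]; simp)
lemma Del_AllIn:
  assumes "good C k" "Del C k (\<lambda>M s. R M (\<lambda>i. s (Suc i)) (s 0))"
  shows "Del C k (\<lambda>M s. \<forall>a\<in>dom M. mem M a (s y) \<longrightarrow> R M s a)"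
  using assms(2) unfolding Del_def by (intro conjI Pie_AllIn Sig_AllIn[OF assms(1)]; simp)
text \<open>
  One level better than \<open>Sep_levy\<close>: Collection yields witnesses for \<open>R x\<close> or for its negation, for
  all \<open>x\<close> in \<open>w\<close> at once.
\<close>

lemma Sep_Del:
  fixes M :: "'a struct"
  assumes g: "good C (Suc k)" and M: "M \<in> C" and s: "range s \<subseteq> dom M"
    and D: "Del C (Suc k) (\<lambda>M s. R M (\<lambda>i. s (Suc i)) (s 0))"
  shows "sepa M (R M s)"
proof -
  have g': "good C k" using g by (rule good_mono) simp
  have b: "base M" if "M \<in> C" for M using g that by (simp add: good_def)
  have P1: "Sig C (Suc k) (\<lambda>M s. R M (\<lambda>i. s (Suc i)) (s 0))"
    and P2: "Sig C (Suc k) (\<lambda>M s. \<not> R M (\<lambda>i. s (Suc i)) (s 0))"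
    using D unfolding Del_def by (auto intro: Sig_notI)
  from single_ex[OF b good_absorbs[OF g'] P1] obtain Q where Q:
    "Pie C k (\<lambda>M s. Q M (\<lambda>i. s (Suc i)) (s 0))"
    "\<forall>M\<in>C. \<forall>s. range s \<subseteq> dom M \<longrightarrow> R M (\<lambda>i. s (Suc i)) (s 0) = (\<exists>c\<in>dom M. Q M s c)" by auto
  have R: "R M s x = (\<exists>c\<in>dom M. Q M (x ## s) c)" if "x \<in> dom M" for x
    using Q(2)[rule_format, of M "x ## s"] that M s by simp
  let ?f = "\<lambda>j. case j of 0 \<Rightarrow> 0 | Suc 0 \<Rightarrow> Suc 0 | Suc (Suc i) \<Rightarrow> Suc (Suc i)"
  have "Pie C k (\<lambda>M s. Q M (\<lambda>i. s (?f (Suc i))) (s (?f 0)))" by (rule Pie_sub[OF Q(1)])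
  then have 1: "Pie C k (\<lambda>M s. Q M (s (Suc 0) ## (\<lambda>i. s (Suc (Suc i)))) (s 0))"
    by (rule Dfn_cong) (auto simp: econs_def intro!: arg_cong2[where f = "Q _"] split: nat.splits)
  have R1: "Sig C (Suc k) (\<lambda>M s. \<not> R M (\<lambda>i. s (Suc (Suc i))) (s (Suc 0)))"
    using Sig_sub[OF P2, of "\<lambda>i. Suc i"] by simp
  have c: "coll M ((\<lambda>M s x c. Q M (x ## s) c \<or> \<not> R M s x) M s)"
  proof (rule Coll_Sig[OF g M s])
    show "Sig C (Suc k) (\<lambda>M s. Q M (s (Suc 0) ## (\<lambda>i. s (Suc (Suc i)))) (s 0) \<or> \<not> R M (\<lambda>i. s (Suc (Suc i))) (s (Suc 0)))"
      by (intro Sig_disj Pie_Sig[OF 1] R1) auto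
  qed
  show ?thesis unfolding sepa_def
  proof
    fix w assume w: "w \<in> dom M"
    have dne: "dom M \<noteq> {}" using w by auto
    then have ex: "\<exists>y\<in>dom M. Q M (x ## s) y \<or> \<not> R M s x" if "x \<in> dom M" for x using R[OF that] by blast
    obtain D where D1: "D \<in> dom M" and D2: "\<forall>x\<in>dom M. mem M x w \<longrightarrow>
      (\<exists>y\<in>dom M. mem M y D \<and> (Q M (x ## s) y \<or> \<not> R M s x))" using collD[OF c w ex] ..
    note D = D1 D2[rule_format]
    let ?R = "\<lambda>M s x. \<exists>c\<in>dom M. mem M c (s 0) \<and> Q M (x ## (\<lambda>i. s (Suc i))) c"
    have "Pie C k (\<lambda>M s. ?R M (\<lambda>i. s (Suc i)) (s 0))"
    proof (rule Pie_ExIn[OF g'])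
      let ?f = "\<lambda>j. case j of 0 \<Rightarrow> 0 | Suc 0 \<Rightarrow> Suc 0 | Suc (Suc i) \<Rightarrow> Suc (Suc (Suc i))"
      have "Pie C k (\<lambda>M s. Q M (\<lambda>i. s (?f (Suc i))) (s (?f 0)))" by (rule Pie_sub[OF Q(1)])
      then show "Pie C k (\<lambda>M s. Q M (s (Suc 0) ## (\<lambda>i. s (Suc (Suc (Suc i))))) (s 0))"
        by (rule Dfn_cong) (auto simp: econs_def intro!: arg_cong2[where f = "Q _"] split: nat.splits)
    qed
    then have sep: "sepa M (?R M (D ## s))"
      by (rule Sep_levy[OF g M]) (use s D in auto)
    obtain y where y1: "y \<in> dom M" and y2: "\<forall>x\<in>dom M. mem M x y \<longleftrightarrow> mem M x w \<and> ?R M (D ## s) x"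
      using sepaD[OF sep w] ..
    have "R M s x \<longleftrightarrow> ?R M (D ## s) x" if "x \<in> dom M" "mem M x w" for x
      using D(2)[OF that] R[OF that(1)] D(1) by (auto simp: econs_def)
    then show "\<exists>y\<in>dom M. \<forall>x\<in>dom M. mem M x y \<longleftrightarrow> mem M x w \<and> R M s x"
      using y1 y2[rule_format] by blast
  qed
qed

section \<open>Pairs, relations and levels\<close>

subsection \<open>Formulas\<close>

definition isUp :: "'a struct \<Rightarrow> 'a \<Rightarrow> 'a \<Rightarrow> 'a \<Rightarrow> bool" where
  "isUp M u a b \<longleftrightarrow> mem M a u \<and> mem M b u \<and> (\<forall>x\<in>dom M. mem M x u \<longrightarrow> x = a \<or> x = b)"

definition isPair :: "'a struct \<Rightarrow> 'a \<Rightarrow> 'a \<Rightarrow> 'a \<Rightarrow> bool" where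
  "isPair M z a b \<longleftrightarrow> (\<exists>u\<in>dom M. mem M u z \<and> isUp M u a a \<and>
     (\<exists>v\<in>dom M. mem M v z \<and> isUp M v a b \<and> isUp M z u v))"

definition Rel :: "'a struct \<Rightarrow> 'a \<Rightarrow> 'a \<Rightarrow> 'a \<Rightarrow> bool" where
  "Rel M g a b \<longleftrightarrow> (\<exists>z\<in>dom M. mem M z g \<and> isPair M z a b)"

definition subs :: "'a struct \<Rightarrow> 'a \<Rightarrow> 'a \<Rightarrow> bool" where
  "subs M z v \<longleftrightarrow> (\<forall>x\<in>dom M. mem M x z \<longrightarrow> mem M x v)"

text \<open>
  A history \<open>h\<close>: each \<open>u\<close> in \<open>h\<close> is the set of all \<open>z\<close> that are subsets of some \<open>v\<close> which is in both \<open>h\<close> and \<open>u\<close>.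
  By induction the elements of \<open>h\<close> are the stages of the cumulative hierarchy up to some point. The
  second half quantifies over all sets, which makes the predicate \<open>\<Pi>\<^sub>1\<close>.
\<close>

definition Hist :: "'a struct \<Rightarrow> 'a \<Rightarrow> bool" where
  "Hist M h \<longleftrightarrow>
     (\<forall>u\<in>dom M. mem M u h \<longrightarrow> (\<forall>z\<in>dom M. mem M z u \<longrightarrow>
        (\<exists>v\<in>dom M. mem M v h \<and> mem M v u \<and> subs M z v))) \<and>
     (\<forall>z\<in>dom M. \<forall>u\<in>dom M. mem M u h \<longrightarrow>
        (\<forall>v\<in>dom M. mem M v h \<longrightarrow> mem M v u \<longrightarrow> subs M z v \<longrightarrow> mem M z u))"

lemma D0_isUp: "D0 C (\<lambda>M s. isUp M (s i) (s j) (s k))"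
  unfolding isUp_def by (intro D0_intros)
lemma D0_isPair: "D0 C (\<lambda>M s. isPair M (s i) (s j) (s k))"
  unfolding isPair_def by (intro D0_intros D0_isUp)
lemma D0_Rel: "D0 C (\<lambda>M s. Rel M (s i) (s j) (s k))"
  unfolding Rel_def by (intro D0_intros D0_isPair)
lemma D0_subs: "D0 C (\<lambda>M s. subs M (s i) (s j))"
  unfolding subs_def by (intro D0_intros)
lemma Pie_Hist: "Pie C (Suc 0) (\<lambda>M s. Hist M (s i))"
  unfolding Hist_def by (intro Pie_conj Pie_All D0_Pie) (intro D0_intros D0_subs)+

lemmas D0_rules = D0_intros D0_isUp D0_isPair D0_Rel D0_subs

lemma isPair_bound: "isPair M z a b \<Longrightarrow> (\<exists>u\<in>dom M. mem M u z \<and> mem M a u \<and> mem M b u)"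
  by (auto simp: isPair_def isUp_def)

lemma ExPair_bound:
  "(\<exists>u\<in>dom M. mem M u z \<and> (\<exists>a\<in>dom M. mem M a u \<and> (\<exists>b\<in>dom M. mem M b u \<and> (isPair M z a b \<and> R a b)))) =
   (\<exists>a\<in>dom M. \<exists>b\<in>dom M. isPair M z a b \<and> R a b)"
  using isPair_bound[of M z] by metis

lemma AllRel_bound:
  "(\<forall>z\<in>dom M. mem M z g \<longrightarrow> (\<forall>a\<in>dom M. \<forall>b\<in>dom M. isPair M z a b \<longrightarrow> R a b)) =
   (\<forall>a\<in>dom M. \<forall>b\<in>dom M. Rel M g a b \<longrightarrow> R a b)"
  unfolding Rel_def by metis

lemma AllRel1_bound:
  assumes "j \<in> dom M"
  shows "(\<forall>a\<in>dom M. \<forall>b\<in>dom M. Rel M g a b \<longrightarrow> (a = j \<longrightarrow> R b)) = (\<forall>b\<in>dom M. Rel M g j b \<longrightarrow> R b)"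
  using assms by metis

text \<open>
  The components of a Kuratowski pair \<open>z\<close> lie together in an element of \<open>z\<close>, so quantifiers over them are bounded.
\<close>

lemma D0_ExPair:
  assumes "D0 C (\<lambda>M s. R M (\<lambda>i. s (Suc (Suc i))) (s (Suc 0)) (s 0))"
  shows "D0 C (\<lambda>M s. \<exists>a\<in>dom M. \<exists>b\<in>dom M. isPair M (s z) a b \<and> R M s a b)"
proof -
  let ?f = "\<lambda>j. case j of 0 \<Rightarrow> 0 | Suc 0 \<Rightarrow> Suc 0 | Suc (Suc i) \<Rightarrow> Suc (Suc (Suc i))"
  have "D0 C (\<lambda>M s. R M (\<lambda>i. s (?f (Suc (Suc i)))) (s (?f (Suc 0))) (s (?f 0)))"
    by (rule D0_sub[OF assms])
  then have "D0 C (\<lambda>M s. R M (\<lambda>i. s (Suc (Suc (Suc i)))) (s (Suc 0)) (s 0))" by simp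
  then have "D0 C (\<lambda>M s. \<exists>u\<in>dom M. mem M u (s z) \<and> (\<exists>a\<in>dom M. mem M a u \<and>
     (\<exists>b\<in>dom M. mem M b u \<and> (isPair M (s z) a b \<and> R M s a b))))"
    by (intro D0_ExIn D0_conj D0_isPair)
  then show ?thesis unfolding ExPair_bound .
qed

lemma D0_AllPair:
  assumes "D0 C (\<lambda>M s. R M (\<lambda>i. s (Suc (Suc i))) (s (Suc 0)) (s 0))"
  shows "D0 C (\<lambda>M s. \<forall>a\<in>dom M. \<forall>b\<in>dom M. isPair M (s z) a b \<longrightarrow> R M s a b)"
  using D0_not[OF D0_ExPair[OF D0_not[OF assms], of z]] by simp

lemma D0_AllRel:
  assumes "D0 C (\<lambda>M s. R M (\<lambda>i. s (Suc (Suc i))) (s (Suc 0)) (s 0))"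
  shows "D0 C (\<lambda>M s. \<forall>a\<in>dom M. \<forall>b\<in>dom M. Rel M (s g) a b \<longrightarrow> R M s a b)"
proof -
  let ?f = "\<lambda>j. case j of 0 \<Rightarrow> 0 | Suc 0 \<Rightarrow> Suc 0 | Suc (Suc i) \<Rightarrow> Suc (Suc (Suc i))"
  have "D0 C (\<lambda>M s. R M (\<lambda>i. s (?f (Suc (Suc i)))) (s (?f (Suc 0))) (s (?f 0)))"
    by (rule D0_sub[OF assms])
  then have "D0 C (\<lambda>M s. R M (\<lambda>i. s (Suc (Suc (Suc i)))) (s (Suc 0)) (s 0))" by simp
  then have "D0 C (\<lambda>M s. \<forall>z\<in>dom M. mem M z (s g) \<longrightarrow> (\<forall>a\<in>dom M. \<forall>b\<in>dom M. isPair M z a b \<longrightarrow> R M s a b))"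
    by (intro D0_AllIn D0_AllPair)
  then show ?thesis unfolding AllRel_bound .
qed

lemma D0_AllRel1:
  assumes "D0 C (\<lambda>M s. R M (\<lambda>i. s (Suc i)) (s 0))"
  shows "D0 C (\<lambda>M s. \<forall>b\<in>dom M. Rel M (s g) (s j) b \<longrightarrow> R M s b)"
proof -
  let ?f = "\<lambda>j. case j of 0 \<Rightarrow> 0 | Suc i \<Rightarrow> Suc (Suc i)"
  have "D0 C (\<lambda>M s. R M (\<lambda>i. s (?f (Suc i))) (s (?f 0)))"
    by (rule D0_sub[OF assms])
  then have "D0 C (\<lambda>M s. R M (\<lambda>i. s (Suc (Suc i))) (s 0))" by simp
  then have "D0 C (\<lambda>M s. \<forall>a\<in>dom M. \<forall>b\<in>dom M. Rel M (s g) a b \<longrightarrow> (a = s j \<longrightarrow> R M s b))"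
    by (intro D0_AllRel D0_imp D0_eq)
  then show ?thesis by (rule Dfn_cong) (rule AllRel1_bound, auto)
qed

lemma D0_ExRel1:
  assumes "D0 C (\<lambda>M s. R M (\<lambda>i. s (Suc i)) (s 0))"
  shows "D0 C (\<lambda>M s. \<exists>b\<in>dom M. Rel M (s g) (s j) b \<and> R M s b)"
  using D0_not[OF D0_AllRel1[OF D0_not[OF assms], of g j]] by simp

subsection \<open>Finite sets of the universe\<close>

text \<open>
  Sensible for finite \<open>X\<close>, for which a set with these elements exists.
\<close>

definition vset :: "'k V set \<Rightarrow> 'k V" where "vset X = (SOME x. elts x = X)"

lemma elts_vset [simp]:
  assumes "finite X" shows "elts (vset X) = X"
proof -
  have "X \<lesssim> (UNIV :: (nat + 'a) set)"
    using assms by (intro finite_lepoll_infinite) (simp add: finite_Plus_UNIV_iff)+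
  then have "\<exists>x. elts x = X" using V_comprehension by blast
  then show ?thesis unfolding vset_def by (rule someI_ex)
qed

lemma vset_elts: "elts x = X \<Longrightarrow> finite X \<Longrightarrow> vset X = x"
  by (rule V_extensionality) simp

definition opair :: "'k V \<Rightarrow> 'k V \<Rightarrow> 'k V" where
  "opair a b = vset {vset {a}, vset {a, b}}"

lemma vset_inject: "finite X \<Longrightarrow> finite Y \<Longrightarrow> vset X = vset Y \<longleftrightarrow> X = Y"
  by (metis elts_vset)

lemma opair_inject [simp]: "opair a b = opair c d \<longleftrightarrow> a = c \<and> b = d"
  by (auto simp: opair_def vset_inject doubleton_eq_iff)

lemma elts_irrefl: "x \<notin> elts x"
  using wf_not_refl[OF wf_elts, of x] by simp

lemma elts_asym: "x \<in> elts y \<Longrightarrow> y \<notin> elts x"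
  using wf_asym[OF wf_elts, of x y] by simp

lemma transD: "transitive K \<Longrightarrow> x \<in> K \<Longrightarrow> y \<in> elts x \<Longrightarrow> y \<in> K"
  by (auto simp: transitive_def)

lemma in_struct_simps [simp]: "dom (in_struct K) = K" "mem (in_struct K) x y \<longleftrightarrow> x \<in> elts y"
  by (auto simp: in_struct_def)

lemma isUp_in:
  assumes "transitive K" "u \<in> K"
  shows "isUp (in_struct K) u a b \<longleftrightarrow> u = vset {a, b}"
proof -
  have "isUp (in_struct K) u a b \<longleftrightarrow> elts u = {a, b}"
    using assms by (auto simp: isUp_def dest: transD)
  also have "\<dots> \<longleftrightarrow> u = vset {a, b}" using vset_elts[of u "{a, b}"] by auto
  finally show ?thesis .
qed

lemma isPair_in:
  assumes "transitive K" "z \<in> K"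
  shows "isPair (in_struct K) z a b \<longleftrightarrow> z = opair a b"
proof
  assume "isPair (in_struct K) z a b"
  then obtain u v where "u \<in> K" "v \<in> K" "isUp (in_struct K) u a a" "isUp (in_struct K) v a b" "isUp (in_struct K) z u v"
    by (auto simp: isPair_def)
  then show "z = opair a b" using assms by (simp add: isUp_in opair_def)
next
  assume z: "z = opair a b"
  then have "elts z = {vset {a}, vset {a, b}}" by (simp add: opair_def)
  then have uv: "vset {a} \<in> K" "vset {a, b} \<in> K" "vset {a} \<in> elts z" "vset {a, b} \<in> elts z"
    using assms by (auto dest: transD)
  have "isUp (in_struct K) (vset {a}) a a" "isUp (in_struct K) (vset {a, b}) a b"
    "isUp (in_struct K) z (vset {a}) (vset {a, b})"
    using uv assms z by (simp_all add: isUp_in opair_def)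
  with uv show "isPair (in_struct K) z a b" unfolding isPair_def by auto
qed

lemma Rel_in: "transitive K \<Longrightarrow> g \<in> K \<Longrightarrow> Rel (in_struct K) g a b \<longleftrightarrow> opair a b \<in> elts g"
  by (auto simp: Rel_def isPair_in dest: transD)

lemma subs_in: "transitive K \<Longrightarrow> z \<in> K \<Longrightarrow> subs (in_struct K) z v \<longleftrightarrow> elts z \<subseteq> elts v"
  by (auto simp: subs_def dest: transD)

lemma opair_in_trans: "transitive K \<Longrightarrow> opair a b \<in> K \<Longrightarrow> a \<in> K \<and> b \<in> K"
proof -
  assume K: "transitive K" "opair a b \<in> K"
  have "vset {a, b} \<in> elts (opair a b)" by (simp add: opair_def)
  with K have "vset {a, b} \<in> K" by (blast dest: transD)
  moreover have "a \<in> elts (vset {a, b})" "b \<in> elts (vset {a, b})" by auto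
  ultimately show ?thesis using K by (blast dest: transD)
qed

subsection \<open>Transitive models of M\<close>

locale trans_model =
  fixes K :: "'k V set"
  assumes trans: "transitive K" and modM: "models (in_struct K) M_theory"
begin

lemma ne: "K \<noteq> {}" using modM by (simp add: models_def)

lemma ax: "p \<in> M_theory \<Longrightarrow> \<exists>s. range s \<subseteq> K \<and> sat (in_struct K) s p"
proof -
  assume p: "p \<in> M_theory"
  obtain a where "a \<in> K" using ne by blast
  then have "range (\<lambda>_::nat. a) \<subseteq> K" by auto
  then show ?thesis using modM p unfolding models_def by fastforce
qed

lemma tr: "x \<in> K \<Longrightarrow> y \<in> elts x \<Longrightarrow> y \<in> K"
  using trans by (rule transD)

lemma tr2: "x \<in> K \<Longrightarrow> y \<in> elts x \<Longrightarrow> z \<in> elts y \<Longrightarrow> z \<in> K"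
  using tr[OF tr] .

lemma pair: assumes "a \<in> K" "b \<in> K" shows "vset {a, b} \<in> K"
proof -
  obtain s where "sat (in_struct K) s Pairing"
    using ax[of Pairing] by (auto simp: M_theory_def M_minus_def)
  then have "\<forall>a\<in>K. \<forall>b\<in>K. \<exists>z\<in>K. \<forall>x\<in>K. (x \<in> elts z \<longrightarrow> x = a \<or> x = b) \<and>
      (x = a \<longrightarrow> a \<in> elts z) \<and> (x = b \<longrightarrow> b \<in> elts z)"
    by (simp add: Pairing_def)
  from this[rule_format, OF assms] obtain z where z: "z \<in> K"
    "\<forall>x\<in>K. (x \<in> elts z \<longrightarrow> x = a \<or> x = b) \<and> (x = a \<longrightarrow> a \<in> elts z) \<and> (x = b \<longrightarrow> b \<in> elts z)" ..
  then have "elts z = {a, b}" using tr[OF z(1)] assms by auto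
  then show ?thesis using z vset_elts[of z "{a, b}"] by simp
qed

lemma single: "a \<in> K \<Longrightarrow> vset {a} \<in> K" using pair[of a a] by simp

lemma opair: "a \<in> K \<Longrightarrow> b \<in> K \<Longrightarrow> opair a b \<in> K"
  unfolding opair_def by (intro pair single)

lemma union: assumes "x \<in> K" shows "\<exists>u\<in>K. elts u = (\<Union>y\<in>elts x. elts y)"
proof -
  obtain s where "sat (in_struct K) s Union_ax"
    using ax[of Union_ax] by (auto simp: M_theory_def M_minus_def)
  then have "\<forall>x\<in>K. \<exists>z\<in>K. \<forall>y\<in>K. (y \<in> elts z \<longrightarrow> (\<exists>w\<in>K. w \<in> elts x \<and> y \<in> elts w)) \<and>
      ((\<exists>w\<in>K. w \<in> elts x \<and> y \<in> elts w) \<longrightarrow> y \<in> elts z)"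
    by (simp add: Union_ax_def)
  from this[rule_format, OF assms] obtain z where z: "z \<in> K"
    "\<forall>y\<in>K. (y \<in> elts z \<longrightarrow> (\<exists>w\<in>K. w \<in> elts x \<and> y \<in> elts w)) \<and>
      ((\<exists>w\<in>K. w \<in> elts x \<and> y \<in> elts w) \<longrightarrow> y \<in> elts z)" ..
  have "elts z = (\<Union>y\<in>elts x. elts y)"
  proof (intro set_eqI iffI)
    fix y assume y: "y \<in> elts z"
    with z(2) tr[OF z(1) y] show "y \<in> (\<Union>y\<in>elts x. elts y)" by blast
  next
    fix y assume "y \<in> (\<Union>y\<in>elts x. elts y)"
    then obtain w where w: "w \<in> elts x" "y \<in> elts w" by blast
    from z(2) w tr[OF assms w(1)] tr2[OF assms w] show "y \<in> elts z" by blast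
  qed
  then show ?thesis using z by auto
qed

lemma un: assumes "a \<in> K" "b \<in> K" shows "\<exists>u\<in>K. elts u = elts a \<union> elts b"
  using union[OF pair[OF assms]] by auto

lemma vinsert: assumes "a \<in> K" "b \<in> K" shows "\<exists>u\<in>K. elts u = insert a (elts b)"
  using un[OF single[OF assms(1)] assms(2)] by auto

lemma emptyK: "vset {} \<in> K"
proof -
  obtain s where "sat (in_struct K) s Emptyset"
    using ax[of Emptyset] by (auto simp: M_theory_def M_minus_def)
  then obtain z where z: "z \<in> K" "\<forall>y\<in>K. y \<notin> elts z" by (auto simp: Emptyset_def)
  have "elts z = {}" using z tr[OF z(1)] by auto
  then show ?thesis using z vset_elts[of z "{}"] by simp
qed

lemma finite_in: "finite X \<Longrightarrow> X \<subseteq> K \<Longrightarrow> vset X \<in> K"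
proof (induction rule: finite_induct)
  case empty
  show ?case by (rule emptyK)
next
  case (insert x X)
  then obtain u where "u \<in> K" "elts u = insert x X" using vinsert[of x "vset X"] by auto
  then show ?case using vset_elts[of u "insert x X"] insert by simp
qed

lemma pow: assumes "x \<in> K" shows "\<exists>p\<in>K. elts p = {z \<in> K. elts z \<subseteq> elts x}"
proof -
  obtain s where "sat (in_struct K) s Powerset"
    using ax[of Powerset] by (auto simp: M_theory_def)
  then have "\<forall>x\<in>K. \<exists>p\<in>K. \<forall>z\<in>K. (z \<in> elts p \<longrightarrow> (\<forall>y\<in>K. y \<in> elts z \<longrightarrow> y \<in> elts x)) \<and>
      ((\<forall>y\<in>K. y \<in> elts z \<longrightarrow> y \<in> elts x) \<longrightarrow> z \<in> elts p)"
    by (simp add: Powerset_def)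
  from this[rule_format, OF assms] obtain p where p: "p \<in> K"
    "\<forall>z\<in>K. (z \<in> elts p \<longrightarrow> (\<forall>y\<in>K. y \<in> elts z \<longrightarrow> y \<in> elts x)) \<and>
      ((\<forall>y\<in>K. y \<in> elts z \<longrightarrow> y \<in> elts x) \<longrightarrow> z \<in> elts p)" ..
  have "(\<forall>y\<in>K. y \<in> elts z \<longrightarrow> y \<in> elts x) \<longleftrightarrow> elts z \<subseteq> elts x" if "z \<in> K" for z
    using tr[OF that] by auto
  with p(2) tr[OF p(1)] show ?thesis by (intro bexI[OF _ p(1)]) blast
qed

lemma sep0_models: "models (in_struct K) (Separation Delta0)"
  using modM by (auto simp: M_theory_def M_minus_def models_def)

lemma sepaD_in: 
  assumes "sepa (in_struct K) R" "w \<in> K"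
  shows "\<exists>y\<in>K. elts y = {x \<in> elts w. R x}"
proof -
  obtain y where "y \<in> K" "\<forall>x\<in>K. x \<in> elts y \<longleftrightarrow> x \<in> elts w \<and> R x"
    using sepaD[OF assms(1), of w] assms(2) by auto
  then have "y \<in> K" "elts y = {x \<in> elts w. R x}" using tr[of y] tr[OF assms(2)] by auto
  then show ?thesis by blast
qed

lemma sep0: 
  assumes "D0 {in_struct K} (\<lambda>M s. R M (\<lambda>i. s (Suc i)) (s 0))" "range s \<subseteq> K" "w \<in> K"
  shows "\<exists>y\<in>K. elts y = {x \<in> elts w. R (in_struct K) s x}"
  by (rule sepaD_in[OF Sep_models[OF sep0_models assms(1)] assms(3)]) (use assms(2) in simp)

lemma base_in: "base (in_struct K)"
  unfolding base_def
proof (intro conjI ballI)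
  fix a b assume "a \<in> dom (in_struct K)" "b \<in> dom (in_struct K)"
  then show "\<exists>d\<in>dom (in_struct K). mem (in_struct K) a d \<and> mem (in_struct K) b d"
    using pair[of a b] by (intro bexI[of _ "vset {a, b}"]) auto
next
  fix c assume "c \<in> dom (in_struct K)"
  then obtain u where "u \<in> K" "elts u = (\<Union>y\<in>elts c. elts y)" using union[of c] by auto
  then show "\<exists>e\<in>dom (in_struct K). \<forall>d\<in>dom (in_struct K). mem (in_struct K) d c \<longrightarrow>
      (\<forall>y\<in>dom (in_struct K). mem (in_struct K) y d \<longrightarrow> mem (in_struct K) y e)"
    by (intro bexI[of _ u]) auto
qed (simp add: ne)

end

subsection \<open>Levels\<close>

locale coll_model = trans_model A for A :: "'k V set" +
  fixes k :: nat
  assumes k1: "k \<ge> 1" and collA: "models (in_struct A) (Collection (Pi_fm k))"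
begin

abbreviation "MM \<equiv> in_struct A"

lemma good_MM: "good {MM} (Suc k)"
proof -
  have "models MM (Collection (Pi_fm j))" if "j < Suc k" for j
  proof -
    have "Pi_fm j \<subseteq> Pi_fm k" using levy_mono(2)[of j k] that by (auto simp: Pi_fm_def)
    then have "Collection (Pi_fm j) \<subseteq> Collection (Pi_fm k)" unfolding Collection_def by blast
    then show ?thesis using collA unfolding models_def by blast
  qed
  then show ?thesis by (simp add: good_def base_in sep0_models)
qed

lemma coll_in:
  assumes "Sig {MM} (Suc k) (\<lambda>M s. R M (\<lambda>i. s (Suc (Suc i))) (s (Suc 0)) (s 0))"
    "range s \<subseteq> A" "w \<in> A" "\<And>x. x \<in> elts w \<Longrightarrow> \<exists>y\<in>A. R MM s x y"
  shows "\<exists>c\<in>A. \<forall>x\<in>elts w. \<exists>y\<in>elts c. R MM s x y"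
proof -
  have "coll MM (R MM s)" by (rule Coll_Sig[OF good_MM _ _ assms(1)]) (use assms(2) in auto)
  from collD[OF this, of w] assms(3,4) obtain c where
    c: "c \<in> A" "\<forall>x\<in>A. x \<in> elts w \<longrightarrow> (\<exists>y\<in>A. y \<in> elts c \<and> R MM s x y)" by auto
  show ?thesis by (rule bexI[of _ c]) (use c tr[OF assms(3)] in blast)+
qed

lemma sep_in:
  assumes "Pie {MM} k (\<lambda>M s. R M (\<lambda>i. s (Suc i)) (s 0))" "range s \<subseteq> A" "w \<in> A"
  shows "\<exists>y\<in>A. elts y = {x \<in> elts w. R MM s x}"
  by (rule sepaD_in[OF Sep_levy[OF good_MM _ assms(1)] assms(3)]) (use assms(2) in auto)

definition hist :: "'k V \<Rightarrow> bool" where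
  "hist h \<longleftrightarrow> h \<in> A \<and> (\<forall>u\<in>elts h. elts u = {z \<in> A. \<exists>v\<in>elts h. v \<in> elts u \<and> elts z \<subseteq> elts v})"

lemma Hist_in: "h \<in> A \<Longrightarrow> Hist MM h \<longleftrightarrow> hist h"
proof
  assume h: "h \<in> A" and H: "Hist MM h"
  note H1 = conjunct1[OF H[unfolded Hist_def in_struct_simps], rule_format]
  note H2 = conjunct2[OF H[unfolded Hist_def in_struct_simps], rule_format]
  have "elts u = {z \<in> A. \<exists>v\<in>elts h. v \<in> elts u \<and> elts z \<subseteq> elts v}" if u: "u \<in> elts h" for u
  proof (intro set_eqI iffI)
    fix z assume z: "z \<in> elts u"
    have uA: "u \<in> A" using tr[OF h u] .
    have zA: "z \<in> A" using tr2[OF h u z] .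
    from H1[OF uA u zA z] obtain v where "v \<in> elts h" "v \<in> elts u" "elts z \<subseteq> elts v"
      unfolding subs_in[OF trans zA] by blast
    then show "z \<in> {z \<in> A. \<exists>v\<in>elts h. v \<in> elts u \<and> elts z \<subseteq> elts v}" using zA by blast
  next
    fix z assume "z \<in> {z \<in> A. \<exists>v\<in>elts h. v \<in> elts u \<and> elts z \<subseteq> elts v}"
    then obtain v where zA: "z \<in> A" and v: "v \<in> elts h" "v \<in> elts u" "elts z \<subseteq> elts v" by blast
    from H2[OF zA tr[OF h u] u tr[OF h v(1)] v(1,2)] v(3) show "z \<in> elts u"
      unfolding subs_in[OF trans zA] by blast
  qed
  then show "hist h" using h by (simp add: hist_def)
next
  assume h: "h \<in> A" and H: "hist h"
  have eq: "z \<in> elts u \<longleftrightarrow> (\<exists>v\<in>elts h. v \<in> elts u \<and> elts z \<subseteq> elts v)" if "u \<in> elts h" "z \<in> A" for u z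
    using H that by (auto simp: hist_def)
  show "Hist MM h" unfolding Hist_def in_struct_simps
  proof (intro conjI ballI impI)
    fix u z assume "u \<in> elts h" "z \<in> A" "z \<in> elts u"
    then obtain v where "v \<in> elts h" "v \<in> elts u" "elts z \<subseteq> elts v" using eq by blast
    then show "\<exists>v\<in>A. v \<in> elts h \<and> v \<in> elts u \<and> subs MM z v"
      using tr[OF h] \<open>z \<in> A\<close> by (auto simp: subs_in[OF trans])
  next
    fix z u v assume "z \<in> A" "u \<in> elts h" "v \<in> elts h" "v \<in> elts u" "subs MM z v"
    then show "z \<in> elts u" using eq by (auto simp: subs_in[OF trans])
  qed
qed

lemma histD: "hist h \<Longrightarrow> u \<in> elts h \<Longrightarrow> z \<in> elts u \<longleftrightarrow> z \<in> A \<and> (\<exists>v\<in>elts h. v \<in> elts u \<and> elts z \<subseteq> elts v)"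
  by (auto simp: hist_def)

lemma hist_level_in: "hist h \<Longrightarrow> u \<in> elts h \<Longrightarrow> u \<in> A"
  using tr[of h u] by (simp add: hist_def)

lemma level_super: "hist h \<Longrightarrow> u \<in> elts h \<Longrightarrow> z \<in> A \<Longrightarrow> elts z \<subseteq> elts y \<Longrightarrow> y \<in> elts u \<Longrightarrow> z \<in> elts u"
  using histD[of h u y] histD[of h u z] by auto

lemma level_trans: "hist h \<Longrightarrow> u \<in> elts h \<Longrightarrow> z \<in> elts u \<Longrightarrow> elts z \<subseteq> elts u"
proof (induction u arbitrary: z rule: wf_induct_rule[OF wf_elts])
  case (1 u)
  obtain v where v: "v \<in> elts h" "v \<in> elts u" "elts z \<subseteq> elts v"
    using 1(2-4) histD by blast
  have "elts v \<subseteq> elts u"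
  proof
    fix x assume x: "x \<in> elts v"
    then have "elts x \<subseteq> elts v" using 1(1)[of v x] 1(2) v by auto
    moreover have "x \<in> A" by (rule tr[OF hist_level_in[OF 1(2) v(1)] x])
    ultimately show "x \<in> elts u" using 1(2,3) v histD by blast
  qed
  then show ?case using v by blast
qed

text \<open>
  A double induction: if \<open>u\<close> and \<open>u'\<close> are incomparable, then the levels below each belong to the other, and since
  levels are determined by the levels below them, \<open>u = u'\<close>.
\<close>

lemma level_linear:
  assumes "hist h" "hist h'"
  shows "u \<in> elts h \<Longrightarrow> u' \<in> elts h' \<Longrightarrow> u \<in> elts u' \<or> u = u' \<or> u' \<in> elts u"
proof (induction u arbitrary: u' rule: wf_induct_rule[OF wf_elts])
  case (1 u)
  note IH = 1(1) and u = 1(2)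
  show ?case using 1(3)
  proof (induction u' rule: wf_induct_rule[OF wf_elts])
    case (1 u')
    note IH' = 1(1) and u' = 1(2)
    have uA: "u \<in> A" "u' \<in> A" using hist_level_in assms u u' by blast+
    show ?case
    proof (rule ccontr)
      assume no: "\<not> ?thesis"
      have a: "v \<in> elts u'" if v: "v \<in> elts h" "v \<in> elts u" for v
        using IH[of v u'] v u' no level_trans[OF assms(1) u v(2)] by auto
      have b: "v \<in> elts u" if v: "v \<in> elts h'" "v \<in> elts u'" for v
        using IH'[of v] v no level_trans[OF assms(2) u' v(2)] by auto
      have "elts u \<subseteq> elts u'"
      proof
        fix z assume "z \<in> elts u"
        then obtain v where "z \<in> A" "v \<in> elts h" "v \<in> elts u" "elts z \<subseteq> elts v"
          using histD[OF assms(1) u] by blast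
        then show "z \<in> elts u'" using a level_super[OF assms(2) u'] by blast
      qed
      moreover have "elts u' \<subseteq> elts u"
      proof
        fix z assume "z \<in> elts u'"
        then obtain v where "z \<in> A" "v \<in> elts h'" "v \<in> elts u'" "elts z \<subseteq> elts v"
          using histD[OF assms(2) u'] by blast
        then show "z \<in> elts u" using b level_super[OF assms(1) u] by blast
      qed
      ultimately show False using V_extensionality[of u u'] no by blast
    qed
  qed
qed

lemma level_init:
  assumes "hist h" "hist h'" "u \<in> elts h" "v \<in> elts h'" "v \<in> elts u"
  shows "v \<in> elts h"
  using assms(3,5)
proof (induction u rule: wf_induct_rule[OF wf_elts])
  case (1 u)
  obtain w where w: "w \<in> elts h" "w \<in> elts u" "elts v \<subseteq> elts w"
    using histD[OF assms(1) 1(2)] 1(3) by blast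
  from level_linear[OF assms(2,1) assms(4) w(1)] consider "v \<in> elts w" | "v = w" | "w \<in> elts v" by blast
  then show ?case
  proof cases
    case 3
    then show ?thesis using w(3) elts_irrefl by blast
  qed (use 1(1)[of w] w in auto)
qed

lemma hist_compare: "hist h \<Longrightarrow> hist h' \<Longrightarrow> elts h \<subseteq> elts h' \<or> elts h' \<subseteq> elts h"
  using level_linear[of h h'] level_init[of h h'] level_init[of h' h] by blast

text \<open>
  The next level is the set of all subsets of elements of \<open>h\<close>; it exists by Powerset and \<open>\<Delta>\<^sub>0\<close>-Separation.
\<close>

lemma hist_ext:
  assumes h: "hist h"
  shows "\<exists>h' U. hist h' \<and> elts h' = insert U (elts h) \<and> elts U = {z \<in> A. \<exists>u\<in>elts h. elts z \<subseteq> elts u}"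
proof -
  have hA: "h \<in> A" using h by (simp add: hist_def)
  obtain x where x: "x \<in> A" "elts x = (\<Union>y\<in>elts h. elts y)" using union[OF hA] by blast
  obtain p where p: "p \<in> A" "elts p = {z \<in> A. elts z \<subseteq> elts x}" using pow[OF x(1)] by blast
  have "\<exists>U\<in>A. elts U = {z \<in> elts p. (\<lambda>M s z. \<exists>u\<in>dom M. mem M u (s 0) \<and> subs M z u) MM (\<lambda>_. h) z}"
    by (rule sep0) (use hA p in \<open>auto intro!: D0_rules\<close>)
  then obtain U where U0: "U \<in> A" "elts U = {z \<in> elts p. \<exists>u\<in>A. u \<in> elts h \<and> subs MM z u}" by auto
  have U: "elts U = {z \<in> A. \<exists>u\<in>elts h. elts z \<subseteq> elts u}"
  proof -
    have "(\<exists>u\<in>A. u \<in> elts h \<and> subs MM z u) \<longleftrightarrow> (\<exists>u\<in>elts h. elts z \<subseteq> elts u)" if "z \<in> A" for z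
      unfolding subs_in[OF trans that] using tr[OF hA] by blast
    then show ?thesis unfolding U0(2) p(2) x(2) by blast
  qed
  obtain h' where h': "h' \<in> A" "elts h' = insert U (elts h)" using vinsert[OF U0(1) hA] by blast
  have inU: "u \<in> elts U" if "u \<in> elts h" for u using that tr[OF hA] U by auto
  have "hist h'" unfolding hist_def
  proof (intro conjI ballI)
    fix u assume "u \<in> elts h'"
    then consider "u = U" | "u \<in> elts h" using h' by auto
    then show "elts u = {z \<in> A. \<exists>v\<in>elts h'. v \<in> elts u \<and> elts z \<subseteq> elts v}"
    proof cases
      case 1
      then show ?thesis using U inU h'(2) elts_irrefl[of U] by auto
    next
      case 2
      then have "U \<notin> elts u" using inU elts_asym by blast
      then show ?thesis using h 2 h'(2) by (auto simp: hist_def)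
    qed
  qed (rule h'(1))
  then show ?thesis using h' U by blast
qed

text \<open>
  By induction on \<open>x\<close>: histories covering the elements of \<open>x\<close> are collected, their union \<open>H\<close> is a history because histories are
  initial segments of each other, the level after \<open>H\<close> includes \<open>x\<close>, and the level after that contains \<open>x\<close>.
\<close>

lemma covering: "x \<in> A \<Longrightarrow> \<exists>h u. hist h \<and> u \<in> elts h \<and> x \<in> elts u"
proof (induction x rule: wf_induct_rule[OF wf_elts])
  case (1 x)
  let ?R = "\<lambda>M (s::nat \<Rightarrow> 'k V) y h. Hist M h \<and> (\<exists>u\<in>dom M. mem M u h \<and> mem M y u)"
  have "\<exists>c\<in>A. \<forall>y\<in>elts x. \<exists>h\<in>elts c. ?R MM (\<lambda>_. x) y h"
  proof (rule coll_in)
    show "Sig {MM} (Suc k) (\<lambda>M s. Hist M (s 0) \<and> (\<exists>u\<in>dom M. mem M u (s 0) \<and> mem M (s (Suc 0)) u))"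
      using k1 by (intro Sig_conj D0_Sig Pie_Sig[OF Pie_Hist] D0_rules) auto
    fix y assume y: "y \<in> elts x"
    then obtain h u where h: "hist h" "u \<in> elts h" "y \<in> elts u" using 1(1)[of y] tr[OF 1(2) y] by auto
    have hA: "h \<in> A" using h(1) by (simp add: hist_def)
    show "\<exists>h\<in>A. Hist MM h \<and> (\<exists>u\<in>dom MM. mem MM u h \<and> mem MM y u)"
    proof (rule bexI[OF _ hA], intro conjI)
      show "Hist MM h" using h(1) Hist_in[OF hA] by simp
      show "\<exists>u\<in>dom MM. mem MM u h \<and> mem MM y u"
        using h hist_level_in[OF h(1,2)] by (intro bexI[of _ u]) simp_all
    qed
  qed (use 1 in auto)
  then obtain c where c: "c \<in> A" "\<And>y. y \<in> elts x \<Longrightarrow> \<exists>h\<in>elts c. Hist MM h \<and> (\<exists>u\<in>A. u \<in> elts h \<and> y \<in> elts u)"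
    by auto
  have "\<exists>c'\<in>A. elts c' = {h \<in> elts c. (\<lambda>M s h. Hist M h) MM (\<lambda>_. c) h}"
    using k1 c by (intro sep_in) (auto intro!: Pie_mono[OF Pie_Hist])
  then obtain c' where c': "c' \<in> A" "elts c' = {h \<in> elts c. hist h}"
    using Hist_in[OF tr[OF c(1)]] by auto
  obtain H where H: "H \<in> A" "elts H = (\<Union>h\<in>elts c'. elts h)" using union[OF c'(1)] by blast
  have "hist H" unfolding hist_def
  proof (intro conjI ballI)
    fix u assume "u \<in> elts H"
    then obtain h where h: "u \<in> elts h" "hist h" "h \<in> elts c'" using H(2) c'(2) by blast
    show "elts u = {z \<in> A. \<exists>v\<in>elts H. v \<in> elts u \<and> elts z \<subseteq> elts v}"
    proof (intro set_eqI)
      fix z show "z \<in> elts u \<longleftrightarrow> z \<in> {z \<in> A. \<exists>v\<in>elts H. v \<in> elts u \<and> elts z \<subseteq> elts v}"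
      proof (cases "z \<in> A")
        case True
        have "(\<exists>v\<in>elts H. v \<in> elts u \<and> elts z \<subseteq> elts v) \<longleftrightarrow> (\<exists>v\<in>elts h. v \<in> elts u \<and> elts z \<subseteq> elts v)"
        proof
          assume "\<exists>v\<in>elts H. v \<in> elts u \<and> elts z \<subseteq> elts v"
          then obtain v h' where v: "v \<in> elts h'" "hist h'" "v \<in> elts u" "elts z \<subseteq> elts v"
            using H(2) c'(2) by blast
          from level_init[OF h(2) v(2) h(1) v(1,3)] v
          show "\<exists>v\<in>elts h. v \<in> elts u \<and> elts z \<subseteq> elts v" by blast
        next
          assume "\<exists>v\<in>elts h. v \<in> elts u \<and> elts z \<subseteq> elts v"
          then show "\<exists>v\<in>elts H. v \<in> elts u \<and> elts z \<subseteq> elts v" using H(2) h(3) by blast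
        qed
        with True show ?thesis using histD[OF h(2,1), of z] by blast
      next
        case False
        then show ?thesis using histD[OF h(2,1), of z] by blast
      qed
    qed
  qed (rule H(1))
  from hist_ext[OF this] obtain H1 U1 where H1: "hist H1" "elts H1 = insert U1 (elts H)"
    "elts U1 = {z \<in> A. \<exists>u\<in>elts H. elts z \<subseteq> elts u}" by blast
  from hist_ext[OF H1(1)] obtain H2 U2 where H2: "hist H2" "elts H2 = insert U2 (elts H1)"
    "elts U2 = {z \<in> A. \<exists>u\<in>elts H1. elts z \<subseteq> elts u}" by blast
  have "elts x \<subseteq> elts U1"
  proof
    fix y assume y: "y \<in> elts x"
    then obtain h u where h: "h \<in> elts c" "Hist MM h" "u \<in> elts h" "y \<in> elts u" using c(2) by blast
    have "h \<in> A" using tr[OF c(1) h(1)] .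
    then have "hist h" using h(2) Hist_in by blast
    then have "u \<in> elts H" using h H c' by auto
    moreover have "y \<in> A" by (rule tr[OF 1(2) y])
    moreover have "elts y \<subseteq> elts u" using level_trans[OF \<open>hist h\<close> h(3,4)] .
    ultimately show "y \<in> elts U1" using H1(3) by auto
  qed
  then have "x \<in> elts U2" using H2(3) H1(2) 1(2) by auto
  then show ?case using H2 by blast
qed

end

section \<open>Well-foundedness inside and outside\<close>

text \<open>
  The relation \<open>g\<close> maps members of \<open>a\<close> to sets so that strict inclusion below a member is matched by membership, where
  the matching element need not be unique.
\<close>

definition sim :: "'a struct \<Rightarrow> 'a \<Rightarrow> 'a \<Rightarrow> bool" where
  "sim M a g \<longleftrightarrow> (\<forall>S\<in>dom M. \<forall>t\<in>dom M. Rel M g S t \<longrightarrow>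
     (\<forall>S'\<in>dom M. mem M S' a \<longrightarrow> (subs M S' S \<and> S' \<noteq> S \<longrightarrow> (\<exists>t'\<in>dom M. mem M t' t \<and> Rel M g S' t'))))"

lemma D0_sim: "D0 C (\<lambda>M s. sim M (s i) (s j))"
  unfolding sim_def by (intro D0_AllRel D0_rules)

context coll_model
begin

lemma sim_in:
  assumes "a \<in> A" "g \<in> A"
  shows "sim MM a g \<longleftrightarrow> (\<forall>S t. opair S t \<in> elts g \<longrightarrow>
     (\<forall>S'\<in>elts a. elts S' \<subset> elts S \<longrightarrow> (\<exists>t'\<in>elts t. opair S' t' \<in> elts g)))"
proof -
  have 1: "S \<in> A \<and> t \<in> A" if "opair S t \<in> elts g" for S t
    using opair_in_trans[OF trans tr[OF assms(2) that]] .
  have 2: "subs MM S' S \<and> S' \<noteq> S \<longleftrightarrow> elts S' \<subset> elts S" if "S' \<in> A" for S' S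
    using V_extensionality[of S' S] by (auto simp: subs_in[OF trans that])
  show ?thesis
    unfolding sim_def in_struct_simps Rel_in[OF trans assms(2)]
    using 1 2 tr[OF assms(1)] by (smt (verit, best))
qed

lemma below_set:
  assumes "a \<in> A" "S \<in> A"
  shows "\<exists>W\<in>A. elts W = {T \<in> elts a. elts T \<subset> elts S}"
proof -
  have "\<exists>W\<in>A. elts W = {T \<in> elts a. (\<lambda>M s T. subs M T (s 0) \<and> \<not> T = s 0) MM (\<lambda>_. S) T}"
    by (rule sep0) (use assms in \<open>auto intro!: D0_rules\<close>)
  moreover have "subs MM T S \<and> \<not> T = S \<longleftrightarrow> elts T \<subset> elts S" if "T \<in> elts a" for T
    using V_extensionality[of T S] by (auto simp: subs_in[OF trans tr[OF assms(1) that]])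
  then have "{T \<in> elts a. subs MM T S \<and> \<not> T = S} = {T \<in> elts a. elts T \<subset> elts S}" by blast
  ultimately show ?thesis by simp
qed

text \<open>
  If inclusion on \<open>a\<close> has least elements for all subsets that are in \<open>A\<close>, it is well-founded for arbitrary ones. Let \<open>z\<close> be
  the set of those members of \<open>a\<close> that are not related to anything by a simulation. Its least element \<open>S0\<close> would have only related
  members of \<open>a\<close> strictly below it; collecting their simulations and values \<open>D\<close>, and adding the pair of \<open>S0\<close> and \<open>D\<close>, gives a simulation
  for \<open>S0\<close>. So \<open>z\<close> is empty, every member of \<open>a\<close> is simulated by a set, and membership is really well-founded.
\<close>

lemma real_wf:
  assumes k2: "2 \<le> k" and a: "a \<in> A"
    and wf: "\<And>z. z \<in> A \<Longrightarrow> elts z \<subseteq> elts a \<Longrightarrow> elts z \<noteq> {} \<Longrightarrow> \<exists>S\<in>elts z. \<forall>S'\<in>elts z. elts S \<subseteq> elts S'"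
    and Z: "Z \<subseteq> elts a" "Z \<noteq> {}"
  shows "\<exists>S\<in>Z. \<forall>S'\<in>Z. \<not> elts S' \<subset> elts S"
proof -
  let ?P = "\<lambda>M s S. \<not> (\<exists>g\<in>dom M. \<exists>t\<in>dom M. sim M (s 0) g \<and> Rel M g S t)"
  have "\<exists>z\<in>A. elts z = {S \<in> elts a. ?P MM (\<lambda>_. a) S}"
  proof (rule sep_in)
    have S1: "Sig {MM} (Suc 0) (\<lambda>M s. \<exists>g\<in>dom M. \<exists>t\<in>dom M. sim M (s (Suc 0)) g \<and> Rel M g (s 0) t)"
      by (intro Sig_Ex D0_Sig D0_rules D0_sim)
    show "Pie {MM} k (\<lambda>M s. \<not> (\<exists>g\<in>dom M. \<exists>t\<in>dom M. sim M (s (Suc 0)) g \<and> Rel M g (s 0) t))"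
      by (rule Pie_mono[OF Pie_notI[OF S1]]) (use k2 in simp)
  qed (use a in auto)
  then obtain z where z: "z \<in> A" "elts z = {S \<in> elts a. \<not> (\<exists>g\<in>A. \<exists>t\<in>A. sim MM a g \<and> opair S t \<in> elts g)}"
    by (auto simp: Rel_in[OF trans])
  have all: "\<exists>g\<in>A. \<exists>t\<in>A. sim MM a g \<and> opair S t \<in> elts g" if "S \<in> elts a" for S
  proof (rule ccontr)
    assume "\<not> ?thesis"
    then have "elts z \<noteq> {}" using z(2) that by blast
    then obtain S0 where S0: "S0 \<in> elts z" "\<forall>S'\<in>elts z. elts S0 \<subseteq> elts S'"
      using wf[OF z(1)] z(2) by blast
    have S0A: "S0 \<in> A" using tr[OF z(1) S0(1)] .
    obtain W where W: "W \<in> A" "elts W = {S \<in> elts a. elts S \<subset> elts S0}"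
      using below_set[OF a S0A] by blast
    let ?R = "\<lambda>M (s::nat\<Rightarrow>'k V) S y. \<exists>g\<in>dom M. mem M g y \<and> (\<exists>t\<in>dom M. mem M t y \<and> (sim M (s 0) g \<and> Rel M g S t))"
    have "\<exists>c\<in>A. \<forall>S\<in>elts W. \<exists>y\<in>elts c. ?R MM (\<lambda>_. a) S y"
    proof (rule coll_in)
      show "Sig {MM} (Suc k) (\<lambda>M s. \<exists>g\<in>dom M. mem M g (s 0) \<and> (\<exists>t\<in>dom M. mem M t (s 0) \<and>
          (sim M (s (Suc (Suc 0))) g \<and> Rel M g (s (Suc 0)) t)))"
        by (intro D0_Sig D0_rules D0_sim)
      fix S assume "S \<in> elts W"
      then have "S \<in> elts a" "\<not> elts S0 \<subseteq> elts S" using W by auto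
      then have "S \<notin> elts z" using S0 by blast
      then obtain g t where g: "g \<in> A" "t \<in> A" "sim MM a g" "opair S t \<in> elts g"
        using z(2) \<open>S \<in> elts a\<close> by blast
      show "\<exists>y\<in>A. \<exists>g\<in>dom MM. mem MM g y \<and> (\<exists>t\<in>dom MM. mem MM t y \<and> (sim MM a g \<and> Rel MM g S t))"
      proof (rule bexI[of _ "vset {g, t}"])
        show "\<exists>g'\<in>dom MM. mem MM g' (vset {g, t}) \<and> (\<exists>t'\<in>dom MM. mem MM t' (vset {g, t}) \<and> (sim MM a g' \<and> Rel MM g' S t'))"
          by (rule bexI[of _ g], rule conjI, simp, rule bexI[of _ t]) (use g in \<open>simp_all add: Rel_in[OF trans]\<close>)
      qed (use pair g in simp)
    qed (use a W in auto)
    then obtain c where c: "c \<in> A" "\<And>S. S \<in> elts W \<Longrightarrow>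
       \<exists>y\<in>elts c. \<exists>g\<in>A. g \<in> elts y \<and> (\<exists>t\<in>A. t \<in> elts y \<and> (sim MM a g \<and> Rel MM g S t))" by auto
    obtain D where D: "D \<in> A" "elts D = (\<Union>y\<in>elts c. elts y)" using union[OF c(1)] by blast
    obtain U where U: "U \<in> A" "elts U = (\<Union>y\<in>elts D. elts y)" using union[OF D(1)] by blast
    have D': "\<exists>g\<in>elts D. \<exists>t\<in>elts D. sim MM a g \<and> opair S t \<in> elts g" if S: "S \<in> elts W" for S
    proof -
      from c(2)[OF S] obtain y g t where y: "y \<in> elts c" "g \<in> A" "g \<in> elts y" "t \<in> elts y"
        "sim MM a g" "Rel MM g S t" by blast
      then have "opair S t \<in> elts g" using Rel_in[OF trans y(2)] by blast
      with y D(2) show ?thesis by blast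
    qed
    have "\<exists>g0\<in>A. elts g0 = {e \<in> elts U. (\<lambda>M s e. \<exists>g\<in>dom M. mem M g (s 0) \<and> (sim M (s (Suc 0)) g \<and> mem M e g)) MM (D ## (\<lambda>_. a)) e}"
      by (rule sep0) (use a D U in \<open>auto intro!: D0_rules D0_sim\<close>)
    then obtain g0 where g0: "g0 \<in> A" "elts g0 = {e \<in> elts U. \<exists>g\<in>A. g \<in> elts D \<and> sim MM a g \<and> e \<in> elts g}"
      by auto
    have g0': "e \<in> elts g0 \<longleftrightarrow> (\<exists>g\<in>elts D. sim MM a g \<and> e \<in> elts g)" for e
      unfolding g0(2) U(2) using tr[OF D(1)] by blast
    \<comment> \<open>The values of all strictly smaller members of \<open>a\<close> lie in \<open>D\<close>, so \<open>D\<close> itself is a value for \<open>S0\<close>.\<close>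
    obtain g1 where g1: "g1 \<in> A" "elts g1 = insert (opair S0 D) (elts g0)"
      using vinsert[OF opair[OF S0A D(1)] g0(1)] by blast
    have "sim MM a g1" unfolding sim_in[OF a g1(1)]
    proof (intro allI impI ballI)
      fix S t S' assume "opair S t \<in> elts g1" and S': "S' \<in> elts a" "elts S' \<subset> elts S"
      then consider "S = S0" "t = D" | "opair S t \<in> elts g0" using g1(2) by auto
      then show "\<exists>t'\<in>elts t. opair S' t' \<in> elts g1"
      proof cases
        case 1
        then have "S' \<in> elts W" using W S' by auto
        from D'[OF this] obtain g t' where "g \<in> elts D" "t' \<in> elts D" "sim MM a g" "opair S' t' \<in> elts g" by blast
        then have "opair S' t' \<in> elts g0" "t' \<in> elts t" using g0' 1 by blast+
        then show ?thesis using g1(2) by blast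
      next
        case 2
        then obtain g where g: "g \<in> elts D" "sim MM a g" "opair S t \<in> elts g" using g0' by blast
        have gA: "g \<in> A" using tr[OF D(1) g(1)] .
        from g(2)[unfolded sim_in[OF a gA], rule_format, OF g(3) S'] obtain t' where
          "t' \<in> elts t" "opair S' t' \<in> elts g" by blast
        then have "opair S' t' \<in> elts g0" using g0' g by blast
        then show ?thesis using g1(2) \<open>t' \<in> elts t\<close> by blast
      qed
    qed
    then have "\<exists>g\<in>A. \<exists>t\<in>A. sim MM a g \<and> opair S0 t \<in> elts g" using g1 D(1) by blast
    then show False using S0(1) z(2) by blast
  qed
  obtain S where S: "S \<in> Z" using Z by blast
  then obtain g t where g: "g \<in> A" "sim MM a g" "opair S t \<in> elts g" using all[of S] Z by blast
  note sim = g(2)[unfolded sim_in[OF a g(1)], rule_format]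
  have "\<exists>S\<in>Z. \<forall>S'\<in>Z. \<not> elts S' \<subset> elts S" if "S \<in> Z" "opair S t \<in> elts g" for S
    using that
  proof (induction t arbitrary: S rule: wf_induct_rule[OF wf_elts])
    case (1 t)
    show ?case
    proof (cases "\<exists>S'\<in>Z. elts S' \<subset> elts S")
      case True
      then obtain S' where S': "S' \<in> Z" "elts S' \<subset> elts S" by blast
      then have "S' \<in> elts a" using Z by blast
      from sim[OF 1(3) this S'(2)] obtain t' where "t' \<in> elts t" "opair S' t' \<in> elts g" by blast
      then show ?thesis using 1(1)[of t' S'] S' by blast
    next
      case False
      then show ?thesis using 1(2) by blast
    qed
  qed
  then show ?thesis using S g(3) by blast
qed

end

section \<open>An end extension\<close>

locale endext = coll_model A "Suc m" for A :: "'k V set" and m :: nat +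
  fixes NN :: "'k V struct"
  assumes m1: "m \<ge> 1" and elem: "elem_end_ext (Suc (Suc m)) MM NN"
    and neq: "dom NN \<noteq> A" and collN: "models NN (Collection (Pi_fm m))"
begin

abbreviation "CC \<equiv> {MM, NN}"

lemma sub: "A \<subseteq> dom NN"
  using elem by (auto simp: elem_end_ext_def end_extension_def substructure_def)

lemma inN: "x \<in> A \<Longrightarrow> x \<in> dom NN" using sub by blast

lemma memN: "y \<in> A \<Longrightarrow> x \<in> dom NN \<Longrightarrow> mem NN x y \<longleftrightarrow> x \<in> elts y"
proof -
  assume y: "y \<in> A" and x: "x \<in> dom NN"
  have 1: "\<And>a b. a \<in> A \<Longrightarrow> b \<in> A \<Longrightarrow> a \<in> elts b \<longleftrightarrow> mem NN a b"
    and 2: "\<And>a b. b \<in> A \<Longrightarrow> a \<in> dom NN \<Longrightarrow> mem NN a b \<Longrightarrow> a \<in> A"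
    using elem by (auto simp: elem_end_ext_def end_extension_def substructure_def)
  show ?thesis using 1[of x y] 2[of y x] tr[OF y, of x] x y by blast
qed

lemma endN: "y \<in> A \<Longrightarrow> x \<in> dom NN \<Longrightarrow> mem NN x y \<Longrightarrow> x \<in> A"
  using memN tr by blast

lemma up:
  assumes "Sig CC (Suc m) P" "\<And>s. range s \<subseteq> A \<Longrightarrow> P MM s" "range t \<subseteq> dom NN"
  shows "P NN t"
  by (rule transfer_up[OF elem assms(1) _ _ assms(3)]) (use assms(2) ne in auto)

lemma up0:
  assumes "D0 CC P" "\<And>s. range s \<subseteq> A \<Longrightarrow> P MM s" "range t \<subseteq> dom NN"
  shows "P NN t"
  by (rule up[OF D0_Sig[OF assms(1)] assms(2,3)])

lemma sep0N: "models NN (Separation Delta0)"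
  unfolding models_def
proof (intro conjI ballI allI impI)
  show "dom NN \<noteq> {}" using sub ne by blast
  fix ax and t :: "nat \<Rightarrow> 'k V" assume ax: "ax \<in> Separation Delta0" and t: "range t \<subseteq> dom NN"
  then obtain p x y w where p: "p \<in> Delta0" and
    ax_eq: "ax = Forall w (Exists y (Forall x (Iff (Mem x y) (Conj (Mem x w) p))))"
    unfolding Separation_def by blast
  let ?b = "Exists y (Forall x (Iff (Mem x y) (Conj (Mem x w) p)))"
  have D: "Iff (Mem x y) (Conj (Mem x w) p) \<in> Delta0" using p by (intro Delta0.intros)
  have "is_Pi (Suc 0) (Forall x (Iff (Mem x y) (Conj (Mem x w) p)))"
    by (intro is_Sigma_is_Pi.Pi_Forall is_Sigma_is_Pi.Pi_Sigma is_Sigma_is_Pi.Sigma_0 D)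
  then have "is_Sigma (Suc (Suc 0)) ?b"
    by (intro is_Sigma_is_Pi.Sigma_Exists is_Sigma_is_Pi.Sigma_Pi)
  then have b: "is_Sigma (Suc m) ?b" by (rule levy_mono(1)[rotated]) (use m1 in simp)
  have "sat NN (t(w := a)) ?b" if a: "a \<in> dom NN" for a
  proof (rule up[of "\<lambda>M s. sat M s ?b"])
    show "Sig CC (Suc m) (\<lambda>M s. sat M s ?b)" by (rule Dfn_sat) (simp add: Sigma_fm_def b)
    show "range (t(w := a)) \<subseteq> dom NN" using t a by (rule range_upd)
    fix s :: "nat \<Rightarrow> 'k V" assume s: "range s \<subseteq> A"
    have "sat MM s ax" using sep0_models ax s by (auto simp: models_def)
    then have "\<forall>a\<in>dom MM. sat MM (s(w := a)) ?b" unfolding ax_eq by (rule sat.simps(7)[THEN iffD1])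
    moreover have "s w \<in> dom MM" using s by auto
    ultimately have "sat MM (s(w := s w)) ?b" by (rule bspec)
    then show "sat MM s ?b" by simp
  qed
  then show "sat NN t ax" unfolding ax_eq by simp
qed

lemma baseN: "base NN"
  unfolding base_def
proof (intro conjI ballI)
  show "dom NN \<noteq> {}" using sub ne by blast
  fix a b assume ab: "a \<in> dom NN" "b \<in> dom NN"
  have "\<exists>d\<in>dom NN. mem NN ((a ## (\<lambda>_. b)) 0) d \<and> mem NN ((a ## (\<lambda>_. b)) (Suc 0)) d"
  proof (rule up[of "\<lambda>M s. \<exists>d\<in>dom M. mem M (s 0) d \<and> mem M (s (Suc 0)) d"])
    show "Sig CC (Suc m) (\<lambda>M s. \<exists>d\<in>dom M. mem M (s 0) d \<and> mem M (s (Suc 0)) d)"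
      by (intro Sig_Ex D0_Sig D0_rules)
    fix s :: "nat \<Rightarrow> 'k V" assume "range s \<subseteq> A"
    then have "s 0 \<in> dom MM" "s (Suc 0) \<in> dom MM" by auto
    then show "\<exists>d\<in>dom MM. mem MM (s 0) d \<and> mem MM (s (Suc 0)) d"
      using base_in unfolding base_def by blast
  qed (use ab in auto)
  then show "\<exists>d\<in>dom NN. mem NN a d \<and> mem NN b d" by simp
next
  fix c assume c: "c \<in> dom NN"
  have "\<exists>e\<in>dom NN. \<forall>d\<in>dom NN. mem NN d ((\<lambda>_::nat. c) 0) \<longrightarrow> (\<forall>y\<in>dom NN. mem NN y d \<longrightarrow> mem NN y e)"
  proof (rule up[of "\<lambda>M s. \<exists>e\<in>dom M. \<forall>d\<in>dom M. mem M d (s 0) \<longrightarrow> (\<forall>y\<in>dom M. mem M y d \<longrightarrow> mem M y e)"])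
    show "Sig CC (Suc m) (\<lambda>M s. \<exists>e\<in>dom M. \<forall>d\<in>dom M. mem M d (s 0) \<longrightarrow> (\<forall>y\<in>dom M. mem M y d \<longrightarrow> mem M y e))"
      by (intro Sig_Ex D0_Sig D0_rules)
    fix s :: "nat \<Rightarrow> 'k V" assume "range s \<subseteq> A"
    then have "s 0 \<in> dom MM" by auto
    then show "\<exists>e\<in>dom MM. \<forall>d\<in>dom MM. mem MM d (s 0) \<longrightarrow> (\<forall>y\<in>dom MM. mem MM y d \<longrightarrow> mem MM y e)"
      using base_in unfolding base_def by blast
  qed (use c in auto)
  then show "\<exists>e\<in>dom NN. \<forall>d\<in>dom NN. mem NN d c \<longrightarrow> (\<forall>y\<in>dom NN. mem NN y d \<longrightarrow> mem NN y e)" .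
qed

lemma good_CC: "good CC (Suc m)"
proof -
  have "models NN (Collection (Pi_fm j))" if "j < Suc m" for j
  proof -
    have "Pi_fm j \<subseteq> Pi_fm m" using that levy_mono(2)[of j m] by (auto simp: Pi_fm_def)
    then have "Collection (Pi_fm j) \<subseteq> Collection (Pi_fm m)" unfolding Collection_def by blast
    then show ?thesis using collN unfolding models_def by blast
  qed
  moreover have "good {MM} (Suc m)" by (rule good_mono[OF good_MM]) simp
  ultimately show ?thesis unfolding good_def using baseN sep0N by simp
qed

lemma good_CC': "good CC m" by (rule good_mono[OF good_CC]) simp

text \<open>
  Most of the following facts are true in \<open>A\<close> and expressible by predicates of level at most \<open>\<Sigma>\<^sub>m\<^sub>+\<^sub>1\<close>, so that
  \<open>transfer_up\<close> applies; this is where histories being \<open>\<Pi>\<^sub>1\<close> matters.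
\<close>

lemma relN_add:
  assumes "g \<in> dom NN" "j \<in> dom NN" "c \<in> dom NN"
  shows "\<exists>g'\<in>dom NN. \<forall>a\<in>dom NN. \<forall>b\<in>dom NN. Rel NN g' a b \<longleftrightarrow> Rel NN g a b \<or> (a = j \<and> b = c)"
proof -
  let ?P = "\<lambda>M (s::nat \<Rightarrow> 'k V). \<exists>g'\<in>dom M. (\<forall>a\<in>dom M. \<forall>b\<in>dom M. Rel M g' a b \<longrightarrow> Rel M (s 0) a b \<or> (a = s (Suc 0) \<and> b = s (Suc (Suc 0)))) \<and>
     (\<forall>a\<in>dom M. \<forall>b\<in>dom M. Rel M (s 0) a b \<longrightarrow> Rel M g' a b) \<and> Rel M g' (s (Suc 0)) (s (Suc (Suc 0)))"
  have "?P NN (g ## j ## (\<lambda>_. c))"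
  proof (rule up[of ?P])
    show "Sig CC (Suc m) ?P" by (intro Sig_Ex D0_Sig D0_conj D0_AllRel D0_rules)
    fix s :: "nat \<Rightarrow> 'k V" assume "range s \<subseteq> A"
    then have s: "s 0 \<in> A" "s (Suc 0) \<in> A" "s (Suc (Suc 0)) \<in> A" by auto
    obtain g' where "g' \<in> A" "elts g' = insert (opair (s (Suc 0)) (s (Suc (Suc 0)))) (elts (s 0))"
      using vinsert[OF opair[OF s(2,3)] s(1)] by blast
    then show "?P MM s" by (intro bexI[of _ g']) (auto simp: Rel_in[OF trans] s(1))
  qed (use assms in auto)
  then obtain g' where "g' \<in> dom NN"
    "\<forall>a\<in>dom NN. \<forall>b\<in>dom NN. Rel NN g' a b \<longrightarrow> Rel NN g a b \<or> (a = j \<and> b = c)"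
    "\<forall>a\<in>dom NN. \<forall>b\<in>dom NN. Rel NN g a b \<longrightarrow> Rel NN g' a b" "Rel NN g' j c"
    by auto
  then show ?thesis by (intro bexI[of _ g']) blast+
qed

lemma relN_empty: "\<not> Rel NN (vset {}) a b"
  unfolding Rel_def using memN[OF emptyK] by auto

lemma coverN:
  assumes "x \<in> dom NN"
  shows "\<exists>h\<in>dom NN. \<exists>u\<in>dom NN. Hist NN h \<and> mem NN u h \<and> mem NN x u"
proof -
  let ?P = "\<lambda>M (s::nat \<Rightarrow> 'k V). \<exists>h\<in>dom M. \<exists>u\<in>dom M. Hist M h \<and> mem M u h \<and> mem M (s 0) u"
  have "?P NN (\<lambda>_. x)"
  proof (rule up[of ?P])
    show "Sig CC (Suc m) ?P"
      using m1 by (intro Sig_Ex Sig_conj D0_Sig[OF D0_mem] Pie_Sig[OF Pie_Hist]) auto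
    fix s :: "nat \<Rightarrow> 'k V" assume "range s \<subseteq> A"
    then have "s 0 \<in> A" by auto
    from covering[OF this] obtain h u where h: "hist h" "u \<in> elts h" "s 0 \<in> elts u" by blast
    have "h \<in> A" using h(1) by (simp add: hist_def)
    then have "Hist MM h" using h(1) Hist_in by simp
    then show "?P MM s"
      using h hist_level_in[OF h(1,2)] \<open>h \<in> A\<close> by (intro bexI[of _ h] bexI[of _ u]) simp_all
  qed (use assms in auto)
  then show ?thesis .
qed

lemma linN:
  assumes "h \<in> dom NN" "u \<in> dom NN" "v \<in> dom NN" "Hist NN h" "mem NN u h" "mem NN v h"
  shows "mem NN u v \<or> u = v \<or> mem NN v u"
proof -
  let ?P = "\<lambda>M (s::nat \<Rightarrow> 'k V). Hist M (s 0) \<longrightarrow> mem M (s (Suc 0)) (s 0) \<and> mem M (s (Suc (Suc 0))) (s 0) \<longrightarrow>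
    mem M (s (Suc 0)) (s (Suc (Suc 0))) \<or> s (Suc 0) = s (Suc (Suc 0)) \<or> mem M (s (Suc (Suc 0))) (s (Suc 0))"
  have "?P NN (h ## u ## (\<lambda>_. v))"
  proof (rule up[of ?P])
    show "Sig CC (Suc m) ?P"
      using m1 by (intro Sig_imp Pie_mono[OF Pie_Hist]) (auto intro!: D0_Sig D0_Pie D0_rules)
    fix s :: "nat \<Rightarrow> 'k V" assume "range s \<subseteq> A"
    then have "s 0 \<in> A" by auto
    then show "?P MM s"
      using Hist_in[of "s 0"] level_linear[of "s 0" "s 0" "s (Suc 0)" "s (Suc (Suc 0))"] by auto
  qed (use assms in auto)
  then show ?thesis using assms by (auto simp: econs_def)
qed

lemma compN:
  assumes "h \<in> dom NN" "h' \<in> dom NN" "Hist NN h" "Hist NN h'"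
  shows "subs NN h h' \<or> subs NN h' h"
proof -
  let ?P = "\<lambda>M (s::nat \<Rightarrow> 'k V). Hist M (s 0) \<longrightarrow> Hist M (s (Suc 0)) \<longrightarrow>
    subs M (s 0) (s (Suc 0)) \<or> subs M (s (Suc 0)) (s 0)"
  have "?P NN (h ## (\<lambda>_. h'))"
  proof (rule up[of ?P])
    show "Sig CC (Suc m) ?P"
      using m1 by (intro Sig_imp Pie_mono[OF Pie_Hist]) (auto intro!: D0_Sig D0_Pie D0_rules)
    fix s :: "nat \<Rightarrow> 'k V" assume "range s \<subseteq> A"
    then have "s 0 \<in> A" "s (Suc 0) \<in> A" by auto
    then show "?P MM s"
      using Hist_in[of "s 0"] Hist_in[of "s (Suc 0)"] hist_compare[of "s 0" "s (Suc 0)"]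
      by (simp add: subs_in[OF trans])
  qed (use assms in auto)
  then show ?thesis using assms by (auto simp: econs_def)
qed

lemma levtransN:
  assumes "h \<in> dom NN" "u \<in> dom NN" "z \<in> dom NN" "Hist NN h" "mem NN u h" "mem NN z u"
  shows "subs NN z u"
proof -
  let ?P = "\<lambda>M (s::nat \<Rightarrow> 'k V). Hist M (s 0) \<longrightarrow> mem M (s (Suc 0)) (s 0) \<and> mem M (s (Suc (Suc 0))) (s (Suc 0)) \<longrightarrow>
    subs M (s (Suc (Suc 0))) (s (Suc 0))"
  have "?P NN (h ## u ## (\<lambda>_. z))"
  proof (rule up[of ?P])
    show "Sig CC (Suc m) ?P"
      using m1 by (intro Sig_imp Pie_mono[OF Pie_Hist]) (auto intro!: D0_Sig D0_Pie D0_rules)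
    fix s :: "nat \<Rightarrow> 'k V" assume "range s \<subseteq> A"
    then have "s 0 \<in> A" "s (Suc (Suc 0)) \<in> A" by auto
    then show "?P MM s"
      using Hist_in[of "s 0"] level_trans[of "s 0" "s (Suc 0)" "s (Suc (Suc 0))"]
      by (simp add: subs_in[OF trans])
  qed (use assms in auto)
  then show ?thesis using assms by (auto simp: econs_def)
qed

lemma foundN:
  assumes "z \<in> dom NN" "y \<in> dom NN" "mem NN y z"
  shows "\<exists>y\<in>dom NN. mem NN y z \<and> (\<forall>v\<in>dom NN. mem NN v z \<longrightarrow> \<not> mem NN v y)"
proof -
  let ?P = "\<lambda>M (s::nat \<Rightarrow> 'k V). mem M (s (Suc 0)) (s 0) \<longrightarrow>
    (\<exists>y\<in>dom M. mem M y (s 0) \<and> (\<forall>v\<in>dom M. mem M v (s 0) \<longrightarrow> \<not> mem M v y))"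
  have "?P NN (z ## (\<lambda>_. y))"
  proof (rule up0[of ?P])
    show "D0 CC ?P" by (intro D0_rules)
    fix s :: "nat \<Rightarrow> 'k V" assume "range s \<subseteq> A"
    then have s: "s 0 \<in> A" by auto
    show "?P MM s"
    proof
      assume "mem MM (s (Suc 0)) (s 0)"
      then have "s (Suc 0) \<in> elts (s 0)" by simp
      from wfE_min[OF wf_elts this] obtain y where "y \<in> elts (s 0)" "\<And>v. v \<in> elts y \<Longrightarrow> v \<notin> elts (s 0)"
        by auto
      then show "\<exists>y\<in>dom MM. mem MM y (s 0) \<and> (\<forall>v\<in>dom MM. mem MM v (s 0) \<longrightarrow> \<not> mem MM v y)"
        using tr[OF s] by (intro bexI[of _ y]) auto
    qed
  qed (use assms in auto)
  then show ?thesis using assms by simp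
qed

text \<open>
  The powerset of \<open>w\<close> is the same in both structures: that \<open>p\<close> is the powerset of \<open>w\<close> is a \<open>\<Pi>\<^sub>1\<close> fact about elements of \<open>A\<close>.
\<close>

lemma sub_in_A:
  assumes "w \<in> A" "z \<in> dom NN" "subs NN z w"
  shows "z \<in> A \<and> elts z \<subseteq> elts w"
proof -
  obtain p where p: "p \<in> A" "elts p = {z \<in> A. elts z \<subseteq> elts w}" using pow[OF assms(1)] by blast
  let ?P = "\<lambda>M (s::nat \<Rightarrow> 'k V). \<forall>z\<in>dom M. subs M z (s 0) \<longrightarrow> mem M z (s (Suc 0))"
  have "Pie CC (Suc (Suc m)) ?P" by (intro Pie_All D0_Pie D0_rules)
  moreover have "range (w ## (\<lambda>_. p)) \<subseteq> dom MM" using p assms(1) by auto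
  ultimately have "?P MM (w ## (\<lambda>_. p)) = ?P NN (w ## (\<lambda>_. p))" by (rule elem_Pie[OF elem])
  moreover have "?P MM (w ## (\<lambda>_. p))" using p by (simp add: subs_in[OF trans])
  ultimately have "mem NN z p" using assms(2,3) by simp
  then have "z \<in> elts p" using memN[OF p(1) assms(2)] by blast
  then show ?thesis using p(2) by blast
qed

lemma HistN: "hist h \<Longrightarrow> Hist NN h"
proof -
  assume h: "hist h"
  then have hA: "h \<in> A" by (simp add: hist_def)
  have "Pie CC (Suc (Suc m)) (\<lambda>M s. Hist M (s 0))" by (rule Pie_mono[OF Pie_Hist]) simp
  then have "Hist MM ((\<lambda>_. h) 0) = Hist NN ((\<lambda>_. h) 0)"
    by (rule elem_Pie[OF elem]) (use hA in auto)
  then show ?thesis using h Hist_in[OF hA] by simp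
qed

text \<open>
  A history with a nonstandard element is not included in a standard history, so it includes all of these; by linearity, its nonstandard element is above their levels.
\<close>

lemma std_in:
  assumes "h \<in> dom NN" "Hist NN h" "u \<in> dom NN" "mem NN u h" "u \<notin> A" "hist h'" "v \<in> elts h'"
  shows "mem NN v h \<and> mem NN v u"
proof -
  have h': "h' \<in> A" "h' \<in> dom NN" using assms(6) inN by (auto simp: hist_def)
  have v: "v \<in> A" "v \<in> dom NN" using tr[OF h'(1) assms(7)] inN by auto
  have "\<not> subs NN h h'"
    using assms(3-5) endN[OF h'(1) assms(3)] by (auto simp: subs_def)
  then have "subs NN h' h" using compN[OF assms(1) h'(2) assms(2) HistN[OF assms(6)]] by blast
  then have vh: "mem NN v h" using memN[OF h'(1) v(2)] assms(7) v(2) by (auto simp: subs_def)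
  have "mem NN u v \<or> u = v \<or> mem NN v u" by (rule linN) (use assms v vh in auto)
  then show ?thesis using vh v(1) assms(5) endN[OF v(1) assms(3)] by auto
qed

lemma nonstd_super:
  assumes "h \<in> dom NN" "Hist NN h" "u \<in> dom NN" "mem NN u h" "u \<notin> A" "x \<in> A"
  shows "mem NN x u"
proof -
  obtain h' v where h': "hist h'" "v \<in> elts h'" "x \<in> elts v" using covering[OF assms(6)] by blast
  have v: "v \<in> A" using hist_level_in[OF h'(1,2)] .
  have "mem NN v u" using std_in[OF assms(1-5) h'(1,2)] by blast
  then have "subs NN v u" using levtransN[OF assms(1,3) inN[OF v] assms(2,4)] by blast
  moreover have "mem NN x v" using memN[OF v inN[OF assms(6)]] h'(3) by blast
  ultimately show ?thesis using inN[OF assms(6)] by (auto simp: subs_def)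
qed

lemma nonstd_ex: "\<exists>h\<in>dom NN. \<exists>u\<in>dom NN. Hist NN h \<and> mem NN u h \<and> u \<notin> A"
proof -
  obtain x where x: "x \<in> dom NN" "x \<notin> A" using sub neq by blast
  from coverN[OF x(1)] obtain h u where "h \<in> dom NN" "u \<in> dom NN" "Hist NN h" "mem NN u h" "mem NN x u" by blast
  moreover from this have "u \<notin> A" using endN[of u x] x by blast
  ultimately show ?thesis by blast
qed

end

section \<open>Strong Collection\<close>

text \<open>
  The predicate \<open>\<forall>u. psi x t u\<close> stands for an arbitrary \<open>\<Pi>\<^sub>m\<^sub>+\<^sub>1\<close> predicate; the goal is closure under witnesses \<open>t\<close>
  for \<open>x\<close>. The nonstandard level \<open>d\<close> serves as a bound for \<open>u\<close>.
\<close>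

locale gap_setup = endext A m NN for A :: "'k V set" and m NN +
  fixes psi :: "'k V struct \<Rightarrow> 'k V \<Rightarrow> 'k V \<Rightarrow> 'k V \<Rightarrow> bool" and h0 d :: "'k V"
  assumes psi: "\<And>i j k. Sig UNIV m (\<lambda>M s. psi M (s i) (s j) (s k))"
    and h0: "h0 \<in> dom NN" "Hist NN h0" and d: "d \<in> dom NN" "mem NN d h0" "d \<notin> A"
begin

definition Phi :: "'k V \<Rightarrow> 'k V \<Rightarrow> bool" where
  "Phi x t \<longleftrightarrow> (\<forall>u\<in>A. psi MM x t u)"

lemma psi_el:
  assumes "x \<in> A" "t \<in> A" "u \<in> A"
  shows "psi MM x t u = psi NN x t u"
proof -
  have "Sig CC (Suc (Suc m)) (\<lambda>M s. psi M (s 0) (s (Suc 0)) (s (Suc (Suc 0))))"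
    by (rule Sig_mono[OF Dfn_UNIV[OF psi]]) simp
  from elem_Sig[OF elem this, of "x ## t ## (\<lambda>_. u)"] assms show ?thesis by simp
qed

lemma Phi_el:
  assumes "x \<in> A" "t \<in> A"
  shows "Phi x t = (\<forall>u\<in>dom NN. psi NN x t u)"
proof -
  have "Pie CC (Suc (Suc m)) (\<lambda>M s. \<forall>u\<in>dom M. psi M (s 0) (s (Suc 0)) u)"
    by (rule Pie_All, rule Sig_Pie[OF Dfn_UNIV[OF psi]]) simp
  from elem_Pie[OF elem this, of "x ## (\<lambda>_. t)"] assms show ?thesis
    by (simp add: Phi_def)
qed

lemma d_super: "x \<in> A \<Longrightarrow> mem NN x d"
  by (rule nonstd_super[OF h0 d])

text \<open>
  With \<open>t\<close> bounded by \<open>b\<close> and \<open>u\<close> by \<open>e\<close>, the existence of a witness drops to level \<open>m\<close>. For standard \<open>b\<close> and nonstandard \<open>e\<close>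
  it is still correct (\<open>wit_std\<close>), since \<open>e\<close> includes \<open>A\<close>.
\<close>

definition wit :: "'k V struct \<Rightarrow> 'k V \<Rightarrow> 'k V \<Rightarrow> 'k V \<Rightarrow> bool" where
  "wit M e b x \<longleftrightarrow> (\<exists>t\<in>dom M. mem M t b \<and> (\<forall>u\<in>dom M. mem M u e \<longrightarrow> psi M x t u))"

lemma Sig_wit: "Sig CC m (\<lambda>M s. wit M (s i) (s j) (s k))"
  unfolding wit_def by (rule Sig_ExIn, rule Sig_AllIn[OF good_CC'], rule Dfn_UNIV[OF psi])

lemma Del_wit: "Del CC (Suc m) (\<lambda>M s. wit M (s i) (s j) (s k))"
  by (rule Del_Sig[OF Sig_wit]) simp

lemma SepN:
  assumes "Del CC (Suc m) (\<lambda>M s. R M (\<lambda>i. s (Suc i)) (s 0))" "range s \<subseteq> dom NN" "w \<in> dom NN"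
  shows "\<exists>y\<in>dom NN. \<forall>x\<in>dom NN. mem NN x y \<longleftrightarrow> mem NN x w \<and> R NN s x"
  by (rule sepaD[OF Sep_Del[OF good_CC _ assms(2,1)] assms(3)]) simp

lemma set_in_A:
  assumes y: "y \<in> dom NN" "\<forall>x\<in>dom NN. mem NN x y \<longleftrightarrow> mem NN x w \<and> R x" and w: "w \<in> A"
  shows "y \<in> A \<and> elts y = {x \<in> elts w. R x}"
proof -
  have "y \<in> A" using sub_in_A[OF w y(1)] y(2) by (auto simp: subs_def)
  moreover have "x \<in> elts y \<longleftrightarrow> x \<in> elts w \<and> R x" for x
  proof (cases "x \<in> A")
    case True
    then show ?thesis using y(2) memN[OF w inN[OF True]] memN[OF \<open>y \<in> A\<close> inN[OF True]] inN[OF True] by blast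
  next
    case False
    then show ?thesis using tr[OF w] tr[OF \<open>y \<in> A\<close>] by blast
  qed
  ultimately show ?thesis by blast
qed

lemma wit_std:
  assumes b: "b \<in> A" and xA: "x \<in> A"
  shows "wit NN d b x \<longleftrightarrow> (\<exists>t\<in>elts b. Phi x t)"
proof
  assume "wit NN d b x"
  then obtain t where t: "t \<in> dom NN" "mem NN t b" "\<And>u. u \<in> dom NN \<Longrightarrow> mem NN u d \<Longrightarrow> psi NN x t u"
    unfolding wit_def by blast
  have tb: "t \<in> elts b" using memN[OF b t(1)] t(2) by blast
  have "psi MM x t u" if "u \<in> A" for u
    unfolding psi_el[OF xA tr[OF b tb] that] by (rule t(3)[OF inN[OF that] d_super[OF that]])
  then show "\<exists>t\<in>elts b. Phi x t" using tb unfolding Phi_def by blast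
next
  assume "\<exists>t\<in>elts b. Phi x t"
  then obtain t where t: "t \<in> elts b" "Phi x t" by blast
  have tA: "t \<in> A" using tr[OF b t(1)] .
  have "mem NN t b" using memN[OF b inN[OF tA]] t(1) by blast
  then show "wit NN d b x" using t(2) inN[OF tA] unfolding Phi_el[OF xA tA] wit_def by blast
qed

text \<open>
  The set in question is the union of the sets \<open>Y b\<close> for standard \<open>b\<close>, where \<open>Y b\<close> makes sense, and is increasing in \<open>b\<close>,
  for all levels \<open>b\<close> in \<open>h0\<close>. All \<open>Y b\<close> are subsets of \<open>w\<close>, hence in \<open>A\<close>, and their set \<open>a\<close> is included in the powerset of \<open>w\<close>, hence also in
  \<open>A\<close>. A subset of \<open>a\<close> in \<open>A\<close> has a least element, namely \<open>Y b\<close> for the least suitable \<open>b\<close> in the sense of \<open>NN\<close>, so \<open>real_wf\<close>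
  applies to the set \<open>Z\<close> of those members of \<open>a\<close> that are not \<open>Y b\<close> for any standard \<open>b\<close>. If \<open>Z\<close> is empty, the union of \<open>a\<close> is
  the set sought; otherwise, it is the union of the members of \<open>a\<close> strictly below a minimal element of \<open>Z\<close>.
\<close>

lemma bound_set:
  assumes w: "w \<in> A"
  shows "\<exists>aw\<in>A. elts aw = {x \<in> elts w. \<exists>t\<in>A. Phi x t}"
proof -
  define Y where "Y b = {x \<in> elts w. wit NN d b x}" for b
  have wN: "w \<in> dom NN" using inN[OF w] .
  have Yset: "\<exists>y\<in>A. elts y = Y b" if b: "b \<in> dom NN" for b
  proof -
    have "\<exists>y\<in>dom NN. \<forall>x\<in>dom NN. mem NN x y \<longleftrightarrow> mem NN x w \<and> (\<lambda>M s x. wit M (s 0) (s (Suc 0)) x) NN (d ## (\<lambda>_. b)) x"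
      by (rule SepN) (use Del_wit d b wN in auto)
    then show ?thesis using set_in_A[OF _ _ w, of _ "wit NN d b"] unfolding Y_def by auto
  qed
  have Ymono: "Y b \<subseteq> Y b'" if "b' \<in> dom NN" "mem NN b' h0" "b \<in> dom NN" "mem NN b b'" for b b'
    using levtransN[OF h0(1) that(1,3) h0(2) that(2,4)] unfolding Y_def wit_def subs_def by blast
  have Ystd: "Y b = {x \<in> elts w. \<exists>t\<in>elts b. Phi x t}" if b: "b \<in> A" for b
    using wit_std[OF b tr[OF w]] unfolding Y_def by blast
  obtain p where p: "p \<in> A" "elts p = {z \<in> A. elts z \<subseteq> elts w}" using pow[OF w] by blast
  let ?R = "\<lambda>M s y. \<exists>b\<in>dom M. mem M b (s 0) \<and> (\<forall>x\<in>dom M. mem M x (s (Suc 0)) \<longrightarrow> (mem M x y \<longleftrightarrow> wit M (s (Suc (Suc 0))) b x))"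
  have "\<exists>a\<in>dom NN. \<forall>y\<in>dom NN. mem NN y a \<longleftrightarrow> mem NN y p \<and> ?R NN (h0 ## w ## (\<lambda>_. d)) y"
  proof (rule SepN)
    show "Del CC (Suc m) (\<lambda>M s. \<exists>b\<in>dom M. mem M b (s (Suc 0)) \<and> (\<forall>x\<in>dom M. mem M x (s (Suc (Suc 0))) \<longrightarrow>
        (mem M x (s 0) \<longleftrightarrow> wit M (s (Suc (Suc (Suc 0)))) b x)))"
      by (rule Del_ExIn[OF good_CC], rule Del_AllIn[OF good_CC], rule Del_iff, rule Del_D0[OF D0_mem], rule Del_wit)
  qed (use h0 d wN inN[OF p(1)] in auto)
  then obtain a where a0: "a \<in> dom NN" "\<forall>y\<in>dom NN. mem NN y a \<longleftrightarrow> mem NN y p \<and> ?R NN (h0 ## w ## (\<lambda>_. d)) y" by blast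
  have a: "a \<in> A" "elts a = {y \<in> elts p. ?R NN (h0 ## w ## (\<lambda>_. d)) y}"
    using set_in_A[OF a0 p(1)] by blast+
  have el: "y \<in> elts a \<longleftrightarrow> y \<in> A \<and> (\<exists>b\<in>dom NN. mem NN b h0 \<and> elts y = Y b)" for y
  proof -
    have "(\<forall>x\<in>dom NN. mem NN x w \<longrightarrow> (mem NN x y \<longleftrightarrow> wit NN d b x)) \<longleftrightarrow> elts y = Y b"
      if y: "y \<in> A" "elts y \<subseteq> elts w" for b
    proof -
      have "x \<in> dom NN \<and> mem NN x w \<longleftrightarrow> x \<in> elts w" for x
        using memN[OF w] tr[OF w] inN by blast
      moreover have "mem NN x y \<longleftrightarrow> x \<in> elts y" if "x \<in> elts w" for x
        using memN[OF y(1) inN[OF tr[OF w that]]] .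
      ultimately show ?thesis using y(2) unfolding Y_def by blast
    qed
    then show ?thesis unfolding a(2) p(2) by (auto simp: Y_def econs_def)
  qed
  have wf: "\<exists>S\<in>elts z. \<forall>S'\<in>elts z. elts S \<subseteq> elts S'" if z: "z \<in> A" "elts z \<subseteq> elts a" "elts z \<noteq> {}" for z
  proof -
    let ?R = "\<lambda>M s b. \<exists>y\<in>dom M. mem M y (s 0) \<and> (\<forall>x\<in>dom M. mem M x (s (Suc 0)) \<longrightarrow> (mem M x y \<longleftrightarrow> wit M (s (Suc (Suc 0))) b x))"
    have "\<exists>B\<in>dom NN. \<forall>b\<in>dom NN. mem NN b B \<longleftrightarrow> mem NN b h0 \<and> ?R NN (z ## w ## (\<lambda>_. d)) b"
    proof (rule SepN)
      show "Del CC (Suc m) (\<lambda>M s. \<exists>y\<in>dom M. mem M y (s (Suc 0)) \<and> (\<forall>x\<in>dom M. mem M x (s (Suc (Suc 0))) \<longrightarrow>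
        (mem M x y \<longleftrightarrow> wit M (s (Suc (Suc (Suc 0)))) (s 0) x)))"
        using Del_wit[of "Suc (Suc (Suc (Suc (Suc 0))))" "Suc (Suc 0)" 0]
        by (intro Del_ExIn[OF good_CC] Del_AllIn[OF good_CC] Del_iff Del_D0[OF D0_mem])
    qed (use h0 d wN inN[OF z(1)] in auto)
    then obtain B where B0: "B \<in> dom NN" "\<forall>b\<in>dom NN. mem NN b B \<longleftrightarrow> mem NN b h0 \<and> ?R NN (z ## w ## (\<lambda>_. d)) b" by blast
    have B: "mem NN b B \<longleftrightarrow> mem NN b h0 \<and> (\<exists>y\<in>elts z. elts y = Y b)" if b: "b \<in> dom NN" for b
    proof -
      have "(\<forall>x\<in>dom NN. mem NN x w \<longrightarrow> (mem NN x y \<longleftrightarrow> wit NN d b x)) \<longleftrightarrow> elts y = Y b" if y: "y \<in> elts z" for y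
      proof -
        have yA: "y \<in> A" using tr[OF z(1) y] .
        have "y \<in> elts a" using y z(2) by blast
        then have yw: "elts y \<subseteq> elts w" using el Y_def by blast
        have "x \<in> dom NN \<and> mem NN x w \<longleftrightarrow> x \<in> elts w" for x
          using memN[OF w] tr[OF w] inN by blast
        moreover have "mem NN x y \<longleftrightarrow> x \<in> elts y" if "x \<in> elts w" for x
          using memN[OF yA inN[OF tr[OF w that]]] .
        ultimately show ?thesis using yw unfolding Y_def by blast
      qed
      moreover have "y \<in> dom NN \<and> mem NN y z \<longleftrightarrow> y \<in> elts z" for y
        using memN[OF z(1)] tr[OF z(1)] inN by blast
      ultimately show ?thesis using B0(2)[rule_format, OF b] by (simp add: econs_def) blast
    qed
    obtain y0 where y0: "y0 \<in> elts z" using z(3) by blast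
    then have "y0 \<in> elts a" using z(2) by blast
    then obtain b0 where b0: "b0 \<in> dom NN" "mem NN b0 h0" "elts y0 = Y b0" using el[of y0] by blast
    then have "mem NN b0 B" using B[OF b0(1)] y0 by blast
    from foundN[OF B0(1) b0(1) this] obtain b where b: "b \<in> dom NN" "mem NN b B"
      "\<forall>v\<in>dom NN. mem NN v B \<longrightarrow> \<not> mem NN v b" by blast
    then obtain S where S: "S \<in> elts z" "elts S = Y b" using B[OF b(1)] by blast
    have "elts S \<subseteq> elts S'" if "S' \<in> elts z" for S'
    proof -
      have "S' \<in> elts a" using that z(2) by blast
      then obtain b' where b': "b' \<in> dom NN" "mem NN b' h0" "elts S' = Y b'" using el[of S'] by blast
      then have b'B: "mem NN b' B" using B[OF b'(1)] that by blast
      have "mem NN b h0" using B[OF b(1)] b(2) by blast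
      from linN[OF h0(1) b(1) b'(1) h0(2) this b'(2)] b(3)[rule_format, OF b'(1) b'B]
      have "b = b' \<or> mem NN b b'" by blast
      then show ?thesis using Ymono[OF b'(1,2) b(1)] unfolding S(2) b'(3) by blast
    qed
    then show ?thesis using S(1) by blast
  qed
  have AwI: "{x \<in> elts w. \<exists>t\<in>A. Phi x t} = {x. \<exists>b\<in>A. mem NN b h0 \<and> x \<in> Y b}"
  proof (intro set_eqI iffI)
    fix x assume "x \<in> {x \<in> elts w. \<exists>t\<in>A. Phi x t}"
    then obtain t where t: "x \<in> elts w" "t \<in> A" "Phi x t" by blast
    obtain h v where v: "hist h" "v \<in> elts h" "t \<in> elts v" using covering[OF t(2)] by blast
    have "mem NN v h0" using std_in[OF h0 d v(1,2)] by blast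
    moreover have "v \<in> A" using hist_level_in[OF v(1,2)] .
    ultimately show "x \<in> {x. \<exists>b\<in>A. mem NN b h0 \<and> x \<in> Y b}" using Ystd t v(3) by blast
  next
    fix x assume "x \<in> {x. \<exists>b\<in>A. mem NN b h0 \<and> x \<in> Y b}"
    then obtain b where b: "b \<in> A" "x \<in> Y b" by blast
    then show "x \<in> {x \<in> elts w. \<exists>t\<in>A. Phi x t}" using Ystd[OF b(1)] tr[OF b(1)] by blast
  qed
  define Z where "Z = {S \<in> elts a. \<not> (\<exists>b\<in>A. mem NN b h0 \<and> elts S = Y b)}"
  have Yel: "\<exists>S\<in>elts a. elts S = Y b" if bA: "b \<in> A" "mem NN b h0" for b
  proof -
    obtain y where y: "y \<in> A" "elts y = Y b" using Yset[OF inN[OF bA(1)]] by blast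
    then have "y \<in> elts a" using el[of y] inN[OF bA(1)] bA(2) by blast
    then show ?thesis using y(2) by blast
  qed
  show ?thesis
  proof (cases "Z = {}")
    case True
    obtain u where u: "u \<in> A" "elts u = (\<Union>y\<in>elts a. elts y)" using union[OF a(1)] by blast
    have "elts u = {x. \<exists>b\<in>A. mem NN b h0 \<and> x \<in> Y b}"
    proof (intro set_eqI iffI)
      fix x assume "x \<in> elts u"
      then obtain T where T: "T \<in> elts a" "x \<in> elts T" using u(2) by blast
      then show "x \<in> {x. \<exists>b\<in>A. mem NN b h0 \<and> x \<in> Y b}" using True unfolding Z_def by blast
    next
      fix x assume "x \<in> {x. \<exists>b\<in>A. mem NN b h0 \<and> x \<in> Y b}"
      then obtain b where b: "b \<in> A" "mem NN b h0" "x \<in> Y b" by blast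
      then show "x \<in> elts u" using Yel[OF b(1,2)] u(2) by blast
    qed
    then show ?thesis unfolding AwI using u(1) by blast
  next
    case False
    have "\<exists>S\<in>Z. \<forall>S'\<in>Z. \<not> elts S' \<subset> elts S"
      by (rule real_wf[OF _ a(1) wf _ False]) (use m1 Z_def in auto)
    then obtain S where S: "S \<in> Z" "\<And>S'. S' \<in> Z \<Longrightarrow> \<not> elts S' \<subset> elts S" by blast
    have Sa: "S \<in> elts a" using S(1) unfolding Z_def by blast
    have SA: "S \<in> A" using tr[OF a(1) Sa] .
    obtain bs where bs: "bs \<in> dom NN" "mem NN bs h0" "elts S = Y bs" using Sa el[of S] by blast
    have bsA: "bs \<notin> A" using S(1) bs(2,3) unfolding Z_def by blast
    obtain W where W: "W \<in> A" "elts W = {T \<in> elts a. elts T \<subset> elts S}"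
      using below_set[OF a(1) SA] by blast
    obtain u where u: "u \<in> A" "elts u = (\<Union>y\<in>elts W. elts y)" using union[OF W(1)] by blast
    have "elts u = {x. \<exists>b\<in>A. mem NN b h0 \<and> x \<in> Y b}"
    proof (intro set_eqI iffI)
      fix x assume "x \<in> elts u"
      then obtain T where T: "T \<in> elts a" "elts T \<subset> elts S" "x \<in> elts T"
        unfolding u(2) W(2) by blast
      then have "T \<notin> Z" using S(2) by blast
      then obtain b where "b \<in> A" "mem NN b h0" "elts T = Y b" using T(1) unfolding Z_def by blast
      then show "x \<in> {x. \<exists>b\<in>A. mem NN b h0 \<and> x \<in> Y b}" using T(3) by blast
    next
      fix x assume "x \<in> {x. \<exists>b\<in>A. mem NN b h0 \<and> x \<in> Y b}"
      then obtain b where b: "b \<in> A" "mem NN b h0" "x \<in> Y b" by blast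
      have "mem NN b bs" by (rule nonstd_super[OF h0 bs(1,2) bsA b(1)])
      then have "Y b \<subseteq> elts S" using Ymono[OF bs(1,2) inN[OF b(1)]] bs(3) by blast
      moreover have "Y b \<noteq> elts S" using S(1) b(1,2) unfolding Z_def by auto
      moreover obtain T where T: "T \<in> elts a" "elts T = Y b" using Yel[OF b(1,2)] by blast
      ultimately have "T \<in> elts W" unfolding W(2) by simp
      then show "x \<in> elts u" unfolding u(2) using T(2) b(3) by blast
    qed
    then show ?thesis unfolding AwI using u(1) by blast
  qed
qed

lemma strong_coll:
  assumes w: "w \<in> A"
  shows "\<exists>c\<in>A. \<forall>x\<in>elts w. (\<exists>t\<in>A. Phi x t) \<longrightarrow> (\<exists>t\<in>elts c. Phi x t)"
proof -
  obtain aw where aw: "aw \<in> A" "elts aw = {x \<in> elts w. \<exists>t\<in>A. Phi x t}" using bound_set[OF w] by blast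
  have "\<exists>c\<in>A. \<forall>x\<in>elts aw. \<exists>y\<in>elts c. (\<lambda>M s x t. \<forall>u\<in>dom M. psi M x t u) MM (\<lambda>_. w) x y"
  proof (rule coll_in)
    have "Pie {MM} (Suc m) (\<lambda>M s. \<forall>u\<in>dom M. psi M (s (Suc 0)) (s 0) u)"
      by (rule Pie_All, rule Sig_Pie[OF Dfn_UNIV[OF psi]]) simp
    then show "Sig {MM} (Suc (Suc m)) (\<lambda>M s. \<forall>u\<in>dom M. psi M (s (Suc 0)) (s 0) u)"
      by (rule Pie_Sig) simp
  qed (use w aw in \<open>auto simp: Phi_def\<close>)
  then obtain c where c: "c \<in> A" "\<And>x. x \<in> elts aw \<Longrightarrow> \<exists>y\<in>elts c. Phi x y"
    unfolding Phi_def by auto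
  show ?thesis
  proof (rule bexI[OF _ c(1)], intro ballI impI)
    fix x assume "x \<in> elts w" "\<exists>t\<in>A. Phi x t"
    then show "\<exists>t\<in>elts c. Phi x t" using c(2)[of x] aw(2) by blast
  qed
qed

end

section \<open>Numerals\<close>

text \<open>
  The von Neumann numerals.
\<close>

definition num :: "nat \<Rightarrow> 'k V" where
  "num i = ((\<lambda>x. vset (insert x (elts x))) ^^ i) (vset {})"

lemma num_fin: "finite (elts (num i :: 'k V)) \<and> elts (num (Suc i) :: 'k V) = insert (num i) (elts (num i))"
proof (induction i)
  case 0
  show ?case by (simp add: num_def)
next
  case (Suc i)
  then have f: "finite (elts (num (Suc i) :: 'k V))" by simp
  have "(num (Suc (Suc i)) :: 'k V) = vset (insert (num (Suc i)) (elts (num (Suc i))))" by (simp add: num_def)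
  then have "elts (num (Suc (Suc i)) :: 'k V) = insert (num (Suc i)) (elts (num (Suc i)))" using f by simp
  then show ?case using f by simp
qed

lemma elts_num_0 [simp]: "elts (num 0) = {}" by (simp add: num_def)
lemma elts_num_Suc: "elts (num (Suc i)) = insert (num i) (elts (num i))" using num_fin by blast

lemma elts_num: "elts (num i) = num ` {..<i}"
proof (induction i)
  case (Suc i)
  then show ?case unfolding elts_num_Suc by (simp add: lessThan_Suc)
qed simp

lemma num_inj: "(num i :: 'k V) = num j \<longleftrightarrow> i = j"
proof -
  have "(num i :: 'k V) \<noteq> num j" if "i < j" for i j
  proof
    assume "(num i :: 'k V) = num j"
    then have "(num j :: 'k V) \<in> elts (num j)" unfolding elts_num by (intro image_eqI[of _ _ i]) (use that \<open>(num i :: 'k V) = num j\<close> in auto)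
    then show False using elts_irrefl by blast
  qed
  then show ?thesis by (metis nat_neq_iff)
qed

lemma num_mem: "(num i :: 'k V) \<in> elts (num j) \<longleftrightarrow> i < j"
  by (auto simp: elts_num num_inj)

text \<open>
  Zero or a successor; a set is a natural number if it and all its elements are.
\<close>

definition isSuc :: "'a struct \<Rightarrow> 'a \<Rightarrow> bool" where
  "isSuc M x \<longleftrightarrow> (\<forall>v\<in>dom M. mem M v x \<longrightarrow> \<not> v = v) \<or> (\<exists>z\<in>dom M. mem M z x \<and> (subs M z x \<and> (\<forall>v\<in>dom M. mem M v x \<longrightarrow> mem M v z \<or> v = z)))"

lemma D0_isSuc: "D0 C (\<lambda>M s. isSuc M (s i))"
  unfolding isSuc_def by (intro D0_rules)

context trans_model
begin

lemma num_in: "num i \<in> K"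
proof (induction i)
  case 0
  show ?case using emptyK by (simp add: num_def)
next
  case (Suc i)
  then obtain u where u: "u \<in> K" "elts u = insert (num i) (elts (num i))" using vinsert by blast
  have "elts u = elts (num (Suc i))" unfolding elts_num_Suc u(2) ..
  then have "u = num (Suc i)" by (rule V_extensionality)
  then show ?case using u(1) by simp
qed

lemma omega_in: "\<exists>w\<in>K. elts w = range num"
proof -
  obtain s where "sat (in_struct K) s Infinity"
    using ax[of Infinity] by (auto simp: M_theory_def M_minus_def)
  then have "\<exists>I\<in>K. (\<exists>e\<in>K. e \<in> elts I \<and> (\<forall>y\<in>K. y \<notin> elts e)) \<and>
     (\<forall>x\<in>K. x \<in> elts I \<longrightarrow> (\<exists>z\<in>K. z \<in> elts I \<and> (\<forall>y\<in>K. (y \<in> elts z \<longrightarrow> y \<in> elts x \<or> y = x) \<and>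
       ((y \<in> elts x \<longrightarrow> y \<in> elts z) \<and> (y = x \<longrightarrow> x \<in> elts z)))))"
    by (simp add: Infinity_def)
  then obtain I e where I: "I \<in> K" and e: "e \<in> K" "e \<in> elts I" "\<forall>y\<in>K. y \<notin> elts e" and
    s: "\<And>x. x \<in> K \<Longrightarrow> x \<in> elts I \<Longrightarrow> \<exists>z\<in>K. z \<in> elts I \<and> (\<forall>y\<in>K. (y \<in> elts z \<longrightarrow> y \<in> elts x \<or> y = x) \<and>
       ((y \<in> elts x \<longrightarrow> y \<in> elts z) \<and> (y = x \<longrightarrow> x \<in> elts z)))" by blast
  have nI: "num i \<in> elts I" for i
  proof (induction i)
    case 0
    have "elts e = {}" using e tr[OF e(1)] by blast
    then have "e = num 0" by (intro V_extensionality) simp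
    then show ?case using e(2) by simp
  next
    case (Suc i)
    obtain z where z: "z \<in> K" "z \<in> elts I" "\<forall>y\<in>K. (y \<in> elts z \<longrightarrow> y \<in> elts (num i) \<or> y = num i) \<and>
       ((y \<in> elts (num i) \<longrightarrow> y \<in> elts z) \<and> (y = num i \<longrightarrow> num i \<in> elts z))"
      using s[OF num_in Suc] by blast
    have "elts z = elts (num (Suc i))"
      unfolding elts_num_Suc using z(3) tr[OF z(1)] tr[OF num_in[of i]] num_in[of i] by blast
    then have "z = num (Suc i)" by (rule V_extensionality)
    then show ?case using z(2) by simp
  qed
  let ?R = "\<lambda>M (s::nat \<Rightarrow> 'k V) x. isSuc M x \<and> (\<forall>y\<in>dom M. mem M y x \<longrightarrow> isSuc M y)"
  have "\<exists>w\<in>K. elts w = {x \<in> elts I. ?R (in_struct K) (\<lambda>_. I) x}"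
    by (rule sep0) (use I in \<open>auto intro!: D0_rules D0_isSuc\<close>)
  then obtain w where w: "w \<in> K" "elts w = {x \<in> elts I. isSuc (in_struct K) x \<and> (\<forall>y\<in>K. y \<in> elts x \<longrightarrow> isSuc (in_struct K) y)}"
    by auto
  have suc: "isSuc (in_struct K) x \<longleftrightarrow> elts x = {} \<or> (\<exists>z\<in>elts x. elts x = insert z (elts z))" if x: "x \<in> K" for x
  proof -
    have "(\<exists>z\<in>K. z \<in> elts x \<and> (subs (in_struct K) z x \<and> (\<forall>v\<in>K. v \<in> elts x \<longrightarrow> v \<in> elts z \<or> v = z))) \<longleftrightarrow>
      (\<exists>z\<in>elts x. elts x = insert z (elts z))"
    proof
      assume "\<exists>z\<in>K. z \<in> elts x \<and> (subs (in_struct K) z x \<and> (\<forall>v\<in>K. v \<in> elts x \<longrightarrow> v \<in> elts z \<or> v = z))"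
      then obtain z where z: "z \<in> K" "z \<in> elts x" "elts z \<subseteq> elts x" "\<forall>v\<in>K. v \<in> elts x \<longrightarrow> v \<in> elts z \<or> v = z"
        using subs_in[OF trans] by blast
      have "elts x = insert z (elts z)" using z(2,3,4) tr[OF x] by blast
      then show "\<exists>z\<in>elts x. elts x = insert z (elts z)" using z(2) by blast
    next
      assume "\<exists>z\<in>elts x. elts x = insert z (elts z)"
      then obtain z where z: "z \<in> elts x" "elts x = insert z (elts z)" by blast
      have zK: "z \<in> K" using tr[OF x z(1)] .
      have "subs (in_struct K) z x" unfolding subs_in[OF trans zK] z(2) by blast
      moreover have "\<forall>v\<in>K. v \<in> elts x \<longrightarrow> v \<in> elts z \<or> v = z" unfolding z(2) by blast
      ultimately show "\<exists>z\<in>K. z \<in> elts x \<and> (subs (in_struct K) z x \<and> (\<forall>v\<in>K. v \<in> elts x \<longrightarrow> v \<in> elts z \<or> v = z))"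
        using zK z(1) by blast
    qed
    moreover have "(\<forall>v\<in>K. v \<in> elts x \<longrightarrow> \<not> v = v) \<longleftrightarrow> elts x = {}" using tr[OF x] by blast
    ultimately show ?thesis unfolding isSuc_def in_struct_simps by blast
  qed
  have sn: "isSuc (in_struct K) (num i)" for i
    unfolding suc[OF num_in] by (cases i) (auto simp: elts_num_Suc)
  have nat: "x \<in> range num" if "x \<in> K" "isSuc (in_struct K) x" "\<forall>y\<in>K. y \<in> elts x \<longrightarrow> isSuc (in_struct K) y" for x
    using that
  proof (induction x rule: wf_induct_rule[OF wf_elts])
    case (1 x)
    show ?case
    proof (cases "elts x = {}")
      case True
      then have "x = num 0" by (intro V_extensionality) simp
      then show ?thesis by blast
    next
      case False
      then obtain z where z: "z \<in> elts x" "elts x = insert z (elts z)" using 1(2,3) suc by blast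
      have zK: "z \<in> K" using tr[OF 1(2) z(1)] .
      have "z \<in> range num" by (rule 1(1)) (use z zK 1(4) in auto)
      then obtain i where "z = num i" by blast
      then have "x = num (Suc i)" using z(2) by (intro V_extensionality) (simp add: elts_num_Suc)
      then show ?thesis by blast
    qed
  qed
  have "elts w = range num"
  proof (intro set_eqI iffI)
    fix x :: "'k V" assume "x \<in> elts w"
    then show "x \<in> range num" using nat[of x] tr[OF w(1)] w(2) by blast
  next
    fix x :: "'k V" assume "x \<in> range num"
    then obtain i where "x = num i" by blast
    then show "x \<in> elts w" unfolding w(2) using nI[of i] sn by (auto simp: elts_num)
  qed
  then show ?thesis using w(1) by blast
qed

end

section \<open>The gap argument\<close>

text \<open>
  The relation \<open>g\<close> is a chain indexed by the natural number \<open>i\<close>, of elements of \<open>h\<close> that lie in \<open>b\<close>, strictly increasing in the sense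
  of membership, and with \<open>T\<close> holding between any earlier and any later value. Values are not required to be unique.
\<close>

definition Chain :: "'a struct \<Rightarrow> 'a \<Rightarrow> 'a \<Rightarrow> 'a \<Rightarrow> 'a \<Rightarrow> ('a \<Rightarrow> 'a \<Rightarrow> bool) \<Rightarrow> bool" where
  "Chain M g i h b T \<longleftrightarrow>
     (\<forall>j\<in>dom M. mem M j i \<longrightarrow> (\<exists>c\<in>dom M. mem M c h \<and> Rel M g j c) \<and>
        (\<forall>c\<in>dom M. Rel M g j c \<longrightarrow> mem M c b \<and> mem M c h)) \<and>
     (\<forall>j\<in>dom M. mem M j i \<longrightarrow> (\<forall>k\<in>dom M. mem M k i \<longrightarrow>
       (\<forall>c\<in>dom M. mem M c h \<longrightarrow> (\<forall>c'\<in>dom M. mem M c' h \<longrightarrow>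
          (mem M j k \<and> Rel M g j c \<and> Rel M g k c' \<longrightarrow> mem M c c' \<and> T c c')))))"

lemma ChainD1:
  assumes "Chain M g i h b T" "j \<in> dom M" "mem M j i"
  shows "\<exists>c\<in>dom M. mem M c h \<and> Rel M g j c"
  using assms unfolding Chain_def by blast

lemma ChainD2:
  assumes "Chain M g i h b T" "j \<in> dom M" "mem M j i" "c \<in> dom M" "Rel M g j c"
  shows "mem M c b \<and> mem M c h"
  using assms unfolding Chain_def by blast

lemma ChainD3:
  assumes "Chain M g i h b T" "j \<in> dom M" "k \<in> dom M" "mem M j k" "mem M j i" "mem M k i"
    "c \<in> dom M" "c' \<in> dom M" "Rel M g j c" "Rel M g k c'"
  shows "mem M c c' \<and> T c c'"
  using assms(1)[unfolded Chain_def, THEN conjunct2, rule_format, of j k c c'] assms(2-)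
    ChainD2[OF assms(1,2,5,7,9)] ChainD2[OF assms(1,3,6,8,10)] by blast

lemma Chain_mono:
  assumes "Chain M g i h b T" "subs M i' i" "subs M h h'"
    "\<And>j c. j \<in> dom M \<Longrightarrow> mem M j i' \<Longrightarrow> c \<in> dom M \<Longrightarrow> Rel M g j c \<Longrightarrow> mem M c b'"
    "\<And>c c'. c \<in> dom M \<Longrightarrow> c' \<in> dom M \<Longrightarrow> T c c' \<Longrightarrow> T' c c'"
  shows "Chain M g i' h' b' T'"
  unfolding Chain_def
proof (intro conjI ballI impI)
  fix j assume j: "j \<in> dom M" "mem M j i'"
  then have ji: "mem M j i" using assms(2) by (auto simp: subs_def)
  show "\<exists>c\<in>dom M. mem M c h' \<and> Rel M g j c"
    using ChainD1[OF assms(1) j(1) ji] assms(3) by (auto simp: subs_def)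
  fix c assume c: "c \<in> dom M" "Rel M g j c"
  show "mem M c b'" by (rule assms(4)[OF j c])
  show "mem M c h'" using ChainD2[OF assms(1) j(1) ji c] assms(3) c(1) by (auto simp: subs_def)
next
  fix j k c c' assume j: "j \<in> dom M" "mem M j i'" and k: "k \<in> dom M" "mem M k i'"
    and c: "c \<in> dom M" "c' \<in> dom M" and r: "mem M j k \<and> Rel M g j c \<and> Rel M g k c'"
  have ji: "mem M j i" "mem M k i" using assms(2) j k by (auto simp: subs_def)
  from ChainD3[OF assms(1) j(1) k(1) _ ji c] r assms(5)[OF c]
  show "mem M c c'" "T' c c'" by blast+
qed

lemma irreflN: 
  assumes "endext A m NN" "x \<in> dom NN" shows "\<not> mem NN x x"
proof -
  interpret endext A m NN by fact
  have "\<not> mem NN ((\<lambda>_::nat. x) 0) ((\<lambda>_::nat. x) 0)"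
  proof (rule up0[of "\<lambda>M s. \<not> mem M (s 0) (s 0)"])
    show "D0 CC (\<lambda>M s. \<not> mem M (s 0) (s 0))" by (intro D0_rules)
  qed (use assms elts_irrefl in auto)
  then show ?thesis .
qed

context endext
begin

lemma irrefl: "x \<in> dom NN \<Longrightarrow> \<not> mem NN x x"
  by (rule irreflN) unfold_locales

lemma levsuperN:
  assumes "h \<in> dom NN" "u \<in> dom NN" "y \<in> dom NN" "z \<in> dom NN" "Hist NN h" "mem NN u h" "mem NN y u" "subs NN z y"
  shows "mem NN z u"
proof -
  let ?P = "\<lambda>M (s::nat \<Rightarrow> 'k V). Hist M (s 0) \<longrightarrow> mem M (s (Suc 0)) (s 0) \<and> mem M (s (Suc (Suc 0))) (s (Suc 0)) \<and>
    subs M (s (Suc (Suc (Suc 0)))) (s (Suc (Suc 0))) \<longrightarrow> mem M (s (Suc (Suc (Suc 0)))) (s (Suc 0))"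
  have "?P NN (h ## u ## y ## (\<lambda>_. z))"
  proof (rule up[of ?P])
    show "Sig CC (Suc m) ?P"
      using m1 by (intro Sig_imp Pie_mono[OF Pie_Hist]) (auto intro!: D0_Sig D0_Pie D0_rules)
    fix s :: "nat \<Rightarrow> 'k V" assume "range s \<subseteq> A"
    then have "s 0 \<in> A" "s (Suc (Suc (Suc 0))) \<in> A" by auto
    then show "?P MM s"
      using Hist_in[of "s 0"] level_super[of "s 0" "s (Suc 0)" "s (Suc (Suc (Suc 0)))" "s (Suc (Suc 0))"]
      by (simp add: subs_in[OF trans])
  qed (use assms in auto)
  then show ?thesis using assms by simp
qed

lemma hist_below:
  assumes "h \<in> dom NN" "Hist NN h" "h' \<in> dom NN" "Hist NN h'" "u \<in> dom NN" "mem NN u h'" "mem NN h u"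
  shows "subs NN h h'"
proof (rule ccontr)
  assume "\<not> ?thesis"
  then have "subs NN h' h" using compN[OF assms(1,3,2,4)] by blast
  then have "mem NN u h" using assms(5,6) by (auto simp: subs_def)
  moreover have "subs NN h u" by (rule levtransN[OF assms(3,5,1,4,6,7)])
  ultimately have "mem NN u u" using assms(5) by (auto simp: subs_def)
  then show False using irrefl[OF assms(5)] by blast
qed

lemma pairN: "a \<in> dom NN \<Longrightarrow> b \<in> dom NN \<Longrightarrow> \<exists>p\<in>dom NN. mem NN a p \<and> mem NN b p"
  using baseN by (auto simp: base_def)

lemma levelN:
  assumes "a \<in> dom NN" "b \<in> dom NN"
  shows "\<exists>h\<in>dom NN. \<exists>u\<in>dom NN. Hist NN h \<and> mem NN u h \<and> mem NN a u \<and> mem NN b u \<and> subs NN a u \<and> subs NN b u"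
proof -
  obtain p where p: "p \<in> dom NN" "mem NN a p" "mem NN b p" using pairN[OF assms] by blast
  obtain h u where h: "h \<in> dom NN" "u \<in> dom NN" "Hist NN h" "mem NN u h" "mem NN p u"
    using coverN[OF p(1)] by blast
  have "subs NN p u" by (rule levtransN[OF h(1,2) p(1) h(3,4,5)])
  then have m: "mem NN a u" "mem NN b u" using p assms by (auto simp: subs_def)
  with levtransN[OF h(1,2) assms(1) h(3,4) m(1)] levtransN[OF h(1,2) assms(2) h(3,4) m(2)] h
  show ?thesis by blast
qed

end

context gap_setup
begin

lemmas Del_rules = Del_not Del_conj Del_disj Del_imp Del_iff Del_ExIn[OF good_CC] Del_AllIn[OF good_CC]
  Del_D0[OF D0_mem] Del_D0[OF D0_Rel] Del_D0[OF D0_eq]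

lemma Del_Chain:
  assumes "Del CC (Suc m) (\<lambda>M s. T M (\<lambda>i. s (Suc (Suc (Suc (Suc i))))) (s (Suc 0)) (s 0))"
  shows "Del CC (Suc m) (\<lambda>M s. Chain M (s g) (s i) (s h) (s b) (T M s))"
proof -
  have *: "Del CC (Suc m) (\<lambda>M s. \<forall>c\<in>dom M. Rel M (s g) (s j) c \<longrightarrow> mem M c (s b) \<and> mem M c (s h))" for g j b h
    by (rule Del_D0) (intro D0_AllRel1 D0_rules)
  show ?thesis unfolding Chain_def by (intro Del_rules * assms)
qed

text \<open>
  A certificate that every \<open>x\<close> in \<open>a\<close> with a witness has one in \<open>a'\<close>: for each \<open>x\<close>, either a witness in \<open>a'\<close> up to \<open>e\<close> is
  found, or every candidate \<open>t\<close> in \<open>e\<close> is refuted by some \<open>u\<close> in \<open>c\<close>. All quantifiers are bounded, so the complexity remains low.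
\<close>

definition cert :: "'k V struct \<Rightarrow> 'k V \<Rightarrow> 'k V \<Rightarrow> 'k V \<Rightarrow> 'k V \<Rightarrow> bool" where
  "cert M e c a a' \<longleftrightarrow> (\<forall>x\<in>dom M. mem M x a \<longrightarrow> wit M e a' x \<or>
     (\<forall>t\<in>dom M. mem M t e \<longrightarrow> (\<exists>u\<in>dom M. mem M u c \<and> \<not> psi M x t u)))"

lemma Del_psi: "Del CC (Suc m) (\<lambda>M s. psi M (s i) (s j) (s k))"
  by (rule Del_Sig[OF Dfn_UNIV[OF psi]]) simp

lemma Del_cert: "Del CC (Suc m) (\<lambda>M s. cert M (s e) (s c) (s a) (s a'))"
  unfolding cert_def by (intro Del_rules Del_wit Del_psi)

text \<open>
  Below \<open>b\<close> there are chains of all lengths in \<open>om\<close> of levels that contain \<open>k0\<close> and that close each other off, with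
  the chains and the certificates taken from \<open>c\<close>. Both \<open>b\<close> and \<open>c\<close> can be enlarged.
\<close>

definition chains :: "'k V struct \<Rightarrow> 'k V \<Rightarrow> 'k V \<Rightarrow> 'k V \<Rightarrow> 'k V \<Rightarrow> 'k V \<Rightarrow> 'k V \<Rightarrow> bool" where
  "chains M e h k0 om c b \<longleftrightarrow> (\<forall>i\<in>dom M. mem M i om \<longrightarrow>
     (\<exists>y\<in>dom M. mem M y c \<and> Chain M y i h b (\<lambda>a a'. mem M k0 a \<and> cert M e c a a')))"

lemma Del_Ch: "Del CC (Suc m) (\<lambda>M s. \<exists>y\<in>dom M. mem M y (s c) \<and>
    Chain M y (s i) (s h) (s b) (\<lambda>a a'. mem M (s k) a \<and> cert M (s e) (s c) a a'))"
proof (rule Del_ExIn[OF good_CC])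
  have "Del CC (Suc m) (\<lambda>M s. Chain M (s 0) (s (Suc i)) (s (Suc h)) (s (Suc b))
      ((\<lambda>M s a a'. mem M (s (Suc k)) a \<and> cert M (s (Suc e)) (s (Suc c)) a a') M s))"
    by (rule Del_Chain) (intro Del_rules Del_cert)
  then show "Del CC (Suc m) (\<lambda>M s. Chain M (s 0) (s (Suc i)) (s (Suc h)) (s (Suc b))
      (\<lambda>a a'. mem M (s (Suc k)) a \<and> cert M (s (Suc e)) (s (Suc c)) a a'))" .
qed

lemma Del_chains: "Del CC (Suc m) (\<lambda>M s. chains M (s e) (s h) (s k) (s om) (s c) (s b))"
  unfolding chains_def by (rule Del_AllIn[OF good_CC], rule Del_Ch)

lemma cert_mono: "cert NN e c a a' \<Longrightarrow> subs NN c c' \<Longrightarrow> cert NN e c' a a'"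
  unfolding cert_def subs_def by blast

lemma Ch_mono:
  assumes "\<exists>y\<in>dom NN. mem NN y c \<and> Chain NN y i h b (\<lambda>a a'. mem NN k a \<and> cert NN e c a a')"
    "subs NN c c'" "subs NN b b'" "c \<in> dom NN"
  shows "\<exists>y\<in>dom NN. mem NN y c' \<and> Chain NN y i h b' (\<lambda>a a'. mem NN k a \<and> cert NN e c' a a')"
proof -
  from assms(1) obtain y where y: "y \<in> dom NN" "mem NN y c"
    "Chain NN y i h b (\<lambda>a a'. mem NN k a \<and> cert NN e c a a')" by blast
  have "Chain NN y i h b' (\<lambda>a a'. mem NN k a \<and> cert NN e c' a a')"
  proof (rule Chain_mono[OF y(3)])
    fix j a assume "j \<in> dom NN" "mem NN j i" "a \<in> dom NN" "Rel NN y j a"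
    from ChainD2[OF y(3) this] show "mem NN a b'" using assms(3) \<open>a \<in> dom NN\<close> by (auto simp: subs_def)
  qed (use cert_mono assms(2) in \<open>auto simp: subs_def\<close>)
  then show ?thesis using y assms(2) by (auto simp: subs_def)
qed

lemma chains_mono:
  assumes "chains NN e h k om c b" "subs NN c c'" "subs NN b b'" "c \<in> dom NN"
  shows "chains NN e h k om c' b'"
  unfolding chains_def
proof (intro ballI impI)
  fix i assume i: "i \<in> dom NN" "mem NN i om"
  show "\<exists>y\<in>dom NN. mem NN y c' \<and> Chain NN y i h b' (\<lambda>a a'. mem NN k a \<and> cert NN e c' a a')"
    by (rule Ch_mono[OF assms(1)[unfolded chains_def, rule_format, OF i] assms(2-4)])
qed

lemma subs_refl: "subs M a a" by (simp add: subs_def)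

lemma CollN:
  assumes "Sig CC (Suc m) (\<lambda>M s. R M (\<lambda>i. s (Suc (Suc i))) (s (Suc 0)) (s 0))" "range s \<subseteq> dom NN"
    "w \<in> dom NN" "\<And>x. x \<in> dom NN \<Longrightarrow> mem NN x w \<Longrightarrow> \<exists>y\<in>dom NN. R NN s x y"
  shows "\<exists>c\<in>dom NN. \<forall>x\<in>dom NN. mem NN x w \<longrightarrow> (\<exists>y\<in>dom NN. mem NN y c \<and> R NN s x y)"
  by (rule collD[OF Coll_Sig[OF good_CC _ assms(2,1)] assms(3,4)]) auto

text \<open>
  What a certificate is meant to certify, in terms of the true \<open>Phi\<close>.
\<close>

definition closes :: "'k V \<Rightarrow> 'k V \<Rightarrow> bool" where
  "closes a a' \<longleftrightarrow> (\<forall>x\<in>elts a. (\<exists>t\<in>A. Phi x t) \<longrightarrow> (\<exists>t\<in>elts a'. Phi x t))"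

lemma closes_next: assumes "a \<in> A"
  shows "\<exists>a'\<in>A. mem NN a' h0 \<and> a \<in> elts a' \<and> elts a \<subseteq> elts a' \<and> closes a a'"
proof -
  obtain c where c: "c \<in> A" "\<forall>x\<in>elts a. (\<exists>t\<in>A. Phi x t) \<longrightarrow> (\<exists>t\<in>elts c. Phi x t)"
    using strong_coll[OF assms] by blast
  obtain h u where h: "hist h" "u \<in> elts h" "vset {a, c} \<in> elts u" using covering[OF pair[OF assms c(1)]] by blast
  have "a \<in> elts u" "c \<in> elts u" using level_trans[OF h] by auto
  then have "elts a \<subseteq> elts u" "elts c \<subseteq> elts u" using level_trans[OF h(1,2)] by auto
  moreover have "mem NN u h0" using std_in[OF h0 d h(1,2)] by blast
  moreover have "u \<in> A" using hist_level_in[OF h(1,2)] .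
  ultimately show ?thesis using c(2) \<open>a \<in> elts u\<close> unfolding closes_def by blast
qed

text \<open>
  If \<open>x\<close> has no witness in \<open>A\<close>, it has none in \<open>NN\<close> by elementarity, so counterexamples for all candidates
  in \<open>d\<close> can be collected into one set, and then those sets for all \<open>x\<close> in \<open>a\<close>.
\<close>

lemma cert_ex:
  assumes a: "a \<in> A" "a' \<in> A" "closes a a'"
  shows "\<exists>c\<in>dom NN. cert NN d c a a'"
proof -
  let ?R = "\<lambda>M (s::nat \<Rightarrow> 'k V) x c. wit M (s 0) (s (Suc 0)) x \<or> (\<forall>t\<in>dom M. mem M t (s 0) \<longrightarrow> (\<exists>u\<in>dom M. mem M u c \<and> \<not> psi M x t u))"
  have "\<exists>C\<in>dom NN. \<forall>x\<in>dom NN. mem NN x a \<longrightarrow> (\<exists>c\<in>dom NN. mem NN c C \<and> ?R NN (d ## (\<lambda>_. a')) x c)"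
  proof (rule CollN)
    have "Del CC (Suc m) (\<lambda>M s. wit M (s (Suc (Suc 0))) (s (Suc (Suc (Suc 0)))) (s (Suc 0)) \<or>
      (\<forall>t\<in>dom M. mem M t (s (Suc (Suc 0))) \<longrightarrow> (\<exists>u\<in>dom M. mem M u (s 0) \<and> \<not> psi M (s (Suc 0)) t u)))"
      by (intro Del_rules Del_wit Del_psi)
    then show "Sig CC (Suc m) (\<lambda>M s. wit M (s (Suc (Suc 0))) (s (Suc (Suc (Suc 0)))) (s (Suc 0)) \<or>
      (\<forall>t\<in>dom M. mem M t (s (Suc (Suc 0))) \<longrightarrow> (\<exists>u\<in>dom M. mem M u (s 0) \<and> \<not> psi M (s (Suc 0)) t u)))"
      by (simp add: Del_def)
    fix x assume x: "x \<in> dom NN" "mem NN x a"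
    have xa: "x \<in> elts a" using memN[OF a(1) x(1)] x(2) by blast
    have xA: "x \<in> A" using tr[OF a(1) xa] .
    show "\<exists>c\<in>dom NN. ?R NN (d ## (\<lambda>_. a')) x c"
    proof (cases "\<exists>t\<in>A. Phi x t")
      case True
      then have "\<exists>t\<in>elts a'. Phi x t" using a(3) xa unfolding closes_def by blast
      then have "wit NN d a' x" using wit_std[OF a(2) xA] by blast
      then show ?thesis using d(1) by auto
    next
      case False
      have "Pie CC (Suc (Suc m)) (\<lambda>M s. \<forall>t\<in>dom M. \<exists>u\<in>dom M. \<not> psi M (s 0) t u)"
      proof (rule Pie_All, rule Sig_Pie[of CC "Suc m"], rule Sig_Ex, rule Pie_Sig[of CC m])
        show "Pie CC m (\<lambda>M s. \<not> psi M (s (Suc (Suc 0))) (s (Suc 0)) (s 0))"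
          by (rule Pie_notI[OF Dfn_UNIV[OF psi]])
      qed simp_all
      from elem_Pie[OF elem this, of "\<lambda>_. x"] xA False
      have all: "\<exists>u\<in>dom NN. \<not> psi NN x t u" if "t \<in> dom NN" for t
        using that by (auto simp: Phi_def)
      have "\<exists>c\<in>dom NN. \<forall>t\<in>dom NN. mem NN t d \<longrightarrow> (\<exists>u\<in>dom NN. mem NN u c \<and> (\<lambda>M s t u. \<not> psi M (s 0) t u) NN (\<lambda>_. x) t u)"
      proof (rule CollN)
        have "Pie CC m (\<lambda>M s. \<not> psi M (s (Suc (Suc 0))) (s (Suc 0)) (s 0))"
          by (rule Pie_notI[OF Dfn_UNIV[OF psi]])
        then show "Sig CC (Suc m) (\<lambda>M s. \<not> psi M (s (Suc (Suc 0))) (s (Suc 0)) (s 0))"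
          by (rule Pie_Sig) simp
      qed (use x d all in auto)
      then show ?thesis by simp blast
    qed
  qed (use d inN[OF a(1)] inN[OF a(2)] in auto)
  then obtain C where C: "C \<in> dom NN" "\<And>x. x \<in> dom NN \<Longrightarrow> mem NN x a \<Longrightarrow> \<exists>c\<in>dom NN. mem NN c C \<and>
     (wit NN d a' x \<or> (\<forall>t\<in>dom NN. mem NN t d \<longrightarrow> (\<exists>u\<in>dom NN. mem NN u c \<and> \<not> psi NN x t u)))" by auto
  obtain h u where u: "h \<in> dom NN" "u \<in> dom NN" "Hist NN h" "mem NN u h" "mem NN C u" using coverN[OF C(1)] by blast
  have Cu: "subs NN C u" by (rule levtransN[OF u(1,2) C(1) u(3,4,5)])
  have "cert NN d u a a'" unfolding cert_def
  proof (intro ballI impI)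
    fix x assume x: "x \<in> dom NN" "mem NN x a"
    obtain c where c: "c \<in> dom NN" "mem NN c C"
      "wit NN d a' x \<or> (\<forall>t\<in>dom NN. mem NN t d \<longrightarrow> (\<exists>u\<in>dom NN. mem NN u c \<and> \<not> psi NN x t u))"
      using C(2)[OF x] by blast
    have "mem NN c u" using Cu c by (auto simp: subs_def)
    then have "subs NN c u" by (rule levtransN[OF u(1,2) c(1) u(3,4)])
    then show "wit NN d a' x \<or> (\<forall>t\<in>dom NN. mem NN t d \<longrightarrow> (\<exists>v\<in>dom NN. mem NN v u \<and> \<not> psi NN x t v))"
      using c(3) unfolding subs_def by blast
  qed
  then show ?thesis using u(2) by blast
qed

text \<open>
  A true witness in \<open>A\<close> belongs to \<open>d\<close> and cannot be refuted, so only the first alternative of the certificate is left.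
\<close>

lemma cert_std:
  assumes a: "a \<in> A" "a' \<in> A" "cert NN d c a a'" "c \<in> dom NN"
  shows "closes a a'"
  unfolding closes_def
proof (intro ballI impI)
  fix x assume x: "x \<in> elts a" "\<exists>t\<in>A. Phi x t"
  have xA: "x \<in> A" using tr[OF a(1) x(1)] .
  obtain t where t: "t \<in> A" "Phi x t" using x(2) by blast
  have "mem NN x a" using memN[OF a(1) inN[OF xA]] x(1) by blast
  then have "wit NN d a' x \<or> (\<forall>t\<in>dom NN. mem NN t d \<longrightarrow> (\<exists>u\<in>dom NN. mem NN u c \<and> \<not> psi NN x t u))"
    using a(3) inN[OF xA] unfolding cert_def by blast
  moreover have "\<not> (\<exists>u\<in>dom NN. mem NN u c \<and> \<not> psi NN x t u)"
    using t(2) Phi_el[OF xA t(1)] by blast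
  ultimately show "\<exists>t\<in>elts a'. Phi x t"
    using wit_std[OF a(2) xA] d_super[OF t(1)] inN[OF t(1)] by blast
qed

lemma Rel_std:
  assumes "g \<in> A" "j \<in> dom NN" "a \<in> dom NN"
  shows "Rel NN g j a \<longleftrightarrow> opair j a \<in> elts g"
proof -
  have el: "Rel NN g j a \<longleftrightarrow> opair j a \<in> elts g" if ja: "j \<in> A" "a \<in> A"
  proof -
    have "Sig CC (Suc (Suc m)) (\<lambda>M s. Rel M (s 0) (s (Suc 0)) (s (Suc (Suc 0))))" by (rule D0_Sig[OF D0_Rel])
    from elem_Sig[OF elem this, of "g ## j ## (\<lambda>_. a)"] assms(1) ja show ?thesis
      by (simp add: Rel_in[OF trans])
  qed
  show ?thesis
  proof
    assume r: "Rel NN g j a"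
    then obtain z where z: "z \<in> dom NN" "mem NN z g" "isPair NN z j a" unfolding Rel_def by blast
    have zA: "z \<in> A" using endN[OF assms(1) z(1,2)] .
    from isPair_bound[OF z(3)] obtain u where u: "u \<in> dom NN" "mem NN u z" "mem NN j u" "mem NN a u" by blast
    have uA: "u \<in> A" using endN[OF zA u(1,2)] .
    have "j \<in> A" "a \<in> A" using endN[OF uA assms(2) u(3)] endN[OF uA assms(3) u(4)] .
    then show "opair j a \<in> elts g" using el r by blast
  next
    assume r: "opair j a \<in> elts g"
    have "j \<in> A \<and> a \<in> A" by (rule opair_in_trans[OF trans tr[OF assms(1) r]])
    then show "Rel NN g j a" using el r by blast
  qed
qed

lemma mem_num: "j \<in> dom NN \<Longrightarrow> mem NN j (num i) \<longleftrightarrow> (\<exists>j'<i. j = num j')"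
  using memN[OF num_in, of j i] by (auto simp: elts_num)

lemma closes_mono: "closes a a' \<Longrightarrow> elts a' \<subseteq> elts a'' \<Longrightarrow> closes a a''"
  unfolding closes_def by blast

lemma closes_anti: "closes a a' \<Longrightarrow> elts a0 \<subseteq> elts a \<Longrightarrow> closes a0 a'"
  unfolding closes_def by blast

text \<open>
  Strong Collection gives an infinite sequence \<open>f\<close> of standard levels closing each other off. Each finite initial part of it has a
  certificate, and Collection over the natural numbers gives a common one.
\<close>

lemma chains_ex:
  assumes b: "b \<in> dom NN" "mem NN b h0" "b \<notin> A" and k0: "k0 \<in> A" and om: "om \<in> A" "elts om = range num"
  shows "\<exists>c\<in>dom NN. chains NN d h0 k0 om c b"
proof -
  have "\<exists>f. \<forall>j::nat. (f j \<in> A \<and> mem NN (f j) h0 \<and> k0 \<in> elts (f j)) \<and>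
     (f j \<in> elts (f (Suc j)) \<and> elts (f j) \<subseteq> elts (f (Suc j)) \<and> closes (f j) (f (Suc j)))"
  proof (rule dependent_nat_choice)
    show "\<exists>x. x \<in> A \<and> mem NN x h0 \<and> k0 \<in> elts x" using closes_next[OF k0] by blast
    fix x and n :: nat assume x: "x \<in> A \<and> mem NN x h0 \<and> k0 \<in> elts x"
    then show "\<exists>y. (y \<in> A \<and> mem NN y h0 \<and> k0 \<in> elts y) \<and> (x \<in> elts y \<and> elts x \<subseteq> elts y \<and> closes x y)"
      using closes_next[of x] by blast
  qed
  then obtain f where f: "\<And>j::nat. f j \<in> A" "\<And>j. mem NN (f j) h0" "\<And>j. k0 \<in> elts (f j)"
    "\<And>j. f j \<in> elts (f (Suc j))" "\<And>j. elts (f j) \<subseteq> elts (f (Suc j))" "\<And>j. closes (f j) (f (Suc j))" by blast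
  have fless: "f j \<in> elts (f k) \<and> closes (f j) (f k)" if "j < k" for j k
    using that
  proof (induction k)
    case (Suc k)
    show ?case
    proof (cases "j = k")
      case True
      then show ?thesis using f(4,6) by blast
    next
      case False
      then have "f j \<in> elts (f k) \<and> closes (f j) (f k)" using Suc by auto
      then show ?thesis using f(5)[of k] closes_mono by blast
    qed
  qed simp
  have Qfin: "\<exists>c\<in>dom NN. \<forall>(j, k)\<in>F. cert NN d c (f j) (f k)" if "finite F" "\<forall>(j, k)\<in>F. j < k" for F
    using that
  proof (induction rule: finite_induct)
    case empty
    then show ?case using d(1) by blast
  next
    case (insert p F)
    obtain j k where p: "p = (j, k)" by (cases p)
    then have "j < k" using insert.prems by auto
    obtain c1 where c1: "c1 \<in> dom NN" "cert NN d c1 (f j) (f k)"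
      using cert_ex[OF f(1) f(1)] fless[OF \<open>j < k\<close>] by blast
    obtain c2 where c2: "c2 \<in> dom NN" "\<forall>(j, k)\<in>F. cert NN d c2 (f j) (f k)" using insert by auto
    obtain u where u: "u \<in> dom NN" "subs NN c1 u" "subs NN c2 u" using levelN[OF c1(1) c2(1)] by blast
    show ?case
    proof (rule bexI[OF _ u(1)])
      show "\<forall>(j, k)\<in>insert p F. cert NN d u (f j) (f k)"
        using cert_mono[OF c1(2) u(2)] c2(2) cert_mono[OF _ u(3)] p by auto
    qed
  qed
  let ?T = "\<lambda>c a a'. mem NN k0 a \<and> cert NN d c a a'"
  have ch: "\<exists>c\<in>dom NN. \<exists>y\<in>dom NN. mem NN y c \<and> Chain NN y (num i) h0 b (?T c)" for i
  proof -
    have "finite {(j, k). j < k \<and> k < i}" by (rule finite_subset[of _ "{..<i} \<times> {..<i}"]) auto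
    from Qfin[OF this] obtain c where c: "c \<in> dom NN" "\<And>j k. j < k \<Longrightarrow> k < i \<Longrightarrow> cert NN d c (f j) (f k)" by auto
    define y where "y = vset ((\<lambda>j. opair (num j) (f j)) ` {..<i})"
    have yA: "y \<in> A" unfolding y_def using opair[OF num_in f(1)] by (intro finite_in) auto
    have ey: "elts y = (\<lambda>j. opair (num j) (f j)) ` {..<i}" unfolding y_def by simp
    have r: "Rel NN y j a \<longleftrightarrow> (\<exists>j'<i. j = num j' \<and> a = f j')" if "j \<in> dom NN" "a \<in> dom NN" for j a
      unfolding Rel_std[OF yA that] ey by auto
    obtain u where u: "u \<in> dom NN" "mem NN y u" "subs NN c u" using levelN[OF inN[OF yA] c(1)] by blast
    have "Chain NN y (num i) h0 b (?T u)"
      unfolding Chain_def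
    proof (intro conjI ballI impI)
      fix j assume j: "j \<in> dom NN" "mem NN j (num i)"
      then obtain j' where j': "j' < i" "j = num j'" using mem_num by blast
      have "Rel NN y j (f j')" using r[OF j(1) inN[OF f(1)]] j' by blast
      then show "\<exists>c\<in>dom NN. mem NN c h0 \<and> Rel NN y j c" using f(2) inN[OF f(1)] by blast
      fix a assume a: "a \<in> dom NN" "Rel NN y j a"
      then obtain k where "a = f k" using r[OF j(1) a(1)] by blast
      then show "mem NN a h0" "mem NN a b" using f(2) nonstd_super[OF h0 b f(1)] by blast+
    next
      fix j k a a' assume j: "j \<in> dom NN" "k \<in> dom NN" "a \<in> dom NN" "a' \<in> dom NN"
        and rr: "mem NN j k \<and> Rel NN y j a \<and> Rel NN y k a'"
      obtain j' where j': "j' < i" "j = num j'" "a = f j'" using rr r[OF j(1,3)] by blast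
      obtain k' where k': "k' < i" "k = num k'" "a' = f k'" using rr r[OF j(2,4)] by blast
      have "j' < k'" using rr memN[OF num_in inN[OF num_in]] unfolding j'(2) k'(2) num_mem by blast
      then show "mem NN a a'" using fless memN[OF f(1) inN[OF f(1)]] unfolding j'(3) k'(3) by blast
      show "mem NN k0 a" using f(3) memN[OF f(1) inN[OF k0]] unfolding j'(3) by blast
      show "cert NN d u a a'" using cert_mono[OF c(2)[OF \<open>j' < k'\<close> k'(1)] u(3)] unfolding j'(3) k'(3) .
    qed
    then show ?thesis using u(1,2) inN[OF yA]
      by - (rule bexI[of _ u], rule bexI[of _ y], rule conjI)
  qed
  let ?R = "\<lambda>M s i c. \<exists>y\<in>dom M. mem M y c \<and>
     Chain M y i (s 0) (s (Suc 0)) (\<lambda>a a'. mem M (s (Suc (Suc 0))) a \<and> cert M (s (Suc (Suc (Suc 0)))) c a a')"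
  have "\<exists>C\<in>dom NN. \<forall>i\<in>dom NN. mem NN i om \<longrightarrow> (\<exists>c\<in>dom NN. mem NN c C \<and> ?R NN (h0 ## b ## k0 ## (\<lambda>_. d)) i c)"
  proof (rule CollN)
    show "Sig CC (Suc m) (\<lambda>M s. ?R M (\<lambda>i. s (Suc (Suc i))) (s (Suc 0)) (s 0))"
      by (rule conjunct1[OF Del_Ch[unfolded Del_def]])
    fix i assume "i \<in> dom NN" "mem NN i om"
    then obtain i' where "i = num i'" using memN[OF om(1)] om(2) by blast
    then show "\<exists>c\<in>dom NN. ?R NN (h0 ## b ## k0 ## (\<lambda>_. d)) i c" using ch[of i'] by simp
  qed (use h0 b d inN[OF k0] inN[OF om(1)] in auto)
  then obtain C where C: "C \<in> dom NN" "\<And>i. i \<in> dom NN \<Longrightarrow> mem NN i om \<Longrightarrow> \<exists>c\<in>dom NN. mem NN c C \<and>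
    (\<exists>y\<in>dom NN. mem NN y c \<and> Chain NN y i h0 b (?T c))" by auto
  obtain h u where u: "h \<in> dom NN" "u \<in> dom NN" "Hist NN h" "mem NN u h" "mem NN C u" using coverN[OF C(1)] by blast
  have Cu: "subs NN C u" by (rule levtransN[OF u(1,2) C(1) u(3,4,5)])
  have "chains NN d h0 k0 om u b" unfolding chains_def
  proof (intro ballI impI)
    fix i assume i: "i \<in> dom NN" "mem NN i om"
    obtain c where c: "c \<in> dom NN" "mem NN c C" "\<exists>y\<in>dom NN. mem NN y c \<and> Chain NN y i h0 b (?T c)" using C(2)[OF i] by blast
    have "mem NN c u" using Cu c by (auto simp: subs_def)
    then have "subs NN c u" by (rule levtransN[OF u(1,2) c(1) u(3,4)])
    from Ch_mono[OF c(3) this subs_refl c(1)]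
    show "\<exists>y\<in>dom NN. mem NN y u \<and> Chain NN y i h0 b (?T u)" .
  qed
  then show ?thesis using u(2) by blast
qed

text \<open>
  Suppose that no \<open>c\<close> serves all \<open>b\<close>. Call \<open>c < c'\<close> a jump if \<open>c'\<close> serves some \<open>b\<close> that \<open>c\<close> does not. Every \<open>c\<close> is the lower end
  of a jump, so there are chains of jumps of every finite length, and by Collection all of them are found below a common level \<open>e\<close>. Let \<open>c0\<close> be
  the least level below which, with chains taken from \<open>e\<close>, there are chains of jumps of every finite length. Let \<open>b1\<close> be the
  least \<open>b\<close> served by some level below \<open>c0\<close>, say by \<open>c1\<close>. Then \<open>c1\<close> serves every \<open>b\<close> served by something below \<open>c0\<close>.
  Each element of a chain of jumps below \<open>c0\<close>, except the last, fails to serve some such \<open>b\<close>, and so is an element of \<open>c1\<close>. Deleting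
  last elements gives chains of jumps of every finite length below \<open>c1\<close>, which contradicts the choice of \<open>c0\<close>.
\<close>

lemma chains_stable:
  assumes k0: "k0 \<in> A" and om: "om \<in> A" "elts om = range num"
  shows "\<exists>cs\<in>dom NN. \<forall>c\<in>dom NN. \<forall>b\<in>dom NN. mem NN b h0 \<longrightarrow> chains NN d h0 k0 om c b \<longrightarrow> chains NN d h0 k0 om cs b"
proof (rule ccontr)
  assume no: "\<not> ?thesis"
  let ?X = "chains NN d h0 k0 om"
  \<comment> \<open>The pair \<open>a\<close>, \<open>a'\<close> is a jump.\<close>
  define J where "J M e h k om a a' \<longleftrightarrow> (\<exists>b\<in>dom M. mem M b h \<and> (chains M e h k om a' b \<and> \<not> chains M e h k om a b))"
    for M :: "'k V struct" and e h k om a a'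
  let ?J = "J NN d h0 k0 om"
  have Del_J: "Del CC (Suc m) (\<lambda>M s. J M (s e) (s h) (s k) (s o') (s a) (s a'))" for e h k o' a a'
    unfolding J_def by (intro Del_rules Del_chains)
  have jump: "\<exists>c'\<in>dom NN. ?J c c'" if "c \<in> dom NN" for c
    using no that unfolding J_def by blast
  \<comment> \<open>Chains of jumps of every finite length, built one jump at a time.\<close>
  have step: "\<exists>g\<in>dom NN. \<exists>h\<in>dom NN. \<exists>c\<in>dom NN. Hist NN h \<and> mem NN c h \<and> Chain NN g (num i) h c ?J \<and>
     (\<forall>j\<in>dom NN. \<forall>a\<in>dom NN. Rel NN g j a \<longrightarrow> mem NN j (num i))" for i
  proof (induction i)
    case 0
    have "Chain NN (vset {}) (num 0) h0 d ?J" unfolding Chain_def using mem_num by auto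
    then show ?case using h0 d inN[OF emptyK] relN_empty by blast
  next
    case (Suc i)
    then obtain g h c where g: "g \<in> dom NN" "h \<in> dom NN" "c \<in> dom NN" "Hist NN h" "mem NN c h"
      "Chain NN g (num i) h c ?J" and inv: "\<And>j a. j \<in> dom NN \<Longrightarrow> a \<in> dom NN \<Longrightarrow> Rel NN g j a \<Longrightarrow> mem NN j (num i)"
      by blast
    obtain c' where c': "c' \<in> dom NN" "?J c c'" using jump[OF g(3)] by blast
    obtain h1 u1 where u1: "h1 \<in> dom NN" "u1 \<in> dom NN" "Hist NN h1" "mem NN u1 h1" "mem NN c u1" "subs NN c u1" "subs NN c' u1"
      using levelN[OF g(3) c'(1)] by blast
    obtain h2 u2 where u2: "h2 \<in> dom NN" "u2 \<in> dom NN" "Hist NN h2" "mem NN u2 h2" "mem NN h u2" "mem NN h1 u2" "subs NN h1 u2"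
      using levelN[OF g(2) u1(1)] by blast
    have hh2: "subs NN h h2" by (rule hist_below[OF g(2,4) u2(1,3,2,4,5)])
    have h1h2: "subs NN h1 h2" by (rule hist_below[OF u1(1,3) u2(1,3,2,4,6)])
    have u1u2: "mem NN u1 u2" using u2(7) u1(2,4) by (auto simp: subs_def)
    have u1h2: "mem NN u1 h2" using h1h2 u1(2,4) by (auto simp: subs_def)
    have su: "subs NN u1 u2" by (rule levtransN[OF u2(1,2) u1(2) u2(3,4) u1u2])
    have Ni: "num i \<in> dom NN" by (rule inN[OF num_in])
    obtain g' where g': "g' \<in> dom NN" "\<forall>a\<in>dom NN. \<forall>b\<in>dom NN. Rel NN g' a b \<longleftrightarrow> Rel NN g a b \<or> (a = num i \<and> b = u1)"
      using relN_add[OF g(1) Ni u1(2)] by blast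
    have mS: "mem NN j (num (Suc i)) \<longleftrightarrow> mem NN j (num i) \<or> j = num i" if "j \<in> dom NN" for j
      unfolding mem_num[OF that] by (auto simp: less_Suc_eq)
    have nii: "\<not> mem NN (num i) (num i)" using irrefl[OF Ni] .
    have old: "mem NN a c \<and> mem NN a h" if "j \<in> dom NN" "a \<in> dom NN" "Rel NN g j a" for j a
      by (rule ChainD2[OF g(6) that(1) inv[OF that] that(2,3)])
    have "Chain NN g' (num (Suc i)) h2 u2 ?J"
      unfolding Chain_def
    proof (intro conjI ballI impI)
      fix j assume j: "j \<in> dom NN" "mem NN j (num (Suc i))"
      show "\<exists>c\<in>dom NN. mem NN c h2 \<and> Rel NN g' j c"
      proof (cases "j = num i")
        case True
        then show ?thesis using g'(2) u1(2) u1h2 Ni by blast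
      next
        case False
        then have "mem NN j (num i)" using mS[OF j(1)] j(2) by blast
        from ChainD1[OF g(6) j(1) this] obtain a where "a \<in> dom NN" "mem NN a h" "Rel NN g j a" by blast
        then show ?thesis using hh2 g'(2) j(1) unfolding subs_def by blast
      qed
      fix a assume a: "a \<in> dom NN" "Rel NN g' j a"
      then consider "Rel NN g j a" | "j = num i" "a = u1" using g'(2) j(1) by blast
      then have "mem NN a u2 \<and> mem NN a h2"
      proof cases
        case 1
        from old[OF j(1) a(1) 1] have "mem NN a c" "mem NN a h" by blast+
        then show ?thesis using u1(6) su hh2 a(1) unfolding subs_def by blast
      next
        case 2
        then show ?thesis using u1u2 u1h2 by blast
      qed
      then show "mem NN a u2" "mem NN a h2" by blast+
    next
      fix j k a a' assume j: "j \<in> dom NN" "mem NN j (num (Suc i))" and k: "k \<in> dom NN" "mem NN k (num (Suc i))"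
        and a: "a \<in> dom NN" "a' \<in> dom NN" and r: "mem NN j k \<and> Rel NN g' j a \<and> Rel NN g' k a'"
      have "mem NN a a' \<and> ?J a a'"
      proof (cases "k = num i")
        case True
        then have "\<not> Rel NN g k a'" using inv[OF k(1) a(2)] nii by blast
        then have a': "a' = u1" using r g'(2) k(1) a(2) by blast
        have "j \<noteq> num i" using r True nii by blast
        then have rg: "Rel NN g j a" using r g'(2) j(1) a(1) by blast
        have ac: "mem NN a c" using old[OF j(1) a(1) rg] by blast
        have sac: "subs NN a c" by (rule levtransN[OF g(2,3) a(1) g(4,5) ac])
        have "?J a u1"
        proof -
          from c'(2) obtain b where b: "b \<in> dom NN" "mem NN b h0" "?X c' b" "\<not> ?X c b" unfolding J_def by blast
          have "?X u1 b" by (rule chains_mono[OF b(3) u1(7) subs_refl c'(1)])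
          moreover have "\<not> ?X a b" using chains_mono[OF _ sac subs_refl a(1)] b(4) by blast
          ultimately show ?thesis using b(1,2) unfolding J_def by blast
        qed
        moreover have "mem NN a u1" using ac u1(6) a(1) unfolding subs_def by blast
        ultimately show ?thesis unfolding a' by blast
      next
        case False
        then have ki: "mem NN k (num i)" using mS[OF k(1)] k(2) by blast
        have rk: "Rel NN g k a'" using r g'(2) k(1) a(2) False by blast
        have "j \<noteq> num i"
        proof
          assume "j = num i"
          then have "mem NN (num i) k" using r by blast
          moreover obtain k' where "k' < i" "k = num k'" using ki mem_num[OF k(1)] by blast
          ultimately show False using memN[OF num_in Ni, of k'] num_mem[of i k'] by auto
        qed
        then have ji: "mem NN j (num i)" and rj: "Rel NN g j a" using mS[OF j(1)] j(2) r g'(2) j(1) a(1) by blast+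
        show ?thesis using ChainD3[OF g(6) j(1) k(1) _ ji ki a rj rk] r by blast
      qed
      then show "mem NN a a'" "?J a a'" by blast+
    qed
    moreover have "mem NN j (num (Suc i))" if "j \<in> dom NN" "a \<in> dom NN" "Rel NN g' j a" for j a
      using that g'(2) inv[OF that(1,2)] mS[OF that(1)] by blast
    ultimately show ?case using g'(1) u2(1,2,3,4) by blast
  qed
  let ?R = "\<lambda>M s i y. \<exists>g\<in>dom M. mem M g y \<and> (\<exists>h\<in>dom M. mem M h y \<and> (\<exists>c\<in>dom M. mem M c y \<and> (Hist M h \<and>
     (mem M c h \<and> Chain M g i h c (J M (s 0) (s (Suc 0)) (s (Suc (Suc 0))) (s (Suc (Suc (Suc 0)))))))))"
  have "\<exists>C\<in>dom NN. \<forall>i\<in>dom NN. mem NN i om \<longrightarrow> (\<exists>y\<in>dom NN. mem NN y C \<and> ?R NN (d ## h0 ## k0 ## (\<lambda>_. om)) i y)"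
  proof (rule CollN)
    have "Del CC (Suc m) (\<lambda>M s. Chain M (s g) (s i) (s h) (s c)
      ((\<lambda>M s. J M (s e1) (s e2) (s e3) (s e4)) M s))" for g i h c e1 e2 e3 e4
      by (rule Del_Chain) (rule Del_J)
    then have 1: "Del CC (Suc m) (\<lambda>M s. Chain M (s g) (s i) (s h) (s c) (J M (s e1) (s e2) (s e3) (s e4)))"
      for g i h c e1 e2 e3 e4 .
    have 2: "Del CC (Suc m) (\<lambda>M s. Hist M (s h))" for h by (rule Del_Pie[OF Pie_Hist]) (use m1 in simp)
    have "Del CC (Suc m) (\<lambda>M s. ?R M (\<lambda>i. s (Suc (Suc i))) (s (Suc 0)) (s 0))"
      by (intro Del_rules 1 2)
    then show "Sig CC (Suc m) (\<lambda>M s. ?R M (\<lambda>i. s (Suc (Suc i))) (s (Suc 0)) (s 0))"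
      unfolding Del_def by (rule conjunct1)
    fix i assume "i \<in> dom NN" "mem NN i om"
    then obtain i' where i': "i = num i'" using memN[OF om(1)] om(2) by blast
    from step[of i'] obtain g h c where g: "g \<in> dom NN" "h \<in> dom NN" "c \<in> dom NN" "Hist NN h" "mem NN c h"
      "Chain NN g (num i') h c ?J" by blast
    obtain p where p: "p \<in> dom NN" "mem NN g p" "mem NN h p" using pairN[OF g(1,2)] by blast
    obtain y where y: "y \<in> dom NN" "mem NN c y" "subs NN p y" using levelN[OF g(3) p(1)] by blast
    have "mem NN g y" "mem NN h y" using p y(3) g unfolding subs_def by blast+
    then show "\<exists>y\<in>dom NN. ?R NN (d ## h0 ## k0 ## (\<lambda>_. om)) i y"
      using y(1,2) g unfolding i' by auto
  qed (use h0 d inN[OF k0] inN[OF om(1)] in auto)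
  then obtain C where C: "C \<in> dom NN" "\<And>i. i \<in> dom NN \<Longrightarrow> mem NN i om \<Longrightarrow> \<exists>y\<in>dom NN. mem NN y C \<and>
    (\<exists>g\<in>dom NN. mem NN g y \<and> (\<exists>h\<in>dom NN. mem NN h y \<and> (\<exists>c\<in>dom NN. mem NN c y \<and> (Hist NN h \<and>
     (mem NN c h \<and> Chain NN g i h c ?J)))))" by auto
  \<comment> \<open>A level \<open>e\<close> that contains all these chains, the levels bounding them and, through \<open>hs\<close>, their histories.\<close>
  obtain hs e where e: "hs \<in> dom NN" "e \<in> dom NN" "Hist NN hs" "mem NN e hs" "mem NN C e" "subs NN C e"
    using levelN[OF C(1) C(1)] by blast
  have ee: "subs NN z e" if "z \<in> dom NN" "mem NN z e" for z
    by (rule levtransN[OF e(1,2) that(1) e(3,4) that(2)])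
  define E where "E c \<longleftrightarrow> (\<forall>i\<in>dom NN. mem NN i om \<longrightarrow> (\<exists>g\<in>dom NN. mem NN g e \<and> Chain NN g i hs c ?J))" for c
  have Ee: "E e" unfolding E_def
  proof (intro ballI impI)
    fix i assume i: "i \<in> dom NN" "mem NN i om"
    from C(2)[OF i] obtain y g h c where y: "y \<in> dom NN" "mem NN y C" and
      g: "g \<in> dom NN" "mem NN g y" "h \<in> dom NN" "mem NN h y" "c \<in> dom NN" "mem NN c y" "Hist NN h"
       "Chain NN g i h c ?J" by blast
    have "mem NN y e" using y e(6) unfolding subs_def by blast
    then have "subs NN y e" by (rule ee[OF y(1)])
    then have m: "mem NN g e" "mem NN h e" "mem NN c e" using g unfolding subs_def by blast+
    have hhs: "subs NN h hs" by (rule hist_below[OF g(3,7) e(1,3,2,4) m(2)])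
    have ce: "subs NN c e" by (rule ee[OF g(5) m(3)])
    have "Chain NN g i hs e ?J"
    proof (rule Chain_mono[OF g(8) subs_refl hhs])
      fix j a assume "j \<in> dom NN" "mem NN j i" "a \<in> dom NN" "Rel NN g j a"
      from ChainD2[OF g(8) this] show "mem NN a e" using ce \<open>a \<in> dom NN\<close> unfolding subs_def by blast
    qed
    then show "\<exists>g\<in>dom NN. mem NN g e \<and> Chain NN g i hs e ?J" using g(1) m(1) by blast
  qed
  let ?E = "\<lambda>M s c. \<forall>i\<in>dom M. mem M i (s 0) \<longrightarrow> (\<exists>g\<in>dom M. mem M g (s (Suc 0)) \<and>
     Chain M g i (s (Suc (Suc 0))) c (J M (s (Suc (Suc (Suc 0)))) (s (Suc (Suc (Suc (Suc 0))))) (s (Suc (Suc (Suc (Suc (Suc 0)))))) (s 0)))"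
  have "\<exists>S\<in>dom NN. \<forall>c\<in>dom NN. mem NN c S \<longleftrightarrow> mem NN c hs \<and> ?E NN (om ## e ## hs ## d ## h0 ## (\<lambda>_. k0)) c"
  proof (rule SepN)
    have "Del CC (Suc m) (\<lambda>M s. Chain M (s g) (s i) (s h) (s c)
      ((\<lambda>M s. J M (s e1) (s e2) (s e3) (s e4)) M s))" for g i h c e1 e2 e3 e4
      by (rule Del_Chain) (rule Del_J)
    then have 1: "Del CC (Suc m) (\<lambda>M s. Chain M (s g) (s i) (s h) (s c) (J M (s e1) (s e2) (s e3) (s e4)))"
      for g i h c e1 e2 e3 e4 .
    show "Del CC (Suc m) (\<lambda>M s. ?E M (\<lambda>i. s (Suc i)) (s 0))" by (intro Del_rules 1)
  qed (use h0 d e inN[OF k0] inN[OF om(1)] in auto)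
  then obtain S where S: "S \<in> dom NN" "\<And>c. c \<in> dom NN \<Longrightarrow> mem NN c S \<longleftrightarrow> mem NN c hs \<and> E c"
    unfolding E_def by auto
  have "mem NN e S" using S(2)[OF e(2)] e(4) Ee by blast
  from foundN[OF S(1) e(2) this] obtain c0 where c0: "c0 \<in> dom NN" "mem NN c0 S"
    "\<And>v. v \<in> dom NN \<Longrightarrow> mem NN v S \<Longrightarrow> \<not> mem NN v c0" by blast
  have c0h: "mem NN c0 hs" "E c0" using S(2)[OF c0(1)] c0(2) by blast+
  have omN: "mem NN (num i) om" for i using memN[OF om(1) inN[OF num_in]] om(2) by blast
  have Ni: "num i \<in> dom NN" for i by (rule inN[OF num_in])
  have mn: "mem NN (num j) (num i)" if "j < i" for i j using mem_num[OF Ni] that by blast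
  let ?B = "\<lambda>M s b. \<exists>a\<in>dom M. mem M a (s 0) \<and> (mem M a (s (Suc 0)) \<and> chains M (s (Suc (Suc 0))) (s (Suc (Suc (Suc 0))))
     (s (Suc (Suc (Suc (Suc 0))))) (s (Suc (Suc (Suc (Suc (Suc 0)))))) a b)"
  have "\<exists>B\<in>dom NN. \<forall>b\<in>dom NN. mem NN b B \<longleftrightarrow> mem NN b h0 \<and> ?B NN (hs ## c0 ## d ## h0 ## k0 ## (\<lambda>_. om)) b"
  proof (rule SepN)
    show "Del CC (Suc m) (\<lambda>M s. ?B M (\<lambda>i. s (Suc i)) (s 0))" by (intro Del_rules Del_chains)
  qed (use h0 d e c0 inN[OF k0] inN[OF om(1)] in auto)
  then obtain B where B: "B \<in> dom NN" "\<And>b. b \<in> dom NN \<Longrightarrow> mem NN b B \<longleftrightarrow> mem NN b h0 \<and>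
     (\<exists>a\<in>dom NN. mem NN a hs \<and> (mem NN a c0 \<and> ?X a b))" by auto
  have jumpB: "\<exists>a'\<in>dom NN. \<exists>b\<in>dom NN. mem NN b h0 \<and> mem NN b B \<and> ?X a' b \<and> \<not> ?X a b \<and> mem NN a hs"
    if g: "g \<in> dom NN" "Chain NN g (num (Suc i)) hs c0 ?J" "j < i" "a \<in> dom NN" "Rel NN g (num j) a" for g i j a
  proof -
    obtain a' where a': "a' \<in> dom NN" "mem NN a' hs" "Rel NN g (num i) a'"
      using ChainD1[OF g(2) Ni mn[of i "Suc i"]] by blast
    have "mem NN a' c0" using ChainD2[OF g(2) Ni mn[of i "Suc i"] a'(1,3)] by blast
    moreover have "?J a a'"
      using ChainD3[OF g(2) Ni Ni mn[OF g(3)] mn[of j "Suc i"] mn[of i "Suc i"] g(4) a'(1) g(5) a'(3)] g(3) by simp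
    then obtain b where b: "b \<in> dom NN" "mem NN b h0" "?X a' b" "\<not> ?X a b" unfolding J_def by blast
    ultimately have "mem NN b B" using B(2)[OF b(1)] a' by blast
    moreover have "mem NN a hs" using ChainD2[OF g(2) Ni mn[of j "Suc i"] g(4,5)] g(3) by simp
    ultimately show ?thesis using a'(1) b by blast
  qed
  obtain g2 where g2: "g2 \<in> dom NN" "Chain NN g2 (num (Suc (Suc 0))) hs c0 ?J"
    using c0h(2) Ni omN unfolding E_def by blast
  obtain a0 where "a0 \<in> dom NN" "Rel NN g2 (num 0) a0" using ChainD1[OF g2(2) Ni mn[of 0 "Suc (Suc 0)"]] by blast
  from jumpB[OF g2 _ this] obtain b0 where "b0 \<in> dom NN" "mem NN b0 B" by blast
  from foundN[OF B(1) this] obtain b1 where b1: "b1 \<in> dom NN" "mem NN b1 B"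
    "\<And>v. v \<in> dom NN \<Longrightarrow> mem NN v B \<Longrightarrow> \<not> mem NN v b1" by blast
  obtain c1 where c1: "c1 \<in> dom NN" "mem NN c1 hs" "mem NN c1 c0" "?X c1 b1" and b1h: "mem NN b1 h0"
    using B(2)[OF b1(1)] b1(2) by blast
  have domn: "?X c1 b" if "b \<in> dom NN" "mem NN b B" for b
  proof -
    have bh: "mem NN b h0" using B(2)[OF that(1)] that(2) by blast
    have "b1 = b \<or> mem NN b1 b" using linN[OF h0(1) b1(1) that(1) h0(2) b1h bh] b1(3)[OF that] by blast
    then have "subs NN b1 b" using levtransN[OF h0(1) that(1) b1(1) h0(2) bh] subs_refl[of NN b] by blast
    then show ?thesis by (rule chains_mono[OF c1(4) subs_refl _ c1(1)])
  qed
  have "E c1" unfolding E_def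
  proof (intro ballI impI)
    fix i assume "i \<in> dom NN" "mem NN i om"
    then obtain i' where i': "i = num i'" using memN[OF om(1)] om(2) by blast
    obtain g where g: "g \<in> dom NN" "mem NN g e" "Chain NN g (num (Suc i')) hs c0 ?J"
      using c0h(2) Ni omN unfolding E_def by blast
    have "Chain NN g (num i') hs c1 ?J"
    proof (rule Chain_mono[OF g(3) _ subs_refl])
      show "subs NN (num i') (num (Suc i'))" unfolding subs_def using mem_num less_SucI by blast
      fix j a assume j: "j \<in> dom NN" "mem NN j (num i')" and a: "a \<in> dom NN" "Rel NN g j a"
      obtain j' where j': "j' < i'" "j = num j'" using mem_num[OF j(1)] j(2) by blast
      obtain a' b where b: "b \<in> dom NN" "mem NN b B" "\<not> ?X a b" "mem NN a hs"
        using jumpB[OF g(1,3) j'(1) a(1) a(2)[unfolded j'(2)]] by blast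
      have X1: "?X c1 b" by (rule domn[OF b(1,2)])
      from linN[OF e(1) a(1) c1(1) e(3) b(4) c1(2)] consider "mem NN a c1" | "a = c1" | "mem NN c1 a" by blast
      then show "mem NN a c1"
      proof cases
        case 3
        then have "subs NN c1 a" by (rule levtransN[OF e(1) a(1) c1(1) e(3) b(4)])
        then have "?X a b" by (rule chains_mono[OF X1 _ subs_refl c1(1)])
        then show ?thesis using b(3) by blast
      qed (use X1 b(3) in auto)
    qed
    then show "\<exists>g\<in>dom NN. mem NN g e \<and> Chain NN g i hs c1 ?J" using g(1,2) i' by blast
  qed
  then have "mem NN c1 S" using S(2)[OF c1(1)] c1(2) by blast
  then show False using c0(3)[OF c1(1)] c1(3) by blast
qed

text \<open>
  Fix \<open>cs\<close> that serves all nonstandard levels in \<open>h0\<close>. The least level \<open>bs\<close> served by \<open>cs\<close> exists, and it is standard because below every nonstandard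
  level in \<open>h0\<close> there is another one. Chains of finite length below \<open>bs\<close> are genuine finite sequences of standard levels
  that close each other off. An infinite sequence is built by always choosing the least admissible next level: the \<open>j\<close>-th level chosen
  is included in the \<open>j\<close>-th entry of every finite sequence that has a further entry, so the construction never gets stuck below \<open>bs\<close>.
\<close>

lemma gap:
  assumes case2: "\<And>u. u \<in> dom NN \<Longrightarrow> mem NN u h0 \<Longrightarrow> u \<notin> A \<Longrightarrow> \<exists>v\<in>dom NN. mem NN v h0 \<and> v \<notin> A \<and> mem NN v u"
    and k0: "k0 \<in> A"
  shows "\<exists>b\<in>A. \<exists>K. K \<subseteq> elts b \<and> k0 \<in> K \<and> transitive K \<and>
    (\<forall>x\<in>K. \<forall>x'\<in>K. \<exists>v\<in>K. x \<in> elts v \<and> x' \<in> elts v \<and> transitive (elts v) \<and>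
       (\<forall>z\<in>A. \<forall>y\<in>elts v. elts z \<subseteq> elts y \<longrightarrow> z \<in> elts v)) \<and>
    (\<forall>x\<in>K. (\<exists>t\<in>A. Phi x t) \<longrightarrow> (\<exists>t\<in>K. Phi x t))"
proof -
  obtain om where om: "om \<in> A" "elts om = range num" using omega_in by blast
  let ?X = "chains NN d h0 k0 om"
  obtain cs where cs: "cs \<in> dom NN" "\<And>c b. c \<in> dom NN \<Longrightarrow> b \<in> dom NN \<Longrightarrow> mem NN b h0 \<Longrightarrow> ?X c b \<Longrightarrow> ?X cs b"
    using chains_stable[OF k0 om] by blast
  have allX: "?X cs b" if "b \<in> dom NN" "mem NN b h0" "b \<notin> A" for b
    using chains_ex[OF that k0 om] cs(2)[OF _ that(1,2)] by blast
  have "\<exists>S\<in>dom NN. \<forall>b\<in>dom NN. mem NN b S \<longleftrightarrow> mem NN b h0 \<and>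
    (\<lambda>M s b. chains M (s 0) (s (Suc 0)) (s (Suc (Suc 0))) (s (Suc (Suc (Suc 0)))) (s (Suc (Suc (Suc (Suc 0))))) b)
      NN (d ## h0 ## k0 ## om ## (\<lambda>_. cs)) b"
    by (rule SepN, rule Del_chains) (use d h0 cs inN[OF k0] inN[OF om(1)] in auto)
  then obtain S where S: "S \<in> dom NN" "\<And>b. b \<in> dom NN \<Longrightarrow> mem NN b S \<longleftrightarrow> mem NN b h0 \<and> ?X cs b" by auto
  have "mem NN d S" using S(2)[OF d(1)] d(2) allX[OF d] by blast
  from foundN[OF S(1) d(1) this] obtain bs where bs: "bs \<in> dom NN" "mem NN bs S"
    "\<And>v. v \<in> dom NN \<Longrightarrow> mem NN v S \<Longrightarrow> \<not> mem NN v bs" by blast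
  have bsh: "mem NN bs h0" and Xbs: "?X cs bs" using S(2)[OF bs(1)] bs(2) by blast+
  have bsA: "bs \<in> A"
  proof (rule ccontr)
    assume "bs \<notin> A"
    from case2[OF bs(1) bsh this] obtain v where v: "v \<in> dom NN" "mem NN v h0" "v \<notin> A" "mem NN v bs" by blast
    then have "mem NN v S" using S(2) allX by blast
    then show False using bs(3) v by blast
  qed
  define lev where "lev a \<longleftrightarrow> a \<in> elts bs \<and> mem NN a h0" for a
  have levA: "a \<in> A" if "lev a" for a using that tr[OF bsA] unfolding lev_def by blast
  have lin: "a \<in> elts a' \<or> a = a' \<or> a' \<in> elts a" if a: "lev a" "lev a'" for a a'
  proof -
    have N: "a \<in> dom NN" "a' \<in> dom NN" using inN levA a by blast+
    show ?thesis using linN[OF h0(1) N h0(2)] a memN[OF levA[OF a(2)] N(1)] memN[OF levA[OF a(1)] N(2)]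
      unfolding lev_def by blast
  qed
  have subsA: "elts x \<subseteq> elts y" if "x \<in> A" "y \<in> A" "subs NN x y" for x y
    using sub_in_A[OF that(2) inN[OF that(1)] that(3)] by blast
  have levtr: "elts x \<subseteq> elts a" if a: "lev a" "x \<in> elts a" for a x
  proof -
    have aA: "a \<in> A" using levA a by blast
    have xA: "x \<in> A" using tr[OF aA a(2)] .
    have "mem NN x a" using memN[OF aA inN[OF xA]] a(2) by blast
    then have "subs NN x a" using levtransN[OF h0(1) inN[OF aA] inN[OF xA] h0(2)] a(1) unfolding lev_def by blast
    then show ?thesis by (rule subsA[OF xA aA])
  qed
  have levsup: "z \<in> elts a" if a: "lev a" "z \<in> A" "y \<in> elts a" "elts z \<subseteq> elts y" for a y z
  proof -
    have aA: "a \<in> A" using levA a by blast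
    have yA: "y \<in> A" using tr[OF aA a(3)] .
    have ya: "mem NN y a" using memN[OF aA inN[OF yA]] a(3) by blast
    have "subs NN z y" unfolding subs_def using memN[OF a(2)] memN[OF yA] a(4) by blast
    then have "mem NN z a" using levsuperN[OF h0(1) inN[OF aA] inN[OF yA] inN[OF a(2)] h0(2) _ ya] a(1)
      unfolding lev_def by blast
    then show ?thesis using memN[OF aA inN[OF a(2)]] by blast
  qed
  have least: "\<exists>a. (lev a \<and> R a) \<and> (\<forall>a'. lev a' \<and> R a' \<longrightarrow> elts a \<subseteq> elts a')" if ex: "lev a0" "R a0" for R a0
  proof -
    have "a0 \<in> {a. lev a \<and> R a}" using ex by blast
    from wfE_min[OF wf_elts this] obtain a where a: "lev a" "R a"
      "\<And>v. v \<in> elts a \<Longrightarrow> \<not> (lev v \<and> R v)" by auto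
    have "elts a \<subseteq> elts a'" if "lev a'" "R a'" for a'
      using lin[OF a(1) that(1)] a(3)[of a'] that levtr[OF that(1)] by blast
    then show ?thesis using a by blast
  qed
  define good_seq where "good_seq f i \<longleftrightarrow> (\<forall>j<i. lev (f j)) \<and>
    (\<forall>j k. j < k \<and> k < i \<longrightarrow> f j \<in> elts (f k) \<and> k0 \<in> elts (f j) \<and> closes (f j) (f k))" for f and i :: nat
  have ex_seq: "\<exists>f. good_seq f i" for i
  proof -
    have Ni: "num j \<in> dom NN" for j by (rule inN[OF num_in])
    have mn: "mem NN (num j) (num i)" if "j < i" for j i using mem_num[OF Ni] that by blast
    have "mem NN (num i) om" using memN[OF om(1) Ni] om(2) by blast
    then obtain y where y: "y \<in> dom NN" "Chain NN y (num i) h0 bs (\<lambda>a a'. mem NN k0 a \<and> cert NN d cs a a')"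
      using Xbs Ni unfolding chains_def by blast
    have "\<forall>j. \<exists>a. j < i \<longrightarrow> a \<in> dom NN \<and> mem NN a h0 \<and> Rel NN y (num j) a"
      using ChainD1[OF y(2) Ni mn] by blast
    then obtain f where f: "\<And>j. j < i \<Longrightarrow> f j \<in> dom NN \<and> mem NN (f j) h0 \<and> Rel NN y (num j) (f j)" by metis
    have flev: "lev (f j)" if "j < i" for j
    proof -
      have "mem NN (f j) bs" using ChainD2[OF y(2) Ni mn[OF that]] f[OF that] by blast
      then show ?thesis using memN[OF bsA] f[OF that] unfolding lev_def by blast
    qed
    have "f j \<in> elts (f k) \<and> k0 \<in> elts (f j) \<and> closes (f j) (f k)" if jk: "j < k" "k < i" for j k
    proof -
      have ji: "j < i" using jk by simp
      have *: "mem NN (f j) (f k) \<and> mem NN k0 (f j) \<and> cert NN d cs (f j) (f k)"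
        using ChainD3[OF y(2) Ni Ni mn[OF jk(1)] mn[OF ji] mn[OF jk(2)]] f[OF ji] f[OF jk(2)] by blast
      have A: "f j \<in> A" "f k \<in> A" using levA flev ji jk by blast+
      show ?thesis using * cert_std[OF A _ cs(1)] memN[OF A(2) inN[OF A(1)]] memN[OF A(1) inN[OF k0]] by blast
    qed
    then show ?thesis using flev unfolding good_seq_def by blast
  qed
  \<comment> \<open>The invariant that compares the \<open>j\<close>-th choice with all finite sequences.\<close>
  define I where "I j a \<longleftrightarrow> (lev a \<and> k0 \<in> elts a) \<and> (\<forall>i f. good_seq f i \<and> Suc j < i \<longrightarrow> elts a \<subseteq> elts (f j))" for j a
  have "\<exists>f. \<forall>j. I j (f j) \<and> (f j \<in> elts (f (Suc j)) \<and> closes (f j) (f (Suc j)))"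
  proof (rule dependent_nat_choice)
    obtain f where f: "good_seq f (Suc (Suc 0))" using ex_seq by blast
    have "lev (f 0)" "k0 \<in> elts (f 0)" using f unfolding good_seq_def by auto
    from least[of "f 0" "\<lambda>a. k0 \<in> elts a", OF this] obtain a where
      a: "lev a" "k0 \<in> elts a" "\<And>a'. lev a' \<Longrightarrow> k0 \<in> elts a' \<Longrightarrow> elts a \<subseteq> elts a'" by blast
    have "elts a \<subseteq> elts (f 0)" if "good_seq f i" "Suc 0 < i" for f i
      by (rule a(3)) (use that in \<open>auto simp: good_seq_def\<close>)
    then show "\<exists>a. I 0 a" using a unfolding I_def by blast
  next
    fix a j assume a: "I j a"
    have la: "lev a" "k0 \<in> elts a" using a unfolding I_def by blast+
    have cand: "lev (f (Suc j)) \<and> a \<in> elts (f (Suc j)) \<and> closes a (f (Suc j))" if f: "good_seq f i" "Suc (Suc j) < i" for f i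
    proof -
      have l: "lev (f j)" "lev (f (Suc j))" and s: "f j \<in> elts (f (Suc j))" "closes (f j) (f (Suc j))"
        using f unfolding good_seq_def by auto
      have "Suc j < i" using f(2) by simp
      then have aj: "elts a \<subseteq> elts (f j)" using a f(1) unfolding I_def by blast
      have "f j \<notin> elts a" using aj elts_irrefl by blast
      then have "a \<in> elts (f j) \<or> a = f j" using lin[OF la(1) l(1)] by blast
      then have "a \<in> elts (f (Suc j))" using s(1) levtr[OF l(2) s(1)] by blast
      then show ?thesis using l(2) closes_anti[OF s(2) aj] by blast
    qed
    obtain f where f: "good_seq f (Suc (Suc (Suc j)))" using ex_seq by blast
    from cand[OF f] have c: "lev (f (Suc j))" "a \<in> elts (f (Suc j)) \<and> closes a (f (Suc j))" by simp_all
    from least[of "f (Suc j)" "\<lambda>b. a \<in> elts b \<and> closes a b", OF c] obtain b where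
      b: "lev b" "a \<in> elts b" "closes a b" "\<And>b'. lev b' \<Longrightarrow> a \<in> elts b' \<Longrightarrow> closes a b' \<Longrightarrow> elts b \<subseteq> elts b'" by blast
    have "elts b \<subseteq> elts (f (Suc j))" if "good_seq f i" "Suc (Suc j) < i" for f i
      using b(4) cand[OF that] by blast
    moreover have "k0 \<in> elts b" using levtr[OF b(1,2)] la(2) by blast
    ultimately show "\<exists>y. I (Suc j) y \<and> (a \<in> elts y \<and> closes a y)" using b(1,2,3) unfolding I_def by blast
  qed
  then obtain f where f: "\<And>j. I j (f j)" "\<And>j. f j \<in> elts (f (Suc j))" "\<And>j. closes (f j) (f (Suc j))" by blast
  have fl: "lev (f j)" "k0 \<in> elts (f j)" for j using f(1)[of j] unfolding I_def by blast+
  let ?K = "\<Union>j. elts (f j)"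
  show ?thesis
  proof (intro bexI[OF _ bsA] exI[of _ ?K] conjI ballI impI)
    show "?K \<subseteq> elts bs"
    proof
      fix x assume "x \<in> ?K"
      then obtain j where x: "x \<in> elts (f j)" by blast
      have fjA: "f j \<in> A" using levA fl by blast
      have xA: "x \<in> A" using tr[OF fjA x] .
      have "f j \<in> elts bs" using fl unfolding lev_def by blast
      then have "mem NN (f j) bs" using memN[OF bsA inN[OF fjA]] by blast
      then have "subs NN (f j) bs" by (rule levtransN[OF h0(1) bs(1) inN[OF fjA] h0(2) bsh])
      then show "x \<in> elts bs" using subsA[OF fjA bsA] x by blast
    qed
    show "k0 \<in> ?K" using fl by blast
    show "transitive ?K" unfolding transitive_def using levtr[OF fl(1)] by blast
  next
    fix x x' assume "x \<in> ?K" "x' \<in> ?K"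
    then obtain i j where x: "x \<in> elts (f i)" "x' \<in> elts (f j)" by blast
    have "elts (f j) \<subseteq> elts (f (Suc j))" for j using levtr[OF fl(1) f(2)] .
    then have mono: "elts (f i) \<subseteq> elts (f j)" if "i \<le> j" for i j
      using lift_Suc_mono_le[of "\<lambda>j. elts (f j)"] that by blast
    show "\<exists>v\<in>?K. x \<in> elts v \<and> x' \<in> elts v \<and> transitive (elts v) \<and>
       (\<forall>z\<in>A. \<forall>y\<in>elts v. elts z \<subseteq> elts y \<longrightarrow> z \<in> elts v)"
    proof (rule bexI[of _ "f (max i j)"], intro conjI)
      show "x \<in> elts (f (max i j))" "x' \<in> elts (f (max i j))"
        using x mono[of i "max i j"] mono[of j "max i j"] by auto
      show "transitive (elts (f (max i j)))" unfolding transitive_def using levtr[OF fl(1)] by blast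
      show "\<forall>z\<in>A. \<forall>y\<in>elts (f (max i j)). elts z \<subseteq> elts y \<longrightarrow> z \<in> elts (f (max i j))"
        using levsup[OF fl(1)] by blast
      show "f (max i j) \<in> ?K" using f(2) by blast
    qed
  next
    fix x assume "x \<in> ?K" and t: "\<exists>t\<in>A. Phi x t"
    then obtain j where x: "x \<in> elts (f j)" by blast
    then have "\<exists>t\<in>elts (f (Suc j)). Phi x t" using f(3)[of j] t unfolding closes_def by blast
    then show "\<exists>t\<in>?K. Phi x t" by blast
  qed
qed

end

section \<open>Universal formulas\<close>

subsection \<open>Codes of bounded formulas\<close>

text \<open>
  Truth of bounded formulas is formalized for this reduced syntax; the bounded quantifier is its only
  quantifier. Codes are sets built from numerals by pairing.
\<close>

datatype bfm = BMem nat nat | BEq nat nat | BNand bfm bfm | BEx nat nat bfm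

primrec bfv :: "bfm \<Rightarrow> nat set" where
  "bfv (BMem x y) = {x, y}"
| "bfv (BEq x y) = {x, y}"
| "bfv (BNand p q) = bfv p \<union> bfv q"
| "bfv (BEx x y p) = insert y (bfv p - {x})"

primrec beval :: "(nat \<Rightarrow> 'k V) \<Rightarrow> bfm \<Rightarrow> bool" where
  "beval s (BMem x y) \<longleftrightarrow> s x \<in> elts (s y)"
| "beval s (BEq x y) \<longleftrightarrow> s x = s y"
| "beval s (BNand p q) \<longleftrightarrow> \<not> (beval s p \<and> beval s q)"
| "beval s (BEx x y p) \<longleftrightarrow> (\<exists>a\<in>elts (s y). beval (s(x := a)) p)"

primrec code :: "bfm \<Rightarrow> 'k V" where
  "code (BMem x y) = opair (num 0) (opair (num x) (num y))"
| "code (BEq x y) = opair (num 1) (opair (num x) (num y))"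
| "code (BNand p q) = opair (num 2) (opair (code p) (code q))"
| "code (BEx x y p) = opair (num 3) (opair (opair (num x) (num y)) (code p))"

lemma Delta0_bfm:
  assumes "p \<in> Delta0"
  shows "\<exists>b. bfv b \<subseteq> fv p \<and> (\<forall>K s. transitive (K :: 'k V set) \<longrightarrow> range s \<subseteq> K \<longrightarrow>
     sat (in_struct K) s p = beval s b)"
  using assms
proof induction
  case (Mem x y)
  show ?case by (rule exI[of _ "BMem x y"]) auto
next
  case (Eq x y)
  show ?case by (rule exI[of _ "BEq x y"]) auto
next
  case (Neg p)
  then obtain b where "bfv b \<subseteq> fv p" "\<forall>K s. transitive (K :: 'k V set) \<longrightarrow> range s \<subseteq> K \<longrightarrow>
     sat (in_struct K) s p = beval s b" by blast
  then show ?case by (intro exI[of _ "BNand b b"]) auto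
next
  case (Conj p q)
  then obtain b c where "bfv b \<subseteq> fv p" "\<forall>K s. transitive (K :: 'k V set) \<longrightarrow> range s \<subseteq> K \<longrightarrow>
     sat (in_struct K) s p = beval s b" "bfv c \<subseteq> fv q" "\<forall>K s. transitive (K :: 'k V set) \<longrightarrow> range s \<subseteq> K \<longrightarrow>
     sat (in_struct K) s q = beval s c" by blast
  then show ?case by (intro exI[of _ "BNand (BNand b c) (BNand b c)"]) auto
next
  case (Disj p q)
  then obtain b c where "bfv b \<subseteq> fv p" "\<forall>K s. transitive (K :: 'k V set) \<longrightarrow> range s \<subseteq> K \<longrightarrow>
     sat (in_struct K) s p = beval s b" "bfv c \<subseteq> fv q" "\<forall>K s. transitive (K :: 'k V set) \<longrightarrow> range s \<subseteq> K \<longrightarrow>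
     sat (in_struct K) s q = beval s c" by blast
  then show ?case by (intro exI[of _ "BNand (BNand b b) (BNand c c)"]) auto
next
  case (Imp p q)
  then obtain b c where "bfv b \<subseteq> fv p" "\<forall>K s. transitive (K :: 'k V set) \<longrightarrow> range s \<subseteq> K \<longrightarrow>
     sat (in_struct K) s p = beval s b" "bfv c \<subseteq> fv q" "\<forall>K s. transitive (K :: 'k V set) \<longrightarrow> range s \<subseteq> K \<longrightarrow>
     sat (in_struct K) s q = beval s c" by blast
  then show ?case by (intro exI[of _ "BNand b (BNand c c)"]) auto
next
  case (ForallIn p x y)
  then obtain b where b: "bfv b \<subseteq> fv p" "\<And>K s. transitive (K :: 'k V set) \<Longrightarrow> range s \<subseteq> K \<Longrightarrow>
     sat (in_struct K) s p = beval s b" by blast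
  show ?case
  proof (intro exI[of _ "BNand (BEx x y (BNand b b)) (BEx x y (BNand b b))"] conjI allI impI)
    fix K :: "'k V set" and s :: "nat \<Rightarrow> 'k V" assume K: "transitive K" "range s \<subseteq> K"
    have "s y \<in> K" using K(2) by auto
    then have "a \<in> K" if "a \<in> elts (s y)" for a using transD[OF K(1) _ that] by blast
    then show "sat (in_struct K) s (ForallIn x y p) = beval s (BNand (BEx x y (BNand b b)) (BEx x y (BNand b b)))"
      using b(2)[OF K(1) range_upd[OF K(2)]] ForallIn(2) by auto
  qed (use b(1) ForallIn(2) in auto)
next
  case (ExistsIn p x y)
  then obtain b where b: "bfv b \<subseteq> fv p" "\<And>K s. transitive (K :: 'k V set) \<Longrightarrow> range s \<subseteq> K \<Longrightarrow>
     sat (in_struct K) s p = beval s b" by blast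
  show ?case
  proof (intro exI[of _ "BEx x y b"] conjI allI impI)
    fix K :: "'k V set" and s :: "nat \<Rightarrow> 'k V" assume K: "transitive K" "range s \<subseteq> K"
    have "s y \<in> K" using K(2) by auto
    then have "a \<in> K" if "a \<in> elts (s y)" for a using transD[OF K(1) _ that] by blast
    then show "sat (in_struct K) s (ExistsIn x y p) = beval s (BEx x y b)"
      using b(2)[OF K(1) range_upd[OF K(2)]] ExistsIn(2) by auto
  qed (use b(1) ExistsIn(2) in auto)
qed

subsection \<open>Formulas for truth\<close>

primrec isN :: "'a struct \<Rightarrow> nat \<Rightarrow> 'a \<Rightarrow> bool" where
  "isN M 0 z \<longleftrightarrow> (\<forall>v\<in>dom M. mem M v z \<longrightarrow> \<not> v = v)"
| "isN M (Suc k) z \<longleftrightarrow> (\<exists>u\<in>dom M. mem M u z \<and> (isN M k u \<and> subs M u z \<and> (\<forall>v\<in>dom M. mem M v z \<longrightarrow> mem M v u \<or> v = u)))"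

text \<open>
  The assignment \<open>s'\<close>, a set of pairs of numerals and values, is \<open>s\<close> with the value at \<open>x\<close> changed to \<open>a\<close>.
\<close>

definition upd :: "'a struct \<Rightarrow> 'a \<Rightarrow> 'a \<Rightarrow> 'a \<Rightarrow> 'a \<Rightarrow> bool" where
  "upd M s x a s' \<longleftrightarrow> Rel M s' x a \<and>
     (\<forall>j\<in>dom M. \<forall>b\<in>dom M. Rel M s' j b \<longrightarrow> (j = x \<and> b = a) \<or> (\<not> j = x \<and> Rel M s j b)) \<and>
     (\<forall>j\<in>dom M. \<forall>b\<in>dom M. Rel M s j b \<longrightarrow> j = x \<or> Rel M s' j b)"

definition has_value :: "'a struct \<Rightarrow> 'a \<Rightarrow> 'a \<Rightarrow> 'a \<Rightarrow> nat \<Rightarrow> bool" where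
  "has_value M T c s k \<longleftrightarrow> (\<exists>z\<in>dom M. mem M z T \<and> (\<exists>p\<in>dom M. \<exists>b\<in>dom M. isPair M z p b \<and> (isN M k b \<and> isPair M p c s)))"

definition upd_value :: "'a struct \<Rightarrow> 'a \<Rightarrow> 'a \<Rightarrow> 'a \<Rightarrow> 'a \<Rightarrow> 'a \<Rightarrow> nat \<Rightarrow> bool" where
  "upd_value M T s x a p k \<longleftrightarrow> (\<exists>z\<in>dom M. mem M z T \<and> (\<exists>q\<in>dom M. \<exists>b\<in>dom M. isPair M z q b \<and>
     (isN M k b \<and> (\<exists>p'\<in>dom M. \<exists>s'\<in>dom M. isPair M q p' s' \<and> (p' = p \<and> upd M s x a s')))))"

text \<open>
  The truth value \<open>b\<close> of \<open>c\<close> under \<open>s\<close> is justified by the entries of \<open>T\<close> for its immediate parts. No completeness is demanded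
  of \<open>T\<close>, so unions of such sets are again closed under justification, and being one is \<open>\<Delta>\<^sub>0\<close>.
\<close>

definition justified :: "'a struct \<Rightarrow> 'a \<Rightarrow> 'a \<Rightarrow> 'a \<Rightarrow> 'a \<Rightarrow> bool" where
  "justified M T c s b \<longleftrightarrow> (\<exists>t\<in>dom M. \<exists>r\<in>dom M. isPair M c t r \<and>
    ((isN M 0 t \<and> (\<exists>x\<in>dom M. \<exists>y\<in>dom M. isPair M r x y \<and> (\<exists>a\<in>dom M. Rel M s x a \<and> (\<exists>w\<in>dom M. Rel M s y w \<and>
         ((isN M 1 b \<and> mem M a w) \<or> (isN M 0 b \<and> \<not> mem M a w)))))) \<or>
     (isN M 1 t \<and> (\<exists>x\<in>dom M. \<exists>y\<in>dom M. isPair M r x y \<and> (\<exists>a\<in>dom M. Rel M s x a \<and> (\<exists>w\<in>dom M. Rel M s y w \<and>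
         ((isN M 1 b \<and> a = w) \<or> (isN M 0 b \<and> \<not> a = w)))))) \<or>
     (isN M 2 t \<and> (\<exists>p\<in>dom M. \<exists>q\<in>dom M. isPair M r p q \<and>
         ((isN M 1 b \<and> (has_value M T p s 0 \<or> has_value M T q s 0)) \<or> (isN M 0 b \<and> (has_value M T p s 1 \<and> has_value M T q s 1))))) \<or>
     (isN M 3 t \<and> (\<exists>v\<in>dom M. \<exists>p\<in>dom M. isPair M r v p \<and> (\<exists>x\<in>dom M. \<exists>y\<in>dom M. isPair M v x y \<and> (\<exists>w\<in>dom M. Rel M s y w \<and>
         ((isN M 1 b \<and> (\<exists>a\<in>dom M. mem M a w \<and> upd_value M T s x a p 1)) \<or>
          (isN M 0 b \<and> (\<forall>a\<in>dom M. mem M a w \<longrightarrow> upd_value M T s x a p 0)))))))))"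

definition truth_set :: "'a struct \<Rightarrow> 'a \<Rightarrow> bool" where
  "truth_set M T \<longleftrightarrow> (\<forall>z\<in>dom M. mem M z T \<longrightarrow> (\<forall>p\<in>dom M. \<forall>b\<in>dom M. isPair M z p b \<longrightarrow>
     (\<forall>c\<in>dom M. \<forall>s\<in>dom M. isPair M p c s \<longrightarrow> justified M T c s b)))"

text \<open>
  The assignments \<open>s\<close> and \<open>s1\<close> differ only on \<open>B\<close>, where \<open>s1\<close> is single-valued: a block of quantifiers is a quantifier over such \<open>s1\<close>.
\<close>

definition agree :: "'a struct \<Rightarrow> 'a \<Rightarrow> 'a \<Rightarrow> 'a \<Rightarrow> bool" where
  "agree M B s s1 \<longleftrightarrow>
     (\<forall>j\<in>dom M. \<forall>b\<in>dom M. Rel M s1 j b \<longrightarrow> mem M j B \<or> Rel M s j b) \<and>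
     (\<forall>j\<in>dom M. \<forall>b\<in>dom M. Rel M s j b \<longrightarrow> mem M j B \<or> Rel M s1 j b) \<and>
     (\<forall>j\<in>dom M. mem M j B \<longrightarrow> (\<exists>a\<in>dom M. Rel M s1 j a \<and> (\<forall>a'\<in>dom M. Rel M s1 j a' \<longrightarrow> a' = a)))"

lemma D0_isN: "D0 C (\<lambda>M s. isN M k (s i))"
proof (induction k arbitrary: i)
  case 0
  show ?case unfolding isN.simps by (intro D0_rules)
next
  case (Suc k)
  show ?case unfolding isN.simps by (intro D0_rules Suc)
qed

lemma D0_upd: "D0 C (\<lambda>M s. upd M (s i1) (s i2) (s i3) (s i4))"
  unfolding upd_def by (intro D0_AllRel D0_rules)

lemma D0_has_value: "D0 C (\<lambda>M s. has_value M (s i1) (s i2) (s i3) k)"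
  unfolding has_value_def by (intro D0_ExPair D0_rules D0_isN)

lemma D0_upd_value: "D0 C (\<lambda>M s. upd_value M (s i1) (s i2) (s i3) (s i4) (s i5) k)"
  unfolding upd_value_def by (intro D0_ExPair D0_rules D0_isN D0_upd)

lemma D0_justified: "D0 C (\<lambda>M s. justified M (s i1) (s i2) (s i3) (s i4))"
  unfolding justified_def by (intro D0_ExPair D0_ExRel1 D0_rules D0_isN D0_has_value D0_upd_value)

lemma D0_truth_set: "D0 C (\<lambda>M s. truth_set M (s i))"
  unfolding truth_set_def by (intro D0_AllPair D0_rules D0_justified)

lemma D0_agree: "D0 C (\<lambda>M s. agree M (s i1) (s i2) (s i3))"
  unfolding agree_def by (intro D0_AllRel D0_ExRel1 D0_AllRel1 D0_rules)

text \<open>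
  The universal \<open>\<Sigma>\<^sub>k\<^sub>+\<^sub>1\<close> and \<open>\<Pi>\<^sub>k\<^sub>+\<^sub>1\<close> formulas: a code is a pair of a block of variables and a code of the rest. Truth of a
  bounded formula is both \<open>\<Sigma>\<^sub>1\<close> and \<open>\<Pi>\<^sub>1\<close>: some truth set makes it true, or none makes it false.
\<close>

fun US :: "nat \<Rightarrow> 'a struct \<Rightarrow> 'a \<Rightarrow> 'a \<Rightarrow> bool" and UP :: "nat \<Rightarrow> 'a struct \<Rightarrow> 'a \<Rightarrow> 'a \<Rightarrow> bool" where
  "US 0 M e s = (\<exists>B\<in>dom M. \<exists>c\<in>dom M. \<exists>t\<in>dom M. isPair M e B c \<and> agree M B s t \<and> (\<exists>T\<in>dom M. truth_set M T \<and> has_value M T c t 1))"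
| "UP 0 M e s = (\<forall>B\<in>dom M. \<forall>c\<in>dom M. \<forall>t\<in>dom M. isPair M e B c \<and> agree M B s t \<longrightarrow> \<not> (\<exists>T\<in>dom M. truth_set M T \<and> has_value M T c t 0))"
| "US (Suc k) M e s = (\<exists>B\<in>dom M. \<exists>c\<in>dom M. \<exists>t\<in>dom M. isPair M e B c \<and> agree M B s t \<and> UP k M c t)"
| "UP (Suc k) M e s = (\<forall>B\<in>dom M. \<forall>c\<in>dom M. \<forall>t\<in>dom M. isPair M e B c \<and> agree M B s t \<longrightarrow> US k M c t)"

lemma U_levy: "Sig C (Suc k) (\<lambda>M s. US k M (s i) (s j)) \<and> Pie C (Suc k) (\<lambda>M s. UP k M (s i) (s j))"
proof (induction k arbitrary: i j)
  case 0
  have *: "Sig C (Suc 0) (\<lambda>M s. \<exists>T\<in>dom M. truth_set M T \<and> has_value M T (s i) (s j) k)" for i j k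
    by (intro Sig_Ex D0_Sig D0_conj D0_truth_set D0_has_value)
  show ?case unfolding US.simps UP.simps
    by (intro conjI Sig_Ex Pie_All Sig_conj Pie_imp D0_Sig[OF D0_isPair] D0_Sig[OF D0_agree] Pie_notI *)
next
  case (Suc k)
  have 1: "Sig C (Suc (Suc k)) (\<lambda>M s. UP k M (s i) (s j))" for i j
    by (rule Pie_Sig[OF conjunct2[OF Suc.IH]]) simp
  have 2: "Pie C (Suc (Suc k)) (\<lambda>M s. US k M (s i) (s j))" for i j
    by (rule Sig_Pie[OF conjunct1[OF Suc.IH]]) simp
  show ?case unfolding US.simps UP.simps
    by (intro conjI Sig_Ex Pie_All Sig_conj Pie_imp D0_Sig[OF D0_isPair] D0_Sig[OF D0_agree] 1 2)
qed

subsection \<open>Their meaning in transitive models\<close>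

text \<open>
  The relations \<open>upd\<close> and \<open>justified\<close> as they are evaluated in transitive models.
\<close>

definition updr :: "'k V \<Rightarrow> 'k V \<Rightarrow> 'k V \<Rightarrow> 'k V \<Rightarrow> bool" where
  "updr s x a s' \<longleftrightarrow> opair x a \<in> elts s' \<and>
     (\<forall>j b. opair j b \<in> elts s' \<longrightarrow> (j = x \<and> b = a) \<or> (\<not> j = x \<and> opair j b \<in> elts s)) \<and>
     (\<forall>j b. opair j b \<in> elts s \<longrightarrow> j = x \<or> opair j b \<in> elts s')"

definition justifies :: "'k V \<Rightarrow> 'k V \<Rightarrow> 'k V \<Rightarrow> 'k V \<Rightarrow> bool" where
  "justifies T c s b \<longleftrightarrow> (\<exists>t r. c = opair t r \<and>
    ((t = num 0 \<and> (\<exists>x y. r = opair x y \<and> (\<exists>a. opair x a \<in> elts s \<and> (\<exists>w. opair y w \<in> elts s \<and>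
         ((b = num 1 \<and> a \<in> elts w) \<or> (b = num 0 \<and> \<not> a \<in> elts w)))))) \<or>
     (t = num 1 \<and> (\<exists>x y. r = opair x y \<and> (\<exists>a. opair x a \<in> elts s \<and> (\<exists>w. opair y w \<in> elts s \<and>
         ((b = num 1 \<and> a = w) \<or> (b = num 0 \<and> \<not> a = w)))))) \<or>
     (t = num 2 \<and> (\<exists>p q. r = opair p q \<and>
         ((b = num 1 \<and> (opair (opair p s) (num 0) \<in> elts T \<or> opair (opair q s) (num 0) \<in> elts T)) \<or>
          (b = num 0 \<and> (opair (opair p s) (num 1) \<in> elts T \<and> opair (opair q s) (num 1) \<in> elts T))))) \<or>
     (t = num 3 \<and> (\<exists>v p. r = opair v p \<and> (\<exists>x y. v = opair x y \<and> (\<exists>w. opair y w \<in> elts s \<and>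
         ((b = num 1 \<and> (\<exists>a\<in>elts w. \<exists>s'. updr s x a s' \<and> opair (opair p s') (num 1) \<in> elts T)) \<or>
          (b = num 0 \<and> (\<forall>a\<in>elts w. \<exists>s'. updr s x a s' \<and> opair (opair p s') (num 0) \<in> elts T)))))))))"

lemma justifies_mono:
  assumes "justifies T c s b" and sub: "elts T \<subseteq> elts T'"
  shows "justifies T' c s b"
  by (insert assms(1), unfold justifies_def Bex_def Ball_def,
    (assumption | erule subsetD[OF sub] ex_forward conj_forward disj_forward all_forward imp_forward)+)

context trans_model
begin

abbreviation "KK \<equiv> in_struct K"

lemma isN_in: "z \<in> K \<Longrightarrow> isN KK k z \<longleftrightarrow> z = num k"
proof (induction k arbitrary: z)
  case 0
  have "isN KK 0 z \<longleftrightarrow> elts z = {}" using tr[OF 0] by auto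
  also have "\<dots> \<longleftrightarrow> z = num 0" using V_extensionality[of z "num 0"] by auto
  finally show ?case .
next
  case (Suc k)
  have "isN KK (Suc k) z \<longleftrightarrow> elts z = insert (num k) (elts (num k))"
  proof
    assume "isN KK (Suc k) z"
    then obtain u where u: "u \<in> K" "u \<in> elts z" "isN KK k u" "subs KK u z" "\<forall>v\<in>K. v \<in> elts z \<longrightarrow> v \<in> elts u \<or> v = u" by auto
    then have "u = num k" using Suc.IH by blast
    then show "elts z = insert (num k) (elts (num k))"
      using u(2,4,5) tr[OF Suc.prems] unfolding subs_in[OF trans u(1)] by blast
  next
    assume z: "elts z = insert (num k) (elts (num k))"
    have "isN KK k (num k)" using Suc.IH num_in by blast
    then show "isN KK (Suc k) z" using z num_in[of k] by (auto simp: subs_in[OF trans num_in] intro!: bexI[of _ "num k"])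
  qed
  also have "\<dots> \<longleftrightarrow> z = num (Suc k)"
    using V_extensionality[of z "num (Suc k)"] unfolding elts_num_Suc by (auto simp: elts_num_Suc)
  finally show ?case .
qed

lemma pairK: "opair a b \<in> K \<longleftrightarrow> a \<in> K \<and> b \<in> K"
  using opair opair_in_trans[OF trans] by blast

lemma relK: "g \<in> K \<Longrightarrow> opair a b \<in> elts g \<Longrightarrow> a \<in> K \<and> b \<in> K"
  using tr pairK by blast

lemma exPair_cong:
  assumes "z \<in> K" "\<And>a b. a \<in> K \<Longrightarrow> b \<in> K \<Longrightarrow> P a b = P' a b"
  shows "(\<exists>a\<in>dom KK. \<exists>b\<in>dom KK. isPair KK z a b \<and> P a b) = (\<exists>a b. z = opair a b \<and> P' a b)"
  unfolding in_struct_simps isPair_in[OF trans assms(1)] using assms pairK by blast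

lemma exRel_cong:
  assumes "g \<in> K" "\<And>b. b \<in> K \<Longrightarrow> P b = P' b"
  shows "(\<exists>b\<in>dom KK. Rel KK g x b \<and> P b) = (\<exists>b. opair x b \<in> elts g \<and> P' b)"
  unfolding in_struct_simps Rel_in[OF trans assms(1)] using assms relK by blast

lemma exIn_cong:
  assumes "w \<in> K" "\<And>b. b \<in> K \<Longrightarrow> P b = P' b"
  shows "(\<exists>b\<in>dom KK. mem KK b w \<and> P b) = (\<exists>b\<in>elts w. P' b)"
  unfolding in_struct_simps using assms tr by blast

lemma allIn_cong:
  assumes "w \<in> K" "\<And>b. b \<in> K \<Longrightarrow> P b = P' b"
  shows "(\<forall>b\<in>dom KK. mem KK b w \<longrightarrow> P b) = (\<forall>b\<in>elts w. P' b)"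
  unfolding in_struct_simps using assms tr by blast

lemma allRel_cong:
  assumes "g \<in> K" "\<And>a b. a \<in> K \<Longrightarrow> b \<in> K \<Longrightarrow> P a b = P' a b"
  shows "(\<forall>a\<in>dom KK. \<forall>b\<in>dom KK. Rel KK g a b \<longrightarrow> P a b) = (\<forall>a b. opair a b \<in> elts g \<longrightarrow> P' a b)"
  unfolding in_struct_simps Rel_in[OF trans assms(1)] using assms relK by blast

lemma conj_eqI: "P = P' \<Longrightarrow> Q = Q' \<Longrightarrow> (P \<and> Q) = (P' \<and> Q')" by simp
lemma disj_eqI: "P = P' \<Longrightarrow> Q = Q' \<Longrightarrow> (P \<or> Q) = (P' \<or> Q')" by simp
lemma not_eqI: "P = P' \<Longrightarrow> (\<not> P) = (\<not> P')" by simp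

lemma upd_in:
  assumes "s \<in> K" "s' \<in> K"
  shows "upd KK s x a s' \<longleftrightarrow> updr s x a s'"
  unfolding upd_def updr_def
  by (intro conj_eqI allRel_cong Rel_in[OF trans] disj_eqI not_eqI refl assms)

lemma has_value_in:
  assumes "T \<in> K"
  shows "has_value KK T c s k \<longleftrightarrow> opair (opair c s) (num k) \<in> elts T"
proof -
  have "has_value KK T c s k \<longleftrightarrow> (\<exists>z\<in>elts T. \<exists>p b. z = opair p b \<and> (b = num k \<and> p = opair c s))"
    unfolding has_value_def by (intro exIn_cong exPair_cong conj_eqI isN_in isPair_in[OF trans] assms)
  then show ?thesis by blast
qed

lemma upd_value_in:
  assumes "T \<in> K" "s \<in> K"
  shows "upd_value KK T s x a p k \<longleftrightarrow> (\<exists>s'. updr s x a s' \<and> opair (opair p s') (num k) \<in> elts T)"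
proof -
  have "upd_value KK T s x a p k \<longleftrightarrow> (\<exists>z\<in>elts T. \<exists>q b. z = opair q b \<and> (b = num k \<and> (\<exists>p' s'. q = opair p' s' \<and> (p' = p \<and> updr s x a s'))))"
    unfolding upd_value_def by (intro exIn_cong exPair_cong conj_eqI isN_in refl upd_in assms)
  then show ?thesis by blast
qed

lemma justified_in:
  assumes "T \<in> K" "c \<in> K" "s \<in> K" "b \<in> K"
  shows "justified KK T c s b \<longleftrightarrow> justifies T c s b"
  unfolding justified_def justifies_def
  by (intro exPair_cong exRel_cong exIn_cong allIn_cong conj_eqI disj_eqI not_eqI isN_in has_value_in upd_value_in assms refl in_struct_simps)

lemma truth_set_in:
  assumes "T \<in> K"
  shows "truth_set KK T \<longleftrightarrow> (\<forall>c s b. opair (opair c s) b \<in> elts T \<longrightarrow> justifies T c s b)"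
proof
  assume J: "truth_set KK T"
  show "\<forall>c s b. opair (opair c s) b \<in> elts T \<longrightarrow> justifies T c s b"
  proof (intro allI impI)
    fix c s b assume e: "opair (opair c s) b \<in> elts T"
    have z: "opair (opair c s) b \<in> K" using tr[OF assms e] .
    then have k: "opair c s \<in> K" "b \<in> K" "c \<in> K" "s \<in> K" using pairK by blast+
    have "justified KK T c s b"
      using J[unfolded truth_set_def in_struct_simps, rule_format, OF z e k(1,2) _ k(3,4)]
      unfolding isPair_in[OF trans z] isPair_in[OF trans k(1)] by blast
    then show "justifies T c s b" by (rule iffD1[OF justified_in[OF assms k(3,4,2)]])
  qed
next
  assume j: "\<forall>c s b. opair (opair c s) b \<in> elts T \<longrightarrow> justifies T c s b"
  show "truth_set KK T" unfolding truth_set_def in_struct_simps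
  proof (intro ballI impI)
    fix z p b c s assume z: "z \<in> K" "z \<in> elts T" and p: "p \<in> K" "b \<in> K" "isPair KK z p b"
      and c: "c \<in> K" "s \<in> K" "isPair KK p c s"
    have "z = opair (opair c s) b" using iffD1[OF isPair_in[OF trans z(1)] p(3)] iffD1[OF isPair_in[OF trans p(1)] c(3)] by simp
    then have "justifies T c s b" using j z(2) by simp
    then show "justified KK T c s b" by (rule iffD2[OF justified_in[OF assms c(1,2) p(2)]])
  qed
qed

lemma agree_in:
  assumes "B \<in> K" "s \<in> K" "t \<in> K"
  shows "agree KK B s t \<longleftrightarrow>
     (\<forall>j b. opair j b \<in> elts t \<longrightarrow> j \<in> elts B \<or> opair j b \<in> elts s) \<and>
     (\<forall>j b. opair j b \<in> elts s \<longrightarrow> j \<in> elts B \<or> opair j b \<in> elts t) \<and>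
     (\<forall>j\<in>elts B. \<exists>a. opair j a \<in> elts t \<and> (\<forall>a'. opair j a' \<in> elts t \<longrightarrow> a' = a))"
proof -
  have 1: "(\<forall>a'\<in>dom KK. Rel KK t j a' \<longrightarrow> a' = a) = (\<forall>a'. opair j a' \<in> elts t \<longrightarrow> a' = a)" for j a
    unfolding in_struct_simps Rel_in[OF trans assms(3)] using relK[OF assms(3)] by blast
  show ?thesis unfolding agree_def
    by (intro conj_eqI allRel_cong exRel_cong allIn_cong disj_eqI Rel_in[OF trans] 1 assms in_struct_simps)
qed

end

text \<open>
  The truth set \<open>T\<close> makes false the matrix of a bounded quantifier when its variable has the value \<open>a\<close>. Collection for this
  one predicate is all that is needed to evaluate bounded formulas.
\<close>

definition refutes :: "'a struct \<Rightarrow> (nat \<Rightarrow> 'a) \<Rightarrow> 'a \<Rightarrow> 'a \<Rightarrow> bool" where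
  "refutes M s a T \<longleftrightarrow> truth_set M T \<and> upd_value M T (s 0) (s (Suc 0)) a (s (Suc (Suc 0))) 0"

lemma D0_refutes: "D0 C (\<lambda>M s. refutes M (\<lambda>i. s (Suc (Suc i))) (s (Suc 0)) (s 0))"
  unfolding refutes_def by (intro D0_conj D0_truth_set D0_upd_value)

text \<open>
  The set \<open>s\<close> represents the assignment \<open>f\<close> on the variables in \<open>X\<close>.
\<close>

definition Asg :: "'k V \<Rightarrow> (nat \<Rightarrow> 'k V) \<Rightarrow> nat set \<Rightarrow> bool" where
  "Asg s f X \<longleftrightarrow> (\<forall>i\<in>X. \<forall>a. opair (num i) a \<in> elts s \<longleftrightarrow> a = f i)"

lemma Asg_upd: "Asg s f X \<Longrightarrow> updr s (num x) a s' \<Longrightarrow> Asg s' (f(x := a)) (insert x X)"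
proof (unfold Asg_def, intro ballI allI)
  fix i b assume A: "\<forall>i\<in>X. \<forall>a. (opair (num i) a \<in> elts s) = (a = f i)" and u: "updr s (num x) a s'"
    and i: "i \<in> insert x X"
  note u' = u[unfolded updr_def]
  show "(opair (num i) b \<in> elts s') = (b = (f(x := a)) i)"
  proof (cases "i = x")
    case True
    then show ?thesis using u' by auto
  next
    case False
    then have n: "(num i :: 'a V) \<noteq> num x" by (simp add: num_inj)
    then have "opair (num i) b \<in> elts s' \<longleftrightarrow> opair (num i) b \<in> elts s" using u' by blast
    then show ?thesis using A i False by simp
  qed
qed

definition blk :: "nat set \<Rightarrow> 'k V" where "blk X = vset (num ` X)"

lemma elts_blk: "finite X \<Longrightarrow> elts (blk X) = num ` X" by (simp add: blk_def)

text \<open>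
  Codes must belong to the small model under construction as well as to \<open>A\<close>. They are hereditarily finite, and therefore
  in the intersection of all transitive models.
\<close>

definition core :: "'k V set" where "core = {e. \<forall>K. trans_model K \<longrightarrow> e \<in> K}"

lemma (in trans_model) core_in: "e \<in> core \<Longrightarrow> e \<in> K"
  unfolding core_def using trans_model_axioms by blast

lemma blk_core: "finite X \<Longrightarrow> blk X \<in> core"
  unfolding core_def blk_def using trans_model.finite_in trans_model.num_in by blast

lemma opair_core: "a \<in> core \<Longrightarrow> b \<in> core \<Longrightarrow> opair a b \<in> core"
  unfolding core_def using trans_model.opair by blast

lemma num_core: "num i \<in> core"
  unfolding core_def using trans_model.num_in by blast

lemma code_core: "code b \<in> core"
  by (induction b) (simp_all add: opair_core num_core)

context trans_model
begin

lemmas blk_in = core_in[OF blk_core] and code_in = core_in[OF code_core]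

lemma Asg_ex:
  assumes "finite X" "range f \<subseteq> K"
  shows "\<exists>s\<in>K. Asg s f X"
proof (rule bexI)
  show "Asg (vset ((\<lambda>i. opair (num i) (f i)) ` X)) f X"
    using assms(1) by (auto simp: Asg_def num_inj)
  show "vset ((\<lambda>i. opair (num i) (f i)) ` X) \<in> K"
    by (rule finite_in) (use assms opair[OF num_in] in auto)
qed

end

locale univ = trans_model K for K :: "'k V set" +
  assumes coll_refutes: "\<And>s. range s \<subseteq> K \<Longrightarrow> coll (in_struct K) (refutes (in_struct K) s)"
begin

lemma sound:
  assumes T: "T \<in> K" "truth_set KK T"
  shows "opair (opair (code p) s) b \<in> elts T \<Longrightarrow> Asg s f X \<Longrightarrow> bfv p \<subseteq> X \<Longrightarrow>
    (b = num 1 \<and> beval f p) \<or> (b = num 0 \<and> \<not> beval f p)"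
proof (induction p arbitrary: s b f X)
  case (BMem x y)
  have "justifies T (code (BMem x y)) s b" using T BMem(1) truth_set_in[OF T(1)] by blast
  then show ?case using BMem(2,3) by (auto simp: justifies_def num_inj Asg_def)
next
  case (BEq x y)
  have "justifies T (code (BEq x y)) s b" using T BEq(1) truth_set_in[OF T(1)] by blast
  then show ?case using BEq(2,3) by (auto simp: justifies_def num_inj Asg_def)
next
  case (BNand p q)
  have j: "justifies T (code (BNand p q)) s b" using T BNand(3) truth_set_in[OF T(1)] by blast
  have sub: "bfv p \<subseteq> X" "bfv q \<subseteq> X" using BNand.prems by auto
  note IH = BNand.IH(1)[OF _ BNand.prems(2) sub(1)] BNand.IH(2)[OF _ BNand.prems(2) sub(2)]
  from j have "(b = num 1 \<and> (opair (opair (code p) s) (num 0) \<in> elts T \<or> opair (opair (code q) s) (num 0) \<in> elts T)) \<or>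
    (b = num 0 \<and> (opair (opair (code p) s) (num 1) \<in> elts T \<and> opair (opair (code q) s) (num 1) \<in> elts T))"
    by (simp add: justifies_def num_inj)
  then show ?case using IH[of "num 0"] IH[of "num 1"] by (auto simp: num_inj)
next
  case (BEx x y p)
  have j: "justifies T (code (BEx x y p)) s b" using T BEx(2) truth_set_in[OF T(1)] by blast
  have w: "opair (num y) w \<in> elts s \<longleftrightarrow> w = f y" for w using BEx.prems by (auto simp: Asg_def)
  from j have c: "(b = num 1 \<and> (\<exists>a\<in>elts (f y). \<exists>s'. updr s (num x) a s' \<and> opair (opair (code p) s') (num 1) \<in> elts T)) \<or>
          (b = num 0 \<and> (\<forall>a\<in>elts (f y). \<exists>s'. updr s (num x) a s' \<and> opair (opair (code p) s') (num 0) \<in> elts T))"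
    by (simp add: justifies_def num_inj w)
  have IH: "(b' = num 1 \<and> beval (f(x := a)) p) \<or> (b' = num 0 \<and> \<not> beval (f(x := a)) p)"
    if "updr s (num x) a s'" "opair (opair (code p) s') b' \<in> elts T" for a s' b'
    by (rule BEx.IH[OF that(2) Asg_upd[OF BEx.prems(2) that(1)]]) (use BEx.prems in auto)
  have n01: "(num 0 :: 'k V) \<noteq> num 1" by (simp add: num_inj)
  from c show ?case
  proof (elim disjE conjE)
    assume b: "b = num 1" and "\<exists>a\<in>elts (f y). \<exists>s'. updr s (num x) a s' \<and> opair (opair (code p) s') (num 1) \<in> elts T"
    then obtain a s' where a: "a \<in> elts (f y)" "updr s (num x) a s'" "opair (opair (code p) s') (num 1) \<in> elts T" by blast
    from IH[OF a(2,3)] have "beval (f(x := a)) p" using n01 by auto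
    then show ?thesis using a(1) b by auto
  next
    assume b: "b = num 0" and all: "\<forall>a\<in>elts (f y). \<exists>s'. updr s (num x) a s' \<and> opair (opair (code p) s') (num 0) \<in> elts T"
    have "\<not> beval (f(x := a)) p" if "a \<in> elts (f y)" for a
      using all[rule_format, OF that] IH n01 by blast
    then show ?thesis using b by auto
  qed
qed

lemma add_triple:
  assumes "T \<in> K" "truth_set KK T" "justifies T c s b" "c \<in> K" "s \<in> K" "b \<in> K"
  shows "\<exists>T'\<in>K. truth_set KK T' \<and> opair (opair c s) b \<in> elts T'"
proof -
  have "opair (opair c s) b \<in> K" using assms(4-6) opair by blast
  then obtain T' where T': "T' \<in> K" "elts T' = insert (opair (opair c s) b) (elts T)"
    using vinsert[OF _ assms(1)] by blast
  have sub: "elts T \<subseteq> elts T'" using T'(2) by blast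
  have "truth_set KK T'" unfolding truth_set_in[OF T'(1)] T'(2)
    using assms(2)[unfolded truth_set_in[OF assms(1)]] justifies_mono[OF _ sub] assms(3) by auto
  then show ?thesis using T' by blast
qed

lemma upd_ex:
  assumes "s \<in> K" "x \<in> K" "a \<in> K"
  shows "\<exists>s'\<in>K. updr s x a s'"
proof -
  have "\<exists>s1\<in>K. elts s1 = {z \<in> elts s. (\<lambda>M s z. \<forall>j\<in>dom M. \<forall>b\<in>dom M. isPair M z j b \<longrightarrow> \<not> j = s 0) KK (\<lambda>_. x) z}"
    by (rule sep0) (use assms in \<open>auto intro!: D0_AllPair D0_rules\<close>)
  then obtain s1 where s1: "s1 \<in> K" "elts s1 = {z \<in> elts s. \<forall>j\<in>K. \<forall>b\<in>K. isPair KK z j b \<longrightarrow> \<not> j = x}" by auto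
  have e1: "opair j b \<in> elts s1 \<longleftrightarrow> opair j b \<in> elts s \<and> j \<noteq> x" for j b
  proof (cases "opair j b \<in> elts s")
    case True
    then have "opair j b \<in> K" using tr[OF assms(1)] by blast
    then show ?thesis unfolding s1(2) using True pairK by (auto simp: isPair_in[OF trans])
  qed (simp add: s1(2))
  obtain s' where s': "s' \<in> K" "elts s' = insert (opair x a) (elts s1)"
    using vinsert[OF opair[OF assms(2,3)] s1(1)] by blast
  have "updr s x a s'" unfolding updr_def s'(2) by (auto simp: e1)
  then show ?thesis using s'(1) by blast
qed

text \<open>
  By induction on \<open>p\<close>. In the only infinitary case, that of a false bounded quantification, truth sets for all instances are collected
  into \<open>C\<close>, and the union of those members of \<open>C\<close> that are truth sets is again one.
\<close>

lemma complete:
  "s \<in> K \<Longrightarrow> Asg s f X \<Longrightarrow> bfv p \<subseteq> X \<Longrightarrow>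
    \<exists>T\<in>K. truth_set KK T \<and> opair (opair (code p) s) (num (if beval f p then 1 else 0)) \<in> elts T"
proof (induction p arbitrary: s f X)
  case (BMem x y)
  have J0: "truth_set KK (vset {})" unfolding truth_set_in[OF emptyK] by simp
  have "justifies (vset {}) (code (BMem x y)) s (num (if beval f (BMem x y) then 1 else 0))"
    using BMem(2,3) by (auto simp: justifies_def num_inj Asg_def)
  then show ?case by (rule add_triple[OF emptyK J0 _ code_in BMem(1) num_in])
next
  case (BEq x y)
  have J0: "truth_set KK (vset {})" unfolding truth_set_in[OF emptyK] by simp
  have "justifies (vset {}) (code (BEq x y)) s (num (if beval f (BEq x y) then 1 else 0))"
    using BEq(2,3) by (auto simp: justifies_def num_inj Asg_def)
  then show ?case by (rule add_triple[OF emptyK J0 _ code_in BEq(1) num_in])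
next
  case (BNand p q)
  have sub: "bfv p \<subseteq> X" "bfv q \<subseteq> X" using BNand.prems by auto
  obtain T1 where T1: "T1 \<in> K" "truth_set KK T1" "opair (opair (code p) s) (num (if beval f p then 1 else 0)) \<in> elts T1"
    using BNand.IH(1)[OF BNand.prems(1,2) sub(1)] by blast
  obtain T2 where T2: "T2 \<in> K" "truth_set KK T2" "opair (opair (code q) s) (num (if beval f q then 1 else 0)) \<in> elts T2"
    using BNand.IH(2)[OF BNand.prems(1,2) sub(2)] by blast
  obtain T where T: "T \<in> K" "elts T = elts T1 \<union> elts T2" using un[OF T1(1) T2(1)] by blast
  have sT: "elts T1 \<subseteq> elts T" "elts T2 \<subseteq> elts T" using T(2) by auto
  have J: "truth_set KK T" unfolding truth_set_in[OF T(1)] T(2)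
    using T1(2)[unfolded truth_set_in[OF T1(1)]] T2(2)[unfolded truth_set_in[OF T2(1)]] justifies_mono[OF _ sT(1)] justifies_mono[OF _ sT(2)]
    by blast
  have "opair (opair (code p) s) (num (if beval f p then 1 else 0)) \<in> elts T"
    "opair (opair (code q) s) (num (if beval f q then 1 else 0)) \<in> elts T" using T1(3) T2(3) sT by blast+
  then have "justifies T (code (BNand p q)) s (num (if beval f (BNand p q) then 1 else 0))"
    by (auto simp: justifies_def num_inj split: if_splits)
  then show ?case by (rule add_triple[OF T(1) J _ code_in BNand.prems(1) num_in])
next
  case (BEx x y p)
  have w: "opair (num y) w \<in> elts s \<longleftrightarrow> w = f y" for w using BEx.prems by (auto simp: Asg_def)
  then have wK: "f y \<in> K" using relK[OF BEx.prems(1), of "num y" "f y"] by blast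
  have IH: "\<exists>T\<in>K. truth_set KK T \<and> opair (opair (code p) s') (num (if beval (f(x := a)) p then 1 else 0)) \<in> elts T"
    if "s' \<in> K" "updr s (num x) a s'" for s' a
    by (rule BEx.IH[OF that(1) Asg_upd[OF BEx.prems(2) that(2)]]) (use BEx.prems in auto)
  show ?case
  proof (cases "beval f (BEx x y p)")
    case True
    then obtain a where a: "a \<in> elts (f y)" "beval (f(x := a)) p" by auto
    obtain s' where s': "s' \<in> K" "updr s (num x) a s'"
      using upd_ex[OF BEx.prems(1) num_in tr[OF wK a(1)]] by blast
    obtain T where T: "T \<in> K" "truth_set KK T" "opair (opair (code p) s') (num 1) \<in> elts T"
      using IH[OF s'] a(2) by auto
    have "justifies T (code (BEx x y p)) s (num (if beval f (BEx x y p) then 1 else 0))"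
      using True T(3) s'(2) a(1) by (auto simp: justifies_def num_inj w)
    then show ?thesis by (rule add_triple[OF T(1,2) _ code_in BEx.prems(1) num_in])
  next
    case False
    then have na: "\<not> beval (f(x := a)) p" if "a \<in> elts (f y)" for a using that by auto
    let ?s = "s ## num x ## (\<lambda>_. code p)"
    have rs: "range ?s \<subseteq> K" using BEx.prems(1) num_in code_in by simp
    have refutes: "refutes KK ?s a T \<longleftrightarrow> truth_set KK T \<and> (\<exists>s'. updr s (num x) a s' \<and> opair (opair (code p) s') (num 0) \<in> elts T)"
      if "T \<in> K" for a T
      using upd_value_in[OF that BEx.prems(1)] by (simp add: refutes_def)
    have "\<exists>C\<in>K. \<forall>a\<in>K. a \<in> elts (f y) \<longrightarrow> (\<exists>T\<in>K. T \<in> elts C \<and> refutes KK ?s a T)"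
    proof -
      have "\<exists>T\<in>dom KK. refutes KK ?s a T" if "a \<in> dom KK" "mem KK a (f y)" for a
      proof -
        have ay: "a \<in> elts (f y)" using that by simp
        obtain s' where s': "s' \<in> K" "updr s (num x) a s'"
          using upd_ex[OF BEx.prems(1) num_in tr[OF wK ay]] by blast
        obtain T where T: "T \<in> K" "truth_set KK T" "opair (opair (code p) s') (num 0) \<in> elts T"
          using IH[OF s'] na[OF ay] by auto
        show ?thesis using T s'(2) refutes[OF T(1)] by auto
      qed
      from collD[OF coll_refutes[OF rs] _ this] wK show ?thesis by auto
    qed
    then obtain C where C: "C \<in> K" "\<And>a. a \<in> elts (f y) \<Longrightarrow> \<exists>T\<in>K. T \<in> elts C \<and> refutes KK ?s a T"
      using tr[OF wK] by blast
    obtain U where U: "U \<in> K" "elts U = (\<Union>T\<in>elts C. elts T)" using union[OF C(1)] by blast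
    have "\<exists>T0\<in>K. elts T0 = {z \<in> elts U. (\<lambda>M s z. \<exists>T\<in>dom M. mem M T (s 0) \<and> (truth_set M T \<and> mem M z T)) KK (\<lambda>_. C) z}"
      by (rule sep0) (use C U in \<open>auto intro!: D0_rules D0_truth_set\<close>)
    then obtain T0 where T0: "T0 \<in> K" "elts T0 = {z \<in> elts U. \<exists>T\<in>K. T \<in> elts C \<and> truth_set KK T \<and> z \<in> elts T}" by auto
    have sub: "elts T \<subseteq> elts T0" if "T \<in> elts C" "truth_set KK T" for T
      unfolding T0(2) U(2) using that tr[OF C(1)] by blast
    have J: "truth_set KK T0" unfolding truth_set_in[OF T0(1)]
    proof (intro allI impI)
      fix c s b assume "opair (opair c s) b \<in> elts T0"
      then obtain T where T: "T \<in> K" "T \<in> elts C" "truth_set KK T" "opair (opair c s) b \<in> elts T" unfolding T0(2) by blast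
      then have "justifies T c s b" using truth_set_in[OF T(1)] by blast
      then show "justifies T0 c s b" by (rule justifies_mono[OF _ sub[OF T(2,3)]])
    qed
    have "\<exists>s'. updr s (num x) a s' \<and> opair (opair (code p) s') (num 0) \<in> elts T0" if a: "a \<in> elts (f y)" for a
    proof -
      obtain T where T: "T \<in> K" "T \<in> elts C" "refutes KK ?s a T" using C(2)[OF a] by blast
      then show ?thesis using refutes[OF T(1)] sub[OF T(2)] by blast
    qed
    then have "justifies T0 (code (BEx x y p)) s (num (if beval f (BEx x y p) then 1 else 0))"
      using False by (auto simp: justifies_def num_inj w)
    then show ?thesis by (rule add_triple[OF T0(1) J _ code_in BEx.prems(1) num_in])
  qed
qed

lemma dsat:
  assumes "s \<in> K" "Asg s f X" "bfv p \<subseteq> X"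
  shows "(\<exists>T\<in>dom KK. truth_set KK T \<and> has_value KK T (code p) s 1) \<longleftrightarrow> beval f p"
    and "(\<exists>T\<in>dom KK. truth_set KK T \<and> has_value KK T (code p) s 0) \<longleftrightarrow> \<not> beval f p"
proof -
  have n01: "(num 0 :: 'k V) \<noteq> num 1" by (simp add: num_inj)
  obtain T where T: "T \<in> K" "truth_set KK T" "opair (opair (code p) s) (num (if beval f p then 1 else 0)) \<in> elts T"
    using complete[OF assms] by blast
  have *: "\<exists>T\<in>dom KK. truth_set KK T \<and> has_value KK T (code p) s (if beval f p then 1 else 0)"
    using T has_value_in[OF T(1)] by auto
  have s1: "beval f p" if "T \<in> dom KK" "truth_set KK T \<and> has_value KK T (code p) s 1" for T
    using sound[of T p s "num 1" f X] that has_value_in[of T] assms n01 by auto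
  have s0: "\<not> beval f p" if "T \<in> dom KK" "truth_set KK T \<and> has_value KK T (code p) s 0" for T
    using sound[of T p s "num 0" f X] that has_value_in[of T] assms n01 by auto
  show "(\<exists>T\<in>dom KK. truth_set KK T \<and> has_value KK T (code p) s 1) \<longleftrightarrow> beval f p"
    using * s1 by (auto split: if_splits)
  show "(\<exists>T\<in>dom KK. truth_set KK T \<and> has_value KK T (code p) s 0) \<longleftrightarrow> \<not> beval f p"
    using * s0 by (auto split: if_splits)
qed

lemma agree_out:
  assumes X: "finite X" and s: "s \<in> K" "Asg s f V" "t \<in> K" "agree KK (blk X) s t" and f: "range f \<subseteq> K"
  shows "\<exists>g. range g \<subseteq> K \<and> eqoff X f g \<and> Asg t g (V \<union> X)"
proof -
  note a = s(4)[unfolded agree_in[OF blk_in[OF X] s(1,3)] elts_blk[OF X]]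
  have "\<forall>i. \<exists>a. i \<in> X \<longrightarrow> (\<forall>a'. opair (num i) a' \<in> elts t \<longleftrightarrow> a' = a)" using a by blast
  then obtain h where h: "\<And>i a'. i \<in> X \<Longrightarrow> opair (num i) a' \<in> elts t \<longleftrightarrow> a' = h i" by metis
  let ?g = "\<lambda>i. if i \<in> X then h i else f i"
  have "h i \<in> K" if "i \<in> X" for i using relK[OF s(3), of "num i" "h i"] h[OF that] by blast
  then have "range ?g \<subseteq> K" using f by auto
  moreover have "Asg t ?g (V \<union> X)" unfolding Asg_def
  proof (intro ballI allI)
    fix i a' assume i: "i \<in> V \<union> X"
    show "opair (num i) a' \<in> elts t \<longleftrightarrow> a' = ?g i"
    proof (cases "i \<in> X")
      case True
      then show ?thesis using h by simp
    next
      case False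
      then have n: "(num i :: 'k V) \<notin> num ` X" by (auto simp: num_inj)
      have "opair (num i) a' \<in> elts t \<longleftrightarrow> opair (num i) a' \<in> elts s" using a n by blast
      then show ?thesis using s(2) False i by (auto simp: Asg_def)
    qed
  qed
  ultimately show ?thesis by (intro exI[of _ ?g]) (auto simp: eqoff_def)
qed

lemma agree_ex:
  assumes X: "finite X" and s: "s \<in> K" "Asg s f V" and g: "range g \<subseteq> K" "eqoff X f g"
  shows "\<exists>t\<in>K. agree KK (blk X) s t \<and> Asg t g (V \<union> X)"
proof -
  have "\<exists>s1\<in>K. elts s1 = {z \<in> elts s. (\<lambda>M s z. \<forall>j\<in>dom M. \<forall>b\<in>dom M. isPair M z j b \<longrightarrow> \<not> mem M j (s 0)) KK (\<lambda>_. blk X) z}"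
    by (rule sep0) (use s blk_in[OF X] in \<open>auto intro!: D0_AllPair D0_rules\<close>)
  then obtain s1 where s1: "s1 \<in> K" "elts s1 = {z \<in> elts s. \<forall>j\<in>K. \<forall>b\<in>K. isPair KK z j b \<longrightarrow> j \<notin> elts (blk X)}" by auto
  have e1: "opair j b \<in> elts s1 \<longleftrightarrow> opair j b \<in> elts s \<and> j \<notin> num ` X" for j b
  proof (cases "opair j b \<in> elts s")
    case True
    then have "opair j b \<in> K" using tr[OF s(1)] by blast
    then show ?thesis unfolding s1(2) elts_blk[OF X] using True pairK by (auto simp: isPair_in[OF trans])
  qed (simp add: s1(2))
  have fin: "vset ((\<lambda>i. opair (num i) (g i)) ` X) \<in> K"
    by (rule finite_in) (use X g(1) opair[OF num_in] in auto)
  obtain t where t: "t \<in> K" "elts t = elts s1 \<union> (\<lambda>i. opair (num i) (g i)) ` X"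
    using un[OF s1(1) fin] X by auto
  have et: "opair j b \<in> elts t \<longleftrightarrow> (opair j b \<in> elts s \<and> j \<notin> num ` X) \<or> (\<exists>i\<in>X. j = num i \<and> b = g i)" for j b
    unfolding t(2) by (auto simp: e1)
  have "agree KK (blk X) s t" unfolding agree_in[OF blk_in[OF X] s(1) t(1)] elts_blk[OF X] et
    by (auto simp: num_inj)
  moreover have "Asg t g (V \<union> X)" unfolding Asg_def
  proof (intro ballI allI)
    fix i a' assume i: "i \<in> V \<union> X"
    show "opair (num i) a' \<in> elts t \<longleftrightarrow> a' = g i"
    proof (cases "i \<in> X")
      case True
      then show ?thesis unfolding et by (auto simp: num_inj)
    next
      case False
      then have "(num i :: 'k V) \<notin> num ` X" by (auto simp: num_inj)
      moreover have "g i = f i" using g(2) False by (auto simp: eqoff_def)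
      ultimately show ?thesis unfolding et using s(2) False i by (auto simp: Asg_def num_inj)
    qed
  qed
  ultimately show ?thesis using t(1) by blast
qed

lemma block_ex:
  assumes X: "finite X" and s: "s \<in> K" "Asg s f V" "range f \<subseteq> K" and c: "c \<in> K"
    and Q: "\<And>t g. t \<in> K \<Longrightarrow> Asg t g (V \<union> X) \<Longrightarrow> range g \<subseteq> K \<Longrightarrow> P t \<longleftrightarrow> Q g"
  shows "(\<exists>t\<in>K. agree KK (blk X) s t \<and> P t) \<longleftrightarrow> (\<exists>g. range g \<subseteq> K \<and> eqoff X f g \<and> Q g)"
proof
  assume "\<exists>t\<in>K. agree KK (blk X) s t \<and> P t"
  then obtain t where t: "t \<in> K" "agree KK (blk X) s t" "P t" by blast
  from agree_out[OF X s(1,2) t(1,2) s(3)] obtain g where "range g \<subseteq> K" "eqoff X f g" "Asg t g (V \<union> X)" by blast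
  then show "\<exists>g. range g \<subseteq> K \<and> eqoff X f g \<and> Q g" using Q[OF t(1)] t(3) by blast
next
  assume "\<exists>g. range g \<subseteq> K \<and> eqoff X f g \<and> Q g"
  then obtain g where g: "range g \<subseteq> K" "eqoff X f g" "Q g" by blast
  from agree_ex[OF X s(1,2) g(1,2)] obtain t where "t \<in> K" "agree KK (blk X) s t" "Asg t g (V \<union> X)" by blast
  then show "\<exists>t\<in>K. agree KK (blk X) s t \<and> P t" using Q g by blast
qed

lemma US_pair:
  assumes "B \<in> K" "c \<in> K"
  shows "US 0 KK (opair B c) s \<longleftrightarrow> (\<exists>t\<in>K. agree KK B s t \<and> (\<exists>T\<in>dom KK. truth_set KK T \<and> has_value KK T c t 1))"
    "UP 0 KK (opair B c) s \<longleftrightarrow> (\<forall>t\<in>K. agree KK B s t \<longrightarrow> \<not> (\<exists>T\<in>dom KK. truth_set KK T \<and> has_value KK T c t 0))"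
    "US (Suc k) KK (opair B c) s \<longleftrightarrow> (\<exists>t\<in>K. agree KK B s t \<and> UP k KK c t)"
    "UP (Suc k) KK (opair B c) s \<longleftrightarrow> (\<forall>t\<in>K. agree KK B s t \<longrightarrow> US k KK c t)"
  using assms by (auto simp: isPair_in[OF trans opair[OF assms]])

text \<open>
  By induction on \<open>k\<close>, from the normal form in which a formula is a block of quantifiers followed by a formula of lower level; a
  block corresponds to a quantifier over assignments that agree outside it.
\<close>

lemma universal:
  shows "is_Sigma (Suc k) p \<Longrightarrow> \<exists>B\<in>core. \<exists>c\<in>core. \<forall>s f V. s \<in> K \<longrightarrow> Asg s f V \<longrightarrow> fv p \<subseteq> V \<longrightarrow> range f \<subseteq> K \<longrightarrow>
      US k KK (opair B c) s = sat KK f p"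
    and "is_Pi (Suc k) p \<Longrightarrow> \<exists>B\<in>core. \<exists>c\<in>core. \<forall>s f V. s \<in> K \<longrightarrow> Asg s f V \<longrightarrow> fv p \<subseteq> V \<longrightarrow> range f \<subseteq> K \<longrightarrow>
      UP k KK (opair B c) s = sat KK f p"
proof (induction k arbitrary: p)
  case 0
  {
    case 1
    obtain X q where X: "finite X" "is_Pi 0 q" "fv q \<subseteq> fv p \<union> X" "\<And>f. range f \<subseteq> dom KK \<Longrightarrow>
        sat KK f p = (\<exists>t. range t \<subseteq> dom KK \<and> eqoff X f t \<and> sat KK t q)"
      using Sigma_block[OF 1, where 'a = "'k V"] by metis
    from X(2) have "q \<in> Delta0" by (auto elim: is_Pi.cases)
    from Delta0_bfm[OF this] obtain b where b: "bfv b \<subseteq> fv q" "\<And>f. range f \<subseteq> K \<Longrightarrow> sat KK f q = beval f b"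
      using trans by metis
    show ?case
    proof (rule bexI[of _ "blk X"], rule bexI[of _ "code b"], intro allI impI)
      fix s f V assume s: "s \<in> K" "Asg s f V" "fv p \<subseteq> V" "range f \<subseteq> K"
      show "US 0 KK (opair (blk X) (code b)) s = sat KK f p"
        unfolding US_pair(1)[OF blk_in[OF X(1)] code_in]
      proof (subst block_ex[OF X(1) s(1,2,4) code_in, of _ "\<lambda>g. sat KK g q"])
        fix t g assume "t \<in> K" "Asg t g (V \<union> X)" "range g \<subseteq> K"
        then show "(\<exists>T\<in>dom KK. truth_set KK T \<and> has_value KK T (code b) t 1) = sat KK g q"
          using dsat(1)[of t g "V \<union> X" b] b(2)[of g] subset_trans[OF b(1) subset_trans[OF X(3) Un_mono[OF s(3) subset_refl]]] by simp
      qed (use X(4)[of f] s(4) in simp)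
    qed (use blk_core[OF X(1)] code_core in blast)+
  next
    case 2
    obtain X q where X: "finite X" "is_Sigma 0 q" "fv q \<subseteq> fv p \<union> X" "\<And>f. range f \<subseteq> dom KK \<Longrightarrow>
        sat KK f p = (\<forall>t. range t \<subseteq> dom KK \<and> eqoff X f t \<longrightarrow> sat KK t q)"
      using Pi_block[OF 2, where 'a = "'k V"] by metis
    from X(2) have "q \<in> Delta0" by (auto elim: is_Sigma.cases)
    from Delta0_bfm[OF this] obtain b where b: "bfv b \<subseteq> fv q" "\<And>f. range f \<subseteq> K \<Longrightarrow> sat KK f q = beval f b"
      using trans by metis
    show ?case
    proof (rule bexI[of _ "blk X"], rule bexI[of _ "code b"], intro allI impI)
      fix s f V assume s: "s \<in> K" "Asg s f V" "fv p \<subseteq> V" "range f \<subseteq> K"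
      have "(\<exists>t\<in>K. agree KK (blk X) s t \<and> (\<exists>T\<in>dom KK. truth_set KK T \<and> has_value KK T (code b) t 0)) \<longleftrightarrow>
        (\<exists>g. range g \<subseteq> K \<and> eqoff X f g \<and> \<not> sat KK g q)"
      proof (rule block_ex[OF X(1) s(1,2,4) code_in])
        fix t g assume "t \<in> K" "Asg t g (V \<union> X)" "range g \<subseteq> K"
        then show "(\<exists>T\<in>dom KK. truth_set KK T \<and> has_value KK T (code b) t 0) = (\<not> sat KK g q)"
          using dsat(2)[of t g "V \<union> X" b] b(2)[of g] subset_trans[OF b(1) subset_trans[OF X(3) Un_mono[OF s(3) subset_refl]]] by simp
      qed
      then show "UP 0 KK (opair (blk X) (code b)) s = sat KK f p"
        unfolding US_pair(2)[OF blk_in[OF X(1)] code_in] using X(4)[of f] s(4) by auto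
    qed (use blk_core[OF X(1)] code_core in blast)+
  }
next
  case (Suc k)
  {
    case 1
    obtain X q where X: "finite X" "is_Pi (Suc k) q" "fv q \<subseteq> fv p \<union> X" "\<And>f. range f \<subseteq> dom KK \<Longrightarrow>
        sat KK f p = (\<exists>t. range t \<subseteq> dom KK \<and> eqoff X f t \<and> sat KK t q)"
      using Sigma_block[OF 1, where 'a = "'k V"] by metis
    from Suc.IH(2)[OF X(2)] obtain B0 c0 where B0: "B0 \<in> core" "c0 \<in> core"
      "\<And>s f V. s \<in> K \<Longrightarrow> Asg s f V \<Longrightarrow> fv q \<subseteq> V \<Longrightarrow> range f \<subseteq> K \<Longrightarrow> UP k KK (opair B0 c0) s = sat KK f q" by blast
    define c where "c = opair B0 c0"
    have ch: "c \<in> core" unfolding c_def by (rule opair_core[OF B0(1,2)])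
    note c = core_in[OF ch] B0(3)[folded c_def]
    show ?case
    proof (rule bexI[of _ "blk X"], rule bexI[of _ c], intro allI impI)
      fix s f V assume s: "s \<in> K" "Asg s f V" "fv p \<subseteq> V" "range f \<subseteq> K"
      show "US (Suc k) KK (opair (blk X) c) s = sat KK f p"
        unfolding US_pair(3)[OF blk_in[OF X(1)] c(1)]
      proof (subst block_ex[OF X(1) s(1,2,4) c(1), of _ "\<lambda>g. sat KK g q"])
        fix t g assume "t \<in> K" "Asg t g (V \<union> X)" "range g \<subseteq> K"
        then show "UP k KK c t = sat KK g q" using c(2)[of t g "V \<union> X"] subset_trans[OF X(3) Un_mono[OF s(3) subset_refl]] by simp
      qed (use X(4)[of f] s(4) in simp)
    qed (use blk_core[OF X(1)] ch in blast)+
  next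
    case 2
    obtain X q where X: "finite X" "is_Sigma (Suc k) q" "fv q \<subseteq> fv p \<union> X" "\<And>f. range f \<subseteq> dom KK \<Longrightarrow>
        sat KK f p = (\<forall>t. range t \<subseteq> dom KK \<and> eqoff X f t \<longrightarrow> sat KK t q)"
      using Pi_block[OF 2, where 'a = "'k V"] by metis
    from Suc.IH(1)[OF X(2)] obtain B0 c0 where B0: "B0 \<in> core" "c0 \<in> core"
      "\<And>s f V. s \<in> K \<Longrightarrow> Asg s f V \<Longrightarrow> fv q \<subseteq> V \<Longrightarrow> range f \<subseteq> K \<Longrightarrow> US k KK (opair B0 c0) s = sat KK f q" by blast
    define c where "c = opair B0 c0"
    have ch: "c \<in> core" unfolding c_def by (rule opair_core[OF B0(1,2)])
    note c = core_in[OF ch] B0(3)[folded c_def]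
    show ?case
    proof (rule bexI[of _ "blk X"], rule bexI[of _ c], intro allI impI)
      fix s f V assume s: "s \<in> K" "Asg s f V" "fv p \<subseteq> V" "range f \<subseteq> K"
      have "(\<exists>t\<in>K. agree KK (blk X) s t \<and> \<not> US k KK c t) \<longleftrightarrow>
        (\<exists>g. range g \<subseteq> K \<and> eqoff X f g \<and> \<not> sat KK g q)"
      proof (rule block_ex[OF X(1) s(1,2,4) c(1)])
        fix t g assume "t \<in> K" "Asg t g (V \<union> X)" "range g \<subseteq> K"
        then show "(\<not> US k KK c t) = (\<not> sat KK g q)" using c(2)[of t g "V \<union> X"] subset_trans[OF X(3) Un_mono[OF s(3) subset_refl]] by simp
      qed
      then show "UP (Suc k) KK (opair (blk X) c) s = sat KK f p"
        unfolding US_pair(4)[OF blk_in[OF X(1)] c(1)] using X(4)[of f] s(4) by auto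
    qed (use blk_core[OF X(1)] ch in blast)+
  }
qed

end

section \<open>Building transitive models\<close>

definition M_finite :: "fm set" where
  "M_finite = {Extensionality, Pairing, Union_ax, Emptyset, Infinity, TCo, Set_Foundation, Powerset}"

lemma M_theory_M_finite: "M_theory = M_finite \<union> Separation Delta0"
  by (auto simp: M_theory_def M_minus_def M_finite_def)

lemma models_Un: "models M (S \<union> T) \<longleftrightarrow> models M S \<and> models M T"
  by (auto simp: models_def)

lemma models_subset: "models M T \<Longrightarrow> S \<subseteq> T \<Longrightarrow> models M S"
  by (auto simp: models_def)

lemma closed_M_finite:
  fixes K :: "'k V set"
  assumes tr: "transitive K" and ne: "vset {} \<in> K"
    and pair: "\<And>a b. a \<in> K \<Longrightarrow> b \<in> K \<Longrightarrow> vset {a, b} \<in> K"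
    and union: "\<And>x. x \<in> K \<Longrightarrow> \<exists>u\<in>K. elts u = (\<Union>y\<in>elts x. elts y)"
    and om: "om \<in> K" "elts om = range num"
    and tco: "\<And>x. x \<in> K \<Longrightarrow> \<exists>v\<in>K. elts x \<subseteq> elts v \<and> transitive (elts v)"
    and pow: "\<And>x. x \<in> K \<Longrightarrow> \<exists>p\<in>K. elts p = {z \<in> K. elts z \<subseteq> elts x}"
  shows "models (in_struct K) M_finite"
proof -
  have D: "y \<in> K" if "x \<in> K" "y \<in> elts x" for x y using transD[OF tr that] .
  have 1: "sat (in_struct K) s Extensionality" for s
  proof -
    have "a = b" if "a \<in> K" "b \<in> K" "\<forall>z\<in>K. z \<in> elts a \<longleftrightarrow> z \<in> elts b" for a b
      by (rule V_extensionality) (use that D[OF that(1)] D[OF that(2)] in blast)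
    then show ?thesis by (simp add: Extensionality_def iff_conv_conj_imp)
  qed
  have 2: "sat (in_struct K) s Pairing" for s
  proof -
    have "\<exists>c\<in>K. \<forall>z\<in>K. z \<in> elts c \<longleftrightarrow> z = a \<or> z = b" if "a \<in> K" "b \<in> K" for a b
      by (rule bexI[OF _ pair[OF that]]) simp
    then show ?thesis by (simp add: Pairing_def iff_conv_conj_imp)
  qed
  have 3: "sat (in_struct K) s Union_ax" for s
  proof -
    have "\<exists>u\<in>K. \<forall>z\<in>K. z \<in> elts u \<longleftrightarrow> (\<exists>y\<in>K. y \<in> elts x \<and> z \<in> elts y)" if x: "x \<in> K" for x
    proof -
      obtain u where u: "u \<in> K" "elts u = (\<Union>y\<in>elts x. elts y)" using union[OF x] by blast
      show ?thesis by (rule bexI[OF _ u(1)]) (use u(2) D[OF x] in auto)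
    qed
    then show ?thesis by (simp add: Union_ax_def iff_conv_conj_imp)
  qed
  have 4: "sat (in_struct K) s Emptyset" for s
    by (auto simp: Emptyset_def intro!: bexI[OF _ ne])
  have 5: "sat (in_struct K) s Infinity" for s
  proof -
    have n: "num i \<in> K" for i using D[OF om(1)] om(2) by blast
    have a: "\<exists>a\<in>K. a \<in> elts om \<and> (\<forall>z\<in>K. z \<notin> elts a)"
      by (rule bexI[OF _ n[of 0]]) (simp add: om(2))
    have b: "\<exists>b\<in>K. b \<in> elts om \<and> (\<forall>z\<in>K. z \<in> elts b \<longleftrightarrow> z \<in> elts a \<or> z = a)" if "a \<in> elts om" for a
    proof -
      obtain i where i: "a = num i" using \<open>a \<in> elts om\<close> om(2) by blast
      show ?thesis by (rule bexI[OF _ n[of "Suc i"]]) (auto simp: om(2) i elts_num_Suc)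
    qed
    have "(\<exists>a\<in>K. a \<in> elts om \<and> (\<forall>z\<in>K. z \<notin> elts a)) \<and>
      (\<forall>a\<in>K. a \<in> elts om \<longrightarrow> (\<exists>b\<in>K. b \<in> elts om \<and> (\<forall>z\<in>K. z \<in> elts b \<longleftrightarrow> z \<in> elts a \<or> z = a)))"
      using a b by simp
    from bexI[of "\<lambda>om. (\<exists>a\<in>K. a \<in> elts om \<and> (\<forall>z\<in>K. z \<notin> elts a)) \<and>
      (\<forall>a\<in>K. a \<in> elts om \<longrightarrow> (\<exists>b\<in>K. b \<in> elts om \<and> (\<forall>z\<in>K. z \<in> elts b \<longleftrightarrow> z \<in> elts a \<or> z = a)))", OF this om(1)]
    show ?thesis by (simp add: Infinity_def iff_conv_conj_imp)
  qed
  have 6: "sat (in_struct K) s TCo" for s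
  proof -
    have "\<exists>v\<in>K. (\<forall>y\<in>K. y \<in> elts x \<longrightarrow> y \<in> elts v) \<and> (\<forall>y\<in>K. y \<in> elts v \<longrightarrow> (\<forall>z\<in>K. z \<in> elts y \<longrightarrow> z \<in> elts v))" if x: "x \<in> K" for x
    proof -
      obtain v where v: "v \<in> K" "elts x \<subseteq> elts v" "transitive (elts v)" using tco[OF x] by blast
      show ?thesis by (rule bexI[OF _ v(1)]) (use v(2) transD[OF v(3)] in blast)
    qed
    then show ?thesis by (simp add: TCo_def)
  qed
  have 7: "sat (in_struct K) s Set_Foundation" for s
  proof -
    have "\<exists>y\<in>K. y \<in> elts x \<and> (\<forall>z\<in>K. z \<in> elts x \<longrightarrow> z \<notin> elts y)" if x: "x \<in> K" and y: "y \<in> elts x" for x y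
    proof -
      from wfE_min[OF wf_elts y] obtain z where "z \<in> elts x" "\<And>v. v \<in> elts z \<Longrightarrow> v \<notin> elts x" by auto
      then show ?thesis using D[OF x] by (intro bexI[of _ z]) auto
    qed
    then show ?thesis by (auto simp: Set_Foundation_def)
  qed
  have 8: "sat (in_struct K) s Powerset" for s
  proof -
    have "\<exists>p\<in>K. \<forall>z\<in>K. z \<in> elts p \<longleftrightarrow> (\<forall>y\<in>K. y \<in> elts z \<longrightarrow> y \<in> elts x)" if x: "x \<in> K" for x
    proof -
      obtain p where p: "p \<in> K" "elts p = {z \<in> K. elts z \<subseteq> elts x}" using pow[OF x] by blast
      have "z \<in> elts p \<longleftrightarrow> (\<forall>y\<in>K. y \<in> elts z \<longrightarrow> y \<in> elts x)" if "z \<in> K" for z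
        unfolding p(2) using D[OF that] that by auto
      then show ?thesis using p(1) by blast
    qed
    then show ?thesis by (simp add: Powerset_def iff_conv_conj_imp)
  qed
  show ?thesis using ne 1 2 3 4 5 6 7 8 by (auto simp: models_def M_finite_def)
qed

text \<open>
  The set separated off in \<open>K\<close> is a subset of an element of \<open>S\<close>, hence in \<open>S\<close>, and bounded formulas do not change
  their meaning between transitive sets.
\<close>

lemma (in trans_model) Separation_super:
  assumes S: "transitive S" "S \<subseteq> K" "S \<noteq> {}"
    and supertransitive: "\<And>x z. x \<in> S \<Longrightarrow> z \<in> K \<Longrightarrow> elts z \<subseteq> elts x \<Longrightarrow> z \<in> S"
  shows "models (in_struct S) (Separation Delta0)"
  unfolding models_def in_struct_simps
proof (intro conjI ballI allI impI)
  fix ax and s :: "nat \<Rightarrow> 'k V" assume ax: "ax \<in> Separation Delta0" and s: "range s \<subseteq> S"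
  then obtain p x y w where p: "p \<in> Delta0" and
    ax_eq: "ax = Forall w (Exists y (Forall x (Iff (Mem x y) (Conj (Mem x w) p))))"
    and dist: "distinct [x, y, w]" unfolding Separation_def by blast
  obtain b where b: "\<And>K' f. transitive (K' :: 'k V set) \<Longrightarrow> range f \<subseteq> K' \<Longrightarrow> sat (in_struct K') f p = beval f b"
    using Delta0_bfm[OF p] by blast
  have eq: "sat (in_struct S) f p = sat KK f p" if "range f \<subseteq> S" for f
    using b[OF S(1) that] b[OF trans, of f] that S(2) by auto
  have sK: "sat KK s ax" using sep0_models ax s S(2) unfolding models_def by auto
  have "\<exists>y'\<in>S. \<forall>a\<in>S. a \<in> elts y' \<longleftrightarrow> a \<in> elts w' \<and> sat (in_struct S) (s(w := w', y := y', x := a)) p" if w': "w' \<in> S" for w'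
  proof -
    have "w' \<in> K" using w' S(2) by blast
    have "\<forall>w'\<in>K. \<exists>y'\<in>K. \<forall>a\<in>K. a \<in> elts y' \<longleftrightarrow> a \<in> elts w' \<and> sat KK (s(w := w', y := y', x := a)) p"
      using sK dist unfolding ax_eq by (simp add: iff_conv_conj_imp)
    from bspec[OF this \<open>w' \<in> K\<close>] obtain y' where y': "y' \<in> K"
      "\<And>a. a \<in> K \<Longrightarrow> a \<in> elts y' \<longleftrightarrow> a \<in> elts w' \<and> sat KK (s(w := w', y := y', x := a)) p" by blast
    have "elts y' \<subseteq> elts w'" using y'(2) tr[OF y'(1)] by blast
    then have yS: "y' \<in> S" using supertransitive[OF w' y'(1)] by blast
    show ?thesis
    proof (rule bexI[OF _ yS], rule ballI)
      fix a assume a: "a \<in> S"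
      then have "a \<in> K" using S(2) by blast
      from y'(2)[OF this] show "a \<in> elts y' \<longleftrightarrow> a \<in> elts w' \<and> sat (in_struct S) (s(w := w', y := y', x := a)) p"
        using eq[OF range_upd[OF range_upd[OF range_upd[OF s w'] yS] a]] by simp
    qed
  qed
  then show "sat (in_struct S) s ax" unfolding ax_eq using dist by (simp add: iff_conv_conj_imp)
qed (use S in auto)

lemma Collection_modelsI:
  fixes M :: "'a struct"
  assumes ne: "dom M \<noteq> {}" and c: "\<And>p x y s. p \<in> \<Gamma> \<Longrightarrow> x \<noteq> y \<Longrightarrow> range s \<subseteq> dom M \<Longrightarrow> coll M (\<lambda>a b. sat M (s(x := a, y := b)) p)"
  shows "models M (Collection \<Gamma>)"
  unfolding models_def
proof (intro conjI ballI allI impI ne)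
  fix ax and s :: "nat \<Rightarrow> 'a" assume ax: "ax \<in> Collection \<Gamma>" and s: "range s \<subseteq> dom M"
  then obtain p x y w c where p: "p \<in> \<Gamma>" "distinct [x, y, w, c]" "w \<notin> fv p" "c \<notin> fv p" and
    ax_eq: "ax = Forall w (Imp (ForallIn x w (Exists y p)) (Exists c (ForallIn x w (ExistsIn y c p))))"
    unfolding Collection_def by blast
  have 1: "sat M (s(w := w', x := a, y := b)) p = sat M (s(x := a, y := b)) p" for w' a b
    using p by (intro sat_cong) auto
  have 2: "sat M (s(w := w', c := c', x := a, y := b)) p = sat M (s(x := a, y := b)) p" for w' c' a b
    using p by (intro sat_cong) auto
  have "coll M (\<lambda>a b. sat M (s(x := a, y := b)) p)" using c p s by simp
  then show "sat M s ax" unfolding ax_eq coll_def using p(2) by (simp add: 1 2)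
qed

lemma coll_cong:
  assumes "coll M R" "\<And>a b. a \<in> dom M \<Longrightarrow> b \<in> dom M \<Longrightarrow> R a b = R' a b"
  shows "coll M R'"
  using assms(1) unfolding coll_def by (simp add: assms(2) cong: conj_cong)

section \<open>Finite theories and relativization\<close>

text \<open>
  The conjunction of the universal closures.
\<close>

lemma finite_theory_fm:
  assumes "finite F"
  shows "\<exists>q. \<forall>(M :: 'a struct) s. range s \<subseteq> dom M \<longrightarrow> sat M s q = models M F"
  using assms
proof (induction F)
  case empty
  show ?case by (intro exI[of _ "Eq 0 0"]) (auto simp: models_def)
next
  case (insert p F)
  then obtain q where q: "\<And>(M :: 'a struct) s. range s \<subseteq> dom M \<Longrightarrow> sat M s q = models M F" by blast
  obtain r where r: "\<And>(M :: 'a struct) s. range s \<subseteq> dom M \<Longrightarrow> sat M s r = (\<forall>t. range t \<subseteq> dom M \<longrightarrow> sat M t p)"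
    using closure[of p, where 'a = 'a] by blast
  show ?case
  proof (intro exI[of _ "Conj r q"] allI impI)
    fix M :: "'a struct" and s :: "nat \<Rightarrow> 'a" assume s: "range s \<subseteq> dom M"
    show "sat M s (Conj r q) = models M (insert p F)" using q[OF s] r[OF s] by (auto simp: models_def)
  qed
qed

lemma D0_models_restr:
  fixes C :: "'a struct set"
  assumes "finite F"
  shows "D0 C (\<lambda>M s. models (restr M (s i)) F)"
proof -
  obtain q where q: "\<And>(M :: 'a struct) s. range s \<subseteq> dom M \<Longrightarrow> sat M s q = models M F"
    using finite_theory_fm[OF assms, where 'a = 'a] by blast
  have "D0 C (\<lambda>M s. sat (restr M (s (case j of 0 \<Rightarrow> Suc i | Suc j \<Rightarrow> 0))) (\<lambda>j. s (case Suc j of 0 \<Rightarrow> Suc i | Suc j \<Rightarrow> 0)) q)"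
    if "j = 0" for j unfolding that by (rule D0_sub[OF D0_restr])
  from this[OF refl] have "D0 C (\<lambda>M s. sat (restr M (s (Suc i))) (\<lambda>_. s 0) q)" by simp
  from D0_ExIn[of C "\<lambda>M s a. sat (restr M (s i)) (\<lambda>_. a) q", OF this]
  have "D0 C (\<lambda>M s. \<exists>a\<in>dom M. mem M a (s i) \<and> sat (restr M (s i)) (\<lambda>_. a) q)" .
  then show ?thesis
  proof (rule Dfn_cong)
    fix M :: "'a struct" and s :: "nat \<Rightarrow> 'a"
    have "sat (restr M (s i)) (\<lambda>_. a) q = models (restr M (s i)) F" if "a \<in> dom M" "mem M a (s i)" for a
      by (rule q) (use that in auto)
    then show "(\<exists>a\<in>dom M. mem M a (s i) \<and> sat (restr M (s i)) (\<lambda>_. a) q) = models (restr M (s i)) F"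
      by (auto simp: models_def)
  qed
qed

section \<open>Finitely many instances of Collection suffice\<close>

text \<open>
  Collection for this one predicate, for all parameters, amounts to \<open>\<Pi>\<^sub>k\<^sub>+\<^sub>1\<close>-Collection: the parameters are an assignment, the two variables
  of the instance, and the code of its formula.
\<close>

definition upd_sat :: "nat \<Rightarrow> 'a struct \<Rightarrow> (nat \<Rightarrow> 'a) \<Rightarrow> 'a \<Rightarrow> 'a \<Rightarrow> bool" where
  "upd_sat k M s a b \<longleftrightarrow> (\<forall>s1\<in>dom M. \<forall>s2\<in>dom M.
     upd M (s 0) (s (Suc 0)) a s1 \<and> upd M s1 (s (Suc (Suc 0))) b s2 \<longrightarrow> UP k M (s (Suc (Suc (Suc 0)))) s2)"

lemma Pie_upd_sat: "Pie C (Suc k) (\<lambda>M s. upd_sat k M (\<lambda>i. s (Suc (Suc i))) (s (Suc 0)) (s 0))"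
  unfolding upd_sat_def by (intro Pie_All Pie_imp D0_Sig[OF D0_conj[OF D0_upd D0_upd]] conjunct2[OF U_levy])

lemma (in univ) Collection_upd_sat:
  assumes "\<And>s. range s \<subseteq> K \<Longrightarrow> coll KK (upd_sat k KK s)"
  shows "models KK (Collection (Pi_fm (Suc k)))"
proof (rule Collection_modelsI)
  fix p and x y :: nat and s :: "nat \<Rightarrow> 'k V" assume p: "p \<in> Pi_fm (Suc k)" and xy: "x \<noteq> y" and s: "range s \<subseteq> dom KK"
  then have pp: "is_Pi (Suc k) p" and sK: "range s \<subseteq> K" by (auto simp: Pi_fm_def)
  from universal(2)[OF pp] obtain B c where Bc: "B \<in> core" "c \<in> core"
    "\<And>\<sigma> f V. \<sigma> \<in> K \<Longrightarrow> Asg \<sigma> f V \<Longrightarrow> fv p \<subseteq> V \<Longrightarrow> range f \<subseteq> K \<Longrightarrow> UP k KK (opair B c) \<sigma> = sat KK f p" by blast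
  have e: "opair B c \<in> K" using core_in[OF opair_core[OF Bc(1,2)]] .
  obtain \<sigma> where \<sigma>: "\<sigma> \<in> K" "Asg \<sigma> s (fv p)" using Asg_ex[OF finite_fv sK] by blast
  let ?s = "\<sigma> ## num x ## num y ## (\<lambda>_. opair B c)"
  have rs: "range ?s \<subseteq> K" using \<sigma> e num_in by simp
  show "coll KK (\<lambda>a b. sat KK (s(x := a, y := b)) p)"
  proof (rule coll_cong[OF assms[OF rs]])
    fix a b assume "a \<in> dom KK" "b \<in> dom KK"
    then have a: "a \<in> K" and b: "b \<in> K" by simp_all
    have upd_sat: "upd_sat k KK ?s a b \<longleftrightarrow> (\<forall>s1\<in>K. \<forall>s2\<in>K. updr \<sigma> (num x) a s1 \<and> updr s1 (num y) b s2 \<longrightarrow> UP k KK (opair B c) s2)"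
      unfolding upd_sat_def using \<sigma>(1) by (simp add: upd_in)
    have val: "UP k KK (opair B c) s2 = sat KK (s(x := a, y := b)) p"
      if "s1 \<in> K" "s2 \<in> K" "updr \<sigma> (num x) a s1" "updr s1 (num y) b s2" for s1 s2
      by (rule Bc(3)[OF that(2) Asg_upd[OF Asg_upd[OF \<sigma>(2) that(3)] that(4)]])
         (use range_upd[OF range_upd[OF sK a] b] in auto)
    obtain s1 where s1: "s1 \<in> K" "updr \<sigma> (num x) a s1" using upd_ex[OF \<sigma>(1) num_in a] by blast
    obtain s2 where s2: "s2 \<in> K" "updr s1 (num y) b s2" using upd_ex[OF s1(1) num_in b] by blast
    show "upd_sat k KK ?s a b = sat KK (s(x := a, y := b)) p"
      unfolding upd_sat using val s1 s2 by blast
  qed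
qed (use ne in simp)

lemma (in coll_model) univ_A: "univ A"
proof
  fix s :: "nat \<Rightarrow> 'k V" assume "range s \<subseteq> A"
  then show "coll MM (refutes MM s)"
    using Coll_Sig[OF good_MM _ _ D0_Sig[OF D0_refutes], of MM s] by simp
qed

section \<open>A model from a least nonstandard level\<close>

definition supertransitive :: "'a struct \<Rightarrow> 'a \<Rightarrow> bool" where
  "supertransitive M u \<longleftrightarrow> (\<forall>x\<in>dom M. mem M x u \<longrightarrow> subs M x u) \<and>
     (\<forall>z\<in>dom M. \<forall>x\<in>dom M. mem M x u \<and> subs M z x \<longrightarrow> mem M z u)"

lemma Pie_supertransitive: "Pie C (Suc 0) (\<lambda>M s. supertransitive M (s i))"
  unfolding supertransitive_def by (intro Pie_conj Pie_All D0_Pie D0_rules)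

lemma restr_in: "transitive A \<Longrightarrow> u \<in> A \<Longrightarrow> restr (in_struct A) u = in_struct (elts u)"
  by (auto simp: restr_def in_struct_def dest: transD)

context endext
begin

text \<open>
  An element \<open>z\<close> of the least nonstandard level \<open>u\<close> is a subset of a smaller level of \<open>h0\<close>, which is standard, so \<open>z\<close> is in \<open>A\<close>.
  Thus \<open>NN\<close> sees \<open>A\<close> as a set, which is a model of any finite part of the theory, and that there is such a set is reflected to \<open>A\<close>.
\<close>

lemma least_nonstd_model:
  assumes h0: "h0 \<in> dom NN" "Hist NN h0" and u: "u \<in> dom NN" "mem NN u h0" "u \<notin> A"
    and least: "\<And>v. v \<in> dom NN \<Longrightarrow> mem NN v h0 \<Longrightarrow> mem NN v u \<Longrightarrow> v \<in> A"
  shows "\<exists>u\<in>A. transitive (elts u) \<and> models (in_struct (elts u)) (M_theory \<union> Collection (Pi_fm (Suc m)))"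
proof -
  have el: "mem NN z u \<longleftrightarrow> z \<in> A" if z: "z \<in> dom NN" for z
  proof
    assume "z \<in> A" then show "mem NN z u" by (rule nonstd_super[OF h0 u])
  next
    assume zu: "mem NN z u"
    obtain v where v: "v \<in> dom NN" "mem NN v h0" "mem NN v u" "subs NN z v"
      using conjunct1[OF h0(2)[unfolded Hist_def], rule_format, OF u(1,2) z zu] by blast
    from sub_in_A[OF least[OF v(1-3)] z v(4)] show "z \<in> A" by blast
  qed
  have "\<exists>ax\<in>Collection Delta0. \<forall>M\<in>UNIV. (\<forall>t. range t \<subseteq> dom M \<longrightarrow> sat M t ax) \<longrightarrow>
     (\<forall>s. range s \<subseteq> dom M \<longrightarrow> coll M (refutes (M :: 'k V struct) s))" by (rule Coll_ax) (rule D0_refutes)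
  then obtain ax_refutes where ax_refutes: "ax_refutes \<in> Collection Delta0" "\<forall>M\<in>UNIV. (\<forall>t. range t \<subseteq> dom M \<longrightarrow> sat M t ax_refutes) \<longrightarrow>
     (\<forall>s. range s \<subseteq> dom M \<longrightarrow> coll M (refutes (M :: 'k V struct) s))" by (rule bexE)
  have "\<exists>ax\<in>Collection (Pi_fm (Suc m)). \<forall>M\<in>UNIV. (\<forall>t. range t \<subseteq> dom M \<longrightarrow> sat M t ax) \<longrightarrow>
     (\<forall>s. range s \<subseteq> dom M \<longrightarrow> coll M (upd_sat m (M :: 'k V struct) s))" by (rule Coll_ax) (rule Pie_upd_sat)
  then obtain ax_upd_sat where ax_upd_sat: "ax_upd_sat \<in> Collection (Pi_fm (Suc m))" "\<forall>M\<in>UNIV. (\<forall>t. range t \<subseteq> dom M \<longrightarrow> sat M t ax_upd_sat) \<longrightarrow>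
     (\<forall>s. range s \<subseteq> dom M \<longrightarrow> coll M (upd_sat m (M :: 'k V struct) s))" by (rule bexE)
  let ?F = "M_finite \<union> {ax_refutes, ax_upd_sat}"
  have "Delta0 \<subseteq> Pi_fm (Suc m)"
    using levy_mono(2)[of 0 "Suc m"] is_Sigma_is_Pi.intros(4) by (auto simp: Pi_fm_def)
  then have "Collection Delta0 \<subseteq> Collection (Pi_fm (Suc m))" unfolding Collection_def by blast
  then have "models MM (Collection Delta0)" using collA models_subset by blast
  then have M_finite: "models MM ?F" using ax_refutes(1) ax_upd_sat(1) collA modM
    unfolding M_theory_M_finite by (auto simp: models_def)
  have "restr NN u = \<lparr>dom = A, mem = mem NN\<rparr>" using el sub by (auto simp: restr_def)
  moreover have "sat \<lparr>dom = A, mem = mem NN\<rparr> s p = sat MM s p" if "range s \<subseteq> A" for s p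
    by (rule sat_struct_cong) (use that memN inN in auto)
  ultimately have NF: "models (restr NN u) ?F" using M_finite by (auto simp: models_def)
  have sN: "supertransitive NN u" unfolding supertransitive_def
  proof (intro conjI ballI impI)
    fix x assume "x \<in> dom NN" "mem NN x u"
    then show "subs NN x u" using levtransN[OF h0(1) u(1) _ h0(2) u(2)] by simp
  next
    fix z x assume "z \<in> dom NN" "x \<in> dom NN" "mem NN x u \<and> subs NN z x"
    then show "mem NN z u" using levsuperN[OF h0(1) u(1) _ _ h0(2) u(2), of x z] by simp
  qed
  have "Sig CC (Suc (Suc 0)) (\<lambda>M s. \<exists>u\<in>dom M. models (restr M u) ?F \<and> supertransitive M u)"
    by (intro Sig_Ex Sig_conj D0_Sig D0_models_restr Pie_Sig[OF Pie_supertransitive]) (auto simp: M_finite_def)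
  then have S: "Sig CC (Suc (Suc m)) (\<lambda>M s. \<exists>u\<in>dom M. models (restr M u) ?F \<and> supertransitive M u)"
    by (rule Sig_mono) simp
  obtain a where a: "a \<in> A" using ne by blast
  have "\<exists>u\<in>dom MM. models (restr MM u) ?F \<and> supertransitive MM u"
    using elem_Sig[OF elem S, of "\<lambda>_. a"] NF sN u(1) a by auto
  then obtain v where v: "v \<in> A" "models (restr MM v) ?F" "supertransitive MM v" by auto
  let ?K = "elts v"
  have F: "models (in_struct ?K) ?F" using v(2) restr_in[OF trans v(1)] by simp
  have subK: "?K \<subseteq> A" using tr[OF v(1)] by blast
  have trK: "transitive ?K" unfolding transitive_def
    using v(3) subs_in[OF trans] subK unfolding supertransitive_def by auto
  have sup: "z \<in> ?K" if "x \<in> ?K" "z \<in> A" "elts z \<subseteq> elts x" for x z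
    using conjunct2[OF v(3)[unfolded supertransitive_def], rule_format, of z x] subs_in[OF trans that(2)] subK that by auto
  have neK: "?K \<noteq> {}" using F by (simp add: models_def)
  have "models (in_struct ?K) (Separation Delta0)"
    by (rule Separation_super[OF trK subK neK]) (rule sup)
  then have M: "models (in_struct ?K) M_theory" unfolding M_theory_M_finite models_Un
    using models_subset[OF F] by blast
  interpret K: univ ?K
  proof
    fix s :: "nat \<Rightarrow> 'k V" assume "range s \<subseteq> ?K"
    then show "coll (in_struct ?K) (refutes (in_struct ?K) s)"
      using ax_refutes(2)[rule_format, of "in_struct ?K" s] F by (auto simp: models_def)
  qed (use trK M in auto)
  have "models (in_struct ?K) (Collection (Pi_fm (Suc m)))"
  proof (rule K.Collection_upd_sat)
    fix s :: "nat \<Rightarrow> 'k V" assume "range s \<subseteq> ?K"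
    then show "coll (in_struct ?K) (upd_sat m (in_struct ?K) s)"
      using ax_upd_sat(2)[rule_format, of "in_struct ?K" s] F by (auto simp: models_def)
  qed
  then show ?thesis using v(1) trK M models_Un by blast
qed

end

section \<open>A model from a gap below the nonstandard levels\<close>

text \<open>
  The matrix of a universal reflection predicate. If \<open>x\<close> is the pair of the code of a formula with free block \<open>B\<close> and an assignment
  \<open>s\<close>, then \<open>\<forall>u. reflects j M x t u\<close> says that the assignment \<open>t\<close> is a solution of the \<open>\<Pi>\<^sub>j\<^sub>+\<^sub>2\<close> formula in the unknowns \<open>B\<close>. The quantifier over
  \<open>u\<close> is the outermost block of that formula; what follows it is \<open>\<Sigma>\<^sub>j\<^sub>+\<^sub>1\<close>.
\<close>

definition reflects :: "nat \<Rightarrow> 'a struct \<Rightarrow> 'a \<Rightarrow> 'a \<Rightarrow> 'a \<Rightarrow> bool" where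
  "reflects j M x t u \<longleftrightarrow> (\<exists>e\<in>dom M. \<exists>s\<in>dom M. isPair M x e s \<and>
     (\<exists>B\<in>dom M. \<exists>c\<in>dom M. isPair M e B c \<and> (agree M B s t \<and>
        (\<exists>B'\<in>dom M. \<exists>c'\<in>dom M. isPair M c B' c' \<and> (agree M B' t u \<longrightarrow> US j M c' u)))))"

lemma Sig_reflects: "Sig C (Suc j) (\<lambda>M s. reflects j M (s x) (s t) (s u))"
  unfolding reflects_def
  by (intro Sig_Ex Sig_conj Sig_imp D0_Sig[OF D0_isPair] D0_Sig[OF D0_agree] D0_Pie[OF D0_agree] conjunct1[OF U_levy])

lemma (in trans_model) reflects_in:
  assumes "B \<in> K" "B' \<in> K" "c' \<in> K" "s \<in> K"
  shows "reflects j KK (opair (opair B (opair B' c')) s) t u \<longleftrightarrow> agree KK B s t \<and> (agree KK B' t u \<longrightarrow> US j KK c' u)"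
proof -
  have 1: "opair B' c' \<in> K" "opair B (opair B' c') \<in> K" "opair (opair B (opair B' c')) s \<in> K"
    using assms opair by blast+
  show ?thesis unfolding reflects_def in_struct_simps isPair_in[OF trans 1(3)]
    using assms 1 by (auto simp: isPair_in[OF trans])
qed

text \<open>
  The axioms of \<open>M\<close> hold because \<open>K\<close> is a directed union of sets that are transitive and closed under subsets. Reflection for the universal
  formula is the Tarski-Vaught criterion for \<open>\<Sigma>\<^sub>k\<^sub>+\<^sub>1\<close> formulas (\<open>TV\<close>): a code and a finite assignment in \<open>K\<close> form an
  element of \<open>K\<close>. If in \<open>K\<close> every element of \<open>w\<close> has a value, then in \<open>A\<close> the set \<open>b\<close> contains values for all of them;
  that some set does is reflected to \<open>K\<close>.
\<close>

lemma (in coll_model) reflecting_model: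
  assumes k: "k = Suc (Suc j)"
    and K: "transitive K" "K \<subseteq> elts b" "b \<in> A" and om: "om \<in> K" "elts om = range num"
    and dir: "\<And>x x'. x \<in> K \<Longrightarrow> x' \<in> K \<Longrightarrow> \<exists>v\<in>K. x \<in> elts v \<and> x' \<in> elts v \<and> transitive (elts v) \<and>
       (\<forall>z\<in>A. \<forall>y\<in>elts v. elts z \<subseteq> elts y \<longrightarrow> z \<in> elts v)"
    and rf: "\<And>x. x \<in> K \<Longrightarrow> \<exists>t\<in>A. \<forall>u\<in>A. reflects j MM x t u \<Longrightarrow> \<exists>t\<in>K. \<forall>u\<in>A. reflects j MM x t u"
  shows "models (in_struct K) (M_theory \<union> Collection (Pi_fm k))"
proof -
  interpret U: univ A by (rule univ_A)
  have KA: "K \<subseteq> A" using K(2) tr[OF K(3)] by blast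
  have D: "y \<in> K" if "x \<in> K" "y \<in> elts x" for x y using transD[OF K(1) that] .
  have sup: "z \<in> K" if x: "x \<in> K" and z: "z \<in> A" "elts z \<subseteq> elts x" for x z
  proof -
    obtain v where v: "v \<in> K" "x \<in> elts v" "\<forall>z\<in>A. \<forall>y\<in>elts v. elts z \<subseteq> elts y \<longrightarrow> z \<in> elts v"
      using dir[OF x x] by blast
    then show ?thesis using z D by blast
  qed
  have M_finite: "models (in_struct K) M_finite"
  proof (rule closed_M_finite[OF K(1) _ _ _ om])
    show "vset {} \<in> K" by (rule sup[OF om(1) emptyK]) simp
  next
    fix x y assume xy: "x \<in> K" "y \<in> K"
    then obtain v where v: "v \<in> K" "x \<in> elts v" "y \<in> elts v" using dir by blast
    have "vset {x, y} \<in> A" using pair xy KA by blast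
    then show "vset {x, y} \<in> K" by (rule sup[OF v(1)]) (use v in simp)
  next
    fix x assume x: "x \<in> K"
    obtain v where v: "v \<in> K" "x \<in> elts v" "transitive (elts v)" "\<forall>z\<in>A. \<forall>y\<in>elts v. elts z \<subseteq> elts y \<longrightarrow> z \<in> elts v"
      using dir[OF x x] by blast
    have xv: "elts x \<subseteq> elts v" using transD[OF v(3,2)] by blast
    show "\<exists>v\<in>K. elts x \<subseteq> elts v \<and> transitive (elts v)" using v xv by blast
    have xA: "x \<in> A" using x KA by blast
    obtain u where u: "u \<in> A" "elts u = (\<Union>y\<in>elts x. elts y)" using union[OF xA] by blast
    have "elts u \<subseteq> elts v" using u(2) xv transD[OF v(3)] by blast
    then show "\<exists>u\<in>K. elts u = (\<Union>y\<in>elts x. elts y)" using sup[OF v(1) u(1)] u(2) by blast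
    obtain p where p: "p \<in> A" "elts p = {z \<in> A. elts z \<subseteq> elts x}" using pow[OF xA] by blast
    have "elts p \<subseteq> elts v" using p(2) v(2,4) by blast
    then have "p \<in> K" by (rule sup[OF v(1) p(1)])
    moreover have "{z \<in> A. elts z \<subseteq> elts x} = {z \<in> K. elts z \<subseteq> elts x}" using sup[OF x] KA by blast
    ultimately show "\<exists>p\<in>K. elts p = {z \<in> K. elts z \<subseteq> elts x}" using p(2) by auto
  qed
  have neK: "K \<noteq> {}" using om(1) by blast
  have "models (in_struct K) (Separation Delta0)"
    by (rule Separation_super[OF K(1) KA neK]) (rule sup)
  then have M: "models (in_struct K) M_theory" unfolding M_theory_M_finite models_Un using M_finite by blast
  interpret K: trans_model K by unfold_locales (use K(1) M in auto)
  have TV: "\<exists>g. range g \<subseteq> K \<and> eqoff X f g \<and> sat MM g q"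
    if q: "is_Pi k q" and X: "finite X" and f: "range f \<subseteq> K" and g: "range g \<subseteq> A" "eqoff X f g" "sat MM g q" for q X f g
  proof -
    have "is_Pi (Suc (Suc j)) q" using q k by simp
    from U.universal(2)[OF this] obtain B c where Bc: "B \<in> core" "c \<in> core"
      "\<And>s f V. s \<in> A \<Longrightarrow> Asg s f V \<Longrightarrow> fv q \<subseteq> V \<Longrightarrow> range f \<subseteq> A \<Longrightarrow> UP (Suc j) MM (opair B c) s = sat MM f q" by blast
    have fA: "range f \<subseteq> A" using f KA by blast
    obtain s where s: "s \<in> K" "Asg s f (fv q)" using K.Asg_ex[OF finite_fv f] by blast
    have sA: "s \<in> A" using s(1) KA by blast
    let ?x = "opair (opair (blk X) (opair B c)) s"
    have xK: "?x \<in> K" using K.opair K.core_in Bc(1,2) K.blk_in[OF X] s(1) by blast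
    have R: "(\<forall>u\<in>A. reflects j MM ?x t u) \<longleftrightarrow> agree MM (blk X) s t \<and> UP (Suc j) MM (opair B c) t" for t
      unfolding reflects_in[OF blk_in[OF X] core_in[OF Bc(1)] core_in[OF Bc(2)] sA]
        U.US_pair(4)[OF core_in[OF Bc(1)] core_in[OF Bc(2)]] using ne by blast
    have val: "UP (Suc j) MM (opair B c) t = sat MM h q" if "t \<in> A" "Asg t h (fv q \<union> X)" "range h \<subseteq> A" for t h
      using Bc(3)[OF that(1,2) _ that(3)] by blast
    obtain t0 where t0: "t0 \<in> A" "agree MM (blk X) s t0" "Asg t0 g (fv q \<union> X)"
      using U.agree_ex[OF X sA s(2) g(1,2)] by blast
    have "\<forall>u\<in>A. reflects j MM ?x t0 u" unfolding R using t0 val[OF t0(1,3) g(1)] g(3) by blast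
    then obtain t where t: "t \<in> K" "\<forall>u\<in>A. reflects j MM ?x t u" using rf[OF xK] t0(1) by blast
    have tA: "t \<in> A" using t(1) KA by blast
    have ag: "agree MM (blk X) s t" "UP (Suc j) MM (opair B c) t" using t(2) R by blast+
    obtain h where h: "range h \<subseteq> A" "eqoff X f h" "Asg t h (fv q \<union> X)"
      using U.agree_out[OF X sA s(2) tA ag(1) fA] by blast
    have "h i \<in> K" for i
    proof (cases "i \<in> X")
      case True
      then have "opair (num i) (h i) \<in> elts t" using h(3) unfolding Asg_def by blast
      then show ?thesis using K.relK[OF t(1)] by blast
    next
      case False
      then show ?thesis using h(2) f by (auto simp: eqoff_def)
    qed
    then show ?thesis using h(2) val[OF tA h(3,1)] ag(2) by blast
  qed
  have elem: "(is_Sigma l p \<longrightarrow> (\<forall>f. range f \<subseteq> K \<longrightarrow> sat (in_struct K) f p = sat MM f p)) \<and>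
    (is_Pi l p \<longrightarrow> (\<forall>f. range f \<subseteq> K \<longrightarrow> sat (in_struct K) f p = sat MM f p))" if "l \<le> k" for l p
    using that
  proof (induction l arbitrary: p)
    case 0
    have "sat (in_struct K) f p = sat MM f p" if p: "p \<in> Delta0" and f: "range f \<subseteq> K" for f
    proof -
      obtain b where b: "\<And>K' f. transitive (K' :: 'k V set) \<Longrightarrow> range f \<subseteq> K' \<Longrightarrow> sat (in_struct K') f p = beval f b"
        using Delta0_bfm[OF p] by blast
      show ?thesis using b[OF K(1) f] b[OF trans, of f] f KA by auto
    qed
    then show ?case by (auto elim: is_Sigma.cases is_Pi.cases)
  next
    case (Suc l)
    then have l: "l \<le> k" by simp
    have IH: "sat (in_struct K) f q = sat MM f q" if "is_Sigma l q \<or> is_Pi l q" "range f \<subseteq> K" for q f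
      using Suc.IH[OF l, of q] that by blast
    show ?case
    proof (intro conjI impI allI)
      fix f :: "nat \<Rightarrow> 'k V" assume p: "is_Sigma (Suc l) p" and f: "range f \<subseteq> K"
      obtain X q where X: "finite X" "is_Pi l q" and q: "\<forall>(M :: 'k V struct) s. range s \<subseteq> dom M \<longrightarrow>
        sat M s p = (\<exists>t. range t \<subseteq> dom M \<and> eqoff X s t \<and> sat M t q)" using Sigma_block[OF p, where 'a = "'k V"] by blast
      have qk: "is_Pi k q" by (rule levy_mono(2)[OF l X(2)])
      have fA: "range f \<subseteq> A" using f KA by blast
      have 1: "sat (in_struct K) f p = (\<exists>t. range t \<subseteq> K \<and> eqoff X f t \<and> sat (in_struct K) t q)"
        using q[rule_format, of f "in_struct K"] f by simp
      have 2: "sat MM f p = (\<exists>t. range t \<subseteq> A \<and> eqoff X f t \<and> sat MM t q)"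
        using q[rule_format, of f MM] fA by simp
      show "sat (in_struct K) f p = sat MM f p"
      proof
        assume "sat (in_struct K) f p"
        then obtain t where t: "range t \<subseteq> K" "eqoff X f t" "sat (in_struct K) t q" unfolding 1 by blast
        then have "sat MM t q" "range t \<subseteq> A" using IH X(2) KA by blast+
        then show "sat MM f p" unfolding 2 using t(2) by blast
      next
        assume "sat MM f p"
        then obtain t where t: "range t \<subseteq> A" "eqoff X f t" "sat MM t q" unfolding 2 by blast
        obtain h where h: "range h \<subseteq> K" "eqoff X f h" "sat MM h q" using TV[OF qk X(1) f t] by blast
        then show "sat (in_struct K) f p" unfolding 1 using IH X(2) by blast
      qed
    next
      fix f :: "nat \<Rightarrow> 'k V" assume p: "is_Pi (Suc l) p" and f: "range f \<subseteq> K"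
      obtain X q where X: "finite X" "is_Sigma l q" and q: "\<forall>(M :: 'k V struct) s. range s \<subseteq> dom M \<longrightarrow>
        sat M s p = (\<forall>t. range t \<subseteq> dom M \<and> eqoff X s t \<longrightarrow> sat M t q)" using Pi_block[OF p, where 'a = "'k V"] by blast
      obtain nq where nq: "is_Pi l nq" "\<And>(M :: 'k V struct) s. sat M s nq = (\<not> sat M s q)"
        using levy_neg(1)[OF X(2), where 'a = "'k V"] by blast
      have nqk: "is_Pi k nq" by (rule levy_mono(2)[OF l nq(1)])
      have fA: "range f \<subseteq> A" using f KA by blast
      have 1: "sat (in_struct K) f p = (\<forall>t. range t \<subseteq> K \<and> eqoff X f t \<longrightarrow> sat (in_struct K) t q)"
        using q[rule_format, of f "in_struct K"] f by simp
      have 2: "sat MM f p = (\<forall>t. range t \<subseteq> A \<and> eqoff X f t \<longrightarrow> sat MM t q)"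
        using q[rule_format, of f MM] fA by simp
      show "sat (in_struct K) f p = sat MM f p"
      proof
        assume sp: "sat (in_struct K) f p"
        show "sat MM f p" unfolding 2
        proof (intro allI impI, rule ccontr)
          fix t assume t: "range t \<subseteq> A \<and> eqoff X f t" "\<not> sat MM t q"
          then have "sat MM t nq" using nq(2) by blast
          then obtain h where h: "range h \<subseteq> K" "eqoff X f h" "sat MM h nq" using TV[OF nqk X(1) f] t(1) by blast
          then have "\<not> sat (in_struct K) h q" using IH[of q h] X(2) nq(2) by blast
          then show False using sp h(1,2) unfolding 1 by blast
        qed
      next
        assume sp: "sat MM f p"
        have "sat (in_struct K) t q" if "range t \<subseteq> K" "eqoff X f t" for t
        proof -
          have "range t \<subseteq> A" using that(1) KA by blast
          then have "sat MM t q" using sp that(2) unfolding 2 by blast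
          then show ?thesis using IH[of q t] X(2) that(1) by blast
        qed
        then show "sat (in_struct K) f p" unfolding 1 by blast
      qed
    qed
  qed
  have "models (in_struct K) (Collection (Pi_fm k))"
  proof (rule Collection_modelsI)
    fix p and x y :: nat and s :: "nat \<Rightarrow> 'k V"
    assume p: "p \<in> Pi_fm k" and xy: "x \<noteq> y" and s: "range s \<subseteq> dom (in_struct K)"
    have sK: "range s \<subseteq> K" using s by simp
    have pk: "is_Pi k p" using p by (simp add: Pi_fm_def)
    have ep: "sat (in_struct K) (s(x := a, y := d)) p = sat MM (s(x := a, y := d)) p" if "a \<in> K" "d \<in> K" for a d
      using elem[OF order.refl, of p] pk range_upd[OF range_upd[OF sK that(1)] that(2)] by blast
    show "coll (in_struct K) (\<lambda>a d. sat (in_struct K) (s(x := a, y := d)) p)"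
      unfolding coll_def in_struct_simps
    proof (intro ballI impI)
      fix w assume w: "w \<in> K" and ex: "\<forall>a\<in>K. a \<in> elts w \<longrightarrow> (\<exists>d\<in>K. sat (in_struct K) (s(x := a, y := d)) p)"
      let ?P = "\<lambda>M s. \<forall>a\<in>dom M. mem M a (s (Suc 0)) \<longrightarrow>
         (\<exists>d\<in>dom M. mem M d (s 0) \<and> sat M ((\<lambda>i. s (Suc (Suc i)))(x := a, y := d)) p)"
      let ?g = "\<lambda>i. if i = y then 0 else if i = x then Suc 0 else Suc (Suc (Suc (Suc i)))"
      have pg: "Pie {MM} k (\<lambda>M s. sat M (\<lambda>i. s (?g i)) p)" by (rule Pie_sub[OF Dfn_sat[OF p]])
      have sg: "(\<lambda>i. s' (?g i)) = (\<lambda>i. s' (Suc (Suc (Suc (Suc i)))))(x := s' (Suc 0), y := s' 0)" for s' :: "nat \<Rightarrow> 'k V"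
        using xy by (auto simp: fun_upd_def)
      have 1: "Pie {MM} k (\<lambda>M s. sat M ((\<lambda>i. s (Suc (Suc (Suc (Suc i)))))(x := s (Suc 0), y := s 0)) p)"
        by (rule Dfn_cong[OF pg]) (simp only: sg)
      have g: "good {MM} k" by (rule good_mono[OF good_MM]) simp
      have "Pie {MM} k ?P"
        by (rule Pie_AllIn[where R = "\<lambda>M s a. \<exists>d\<in>dom M. mem M d (s 0) \<and> sat M ((\<lambda>i. s (Suc (Suc i)))(x := a, y := d)) p"],
            rule Pie_ExIn[OF g, where R = "\<lambda>M s d. sat M ((\<lambda>i. s (Suc (Suc (Suc i))))(x := s 0, y := d)) p"]) (rule 1)
      then obtain r where r: "is_Pi k r" "\<And>f. range f \<subseteq> A \<Longrightarrow> ?P MM f = sat MM f r"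
        unfolding Dfn_def by (auto simp: Pi_fm_def)
      let ?f = "\<lambda>c. c ## w ## s"
      have fK: "range (?f c) \<subseteq> K" if "c \<in> K" for c using that w sK by simp
      have wA: "w \<in> A" and sA: "range s \<subseteq> A" using w sK KA by blast+
      have rs: "sat MM (?f c) r = (\<forall>a\<in>A. a \<in> elts w \<longrightarrow> (\<exists>d\<in>A. d \<in> elts c \<and> sat MM (s(x := a, y := d)) p))" if "c \<in> A" for c
        using r(2)[of "?f c"] that wA sA by simp
      have "sat MM (?f b) r" unfolding rs[OF K(3)]
      proof (intro ballI impI)
        fix a assume "a \<in> A" and aw: "a \<in> elts w"
        have aK: "a \<in> K" using D[OF w aw] .
        obtain d where d: "d \<in> K" "sat (in_struct K) (s(x := a, y := d)) p" using ex aK aw by blast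
        then have "sat MM (s(x := a, y := d)) p" using ep[OF aK d(1)] by blast
        then show "\<exists>d\<in>A. d \<in> elts b \<and> sat MM (s(x := a, y := d)) p" using d(1) K(2) KA by blast
      qed
      moreover have "eqoff {0} (?f w) (?f b)" by (auto simp: eqoff_def econs_def split: nat.split)
      moreover have "range (?f b) \<subseteq> A" using K(3) wA sA by simp
      ultimately obtain h where h: "range h \<subseteq> K" "eqoff {0} (?f w) h" "sat MM h r"
        using TV[OF r(1) _ fK[OF w], of "{0}" "?f b"] by auto
      define c where "c = h 0"
      have cK: "c \<in> K" using h(1) c_def by auto
      then have cA: "c \<in> A" using KA by blast
      have "h = ?f c"
      proof
        fix i show "h i = ?f c i" using h(2) by (cases i) (auto simp: eqoff_def c_def)
      qed
      then have sc: "sat MM (?f c) r" using h(3) by simp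
      show "\<exists>c\<in>K. \<forall>a\<in>K. a \<in> elts w \<longrightarrow> (\<exists>d\<in>K. d \<in> elts c \<and> sat (in_struct K) (s(x := a, y := d)) p)"
      proof (rule bexI[OF _ cK], intro ballI impI)
        fix a assume aK: "a \<in> K" and aw: "a \<in> elts w"
        have "a \<in> A" using aK KA by blast
        then obtain d where d: "d \<in> elts c" "sat MM (s(x := a, y := d)) p" using sc[unfolded rs[OF cA]] aw by blast
        have dK: "d \<in> K" using D[OF cK d(1)] .
        show "\<exists>d\<in>K. d \<in> elts c \<and> sat (in_struct K) (s(x := a, y := d)) p"
          by (rule bexI[OF _ dK]) (use d ep[OF aK dK] in simp)
      qed
    qed
  qed (use neK in simp)
  then show ?thesis using M models_Un by blast
qed

section \<open>A model inside an element\<close>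

lemma (in endext) smaller_model:
  "\<exists>b\<in>A. \<exists>K. K \<subseteq> elts b \<and> transitive K \<and> models (in_struct K) (M_theory \<union> Collection (Pi_fm (Suc m)))"
proof -
  obtain h0 d where h0: "h0 \<in> dom NN" "Hist NN h0" and d: "d \<in> dom NN" "mem NN d h0" "d \<notin> A"
    using nonstd_ex by blast
  obtain j where j: "m = Suc j" using m1 by (cases m) auto
  show ?thesis
  proof (cases "\<exists>u\<in>dom NN. mem NN u h0 \<and> u \<notin> A \<and> (\<forall>v\<in>dom NN. mem NN v h0 \<longrightarrow> mem NN v u \<longrightarrow> v \<in> A)")
    case True
    then obtain u where u: "u \<in> dom NN" "mem NN u h0" "u \<notin> A"
      "\<And>v. v \<in> dom NN \<Longrightarrow> mem NN v h0 \<Longrightarrow> mem NN v u \<Longrightarrow> v \<in> A" by blast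
    from least_nonstd_model[OF h0 u] show ?thesis by blast
  next
    case False
    then have case2: "\<exists>v\<in>dom NN. mem NN v h0 \<and> v \<notin> A \<and> mem NN v u"
      if "u \<in> dom NN" "mem NN u h0" "u \<notin> A" for u using that by blast
    interpret G: gap_setup A m NN "reflects j" h0 d
      by unfold_locales (use h0 d j Sig_reflects in auto)
    obtain om where om: "om \<in> A" "elts om = range num" using omega_in by blast
    from G.gap[OF case2 om(1)] obtain b K where b: "b \<in> A" and K: "K \<subseteq> elts b" "om \<in> K" "transitive K"
      and dir: "\<forall>x\<in>K. \<forall>x'\<in>K. \<exists>v\<in>K. x \<in> elts v \<and> x' \<in> elts v \<and> transitive (elts v) \<and>
       (\<forall>z\<in>A. \<forall>y\<in>elts v. elts z \<subseteq> elts y \<longrightarrow> z \<in> elts v)"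
      and rf: "\<forall>x\<in>K. (\<exists>t\<in>A. G.Phi x t) \<longrightarrow> (\<exists>t\<in>K. G.Phi x t)" by blast
    have "models (in_struct K) (M_theory \<union> Collection (Pi_fm (Suc m)))"
    proof (rule reflecting_model[OF _ K(3,1) b K(2) om(2)])
      show "Suc m = Suc (Suc j)" using j by simp
    next
      fix x x' assume "x \<in> K" "x' \<in> K"
      then show "\<exists>v\<in>K. x \<in> elts v \<and> x' \<in> elts v \<and> transitive (elts v) \<and>
        (\<forall>z\<in>A. \<forall>y\<in>elts v. elts z \<subseteq> elts y \<longrightarrow> z \<in> elts v)" using dir by blast
    next
      fix x assume "x \<in> K" "\<exists>t\<in>A. \<forall>u\<in>A. reflects j MM x t u"
      then show "\<exists>t\<in>K. \<forall>u\<in>A. reflects j MM x t u" using rf unfolding G.Phi_def by blast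
    qed
    then show ?thesis using b K by blast
  qed
qed

theorem theorem5p5:
  fixes n :: nat and \<alpha> :: "'k V"
  assumes "n \<ge> 2"
    and "\<alpha> \<in> omega1"
    and "minimum_model (M_theory \<union> Collection (Pi_fm n)) (L \<alpha>)"
  shows "\<not> (\<exists>N :: 'k V struct.
            elem_end_ext (n + 1) (in_struct (L \<alpha>)) N \<and>
            dom N \<noteq> L \<alpha> \<and>
            models N (Collection (Pi_fm (n - 1))))"
proof
  assume "\<exists>N :: 'k V struct. elem_end_ext (n + 1) (in_struct (L \<alpha>)) N \<and> dom N \<noteq> L \<alpha> \<and>
            models N (Collection (Pi_fm (n - 1)))"
  then obtain N :: "'k V struct" where N: "elem_end_ext (n + 1) (in_struct (L \<alpha>)) N" "dom N \<noteq> L \<alpha>"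
    "models N (Collection (Pi_fm (n - 1)))" by blast
  obtain m where m: "n = Suc m" "m \<ge> 1" using assms(1) by (cases n) auto
  note mm = assms(3)[unfolded minimum_model_def]
  interpret endext "L \<alpha>" m N
    by unfold_locales (use mm N m in \<open>auto simp: models_Un\<close>)
  obtain b K where b: "b \<in> L \<alpha>" "K \<subseteq> elts b" "transitive K"
    "models (in_struct K) (M_theory \<union> Collection (Pi_fm n))" using smaller_model m(1) by blast
  then have "b \<in> K" using mm by blast
  then show False using b(2) elts_irrefl by blast
qed

end
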